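(* Let $p$ be an odd prime and $\Lambda=\mathbb{Z}[G(p,p-1)]$. If $S$ is a $\Lambda$-module with $S\oplus\Lambda\cong R(2)\oplus[y-1)\oplus\Lambda$, then $S\cong R(2)\oplus[y-1)$; and so the stable module $[R(2)\oplus[y-1)]$ is straight over $\Lambda$.
   Context: Modules are right modules. For an odd prime $p$, $G(p,p-1)=\langle x,y\mid x^p=1,\ y^{p-1}=1,\ yx=x^my\rangle$, where $m$ is an integer of multiplicative order $p-1$ modulo $p$, and $\Lambda=\mathbb{Z}[G(p,p-1)]$. The symbol $[y-1)$ denotes the right ideal $(y-1)\Lambda$. Let $\mathcal{T}_{p-1}=\{(a_{i,j})\in M_{p-1}(\mathbb{Z})\mid a_{i,j}\in p\mathbb{Z}\text{ if }i>j\}$. There is a surjective ring homomorphism $\tilde\lambda:\Lambda\to\mathcal{T}_{p-1}$, realized as follows. Let $\zeta=e^{2\pi i/p}$ and let $\sigma$ be the automorphism of $\mathbb{Z}[\zeta]$ with $\sigma(\zeta)=\zeta^m$. Let $\Lambda$ act on the right on the ideal $(\zeta-1)\mathbb{Z}[\zeta]$ by $v\cdot x=v\zeta$, $v\cdot y=\sigma^{-1}(v)$; $\tilde\lambda(a)$ is the matrix of $v\mapsto v\cdot a$ acting on row vectors with respect to the $\mathbb{Z}$-basis $(\zeta-1)^j$, $1\le j\le p-1$. Then $\mathcal{T}_{p-1}$ is a right $\Lambda$-module via $t\cdot a=t\,\tilde\lambda(a)$, and $R(i)$ denotes its $i$-th row, i.e. $R(i)=\{(r_1,\dots,r_{p-1})\in\mathbb{Z}^{p-1}\mid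 r_j\in p\mathbb{Z}\text{ for }j<i\}$. Thus $\mathcal{T}_{p-1}\cong\bigoplus_{i=1}^{p-1}R(i)$, and $R(i)$ is isomorphic to the ideal $(\zeta-1)^i\mathbb{Z}[\zeta]$ with the right $\Lambda$-action $v\cdot x=v\zeta$, $v\cdot y=\sigma^{-1}(v)$. Finitely generated $\Lambda$-modules $M,N$ are stably equivalent if $M\oplus\Lambda^a\cong N\oplus\Lambda^b$ for some $a,b\ge 0$; the stable module $[M]$ is the class of all modules stably equivalent to $M$. A stable module of lattices is straight if any two modules in it of the same $\mathbb{Z}$-rank are isomorphic (there is exactly one isomorphism class at each level). *)

theory Defs
  imports
    Complex_Main
    "HOL-Computational_Algebra.Polynomial"
    "HOL-Algebra.QuotRing"
    "HOL-Number_Theory.Number_Theory"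
begin

section \<open>Group presentations\<close>

text \<open>
  Words over an alphabet \<open>'x\<close>; the letter \<open>(s, True)\<close> stands for the generator \<open>s\<close> and
  \<open>(s, False)\<close> for its formal inverse. A relation \<open>l = r\<close> is represented by the pair \<open>(l, r)\<close>.
  The group presented by a set of relations consists of the words modulo the least congruence
  that contains the relations and the free cancellations.
\<close>

type_synonym 'x word = "('x \<times> bool) list"

inductive pres_eq :: "('x word \<times> 'x word) set \<Rightarrow> 'x word \<Rightarrow> 'x word \<Rightarrow> bool"
  for E :: "('x word \<times> 'x word) set" where
  refl: "pres_eq E u u"
| sym: "pres_eq E u v \<Longrightarrow> pres_eq E v u"
| trans: "pres_eq E u v \<Longrightarrow> pres_eq E v w \<Longrightarrow> pres_eq E u w"
| cancel: "pres_eq E (u @ [(s, b), (s, \<not> b)] @ v) (u @ v)"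
| relation: "(l, r) \<in> E \<Longrightarrow> pres_eq E (u @ l @ v) (u @ r @ v)"

definition pres_class :: "('x word \<times> 'x word) set \<Rightarrow> 'x word \<Rightarrow> 'x word set" where
  "pres_class E u = {v. pres_eq E u v}"

definition presented_group :: "('x word \<times> 'x word) set \<Rightarrow> 'x word set monoid" where
  "presented_group E =
     \<lparr>carrier = range (pres_class E),
      mult = (\<lambda>A B. \<Union>u\<in>A. \<Union>v\<in>B. pres_class E (u @ v)),
      one = pres_class E []\<rparr>"

definition gen_pow :: "'x \<Rightarrow> int \<Rightarrow> 'x word" where
  "gen_pow s k = replicate (nat \<bar>k\<bar>) (s, 0 \<le> k)"

datatype gen = Gen_x | Gen_y

definition metacyclic_rels :: "nat \<Rightarrow> int \<Rightarrow> (gen word \<times> gen word) set" where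
  "metacyclic_rels p m =
     {(gen_pow Gen_x (int p), []),
      (gen_pow Gen_y (int p - 1), []),
      (gen_pow Gen_y 1 @ gen_pow Gen_x 1, gen_pow Gen_x m @ gen_pow Gen_y 1)}"

definition metacyclic :: "nat \<Rightarrow> int \<Rightarrow> gen word set monoid" where
  "metacyclic p m = presented_group (metacyclic_rels p m)"

definition metacyclic_y :: "nat \<Rightarrow> int \<Rightarrow> gen word set" where
  "metacyclic_y p m = pres_class (metacyclic_rels p m) (gen_pow Gen_y 1)"


section \<open>Integral group rings\<close>

text \<open>Elements are finitely supported functions on the group (zero off the carrier).\<close>

definition supp :: "('g \<Rightarrow> int) \<Rightarrow> 'g set" where
  "supp f = {g. f g \<noteq> 0}"

definition basis_elt :: "'g \<Rightarrow> 'g \<Rightarrow> int" where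
  "basis_elt g = (\<lambda>h. if h = g then 1 else 0)"

definition group_ring :: "'g monoid \<Rightarrow> ('g \<Rightarrow> int) ring" where
  "group_ring H =
     \<lparr>carrier = {f. finite (supp f) \<and> supp f \<subseteq> carrier H},
      mult = (\<lambda>f g z. \<Sum>(a, b) \<in> {(a, b) \<in> supp f \<times> supp g. a \<otimes>\<^bsub>H\<^esub> b = z}. f a * g b),
      one = basis_elt \<one>\<^bsub>H\<^esub>,
      zero = (\<lambda>_. 0),
      add = (\<lambda>f g z. f z + g z)\<rparr>"

type_synonym lambda_elt = "gen word set \<Rightarrow> int"

definition Lambda :: "nat \<Rightarrow> int \<Rightarrow> lambda_elt ring" where
  "Lambda p m = group_ring (metacyclic p m)"


section \<open>Right modules\<close>

text \<open>
  The library's modules are left modules over commutative rings. As there, the record extends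
  \<^typ>\<open>'b ring\<close> for the sake of its additive part; the fields \<^const>\<open>mult\<close> and \<^const>\<open>one\<close> are junk.
\<close>

record ('a, 'b) rmodule = "'b ring" +
  ract :: "['b, 'a] \<Rightarrow> 'b" (infixl \<open>\<triangleleft>\<index>\<close> 70)

locale right_module = R?: ring R + M?: abelian_group M
  for R :: "('a, 'r) ring_scheme" (structure) and M :: "('a, 'b) rmodule" (structure) +
  assumes ract_closed [simp, intro]:
      "\<lbrakk>x \<in> carrier M; a \<in> carrier R\<rbrakk> \<Longrightarrow> x \<triangleleft>\<^bsub>M\<^esub> a \<in> carrier M"
    and ract_l_distr:
      "\<lbrakk>x \<in> carrier M; y \<in> carrier M; a \<in> carrier R\<rbrakk> \<Longrightarrow>
       (x \<oplus>\<^bsub>M\<^esub> y) \<triangleleft>\<^bsub>M\<^esub> a = (x \<triangleleft>\<^bsub>M\<^esub> a) \<oplus>\<^bsub>M\<^esub> (y \<triangleleft>\<^bsub>M\<^esub> a)"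
    and ract_r_distr:
      "\<lbrakk>x \<in> carrier M; a \<in> carrier R; b \<in> carrier R\<rbrakk> \<Longrightarrow>
       x \<triangleleft>\<^bsub>M\<^esub> (a \<oplus>\<^bsub>R\<^esub> b) = (x \<triangleleft>\<^bsub>M\<^esub> a) \<oplus>\<^bsub>M\<^esub> (x \<triangleleft>\<^bsub>M\<^esub> b)"
    and ract_assoc:
      "\<lbrakk>x \<in> carrier M; a \<in> carrier R; b \<in> carrier R\<rbrakk> \<Longrightarrow>
       x \<triangleleft>\<^bsub>M\<^esub> (a \<otimes>\<^bsub>R\<^esub> b) = (x \<triangleleft>\<^bsub>M\<^esub> a) \<triangleleft>\<^bsub>M\<^esub> b"
    and ract_one [simp]:
      "x \<in> carrier M \<Longrightarrow> x \<triangleleft>\<^bsub>M\<^esub> \<one>\<^bsub>R\<^esub> = x"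

definition rmod_iso ::
  "('a, 'r) ring_scheme \<Rightarrow> ('a, 'b) rmodule \<Rightarrow> ('a, 'c) rmodule \<Rightarrow> bool" where
  "rmod_iso R M N \<longleftrightarrow>
     (\<exists>f. bij_betw f (carrier M) (carrier N) \<and>
          (\<forall>x\<in>carrier M. \<forall>y\<in>carrier M. f (x \<oplus>\<^bsub>M\<^esub> y) = f x \<oplus>\<^bsub>N\<^esub> f y) \<and>
          (\<forall>x\<in>carrier M. \<forall>a\<in>carrier R. f (x \<triangleleft>\<^bsub>M\<^esub> a) = f x \<triangleleft>\<^bsub>N\<^esub> a))"

definition rmod_sum ::
  "('a, 'b) rmodule \<Rightarrow> ('a, 'c) rmodule \<Rightarrow> ('a, 'b \<times> 'c) rmodule" (infixl \<open>[+]\<close> 65) where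
  "M [+] N =
     \<lparr>carrier = carrier M \<times> carrier N,
      mult = undefined,
      one = undefined,
      zero = (\<zero>\<^bsub>M\<^esub>, \<zero>\<^bsub>N\<^esub>),
      add = (\<lambda>(x, y) (x', y'). (x \<oplus>\<^bsub>M\<^esub> x', y \<oplus>\<^bsub>N\<^esub> y')),
      ract = (\<lambda>(x, y) a. (x \<triangleleft>\<^bsub>M\<^esub> a, y \<triangleleft>\<^bsub>N\<^esub> a))\<rparr>"

definition principal_right_ideal :: "('a, 'r) ring_scheme \<Rightarrow> 'a \<Rightarrow> ('a, 'a) rmodule" where
  "principal_right_ideal R a =
     \<lparr>carrier = (\<lambda>b. a \<otimes>\<^bsub>R\<^esub> b) ` carrier R,
      mult = undefined,
      one = undefined,
      zero = \<zero>\<^bsub>R\<^esub>,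
      add = (\<lambda>x y. x \<oplus>\<^bsub>R\<^esub> y),
      ract = (\<lambda>x b. x \<otimes>\<^bsub>R\<^esub> b)\<rparr>"

definition regular_rmodule :: "('a, 'r) ring_scheme \<Rightarrow> ('a, 'a) rmodule" where
  "regular_rmodule R =
     \<lparr>carrier = carrier R,
      mult = undefined,
      one = undefined,
      zero = \<zero>\<^bsub>R\<^esub>,
      add = (\<lambda>x y. x \<oplus>\<^bsub>R\<^esub> y),
      ract = (\<lambda>x b. x \<otimes>\<^bsub>R\<^esub> b)\<rparr>"

definition free_rmodule :: "('a, 'r) ring_scheme \<Rightarrow> nat \<Rightarrow> ('a, nat \<Rightarrow> 'a) rmodule" where
  "free_rmodule R n =
     \<lparr>carrier = {..<n} \<rightarrow>\<^sub>E carrier R,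
      mult = undefined,
      one = undefined,
      zero = (\<lambda>i\<in>{..<n}. \<zero>\<^bsub>R\<^esub>),
      add = (\<lambda>x y. \<lambda>i\<in>{..<n}. x i \<oplus>\<^bsub>R\<^esub> y i),
      ract = (\<lambda>x b. \<lambda>i\<in>{..<n}. x i \<otimes>\<^bsub>R\<^esub> b)\<rparr>"

definition fin_gen :: "('a, 'r) ring_scheme \<Rightarrow> ('a, 'b) rmodule \<Rightarrow> bool" where
  "fin_gen R M \<longleftrightarrow>
     (\<exists>B. finite B \<and> B \<subseteq> carrier M \<and>
          (\<forall>x\<in>carrier M. \<exists>c\<in>B \<rightarrow> carrier R. x = (\<Oplus>\<^bsub>M\<^esub>b\<in>B. b \<triangleleft>\<^bsub>M\<^esub> c b)))"


section \<open>Lattices, stable modules, straightness\<close>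

definition torsion_free :: "('b, 's) ring_scheme \<Rightarrow> bool" where
  "torsion_free M \<longleftrightarrow>
     (\<forall>x\<in>carrier M. \<forall>k::int. k \<noteq> 0 \<longrightarrow> [k] \<cdot>\<^bsub>M\<^esub> x = \<zero>\<^bsub>M\<^esub> \<longrightarrow> x = \<zero>\<^bsub>M\<^esub>)"

definition z_fin_gen :: "('b, 's) ring_scheme \<Rightarrow> bool" where
  "z_fin_gen M \<longleftrightarrow>
     (\<exists>B. finite B \<and> B \<subseteq> carrier M \<and>
          (\<forall>x\<in>carrier M. \<exists>c::'b \<Rightarrow> int. x = (\<Oplus>\<^bsub>M\<^esub>b\<in>B. [c b] \<cdot>\<^bsub>M\<^esub> b)))"

definition rmod_lattice :: "('a, 'r) ring_scheme \<Rightarrow> ('a, 'b) rmodule \<Rightarrow> bool" where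
  "rmod_lattice R M \<longleftrightarrow> right_module R M \<and> z_fin_gen M \<and> torsion_free M"

definition z_independent :: "('b, 's) ring_scheme \<Rightarrow> 'b set \<Rightarrow> bool" where
  "z_independent M B \<longleftrightarrow>
     finite B \<and> B \<subseteq> carrier M \<and>
     (\<forall>c::'b \<Rightarrow> int. (\<Oplus>\<^bsub>M\<^esub>b\<in>B. [c b] \<cdot>\<^bsub>M\<^esub> b) = \<zero>\<^bsub>M\<^esub> \<longrightarrow> (\<forall>b\<in>B. c b = 0))"

definition z_rank :: "('b, 's) ring_scheme \<Rightarrow> nat" where
  "z_rank M = (GREATEST n. \<exists>B. z_independent M B \<and> card B = n)"

definition stably_equivalent ::
  "('a, 'r) ring_scheme \<Rightarrow> ('a, 'b) rmodule \<Rightarrow> ('a, 'c) rmodule \<Rightarrow> bool" where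
  "stably_equivalent R M N \<longleftrightarrow>
     (\<exists>a b. rmod_iso R (M [+] free_rmodule R a) (N [+] free_rmodule R b))"

text \<open>
  A module type has to be chosen for the members of the class; since it is a free type variable,
  it can be instantiated to any type, in particular to a disjoint sum when modules over two
  different types are to be compared.
\<close>

definition stable_module ::
  "('a, 'r) ring_scheme \<Rightarrow> ('a, 'b) rmodule \<Rightarrow> ('a, 'c) rmodule set" where
  "stable_module R M = {N. right_module R N \<and> fin_gen R N \<and> stably_equivalent R N M}"

definition straight :: "('a, 'r) ring_scheme \<Rightarrow> ('a, 'b) rmodule set \<Rightarrow> bool" where
  "straight R C \<longleftrightarrow>
     (\<forall>M\<in>C. rmod_lattice R M) \<and>
     (\<forall>M\<in>C. \<forall>N\<in>C. z_rank M = z_rank N \<longrightarrow> rmod_iso R M N)"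


section \<open>The modules $R(i)$\<close>

definition zeta :: "nat \<Rightarrow> complex" where
  "zeta p = exp (2 * of_real pi * \<i> / of_nat p)"

definition cyc :: "nat \<Rightarrow> complex ring" where
  "cyc p =
     \<lparr>carrier = range (\<lambda>f :: int poly. poly (map_poly of_int f) (zeta p)),
      mult = (*), one = 1, zero = 0, add = (+)\<rparr>"

definition sigma :: "nat \<Rightarrow> int \<Rightarrow> complex \<Rightarrow> complex" where
  "sigma p m =
     (THE s. s \<in> ring_iso (cyc p) (cyc p) \<and> s \<in> extensional (carrier (cyc p)) \<and>
             s (zeta p) = zeta p powi m)"

fun letter_act :: "nat \<Rightarrow> int \<Rightarrow> complex \<Rightarrow> gen \<times> bool \<Rightarrow> complex" where
  "letter_act p m v (Gen_x, True) = v * zeta p"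
| "letter_act p m v (Gen_x, False) = v * inverse (zeta p)"
| "letter_act p m v (Gen_y, True) = inv_into (carrier (cyc p)) (sigma p m) v"
| "letter_act p m v (Gen_y, False) = sigma p m v"

text \<open>
  Words act from the right, first letter first. This respects the relations of the group, so
  that the representative chosen in \<open>group_act\<close> is immaterial.
\<close>

definition word_act :: "nat \<Rightarrow> int \<Rightarrow> complex \<Rightarrow> gen word \<Rightarrow> complex" where
  "word_act p m v w = foldl (letter_act p m) v w"

definition group_act :: "nat \<Rightarrow> int \<Rightarrow> complex \<Rightarrow> gen word set \<Rightarrow> complex" where
  "group_act p m v g = word_act p m v (SOME w. w \<in> g)"

definition cyc_act :: "nat \<Rightarrow> int \<Rightarrow> complex \<Rightarrow> lambda_elt \<Rightarrow> complex" where
  "cyc_act p m v a = (\<Sum>g\<in>supp a. of_int (a g) * group_act p m v g)"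

text \<open>
  The entry in row \<open>i\<close> and column \<open>j\<close> (\<open>1 \<le> i, j \<le> p - 1\<close>) of the matrix of the action of \<open>a\<close>
  on the ideal generated by \<open>\<zeta> - 1\<close>, with respect to the basis \<open>(\<zeta> - 1)^j\<close>: row \<open>i\<close> consists
  of the coordinates of the image of the \<open>i\<close>-th basis vector.
\<close>

definition cyc_coords :: "nat \<Rightarrow> complex \<Rightarrow> nat \<Rightarrow> int" where
  "cyc_coords p v =
     (THE c. (\<forall>j. j \<notin> {1..p - 1} \<longrightarrow> c j = 0) \<and>
             v = (\<Sum>j = 1..p - 1. of_int (c j) * (zeta p - 1) ^ j))"

definition lam_tilde :: "nat \<Rightarrow> int \<Rightarrow> lambda_elt \<Rightarrow> nat \<Rightarrow> nat \<Rightarrow> int" where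
  "lam_tilde p m a i j = cyc_coords p (cyc_act p m ((zeta p - 1) ^ i) a) j"

text \<open>Row vectors are functions that vanish outside \<open>{1..p - 1}\<close>.\<close>

definition row_module :: "nat \<Rightarrow> int \<Rightarrow> nat \<Rightarrow> (lambda_elt, nat \<Rightarrow> int) rmodule" where
  "row_module p m i =
     \<lparr>carrier = {r. (\<forall>j. j \<notin> {1..p - 1} \<longrightarrow> r j = 0) \<and> (\<forall>j\<in>{1..<i}. int p dvd r j)},
      mult = undefined,
      one = undefined,
      zero = (\<lambda>_. 0),
      add = (\<lambda>r s j. r j + s j),
      ract = (\<lambda>r a j. if j \<in> {1..p - 1} then (\<Sum>k = 1..p - 1. r k * lam_tilde p m a k j) else 0)\<rparr>"

definition y_minus_1 :: "nat \<Rightarrow> int \<Rightarrow> (lambda_elt, lambda_elt) rmodule" where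
  "y_minus_1 p m =
     principal_right_ideal (Lambda p m) (basis_elt (metacyclic_y p m) \<ominus>\<^bsub>Lambda p m\<^esub> \<one>\<^bsub>Lambda p m\<^esub>)"

end

theory Submission
  imports Defs "HOL-Library.Function_Algebras" "HOL-Library.Product_Plus"
    "HOL-Analysis.Complex_Transcendental"
begin

text \<open>
  Let \<open>d = p - 1\<close> and let \<open>r\<close> generate the cyclic group \<open>C\<close> of order \<open>d\<close>. Sending \<open>x\<close> to \<open>1\<close> and \<open>y\<close> to \<open>r\<close> on the
  one hand, and acting on the ideal of \<open>\<zeta> - 1\<close> on the other, embeds \<open>\<Lambda>\<close> into \<open>\<int>[C] \<times> \<T>\<close>; the image contains the
  radical of \<open>\<T>\<close> and \<open>p \<int>[C]\<close>. So \<open>R(2) \<oplus> [y - 1) \<oplus> \<Lambda>\<^sup>n\<close> becomes a lattice of triples.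

  An isomorphism of \<open>S \<oplus> \<Lambda>\<close> with this lattice yields a unimodular vector in it, the image of the free generator.
  The automorphisms of the lattice are transitive on unimodular vectors if \<open>n > 0\<close>: Euclid's algorithm on the
  augmentations and stable range one for finite quotients of \<open>\<int>[C]\<close> make the components of the vector in \<open>[y - 1)\<close>
  and in the last copy of \<open>\<Lambda>\<close> unimodular over \<open>\<int>[C]\<close>; matrices over \<open>\<int>[C]\<close> that are congruent to \<open>1\<close> modulo \<open>p\<close>
  then turn the latter into \<open>1\<close>; finally the matrix part is reduced to the identity column by column, with integer
  \<open>2 \<times> 2\<close> matrices that mix one of its rows with the component in \<open>R(2)\<close>. Moving the unimodular vector to the last
  coordinate vector identifies \<open>S\<close> with the lattice for \<open>n - 1\<close>. For \<open>n = 0\<close> there is no unimodular vector, because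
  the augmentation vanishes on \<open>y - 1\<close>. So every member of the stable module is one of these lattices, and its
  rank determines \<open>n\<close>.
\<close>

text \<open>Modulo \<open>p\<close> the diagonal of the matrix part is tied to the group ring part,
  so neither part moves alone, except by multiples of \<open>p\<close> in the group ring or by the
  radical in the matrices. Units of the group ring modulo \<open>p\<close> do not lift in general;
  Bezout relations and matrices of determinant 1 need a second group ring component, and [y - 1)
  supplies it. But its group ring part lies in the augmentation ideal and is blind at the trivial
  character; there only the free coordinates count, and they are integers. Likewise a diagonal entry
  that is merely 1 modulo \<open>p\<close> needs a partner coprime to it, which the row in R(2)
  supplies. R(2) fits because only its first entry is bound to be divisible by \<open>p\<close>: it
  can exchange multiples with every row of a matrix at the cost of one divisibility condition on the
  off-diagonal coefficients. On the arithmetic side, relations at zeta are transferred to all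
  conjugates by divisibility and traces; this yields the Galois automorphisms, the independence of
  the powers of zeta - 1 and the faithfulness of the embedding.\<close>

lemma sum_fun_apply: "(\<Sum>i\<in>A. f i) x = (\<Sum>i\<in>A. f i x)"
  by (induction A rule: infinite_finite_induct) auto

lemma of_int_fun_apply [simp]: "(of_int k :: 'a \<Rightarrow> 'b::ring_1) x = of_int k"
  by (cases k) (simp_all del: of_nat_Suc)

lemma power_fun_apply [simp]: "((f :: 'a \<Rightarrow> 'b::comm_ring_1) ^ n) x = f x ^ n"
  by (induction n) auto

section \<open>Lifting units modulo an ideal with finite quotient\<close>

text \<open>A subring is a set inside a commutative ring type, so that one stable range argument
  serves both the integers and the group ring of a cyclic group, which is realised below as a set of
  functions.\<close>

locale subring_pred =
  fixes Z :: "'a::comm_ring_1 set"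
  assumes one_mem [simp, intro]: "1 \<in> Z"
    and add_mem [simp, intro]: "\<And>x y. x \<in> Z \<Longrightarrow> y \<in> Z \<Longrightarrow> x + y \<in> Z"
    and neg_mem [simp, intro]: "\<And>x. x \<in> Z \<Longrightarrow> - x \<in> Z"
    and mult_mem [simp, intro]: "\<And>x y. x \<in> Z \<Longrightarrow> y \<in> Z \<Longrightarrow> x * y \<in> Z"
begin

lemma zero_mem [simp, intro]: "0 \<in> Z"
  using add_mem[OF one_mem neg_mem[OF one_mem]] by simp

lemma diff_mem [simp, intro]: "x \<in> Z \<Longrightarrow> y \<in> Z \<Longrightarrow> x - y \<in> Z"
  using add_mem[of x "- y"] by simp

lemma power_mem [simp, intro]: "x \<in> Z \<Longrightarrow> x ^ n \<in> Z"
  by (induction n) auto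

lemma sum_mem [simp, intro]: "(\<And>i. i \<in> A \<Longrightarrow> f i \<in> Z) \<Longrightarrow> sum f A \<in> Z"
  by (induction A rule: infinite_finite_induct) auto

lemma of_nat_mem [simp, intro]: "of_nat n \<in> Z"
  by (induction n) auto

lemma of_int_mem [simp, intro]: "of_int n \<in> Z"
  by (cases n) (auto simp del: of_nat_Suc)

text \<open>
  Stable range one for a quotient in which some power \<open>s ^ k\<close> is idempotent: on the component
  where this idempotent is \<open>1\<close>, \<open>s\<close> is a unit, on the other one \<open>s\<close> is nilpotent and so \<open>y\<close> is
  a unit.
\<close>

lemma unit_lift:
  assumes mem: "s \<in> Z" "x \<in> Z" "y \<in> Z" "q \<in> Z" "w \<in> Z" "c \<in> Z"
    and k: "k \<ge> 1" and idem: "s ^ (2 * k) = s ^ k + q * c" and eq: "x * s + y = 1 + q * w"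
  shows "\<exists>g\<in>Z. \<exists>w'\<in>Z. g * (s + (1 - s ^ k) * y) + q * w' = 1"
proof -
  define v where "v = s + (1 - s ^ k) * y"
  have v: "v \<in> Z" using mem by (auto simp: v_def)
  \<comment> \<open>The ideal generated by \<open>v\<close> and \<open>q\<close>; the claim is that
    it contains 1.\<close>
  define I where "I = {z \<in> Z. \<exists>g\<in>Z. \<exists>w\<in>Z. z = g * v + q * w}"
  have I_I: "a \<in> I" if "a = g * v + q * w" "a \<in> Z" "g \<in> Z" "w \<in> Z" for a g w
    unfolding I_def using that by (intro CollectI conjI bexI)
  have I_add: "a + b \<in> I" if "a \<in> I" "b \<in> I" for a b
  proof -
    from that obtain g w g' w' where "g \<in> Z" "w \<in> Z" "g' \<in> Z" "w' \<in> Z"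
      "a = g * v + q * w" "b = g' * v + q * w'" "a \<in> Z" "b \<in> Z" by (auto simp: I_def)
    then have "a + b = (g + g') * v + q * (w + w')" "a + b \<in> Z" "g + g' \<in> Z" "w + w' \<in> Z"
      using add_mem[OF that(1)[unfolded I_def, THEN CollectD, THEN conjunct1] that(2)[unfolded I_def, THEN CollectD, THEN conjunct1]]
      by (simp_all add: algebra_simps)
    then show ?thesis by (rule I_I)
  qed
  have I_mult: "a * b \<in> I" if "a \<in> Z" "b \<in> I" for a b
  proof -
    from that obtain g w where "g \<in> Z" "w \<in> Z" "b = g * v + q * w" "b \<in> Z" by (auto simp: I_def)
    then have "a * b = (a * g) * v + q * (a * w)" "a * b \<in> Z" "a * g \<in> Z" "a * w \<in> Z"
      using mult_mem[OF that(1) that(2)[unfolded I_def, THEN CollectD, THEN conjunct1]] that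
      by (simp_all add: algebra_simps)
    then show ?thesis by (rule I_I)
  qed
  have "v = 1 * v + q * 0" by simp
  then have I_v: "v \<in> I" by (rule I_I) (use v in auto)
  have I_q: "q * a \<in> I" if "a \<in> Z" for a
  proof -
    have "q * a = 0 * v + q * a" by simp
    then show ?thesis by (rule I_I) (use mem that in auto)
  qed
  obtain k' where k': "k = Suc k'" using k by (cases k) auto
  define e where "e = s ^ k"
  define t where "t = s ^ k'"
  have ee: "e * e = e + q * c" using idem by (simp add: e_def mult_2 power_add)
  have st: "s * t = e" by (simp add: e_def t_def k')
  \<comment> \<open>Multiplying \<open>v\<close> by \<open>t * e\<close> turns its second term into
    a multiple of \<open>e - e * e\<close>, which is divisible by \<open>q\<close>; what remains is
    \<open>e\<close> up to \<open>q\<close>, so \<open>s ^ k\<close> lies in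
    \<open>I\<close>.\<close>
  have "(t * e) * v = (s * t) * e + t * (e - e * e) * y" by (simp add: v_def e_def algebra_simps)
  also have "\<dots> = e + q * (c - t * (c * y))" unfolding st ee by (simp add: algebra_simps)
  finally have "e = (t * e) * v + q * (- (c - t * (c * y)))" by (simp add: algebra_simps)
  moreover have "t \<in> Z" "e \<in> Z" "- (c - t * (c * y)) \<in> Z" using mem by (auto simp: e_def t_def)
  ultimately have sk: "s ^ k \<in> I"
    using I_add[OF I_mult[OF mult_mem I_v, of t e] I_q[of "- (c - t * (c * y))"]] by (simp add: e_def)
  have "1 + (1 - x) * s = v + y * s ^ k + q * (- w)"
  proof -
    have y: "y = 1 + q * w - x * s" using eq by (simp add: algebra_simps)
    show ?thesis unfolding v_def y by (simp add: algebra_simps)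
  qed
  then have n: "1 + (1 - x) * s \<in> I"
    using I_add[OF I_add[OF I_v I_mult[OF mem(3) sk]] I_q[of "- w"]] mem by simp
  \<comment> \<open>Now \<open>1 - u\<close> lies in \<open>I\<close>, and so does
    \<open>u ^ k\<close>, being a multiple of \<open>s ^ k\<close>; the geometric sum combines the
    two into 1.\<close>
  define u where "u = (x - 1) * s"
  have "1 = (\<Sum>i<k. u ^ i) * (1 - u) + u ^ k"
    using one_diff_power_eq[of u k] by (simp add: mult.commute[of _ "1 - u"] diff_eq_eq)
  moreover have "1 - u \<in> I" using n by (simp add: u_def algebra_simps)
  moreover have "u ^ k \<in> I" using I_mult[OF _ sk, of "(x - 1) ^ k"] mem
    by (simp add: u_def power_mult_distrib)
  moreover have "(\<Sum>i<k. u ^ i) \<in> Z" using mem by (auto simp: u_def)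
  ultimately have "1 \<in> I" using I_add[OF I_mult[of "\<Sum>i<k. u ^ i" "1 - u"], of "u ^ k"] by simp
  then obtain g w' where "g \<in> Z" "w' \<in> Z" "1 = g * v + q * w'" by (auto simp: I_def)
  then show ?thesis unfolding v_def by metis
qed

text \<open>Pigeonhole on the powers of \<open>s\<close> in the finite quotient: they become
  periodic, and an exponent that is a multiple of the period and beyond the preperiod gives an
  idempotent.\<close>

lemma power_idem_mod:
  assumes s: "s \<in> Z" and q: "q \<in> Z" and R: "finite R"
    and rep: "\<And>z. z \<in> Z \<Longrightarrow> \<exists>r\<in>R. \<exists>c\<in>Z. z = r + q * c"
  shows "\<exists>k\<ge>1. \<exists>c\<in>Z. s ^ (2 * k) = s ^ k + q * c"
proof -
  obtain f where f: "\<And>n. f n \<in> R \<and> (\<exists>c\<in>Z. s ^ n = f n + q * c)"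
    using rep[OF power_mem[OF s]] by metis
  have "finite (range f)" using R f by (auto intro: finite_subset)
  then have "\<not> inj f" using range_inj_infinite by auto
  then obtain i j where ij: "f i = f j" "i < j" by (auto simp: inj_def) (metis linorder_neqE_nat)
  obtain c1 c2 where c: "c1 \<in> Z" "c2 \<in> Z" "s ^ i = f i + q * c1" "s ^ j = f j + q * c2"
    using f by metis
  have step: "\<exists>c\<in>Z. s ^ (i + e + n * (j - i)) = s ^ (i + e) + q * c" for n e
  proof (induction n)
    case 0 show ?case by (auto intro!: bexI[of _ 0])
  next
    case (Suc n)
    then obtain c where c': "c \<in> Z" "s ^ (i + e + n * (j - i)) = s ^ (i + e) + q * c" by auto
    have "s ^ (i + e + Suc n * (j - i)) = s ^ ((i + e + n * (j - i)) + (j - i))" by (simp add: ac_simps)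
    also have "\<dots> = (s ^ (i + e) + q * c) * s ^ (j - i)"
      by (subst power_add) (simp only: c'(2))
    finally have e: "s ^ (i + e + Suc n * (j - i)) = (s ^ (i + e) + q * c) * s ^ (j - i)" .
    have "s ^ (i + e) * s ^ (j - i) = s ^ e * s ^ j"
      using ij by (simp add: power_add[symmetric])
    moreover have "s ^ j = s ^ i + q * (c2 - c1)" using c ij by (simp add: algebra_simps)
    ultimately have "s ^ (i + e) * s ^ (j - i) = s ^ (i + e) + q * (s ^ e * (c2 - c1))"
      by (simp add: distrib_left power_add mult.left_commute mult.commute[of "s ^ e"])
    then have "(s ^ (i + e) + q * c) * s ^ (j - i) = s ^ (i + e) + q * (c * s ^ (j - i) + s ^ e * (c2 - c1))"
      by (simp add: algebra_simps)
    with e have "s ^ (i + e + Suc n * (j - i)) = s ^ (i + e) + q * (c * s ^ (j - i) + s ^ e * (c2 - c1))" by simp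
    moreover have "c * s ^ (j - i) + s ^ e * (c2 - c1) \<in> Z" using c' c s by auto
    ultimately show ?case by blast
  qed
  \<comment> \<open>A multiple of the period \<open>j - i\<close> that is at least \<open>i\<close>;
    from \<open>s ^ k\<close>, going \<open>i + 1\<close> periods further leads to
    \<open>s ^ (2 * k)\<close>.\<close>
  define k where "k = (i + 1) * (j - i)"
  have "(i + 1) * 1 \<le> (i + 1) * (j - i)" using ij by (intro mult_left_mono) auto
  then have k: "k \<ge> i" "k \<ge> 1" by (auto simp: k_def)
  have e: "i + (k - i) = k" using k by simp
  have "\<exists>c\<in>Z. s ^ (2 * k) = s ^ k + q * c"
    using step[of "k - i" "i + 1"] unfolding e k_def[symmetric] by (simp add: mult_2)
  then show ?thesis using k by blast
qed

end

section \<open>The integral group ring of a cyclic group\<close>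

definition zpoly :: "int poly \<Rightarrow> complex \<Rightarrow> complex" where
  "zpoly f z = poly (map_poly of_int f) z"

lemma zpoly_pCons: "zpoly (pCons a f) z = of_int a + z * zpoly f z"
  by (simp add: zpoly_def map_poly_pCons)

lemma zpoly_simps [simp]:
  "zpoly 0 z = 0" "zpoly 1 z = 1" "zpoly [:a:] z = of_int a" "zpoly [:a, b:] z = of_int a + of_int b * z"
  by (simp_all add: zpoly_def map_poly_pCons one_pCons)

lemma zpoly_add [simp]: "zpoly (f + g) z = zpoly f z + zpoly g z"
  by (induction f g rule: poly_induct2) (simp_all add: zpoly_pCons algebra_simps)

lemma zpoly_uminus [simp]: "zpoly (- f) z = - zpoly f z"
  by (induction f) (simp_all add: zpoly_pCons algebra_simps)

lemma zpoly_diff [simp]: "zpoly (f - g) z = zpoly f z - zpoly g z"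
  using zpoly_add[of f "- g"] by simp

lemma zpoly_smult [simp]: "zpoly (Polynomial.smult c f) z = of_int c * zpoly f z"
  by (induction f) (simp_all add: zpoly_pCons algebra_simps)

lemma zpoly_mult [simp]: "zpoly (f * g) z = zpoly f z * zpoly g z"
  by (induction f) (simp_all add: zpoly_pCons algebra_simps)

lemma zpoly_power [simp]: "zpoly (f ^ n) z = zpoly f z ^ n"
  by (induction n) simp_all

lemma zpoly_sum [simp]: "zpoly (sum f A) z = (\<Sum>i\<in>A. zpoly (f i) z)"
  by (induction A rule: infinite_finite_induct) simp_all

lemma zpoly_prod [simp]: "zpoly (prod f A) z = (\<Prod>i\<in>A. zpoly (f i) z)"
  by (induction A rule: infinite_finite_induct) simp_all

lemma zpoly_monom [simp]: "zpoly (Polynomial.monom a n) z = of_int a * z ^ n"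
  by (simp add: zpoly_def map_poly_monom poly_monom)

lemma zpoly_of_int: "zpoly f (of_int k) = of_int (poly f k)"
  by (induction f) (simp_all add: zpoly_pCons)

lemma zpoly_1: "zpoly f 1 = of_int (poly f 1)"
  using zpoly_of_int[of f 1] by simp

lemma zpoly_altdef: "degree f < n \<Longrightarrow> zpoly f z = (\<Sum>i<n. of_int (poly.coeff f i) * z ^ i)"
  unfolding zpoly_def
  by (subst poly_altdef) (auto simp: degree_map_poly coeff_map_poly intro!: sum.mono_neutral_left coeff_eq_0)

lemma zpoly_pcompose_monom: "zpoly (pcompose f (Polynomial.monom 1 n)) z = zpoly f (z ^ n)"
  by (induction f) (simp_all add: pcompose_pCons zpoly_pCons)

text \<open>
  The ring of the cyclic group of order \<open>d\<close> is represented by the values of its elements at the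
  \<open>d\<close>-th roots of unity; all other arguments are mapped to the root \<open>1\<close>, so that the
  constant function \<open>1\<close> is the unit.
\<close>

definition root_or_1 :: "nat \<Rightarrow> complex \<Rightarrow> complex" where
  "root_or_1 d w = (if w ^ d = 1 then w else 1)"

definition cyc_ev :: "nat \<Rightarrow> int poly \<Rightarrow> complex \<Rightarrow> complex" where
  "cyc_ev d f = (\<lambda>w. zpoly f (root_or_1 d w))"

definition cyc_ring :: "nat \<Rightarrow> (complex \<Rightarrow> complex) set" where
  "cyc_ring d = range (cyc_ev d)"

lemma root_or_1_pow [simp]: "root_or_1 d w ^ d = 1"
  by (simp add: root_or_1_def)

lemma root_or_1_pow_mod: "root_or_1 d w ^ k = root_or_1 d w ^ (k mod d)"
proof -
  have "root_or_1 d w ^ k = root_or_1 d w ^ (d * (k div d) + k mod d)" by simp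
  also have "\<dots> = root_or_1 d w ^ (k mod d)" by (simp only: power_add power_mult) simp
  finally show ?thesis .
qed

lemma root_or_1_1 [simp]: "root_or_1 d 1 = 1"
  by (simp add: root_or_1_def)

lemma cyc_ev_simps:
  "cyc_ev d 1 = 1" "cyc_ev d (f + g) = cyc_ev d f + cyc_ev d g" "cyc_ev d (- f) = - cyc_ev d f"
  "cyc_ev d (f - g) = cyc_ev d f - cyc_ev d g"
  "cyc_ev d (f * g) = cyc_ev d f * cyc_ev d g" "cyc_ev d [:k:] = of_int k"
  by (auto simp: cyc_ev_def fun_eq_iff)

lemma cyc_ev_mem [simp]: "cyc_ev d f \<in> cyc_ring d"
  by (simp add: cyc_ring_def)

interpretation cyc: subring_pred "cyc_ring d" for d
proof
  show "1 \<in> cyc_ring d" using cyc_ev_mem[of d 1] by (simp only: cyc_ev_simps)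
qed (auto simp: cyc_ring_def cyc_ev_simps(2,3,5)[symmetric])

lemma cyc_ring_int_at_1: "z \<in> cyc_ring d \<Longrightarrow> \<exists>k::int. z 1 = of_int k"
  by (auto simp: cyc_ring_def cyc_ev_def zpoly_1)

definition cyc_gen :: "nat \<Rightarrow> complex \<Rightarrow> complex" where
  "cyc_gen d = root_or_1 d"

lemma cyc_gen_mem [simp, intro]: "cyc_gen d \<in> cyc_ring d"
proof -
  have "cyc_gen d = cyc_ev d [:0, 1:]" by (simp add: cyc_gen_def cyc_ev_def)
  then show ?thesis by simp
qed

lemma cyc_gen_1 [simp]: "cyc_gen d 1 = 1"
  by (simp add: cyc_gen_def)

text \<open>A polynomial that vanishes at 1 is divisible by X - 1; hence the augmentation ideal of
  the cyclic group ring is generated by the generator minus 1. This ties augmentation 0 to the ideal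
  [y - 1).\<close>

lemma cyc_ring_aug_0:
  assumes "z \<in> cyc_ring d" "z 1 = 0"
  shows "\<exists>c\<in>cyc_ring d. z = (cyc_gen d - 1) * c"
proof -
  obtain f where f: "z = cyc_ev d f" using assms by (auto simp: cyc_ring_def)
  then have "poly f 1 = 0" using assms(2) by (simp add: cyc_ev_def zpoly_1)
  then obtain g where g: "f = [:-1, 1:] * g" by (metis dvdE poly_eq_0_iff_dvd)
  have "z = (cyc_gen d - 1) * cyc_ev d g"
    unfolding f g by (simp only: cyc_ev_simps) (auto simp: fun_eq_iff cyc_ev_def cyc_gen_def)
  then show ?thesis by auto
qed

text \<open>At d-th roots of unity exponents count modulo \<open>d\<close> only, so coefficients
  with equal residue are added up.\<close>

lemma cyc_ring_reduce:
  assumes "z \<in> cyc_ring d" "d > 0"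
  shows "\<exists>c::nat \<Rightarrow> int. z = (\<lambda>w. \<Sum>j<d. of_int (c j) * root_or_1 d w ^ j)"
proof -
  obtain f where f: "z = cyc_ev d f" using assms by (auto simp: cyc_ring_def)
  define n where "n = Suc (degree f)"
  define c where "c j = (\<Sum>i\<in>{i\<in>{..<n}. i mod d = j}. poly.coeff f i)" for j
  have "z w = (\<Sum>j<d. of_int (c j) * root_or_1 d w ^ j)" for w
  proof -
    have "z w = (\<Sum>i<n. of_int (poly.coeff f i) * root_or_1 d w ^ i)"
      unfolding f cyc_ev_def by (rule zpoly_altdef) (simp add: n_def)
    also have "\<dots> = (\<Sum>i<n. of_int (poly.coeff f i) * root_or_1 d w ^ (i mod d))"
      using root_or_1_pow_mod by (intro sum.cong) auto
    also have "\<dots> = (\<Sum>j<d. \<Sum>i\<in>{i\<in>{..<n}. i mod d = j}. of_int (poly.coeff f i) * root_or_1 d w ^ (i mod d))"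
      using assms(2) by (intro sum.group[symmetric]) auto
    also have "\<dots> = (\<Sum>j<d. of_int (c j) * root_or_1 d w ^ j)"
      by (intro sum.cong HOL.refl) (auto simp: c_def sum_distrib_right)
    finally show ?thesis .
  qed
  then show ?thesis by (intro exI[of _ c]) auto
qed

lemma cyc_ring_sum_mem:
  "(\<lambda>w. \<Sum>j<(n::nat). of_int (c j) * root_or_1 d w ^ j) \<in> cyc_ring d"
proof -
  have "(\<lambda>w. \<Sum>j<n. of_int (c j) * root_or_1 d w ^ j) = cyc_ev d (\<Sum>j<n. Polynomial.monom (c j) j)"
    by (simp add: cyc_ev_def fun_eq_iff)
  then show ?thesis by simp
qed

text \<open>Reducing the \<open>d\<close> coefficients modulo \<open>N\<close> leaves finitely many
  representatives; these are what \<open>power_idem_mod\<close> asks for.\<close>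

lemma cyc_ring_finite_mod:
  assumes "N > (0::int)" "d > 0"
  shows "\<exists>R. finite R \<and> (\<forall>z\<in>cyc_ring d. \<exists>r\<in>R. \<exists>c\<in>cyc_ring d. z = r + of_int N * c)"
proof -
  let ?F = "\<lambda>(c::nat \<Rightarrow> int) w. \<Sum>j<d. of_int (c j) * root_or_1 d w ^ j"
  let ?R = "?F ` ({..<d} \<rightarrow>\<^sub>E {0..<N})"
  have "finite ?R" by (intro finite_imageI finite_PiE) auto
  moreover have "\<exists>r\<in>?R. \<exists>c\<in>cyc_ring d. z = r + of_int N * c" if z: "z \<in> cyc_ring d" for z
  proof -
    obtain c where c: "z = ?F c" using cyc_ring_reduce[OF z assms(2)] by auto
    let ?r = "\<lambda>j\<in>{..<d}. c j mod N" and ?q = "\<lambda>j. c j div N"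
    have "z w = ?F ?r w + of_int N * ?F ?q w" for w
      unfolding c sum_distrib_left sum.distrib[symmetric]
    proof (rule sum.cong[OF HOL.refl])
      fix j assume j: "j \<in> {..<d}"
      have e: "(of_int (c j) :: complex) = of_int (c j mod N) + of_int N * of_int (c j div N)"
        unfolding of_int_mult[symmetric] of_int_add[symmetric] by (simp only: mod_mult_div_eq)
      show "of_int (c j) * root_or_1 d w ^ j = of_int (?r j) * root_or_1 d w ^ j
          + of_int N * (of_int (?q j) * root_or_1 d w ^ j)"
        unfolding e using j by (simp add: algebra_simps)
    qed
    then have "z = ?F ?r + of_int N * ?F ?q" by (simp add: fun_eq_iff)
    moreover have "?F ?r \<in> ?R" using assms by (intro imageI PiE_I) auto
    ultimately show ?thesis using cyc_ring_sum_mem by (intro bexI[of _ "?F ?r"] bexI[of _ "?F ?q"])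
  qed
  ultimately show ?thesis by (intro exI[of _ ?R] conjI ballI)
qed

text \<open>Elimination without division: a vector with nonzero entry at place \<open>g\<close>
  serves as pivot, and the others are cleared there by cross multiplication. It gives algebraic
  relations in the cyclic group ring as well as the bound on ranks.\<close>

lemma int_relation:
  fixes A :: "'b \<Rightarrow> nat \<Rightarrow> int"
  assumes "finite B" "card B > g"
  shows "\<exists>c. (\<exists>b\<in>B. c b \<noteq> 0) \<and> (\<forall>i<g. (\<Sum>b\<in>B. c b * A b i) = 0)"
  using assms
proof (induction g arbitrary: B A)
  case 0
  then have "B \<noteq> {}" by auto
  then show ?case by (intro exI[of _ "\<lambda>_. 1"]) auto
next
  case (Suc g)
  show ?case
  proof (cases "\<forall>b\<in>B. A b g = 0")
    case True
    have "\<exists>c. (\<exists>b\<in>B. c b \<noteq> 0) \<and> (\<forall>i<g. (\<Sum>b\<in>B. c b * A b i) = 0)"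
      using Suc by auto
    then show ?thesis using True by (auto simp: less_Suc_eq)
  next
    case False
    then obtain b0 where b0: "b0 \<in> B" "A b0 g \<noteq> 0" by auto
    define B' where "B' = B - {b0}"
    have B': "finite B'" "card B' > g" "b0 \<notin> B'" "B = insert b0 B'"
      using Suc.prems b0 by (auto simp: B'_def)
    obtain c where c: "\<exists>b\<in>B'. c b \<noteq> 0"
      "\<forall>i<g. (\<Sum>b\<in>B'. c b * (A b0 g * A b i - A b g * A b0 i)) = 0"
      using Suc.IH[OF B'(1,2), of "\<lambda>b i. A b0 g * A b i - A b g * A b0 i"] by auto
    \<comment> \<open>Undoes the cross multiplication; the coefficient of the pivot is the one that
      makes place \<open>g\<close> cancel.\<close>
    define e where "e b = (if b = b0 then - (\<Sum>b\<in>B'. c b * A b g) else A b0 g * c b)" for b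
    have sum: "(\<Sum>b\<in>B. e b * A b i) = (\<Sum>b\<in>B'. c b * (A b0 g * A b i - A b g * A b0 i))" for i
    proof -
      have "(\<Sum>b\<in>B. e b * A b i) = e b0 * A b0 i + (\<Sum>b\<in>B'. e b * A b i)" using B' by simp
      also have "(\<Sum>b\<in>B'. e b * A b i) = (\<Sum>b\<in>B'. A b0 g * c b * A b i)"
        using B' by (intro sum.cong) (auto simp: e_def)
      also have "e b0 * A b0 i + \<dots> = (\<Sum>b\<in>B'. c b * (A b0 g * A b i - A b g * A b0 i))"
        by (simp add: e_def sum_distrib_right sum_distrib_left sum_subtractf algebra_simps)
      finally show ?thesis .
    qed
    have "(\<Sum>b\<in>B. e b * A b i) = 0" if "i < Suc g" for i
      using c(2) that unfolding sum by (cases "i = g") (auto simp: less_Suc_eq mult.commute)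
    moreover have "\<exists>b\<in>B. e b \<noteq> 0" using c(1) b0 B' by (auto simp: e_def)
    ultimately show ?thesis by (intro exI[of _ e] conjI allI impI)
  qed
qed

text \<open>The powers of \<open>z\<close> up to the exponent \<open>d\<close> lie in a group
  generated by \<open>d\<close> elements, so they satisfy an integer relation. Since
  \<open>z\<close> has no zeros, its lowest power can be cancelled, and the lowest coefficient
  becomes a multiple of \<open>z\<close>. Hence the quotient modulo \<open>z\<close> is
  finite.\<close>

lemma cyc_ring_divides_int:
  assumes z: "z \<in> cyc_ring d" and nz: "\<And>w. z w \<noteq> 0" and d: "d > 0"
  shows "\<exists>N>(0::int). \<exists>c\<in>cyc_ring d. of_int N = z * c"
proof -
  have "\<exists>c. \<forall>w. (z ^ i) w = (\<Sum>j<d. of_int (c j) * root_or_1 d w ^ j)" for i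
    using cyc_ring_reduce[OF cyc.power_mem[OF z] d, of i] by metis
  then obtain A :: "nat \<Rightarrow> nat \<Rightarrow> int"
    where A: "\<And>i w. z w ^ i = (\<Sum>j<d. of_int (A i j) * root_or_1 d w ^ j)"
    by (metis power_fun_apply)
  obtain c where c: "\<exists>i\<in>{..d}. c i \<noteq> 0" "\<forall>j<d. (\<Sum>i\<le>d. c i * A i j) = 0"
    using int_relation[of "{..d}" d A] by auto
  have rel: "(\<Sum>i\<le>d. of_int (c i) * z w ^ i) = 0" for w
  proof -
    have "(\<Sum>i\<le>d. of_int (c i) * z w ^ i) = (\<Sum>i\<le>d. \<Sum>j<d. of_int (c i * A i j) * root_or_1 d w ^ j)"
      unfolding A by (simp add: sum_distrib_left mult.assoc)
    also have "\<dots> = (\<Sum>j<d. of_int (\<Sum>i\<le>d. c i * A i j) * root_or_1 d w ^ j)"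
      by (subst sum.swap) (simp add: sum_distrib_right)
    finally show ?thesis using c(2) by simp
  qed
  define i0 where "i0 = (LEAST i. i \<le> d \<and> c i \<noteq> 0)"
  have i0: "i0 \<le> d" "c i0 \<noteq> 0" using c(1) LeastI_ex[of "\<lambda>i. i \<le> d \<and> c i \<noteq> 0"] by (auto simp: i0_def)
  have lt: "c i = 0" if "i < i0" for i
    using not_less_Least[of i "\<lambda>i. i \<le> d \<and> c i \<noteq> 0"] that i0 by (auto simp: i0_def)
  define g where "g = (\<Sum>i\<in>{i0<..d}. of_int (c i) * z ^ (i - Suc i0))"
  have g: "g \<in> cyc_ring d" using z by (auto simp: g_def)
  have key: "of_int (c i0) + z w * g w = 0" for w
  proof -
    have "0 = (\<Sum>i\<in>insert i0 {i0<..d}. of_int (c i) * z w ^ i)"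
      unfolding rel[of w, symmetric] using i0 lt by (intro sum.mono_neutral_right) (auto simp: not_less)
    also have "\<dots> = of_int (c i0) * z w ^ i0 + (\<Sum>i\<in>{i0<..d}. of_int (c i) * z w ^ i)" by simp
    also have "(\<Sum>i\<in>{i0<..d}. of_int (c i) * z w ^ i) = z w ^ i0 * (z w * g w)"
      unfolding g_def sum_fun_apply sum_distrib_left
    proof (rule sum.cong[OF HOL.refl])
      fix i assume i: "i \<in> {i0<..d}"
      then have "z w ^ i = z w ^ i0 * (z w * z w ^ (i - Suc i0))"
        by (simp flip: power_Suc power_add)
      then show "of_int (c i) * z w ^ i = z w ^ i0 * (z w * (of_int (c i) * z ^ (i - Suc i0)) w)" by simp
    qed
    finally have "0 = z w ^ i0 * (of_int (c i0) + z w * g w)" by (simp add: algebra_simps)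
    then show ?thesis using nz[of w] by simp
  qed
  have "of_int (c i0) = z * (- g)"
    using key by (auto simp: fun_eq_iff eq_neg_iff_add_eq_0)
  then have "of_int (- c i0) = z * g" "of_int (c i0) = z * (- g)" "- g \<in> cyc_ring d"
    using g by simp_all
  moreover have "c i0 > 0 \<or> - c i0 > 0" using i0 by auto
  ultimately show ?thesis using g by metis
qed

section \<open>Pairs of a group ring element and an integer matrix\<close>

type_synonym el = "(complex \<Rightarrow> complex) \<times> (nat \<Rightarrow> nat \<Rightarrow> int)"
text \<open>The components of an \<open>lvec\<close> are a row vector in \<open>R(2)\<close>, the image of an element of \<open>[y - 1)\<close>, and the
  images of the coordinates in a free module.\<close>

type_synonym lvec = "(nat \<Rightarrow> int) \<times> el \<times> (nat \<Rightarrow> el)"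

text \<open>The result is cut off outside \<open>{1..d}\<close>; with this convention equality of
  functions is equality of row vectors and matrices.\<close>

definition vm :: "nat \<Rightarrow> (nat \<Rightarrow> int) \<Rightarrow> (nat \<Rightarrow> nat \<Rightarrow> int) \<Rightarrow> nat \<Rightarrow> int" where
  "vm d r t = (\<lambda>j. if j \<in> {1..d} then \<Sum>k = 1..d. r k * t k j else 0)"

definition elm :: "nat \<Rightarrow> el \<Rightarrow> el \<Rightarrow> el" where
  "elm d a b = (fst a * fst b, \<lambda>i. vm d (snd a i) (snd b))"

definition el_one :: "nat \<Rightarrow> el" where
  "el_one d = (1, \<lambda>i j. if i \<in> {1..d} \<and> i = j then 1 else 0)"

definition lact :: "nat \<Rightarrow> lvec \<Rightarrow> el \<Rightarrow> lvec" where
  "lact d u b = (vm d (fst u) (snd b), elm d (fst (snd u)) b, \<lambda>i. elm d (snd (snd u) i) b)"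

lemma vm_add: "vm d (r + r') t = vm d r t + vm d r' t"
  by (auto simp: vm_def fun_eq_iff distrib_right sum.distrib)

lemma vm_diff: "vm d (r - r') t = vm d r t - vm d r' t"
  by (auto simp: vm_def fun_eq_iff left_diff_distrib sum_subtractf)

lemma vm_uminus: "vm d (- r) t = - vm d r t"
  by (auto simp: vm_def fun_eq_iff sum_negf)

lemma vm_0 [simp]: "vm d 0 t = 0"
  by (auto simp: vm_def fun_eq_iff)

lemma vm_0_right [simp]: "vm d r 0 = 0"
  by (auto simp: vm_def fun_eq_iff)

lemma vm_scale: "vm d (\<lambda>j. c * r j) t = (\<lambda>j. c * vm d r t j)"
  by (auto simp: vm_def fun_eq_iff sum_distrib_left mult.assoc)

lemma vm_comb: "vm d (\<lambda>j. c * r j + c' * r' j) t = (\<lambda>j. c * vm d r t j + c' * vm d r' t j)"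
  using vm_add[of d "\<lambda>j. c * r j" "\<lambda>j. c' * r' j"] by (simp add: vm_scale plus_fun_def)

lemma vm_sum: "vm d (\<lambda>j. \<Sum>k\<in>A. f k j) t = (\<lambda>j. \<Sum>k\<in>A. vm d (f k) t j)"
  by (induction A rule: infinite_finite_induct)
    (simp_all add: vm_add[unfolded plus_fun_def] vm_0[unfolded zero_fun_def])

lemma vm_add_right: "vm d r (t + t') = vm d r t + vm d r t'"
  by (auto simp: vm_def fun_eq_iff distrib_left sum.distrib)

lemma vm_uminus_right: "vm d r (- t) = - vm d r t"
  by (auto simp: vm_def fun_eq_iff sum_negf)

lemma vm_assoc: "vm d (vm d r a) b = vm d r (\<lambda>i. vm d (a i) b)"
proof
  fix j
  show "vm d (vm d r a) b j = vm d r (\<lambda>i. vm d (a i) b) j"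
  proof (cases "j \<in> {1..d}")
    case True
    have "vm d (vm d r a) b j = (\<Sum>k = 1..d. (\<Sum>l = 1..d. r l * a l k) * b k j)"
      using True by (simp add: vm_def)
    also have "\<dots> = (\<Sum>l = 1..d. \<Sum>k = 1..d. r l * a l k * b k j)"
      by (subst sum.swap) (simp add: sum_distrib_right)
    also have "\<dots> = vm d r (\<lambda>i. vm d (a i) b) j"
      using True by (simp add: vm_def sum_distrib_left mult.assoc)
    finally show ?thesis .
  next
    case False
    then show ?thesis by (simp only: vm_def if_False)
  qed
qed

lemma elm_assoc: "elm d (elm d a b) c = elm d a (elm d b c)"
  by (simp add: elm_def vm_assoc mult.assoc)

lemma elm_add_left: "elm d (a + b) c = elm d a c + elm d b c"
  by (simp add: elm_def vm_add distrib_right fun_eq_iff)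

lemma elm_diff_left: "elm d (a - b) c = elm d a c - elm d b c"
  by (simp add: elm_def vm_diff left_diff_distrib fun_eq_iff)

lemma elm_uminus_left: "elm d (- a) c = - elm d a c"
  by (simp add: elm_def vm_uminus fun_eq_iff)

lemma elm_add_right: "elm d a (b + c) = elm d a b + elm d a c"
  by (simp add: elm_def vm_add_right distrib_left fun_eq_iff)

lemma elm_uminus_right: "elm d a (- b) = - elm d a b"
  by (simp add: elm_def vm_uminus_right fun_eq_iff)

lemma elm_0 [simp]: "elm d 0 a = 0" "elm d a 0 = 0"
  by (simp_all add: elm_def prod_eq_iff fun_eq_iff)

lemma elm_sum_left: "elm d (\<Sum>i\<in>A. f i) c = (\<Sum>i\<in>A. elm d (f i) c)"
  by (induction A rule: infinite_finite_induct) (simp_all add: elm_add_left)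

lemma fst_elm [simp]: "fst (elm d a b) = fst a * fst b"
  by (simp add: elm_def)

lemma snd_elm: "snd (elm d a b) = (\<lambda>i. vm d (snd a i) (snd b))"
  by (simp add: elm_def)

lemma fst_el_one [simp]: "fst (el_one d) = 1"
  by (simp add: el_one_def)

lemma vm_one:
  assumes "\<And>j. j \<notin> {1..d} \<Longrightarrow> r j = 0"
  shows "vm d r (snd (el_one d)) = r"
proof
  fix j
  have "(\<Sum>k = 1..d. r k * snd (el_one d) k j) = (\<Sum>k = 1..d. if k = j then r k else 0)"
    by (intro sum.cong) (auto simp: el_one_def)
  then show "vm d r (snd (el_one d)) j = r j" using assms by (auto simp: vm_def)
qed

lemma elm_one_right:
  assumes "\<And>i j. j \<notin> {1..d} \<Longrightarrow> snd a i j = 0"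
  shows "elm d a (el_one d) = a"
proof -
  have "vm d (snd a i) (snd (el_one d)) = snd a i" for i by (rule vm_one) (use assms in auto)
  then show ?thesis by (simp add: elm_def fst_el_one)
qed

lemma elm_one_left:
  assumes "\<And>i j. i \<notin> {1..d} \<or> j \<notin> {1..d} \<Longrightarrow> snd a i j = 0"
  shows "elm d (el_one d) a = a"
proof -
  have "vm d (snd (el_one d) i) (snd a) j = snd a i j" for i j
  proof -
    have "(\<Sum>k = 1..d. snd (el_one d) i k * snd a k j) = (\<Sum>k = 1..d. if k = i then snd a k j else 0)"
      by (intro sum.cong) (auto simp: el_one_def)
    then show ?thesis using assms by (auto simp: vm_def)
  qed
  then show ?thesis by (simp add: elm_def el_one_def prod_eq_iff fun_eq_iff)
qed

lemma lact_add: "lact d (u + v) b = lact d u b + lact d v b"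
  by (simp add: lact_def vm_add elm_add_left fun_eq_iff)

section \<open>Transitivity on unimodular vectors\<close>

lemma additive_scale:
  fixes f :: "int \<Rightarrow> int"
  assumes "\<And>k l. f (k + l) = f k + f l"
  shows "f k = k * f 1"
proof (induction k rule: int_induct[of _ 0])
  case base
  show ?case using assms[of 0 0] by simp
next
  case (step1 i)
  then show ?case using assms[of i 1] by (simp add: algebra_simps)
next
  case (step2 i)
  then show ?case using assms[of "i - 1" 1] by (simp add: algebra_simps)
qed

interpretation int: subring_pred "UNIV :: int set"
  by standard auto

text \<open>Stable range one for the integers modulo \<open>c\<close>: the Bezout relation for
  \<open>a\<close>, \<open>b\<close>, \<open>c\<close> is fed to \<open>unit_lift\<close>, whose
  correction term is here a multiple of \<open>b\<close>.\<close>

lemma coprime_shift: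
  fixes a b c :: int
  assumes c: "c \<noteq> 0" and g: "gcd (gcd a b) c = 1"
  shows "\<exists>q. coprime (a + q * b) c"
proof -
  obtain x y where xy: "x * a + y * b = gcd a b" using bezout_int[of a b] by auto
  obtain v w where vw: "v * gcd a b + w * c = 1" using bezout_int[of "gcd a b" c] g by auto
  have "\<exists>r\<in>{0..<\<bar>c\<bar>}. \<exists>e\<in>UNIV. z = r + c * e" for z
  proof -
    have "z = z mod \<bar>c\<bar> + c * (sgn c * (z div \<bar>c\<bar>))"
      using mod_mult_div_eq[of z "\<bar>c\<bar>"] by (simp add: abs_sgn algebra_simps)
    then show ?thesis using c by (intro bexI[of _ "z mod \<bar>c\<bar>"] bexI[of _ "sgn c * (z div \<bar>c\<bar>)"]) auto
  qed
  then obtain k e where k: "k \<ge> 1" "a ^ (2 * k) = a ^ k + c * e"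
    using int.power_idem_mod[of a c "{0..<\<bar>c\<bar>}"] by auto
  have "v * (x * a + y * b) + w * c = 1" using xy vw by simp
  then have "(v * x) * a + v * y * b = 1 + c * (- w)" by (simp add: algebra_simps)
  then obtain g w' where gw: "g * (a + (1 - a ^ k) * (v * y * b)) + c * w' = 1"
    using int.unit_lift[of a "v * x" "v * y * b" c "- w" e k] k by auto
  have "coprime (a + ((1 - a ^ k) * (v * y)) * b) c"
  proof (rule coprimeI)
    fix h assume h: "h dvd a + ((1 - a ^ k) * (v * y)) * b" "h dvd c"
    then have "h dvd g * (a + (1 - a ^ k) * (v * y * b)) + c * w'"
      using dvd_add[OF dvd_mult[of h _ g] dvd_mult2[of h c w']] by (simp add: mult.assoc)
    then show "h dvd 1" using gw by simp
  qed
  then show ?thesis ..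
qed

text \<open>\<open>L_onto\<close>, \<open>L_rad\<close> and \<open>L_p\<close> describe a pullback:
  the projection to the cyclic group ring is onto with kernel the radical of the triangular
  matrices, and the kernel of the other projection contains \<open>p\<close> times the group ring.
  \<open>sy\<close> stands for the sum of the powers of \<open>y\<close>; by \<open>ann\<close>,
  whatever it kills from the right is a left multiple of \<open>y - 1\<close>, so that homomorphisms
  from [y - 1) to Lambda are left multiplications.\<close>

locale straight_core =
  fixes p d :: nat and L :: "el set" and y sy :: el
  assumes prime: "prime p" and d: "d = p - 1" and d2: "d \<ge> 2"
    and L_ring: "\<And>a. a \<in> L \<Longrightarrow> fst a \<in> cyc_ring d"
    and L_supp: "\<And>a i j. a \<in> L \<Longrightarrow> i \<notin> {1..d} \<or> j \<notin> {1..d} \<Longrightarrow> snd a i j = 0"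
    and L_tri: "\<And>a i j. a \<in> L \<Longrightarrow> j < i \<Longrightarrow> int p dvd snd a i j"
    and L_add: "\<And>a b. a \<in> L \<Longrightarrow> b \<in> L \<Longrightarrow> a + b \<in> L"
    and L_neg: "\<And>a. a \<in> L \<Longrightarrow> - a \<in> L"
    and L_mul: "\<And>a b. a \<in> L \<Longrightarrow> b \<in> L \<Longrightarrow> elm d a b \<in> L"
    and L_one: "el_one d \<in> L"
    and L_onto: "\<And>z. z \<in> cyc_ring d \<Longrightarrow> \<exists>a\<in>L. fst a = z"
    and L_rad: "\<And>t. (0, t) \<in> L \<longleftrightarrow>
        (\<forall>i j. (i \<notin> {1..d} \<or> j \<notin> {1..d} \<longrightarrow> t i j = 0) \<and> (j \<le> i \<longrightarrow> int p dvd t i j))"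
    and L_p: "\<And>z. z \<in> cyc_ring d \<Longrightarrow> (of_nat p * z, 0) \<in> L"
    and y_mem: "y \<in> L" and fst_y: "fst y = cyc_gen d"
    and sy_mem: "sy \<in> L" and y_sy: "elm d (y - el_one d) sy = 0"
    and ann: "\<And>z. z \<in> L \<Longrightarrow> elm d z sy = 0 \<Longrightarrow> \<exists>a\<in>L. z = elm d a (y - el_one d)"
begin

abbreviation em (infixl "\<star>" 70) where "a \<star> b \<equiv> elm d a b"

abbreviation y1 where "y1 \<equiv> y - el_one d"

definition R2 where
  "R2 = {r :: nat \<Rightarrow> int. (\<forall>j. j \<notin> {1..d} \<longrightarrow> r j = 0) \<and> int p dvd r 1}"

definition Y1 where "Y1 = (\<lambda>a. y1 \<star> a) ` L"

definition Lat where
  "Lat n = {u :: lvec. fst u \<in> R2 \<and> fst (snd u) \<in> Y1 \<and>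
     (\<forall>i. if i < n then snd (snd u) i \<in> L else snd (snd u) i = 0)}"

definition aut where
  "aut n \<phi> \<longleftrightarrow> bij_betw \<phi> (Lat n) (Lat n) \<and>
     (\<forall>u\<in>Lat n. \<forall>v\<in>Lat n. \<phi> (u + v) = \<phi> u + \<phi> v) \<and>
     (\<forall>u\<in>Lat n. \<forall>b\<in>L. \<phi> (lact d u b) = lact d (\<phi> u) b)"

definition orb where "orb n u v \<longleftrightarrow> (\<exists>\<phi>. aut n \<phi> \<and> \<phi> u = v)"

text \<open>Unimodular in the module sense: some linear functional takes the value 1. This is how
  the generator of a free direct summand is recognised.\<close>

definition uni where
  "uni n u \<longleftrightarrow> (\<exists>h. (\<forall>v\<in>Lat n. h v \<in> L) \<and>
     (\<forall>v\<in>Lat n. \<forall>w\<in>Lat n. h (v + w) = h v + h w) \<and>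
     (\<forall>v\<in>Lat n. \<forall>b\<in>L. h (lact d v b) = h v \<star> b) \<and> h u = el_one d)"

lemma p_pos [simp]: "p > 0" "d > 0" "p \<noteq> 0"
  using prime_gt_0_nat[OF prime] d2 by auto

lemma L_0 [simp]: "0 \<in> L"
  using L_add[OF L_one L_neg[OF L_one]] by simp

lemma L_diff: "a \<in> L \<Longrightarrow> b \<in> L \<Longrightarrow> a - b \<in> L"
  using L_add[of a "- b"] L_neg by simp

lemma L_sum: "(\<And>i. i \<in> A \<Longrightarrow> f i \<in> L) \<Longrightarrow> sum f A \<in> L"
  by (induction A rule: infinite_finite_induct) (auto intro: L_add)

lemma y1_mem [simp]: "y1 \<in> L"
  by (intro L_diff y_mem L_one)

lemma fst_y1: "fst y1 = cyc_gen d - 1"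
  by (simp add: fst_y el_one_def)

lemma Y1_L: "s \<in> Y1 \<Longrightarrow> s \<in> L"
  by (auto simp: Y1_def intro: L_mul)

lemma Y1_I: "a \<in> L \<Longrightarrow> y1 \<star> a \<in> Y1"
  by (simp add: Y1_def)

lemma Y1_add: "s \<in> Y1 \<Longrightarrow> s' \<in> Y1 \<Longrightarrow> s + s' \<in> Y1"
  unfolding Y1_def by (elim imageE) (simp only: elm_add_right[symmetric] imageI L_add)

lemma Y1_neg: "s \<in> Y1 \<Longrightarrow> - s \<in> Y1"
  unfolding Y1_def by (elim imageE) (simp only: elm_uminus_right[symmetric] imageI L_neg)

lemma Y1_mul: "s \<in> Y1 \<Longrightarrow> b \<in> L \<Longrightarrow> s \<star> b \<in> Y1"
  unfolding Y1_def by (elim imageE) (simp only: elm_assoc imageI L_mul)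

lemma Y1_0 [simp]: "0 \<in> Y1"
  using Y1_I[OF L_0] by simp

lemma Y1_aug: "s \<in> Y1 \<Longrightarrow> fst s 1 = 0"
  unfolding Y1_def by (elim imageE) (simp add: fst_y)

lemma R2_add: "r \<in> R2 \<Longrightarrow> r' \<in> R2 \<Longrightarrow> r + r' \<in> R2"
  by (auto simp: R2_def)

lemma R2_neg: "r \<in> R2 \<Longrightarrow> - r \<in> R2"
  by (auto simp: R2_def)

lemma R2_0 [simp]: "0 \<in> R2"
  by (auto simp: R2_def)

lemma vm_supp: "j \<notin> {1..d} \<Longrightarrow> vm d r t j = 0"
  by (auto simp: vm_def)

text \<open>Below the first row, column 1 of a triangular matrix is divisible by
  \<open>p\<close>.\<close>

lemma R2_vm: assumes "r \<in> R2" "b \<in> L" shows "vm d r (snd b) \<in> R2"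
proof -
  have "int p dvd (\<Sum>k = 1..d. r k * snd b k 1)"
  proof (rule dvd_sum)
    fix k assume "k \<in> {1..d}"
    then show "int p dvd r k * snd b k 1"
      using assms L_tri[OF assms(2), of 1 k] by (cases "k = 1") (auto simp: R2_def)
  qed
  then show ?thesis using vm_supp by (auto simp: R2_def vm_def)
qed

lemma Lat_iff: "(r, s, l) \<in> Lat n \<longleftrightarrow> r \<in> R2 \<and> s \<in> Y1 \<and> (\<forall>i<n. l i \<in> L) \<and> (\<forall>i\<ge>n. l i = 0)"
  by (force simp: Lat_def split: if_splits)

lemma Lat_add: "u \<in> Lat n \<Longrightarrow> v \<in> Lat n \<Longrightarrow> u + v \<in> Lat n"
  by (cases u; cases v) (auto simp: Lat_iff R2_add Y1_add L_add)

lemma Lat_neg: "u \<in> Lat n \<Longrightarrow> - u \<in> Lat n"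
  by (cases u) (auto simp: Lat_iff R2_neg Y1_neg L_neg)

lemma Lat_diff: "u \<in> Lat n \<Longrightarrow> v \<in> Lat n \<Longrightarrow> u - v \<in> Lat n"
  using Lat_add[of u n "- v"] Lat_neg by simp

lemma Lat_0 [simp]: "0 \<in> Lat n"
  by (simp add: zero_prod_def Lat_iff) (simp flip: zero_prod_def)

lemma Lat_lact: "u \<in> Lat n \<Longrightarrow> b \<in> L \<Longrightarrow> lact d u b \<in> Lat n"
  by (cases u) (auto simp: Lat_iff lact_def R2_vm Y1_mul L_mul)

lemma aut_I:
  assumes "\<And>v. v \<in> Lat n \<Longrightarrow> \<phi> v \<in> Lat n" "\<And>v. v \<in> Lat n \<Longrightarrow> \<psi> v \<in> Lat n"
    and "\<And>u v. u \<in> Lat n \<Longrightarrow> v \<in> Lat n \<Longrightarrow> \<phi> (u + v) = \<phi> u + \<phi> v"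
    and "\<And>u b. u \<in> Lat n \<Longrightarrow> b \<in> L \<Longrightarrow> \<phi> (lact d u b) = lact d (\<phi> u) b"
    and "\<And>v. v \<in> Lat n \<Longrightarrow> \<psi> (\<phi> v) = v" "\<And>v. v \<in> Lat n \<Longrightarrow> \<phi> (\<psi> v) = v"
  shows "aut n \<phi>"
  unfolding aut_def using assms by (auto intro!: bij_betw_byWitness[of _ \<psi>])

lemma orb_mem: "orb n u v \<Longrightarrow> u \<in> Lat n \<Longrightarrow> v \<in> Lat n"
  by (auto simp: orb_def aut_def bij_betw_def)

lemma orb_self: "orb n u u"
  unfolding orb_def by (intro exI[of _ "\<lambda>v. v"]) (simp add: aut_def bij_betw_def)

lemma orb_trans: assumes "orb n u v" "orb n v w" shows "orb n u w"
proof -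
  obtain f g where f: "aut n f" "f u = v" and g: "aut n g" "g v = w" using assms by (auto simp: orb_def)
  have m: "x \<in> Lat n \<Longrightarrow> f x \<in> Lat n" for x using f by (auto simp: aut_def bij_betw_def)
  have "aut n (g \<circ> f)"
    using f(1) g(1) m bij_betw_trans[of f "Lat n" "Lat n" g "Lat n"] by (simp add: aut_def)
  then show ?thesis using f g unfolding orb_def by (intro exI[of _ "g \<circ> f"]) simp
qed

lemma uni_orb: assumes "uni n u" "orb n u v" "u \<in> Lat n" shows "uni n v"
proof -
  obtain h where h: "\<forall>v\<in>Lat n. h v \<in> L" "\<forall>v\<in>Lat n. \<forall>w\<in>Lat n. h (v + w) = h v + h w"
    "\<forall>v\<in>Lat n. \<forall>b\<in>L. h (lact d v b) = h v \<star> b" "h u = el_one d"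
    using assms by (auto simp: uni_def)
  obtain f where "aut n f" and fu: "f u = v" using assms by (auto simp: orb_def)
  then have f: "bij_betw f (Lat n) (Lat n)" "f u = v"
    "\<And>u v. u \<in> Lat n \<Longrightarrow> v \<in> Lat n \<Longrightarrow> f (u + v) = f u + f v"
    "\<And>u b. u \<in> Lat n \<Longrightarrow> b \<in> L \<Longrightarrow> f (lact d u b) = lact d (f u) b"
    by (simp_all add: aut_def)
  let ?g = "the_inv_into (Lat n) f"
  have g: "?g x \<in> Lat n" "f (?g x) = x" if "x \<in> Lat n" for x
    using f(1) that by (auto simp: bij_betw_def the_inv_into_into f_the_inv_into_f)
  have gf: "?g (f x) = x" if "x \<in> Lat n" for x
    using f(1) that by (auto simp: bij_betw_def the_inv_into_f_f)
  have ga: "?g (x + x') = ?g x + ?g x'" if "x \<in> Lat n" "x' \<in> Lat n" for x x'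
    using gf[OF Lat_add[OF g(1)[OF that(1)] g(1)[OF that(2)]]] f(3)[OF g(1)[OF that(1)] g(1)[OF that(2)]] g that by simp
  have gl: "?g (lact d x b) = lact d (?g x) b" if "x \<in> Lat n" "b \<in> L" for x b
    using gf[OF Lat_lact[OF g(1)[OF that(1)] that(2)]] f(4)[OF g(1)[OF that(1)] that(2)] g that by simp
  have "h (?g v) = el_one d" using gf[OF assms(3)] f(2) h(4) by simp
  then show ?thesis unfolding uni_def
    by (intro exI[of _ "h \<circ> ?g"]) (simp add: h g ga gl Lat_add Lat_lact)
qed

text \<open>As \<open>\<theta>\<close> squares to zero, 1 + \<open>\<theta>\<close> has the inverse
  1 - \<open>\<theta>\<close>. Most moves below are instances in which \<open>\<theta>\<close> maps
  one summand to another.\<close>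

lemma orb_transvection:
  assumes u: "u \<in> Lat n" and m: "\<And>v. v \<in> Lat n \<Longrightarrow> \<theta> v \<in> Lat n"
    and a: "\<And>v w. v \<in> Lat n \<Longrightarrow> w \<in> Lat n \<Longrightarrow> \<theta> (v + w) = \<theta> v + \<theta> w"
    and l: "\<And>v b. v \<in> Lat n \<Longrightarrow> b \<in> L \<Longrightarrow> \<theta> (lact d v b) = lact d (\<theta> v) b"
    and z: "\<And>v. v \<in> Lat n \<Longrightarrow> \<theta> (\<theta> v) = 0"
  shows "orb n u (u + \<theta> u)"
proof -
  have dif: "\<theta> (v - w) = \<theta> v - \<theta> w" if "v \<in> Lat n" "w \<in> Lat n" for v w
    using a[OF Lat_diff[OF that] that(2)] by (simp add: algebra_simps)
  have "aut n (\<lambda>v. v + \<theta> v)"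
    by (rule aut_I[where \<psi> = "\<lambda>v. v - \<theta> v"])
      (simp_all add: m Lat_add Lat_diff a l z dif lact_add Lat_lact algebra_simps)
  then show ?thesis unfolding orb_def by (intro exI[of _ "\<lambda>v. v + \<theta> v"]) simp
qed

text \<open>A functional is determined on each kind of summand: on [y - 1) it is left multiplication
  by \<open>a\<close>, on a free summand left multiplication by \<open>b i\<close>, and on
  \<open>R2\<close> the rows of its values are rational multiples \<open>c i / p\<close> of the
  argument. Multiplication by \<open>p\<close> makes the equation for the matrix part
  integral.\<close>

lemma uni_rel:
  assumes "uni n (r, s, l)" and u: "(r, s, l) \<in> Lat n"
  shows "\<exists>a\<in>L. \<exists>b c. (\<forall>i. b i \<in> L) \<and>
     fst a * fst s + (\<Sum>i<n. fst (b i) * fst (l i)) = 1 \<and>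
     (\<forall>i\<in>{1..d}. \<forall>j. (if i = j then int p else 0) =
        c i * r j + int p * snd (a \<star> s) i j + int p * (\<Sum>k<n. snd (b k \<star> l k) i j))"
proof -
  obtain h where H: "(\<forall>v\<in>Lat n. h v \<in> L) \<and>
     (\<forall>v\<in>Lat n. \<forall>w\<in>Lat n. h (v + w) = h v + h w) \<and>
     (\<forall>v\<in>Lat n. \<forall>b\<in>L. h (lact d v b) = h v \<star> b) \<and> h (r, s, l) = el_one d"
    using assms(1) unfolding uni_def by (rule exE)
  have h: "\<And>v. v \<in> Lat n \<Longrightarrow> h v \<in> L"
    "\<And>v w. v \<in> Lat n \<Longrightarrow> w \<in> Lat n \<Longrightarrow> h (v + w) = h v + h w"
    "\<And>v b. v \<in> Lat n \<Longrightarrow> b \<in> L \<Longrightarrow> h (lact d v b) = h v \<star> b" "h (r, s, l) = el_one d"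
    using H by blast+
  have h0: "h 0 = 0" using h(2)[of 0 0] by simp
  have rs: "r \<in> R2" "s \<in> Y1" "\<And>i. i < n \<Longrightarrow> l i \<in> L" "\<And>i. i \<ge> n \<Longrightarrow> l i = 0" using u by (auto simp: Lat_iff)
  have mr: "(r', 0, 0) \<in> Lat n" if "r' \<in> R2" for r' using that by (simp add: Lat_iff)
  have ms: "(0, s', 0) \<in> Lat n" if "s' \<in> Y1" for s' using that by (simp add: Lat_iff)
  define sg where "sg i b = (\<lambda>j::nat. if j = i then b else (0::el))" for i b
  have ml: "(0, 0, sg i b) \<in> Lat n" if "i < n" "b \<in> L" for i b using that by (auto simp: Lat_iff sg_def)
  have y1one: "y1 \<in> Y1"
    using Y1_I[OF L_one] elm_one_right[of d y1] L_supp[OF y1_mem] by simp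
  let ?z = "h (0, y1, 0)"
  have y0: "lact d (0, y1, 0) sy = 0" by (simp add: lact_def y_sy prod_eq_iff fun_eq_iff)
  \<comment> \<open>\<open>sy\<close> annihilates the generator \<open>y1\<close>, hence also its
    image; by \<open>ann\<close> the image is a left multiple of \<open>y1\<close>.\<close>
  have "?z \<star> sy = 0" using h(3)[OF ms[OF y1one] sy_mem] unfolding y0 h0 by (rule HOL.sym)
  then obtain a where a: "a \<in> L" "?z = a \<star> y1" using ann h(1)[OF ms[OF y1one]] by blast
  obtain s1 where s1: "s1 \<in> L" "s = y1 \<star> s1" using rs by (auto simp: Y1_def)
  have "(0, s, 0) = lact d (0, y1, 0) s1" by (simp add: lact_def s1 fun_eq_iff)
  then have hs: "h (0, s, 0) = a \<star> s" using h(3)[OF ms[OF y1one] s1(1)] a by (simp add: elm_assoc s1(2))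
  define b where "b i = (if i < n then h (0, 0, sg i (el_one d)) else 0)" for i
  have b: "b i \<in> L" for i using h(1)[OF ml[OF _ L_one]] by (simp add: b_def)
  have hb: "h (0, 0, sg i x) = b i \<star> x" if "i < n" "x \<in> L" for i x
  proof -
    have "(0, 0, sg i x) = lact d (0, 0, sg i (el_one d)) x"
      using elm_one_left[of d x] L_supp[OF that(2)] by (auto simp: lact_def sg_def fun_eq_iff)
    then show ?thesis using h(3)[OF ml[OF that(1) L_one] that(2)] that by (simp add: b_def)
  qed
  have hl: "h (0, 0, \<lambda>i. if i < k then l i else 0) = (\<Sum>i<k. b i \<star> l i)" if "k \<le> n" for k
    using that
  proof (induction k)
    case 0
    then show ?case using h0 by (simp add: zero_prod_def zero_fun_def)
  next
    case (Suc k)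
    have e: "((0, 0, \<lambda>i. if i < Suc k then l i else 0) :: lvec) = (0, 0, \<lambda>i. if i < k then l i else 0) + (0, 0, sg k (l k))"
      by (auto simp: sg_def fun_eq_iff less_Suc_eq)
    have m1: "(0, 0, \<lambda>i. if i < k then l i else 0) \<in> Lat n" using Suc.prems rs(3) by (auto simp: Lat_iff)
    have m2: "(0, 0, sg k (l k)) \<in> Lat n" using Suc.prems rs(3) by (intro ml) auto
    have kn: "k < n" using Suc.prems by simp
    show ?case
      by (simp only: e h(2)[OF m1 m2] Suc.IH[OF Suc_leD[OF Suc.prems]] hb[OF kn rs(3)[OF kn]] sum.lessThan_Suc)
  qed
  have "(\<lambda>i. if i < n then l i else 0) = l" using rs(4) by (auto simp: fun_eq_iff)
  then have hl': "h (0, 0, l) = (\<Sum>i<n. b i \<star> l i)" using hl[OF order.refl] by (simp only:)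
  have sp: "((r, s, l) :: lvec) = (r, 0, 0) + ((0, s, 0) + (0, 0, l))" by simp
  have M: "(0, s, 0) \<in> Lat n" "(0, 0, l) \<in> Lat n" using rs by (auto simp: Lat_iff)
  have total: "el_one d = h (r, 0, 0) + (a \<star> s + (\<Sum>i<n. b i \<star> l i))"
    using h(4) unfolding sp h(2)[OF mr[OF rs(1)] Lat_add[OF M]] h(2)[OF M] hs hl' by (rule HOL.sym)
  \<comment> \<open>The element \<open>(p, 0)\<close> kills row vectors but multiplies the group
    ring component by \<open>p\<close>; so this component of the image of \<open>r\<close>
    vanishes.\<close>
  have "lact d (r, 0, 0) (of_nat p * 1, 0) = 0" by (simp add: lact_def prod_eq_iff fun_eq_iff)
  then have "h (r, 0, 0) \<star> (of_nat p * 1, 0) = 0" using h(3)[OF mr[OF rs(1)] L_p[OF cyc.one_mem]] h0 by simp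
  then have "fst (h (r, 0, 0)) * of_nat p = 0" by (simp add: elm_def prod_eq_iff)
  then have hr0: "fst (h (r, 0, 0)) = 0" by (auto simp: fun_eq_iff)
  \<comment> \<open>\<open>q k\<close> is \<open>k\<close> times the vector with first entry
    \<open>p\<close> and zeros elsewhere; the factors \<open>c i\<close> are read off from the image
    of \<open>q 1\<close>.\<close>
  define q where "q k = (\<lambda>j::nat. if j = 1 then int p * k else (0::int))" for k
  have q: "q k \<in> R2" for k using d2 by (auto simp: q_def R2_def)
  define c where "c i = snd (h (q 1, 0, 0)) i 1" for i
  have ck: "snd (h (q k, 0, 0)) i 1 = k * c i" for k i
  proof -
    have qq: "((q (k + k'), 0, 0) :: lvec) = (q k, 0, 0) + (q k', 0, 0)" for k k'
      by (auto simp: q_def fun_eq_iff algebra_simps)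
    show ?thesis unfolding c_def
      by (rule additive_scale[of "\<lambda>k. snd (h (q k, 0, 0)) i 1"])
        (simp only: qq h(2)[OF mr[OF q] mr[OF q]] snd_add plus_fun_apply)
  qed
  have hr: "int p * snd (h (r, 0, 0)) i j = c i * r j" for i j
  proof (cases "j \<in> {1..d}")
    case True
    \<comment> \<open>\<open>p\<close> times the matrix unit in row \<open>j\<close> and column 1,
      an element of the radical: it moves the entry \<open>r j\<close> to the first place and so
      compares \<open>r\<close> with \<open>q\<close>.\<close>
    define E where "E = (\<lambda>(k::nat) (l::nat). if k = j \<and> l = 1 then int p else 0)"
    have E: "(0, E) \<in> L" using True d2 by (auto simp: L_rad E_def)
    have v: "vm d r' E = (\<lambda>l. if l = 1 then int p * r' j else 0)" for r'
    proof -
      have "(\<Sum>k = 1..d. r' k * E k 1) = (\<Sum>k = 1..d. if k = j then int p * r' j else 0)"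
        by (intro sum.cong) (auto simp: E_def)
      then show ?thesis using True d2 by (auto simp: vm_def fun_eq_iff E_def)
    qed
    have lq: "lact d (r, 0, 0) (0, E) = (q (r j), 0, 0)" by (simp add: lact_def v prod_eq_iff fun_eq_iff q_def)
    have "h (q (r j), 0, 0) = h (r, 0, 0) \<star> (0, E)" using h(3)[OF mr[OF rs(1)] E] unfolding lq .
    then have "snd (h (q (r j), 0, 0)) i 1 = int p * snd (h (r, 0, 0)) i j" by (simp add: snd_elm v)
    then show ?thesis using ck[of "r j" i] by (simp only: mult.commute)
  next
    case False
    then show ?thesis using rs(1) L_supp[OF h(1)[OF mr[OF rs(1)]], of i j] by (auto simp: R2_def)
  qed
  have sn: "snd (\<Sum>k\<in>A. f k) i j = (\<Sum>k\<in>A. snd (f k) i j)" for A and f :: "nat \<Rightarrow> el" and i j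
    by (simp add: snd_sum sum_fun_apply)
  have "fst (el_one d) = fst (h (r, 0, 0)) + (fst a * fst s + (\<Sum>i<n. fst (b i) * fst (l i)))"
    by (subst total) (simp add: fst_sum)
  then have e1: "fst a * fst s + (\<Sum>i<n. fst (b i) * fst (l i)) = 1" by (simp add: hr0 el_one_def)
  have e2: "(if i = j then int p else 0) = c i * r j + int p * snd (a \<star> s) i j + int p * (\<Sum>k<n. snd (b k \<star> l k) i j)"
    if "i \<in> {1..d}" for i j
  proof -
    have "snd (el_one d) i j = snd (h (r, 0, 0)) i j + (snd (a \<star> s) i j + (\<Sum>k<n. snd (b k \<star> l k) i j))"
      by (subst total) (simp add: sn)
    then have "int p * snd (el_one d) i j = int p * snd (h (r, 0, 0)) i j + int p * snd (a \<star> s) i j + int p * (\<Sum>k<n. snd (b k \<star> l k) i j)"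
      by (simp add: distrib_left)
    then show ?thesis using that unfolding hr by (auto simp: el_one_def)
  qed
  show ?thesis using a(1) b e1 e2 by (intro bexI[of _ a] exI[of _ b] exI[of _ c] conjI allI ballI)
qed

end

section \<open>Elementary automorphisms of the lattice and their effect over the cyclic group
  ring\<close>

context straight_core
begin

definition zs :: "lvec \<Rightarrow> complex \<Rightarrow> complex" where "zs u = fst (fst (snd u))"

definition zl :: "lvec \<Rightarrow> nat \<Rightarrow> complex \<Rightarrow> complex" where "zl u i = fst (snd (snd u) i)"

lemma LatD:
  assumes "u \<in> Lat n"
  shows "fst u \<in> R2" "fst (snd u) \<in> Y1" "\<And>i. i < n \<Longrightarrow> snd (snd u) i \<in> L"
    "\<And>i. i \<ge> n \<Longrightarrow> snd (snd u) i = 0"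
  using assms by (auto simp: Lat_def split: if_splits)

lemma LatI:
  assumes "r \<in> R2" "s \<in> Y1" "\<And>i. i < n \<Longrightarrow> l i \<in> L" "\<And>i. i \<ge> n \<Longrightarrow> l i = 0"
  shows "(r, s, l) \<in> Lat n"
  using assms by (simp add: Lat_iff)

lemma lvec_eqI: "fst u = fst v \<Longrightarrow> fst (snd u) = fst (snd v) \<Longrightarrow> (\<And>i. snd (snd u) i = snd (snd v) i)
   \<Longrightarrow> u = (v :: lvec)"
  by (simp add: prod_eq_iff fun_eq_iff)

lemma lact_simps [simp]: "fst (lact d u b) = vm d (fst u) (snd b)" "fst (snd (lact d u b)) = fst (snd u) \<star> b"
  "snd (snd (lact d u b)) i = snd (snd u) i \<star> b"
  by (simp_all add: lact_def)

lemma orb_last: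
  assumes u: "u \<in> Lat (Suc N)" and a: "a \<in> L" and b: "\<And>i. b i \<in> L"
  shows "orb (Suc N) u (fst u, fst (snd u), \<lambda>i. snd (snd u) i +
     (if i = N then a \<star> fst (snd u) + (\<Sum>k<N. b k \<star> snd (snd u) k) else 0))"
proof -
  let ?\<theta> = "\<lambda>v :: lvec. (0 :: nat \<Rightarrow> int, 0 :: el, \<lambda>i. if i = N then a \<star> fst (snd v) + (\<Sum>k<N. b k \<star> snd (snd v) k) else 0)"
  have "orb (Suc N) u (u + ?\<theta> u)"
  proof (rule orb_transvection[OF u])
    fix v assume v: "v \<in> Lat (Suc N)"
    show "?\<theta> v \<in> Lat (Suc N)"
      using LatD[OF v] Y1_L[OF LatD(2)[OF v]] a b by (intro LatI) (auto intro!: L_add L_mul L_sum)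
    show "?\<theta> (?\<theta> v) = 0" by (rule lvec_eqI) simp_all
    fix w
    show "?\<theta> (v + w) = ?\<theta> v + ?\<theta> w"
      by (rule lvec_eqI) (simp_all add: elm_add_right sum.distrib algebra_simps)
    fix c
    show "?\<theta> (lact d v c) = lact d (?\<theta> v) c"
      by (rule lvec_eqI) (simp_all add: elm_add_left elm_sum_left elm_assoc)
  qed
  also have "u + ?\<theta> u = (fst u, fst (snd u), \<lambda>i. snd (snd u) i +
     (if i = N then a \<star> fst (snd u) + (\<Sum>k<N. b k \<star> snd (snd u) k) else 0))"
    by (rule lvec_eqI) simp_all
  finally show ?thesis .
qed

text \<open>The factor \<open>y1\<close> on the left keeps the correction inside the right ideal [y
  - 1).\<close>

lemma orb_middle:
  assumes u: "u \<in> Lat n" and b: "\<And>i. b i \<in> L"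
  shows "orb n u (fst u, fst (snd u) + y1 \<star> (\<Sum>k<n. b k \<star> snd (snd u) k), snd (snd u))"
proof -
  let ?\<theta> = "\<lambda>v :: lvec. (0 :: nat \<Rightarrow> int, y1 \<star> (\<Sum>k<n. b k \<star> snd (snd v) k), 0 :: nat \<Rightarrow> el)"
  have "orb n u (u + ?\<theta> u)"
  proof (rule orb_transvection[OF u])
    fix v assume v: "v \<in> Lat n"
    show "?\<theta> v \<in> Lat n"
      using LatD[OF v] b by (intro LatI) (auto intro!: Y1_I L_mul L_sum)
    show "?\<theta> (?\<theta> v) = 0" by (rule lvec_eqI) simp_all
    fix w
    show "?\<theta> (v + w) = ?\<theta> v + ?\<theta> w"
      by (rule lvec_eqI) (simp_all add: elm_add_right sum.distrib)
    fix c
    show "?\<theta> (lact d v c) = lact d (?\<theta> v) c"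
      by (rule lvec_eqI) (simp_all add: elm_sum_left elm_assoc)
  qed
  also have "u + ?\<theta> u = (fst u, fst (snd u) + y1 \<star> (\<Sum>k<n. b k \<star> snd (snd u) k), snd (snd u))"
    by (rule lvec_eqI) simp_all
  finally show ?thesis .
qed

text \<open>Any member of another summand can be the image of the last free generator, so multiples
  by the last coordinate are added to all other components at once.\<close>

lemma orb_by_last:
  assumes u: "u \<in> Lat (Suc N)" and r: "r \<in> R2" and s: "s \<in> Y1" and b: "\<And>i. b i \<in> L"
  shows "orb (Suc N) u (fst u + vm d r (snd (snd (snd u) N)), fst (snd u) + s \<star> snd (snd u) N,
    \<lambda>i. snd (snd u) i + (if i < N then b i \<star> snd (snd u) N else 0))"
proof -
  let ?\<theta> = "\<lambda>v :: lvec. (vm d r (snd (snd (snd v) N)), s \<star> snd (snd v) N,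
      \<lambda>i. if i < N then b i \<star> snd (snd v) N else 0)"
  have "orb (Suc N) u (u + ?\<theta> u)"
  proof (rule orb_transvection[OF u])
    fix v assume v: "v \<in> Lat (Suc N)"
    show "?\<theta> v \<in> Lat (Suc N)"
      using LatD[OF v] b r s by (intro LatI) (auto intro!: Y1_mul L_mul R2_vm)
    show "?\<theta> (?\<theta> v) = 0" by (rule lvec_eqI) simp_all
    fix w
    show "?\<theta> (v + w) = ?\<theta> v + ?\<theta> w"
      by (rule lvec_eqI) (simp_all add: elm_add_right vm_add_right)
    fix c
    show "?\<theta> (lact d v c) = lact d (?\<theta> v) c"
      by (rule lvec_eqI) (simp_all add: elm_assoc snd_elm vm_assoc)
  qed
  also have "u + ?\<theta> u = (fst u + vm d r (snd (snd (snd u) N)), fst (snd u) + s \<star> snd (snd u) N,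
    \<lambda>i. snd (snd u) i + (if i < N then b i \<star> snd (snd u) N else 0))"
    by (rule lvec_eqI) simp_all
  finally show ?thesis .
qed

definition swp :: "nat \<Rightarrow> nat \<Rightarrow> nat \<Rightarrow> nat" where
  "swp i j k = (if k = i then j else if k = j then i else k)"

lemma orb_swap:
  assumes u: "u \<in> Lat n" and i: "i < n" "j < n"
  shows "orb n u (fst u, fst (snd u), snd (snd u) \<circ> swp i j)"
proof -
  let ?\<phi> = "\<lambda>v :: lvec. (fst v, fst (snd v), snd (snd v) \<circ> swp i j)"
  have lt: "swp i j k < n \<longleftrightarrow> k < n" for k
    using i by (auto simp: swp_def)
  have ss: "swp i j (swp i j k) = k" for k by (auto simp: swp_def)
  have m: "?\<phi> v \<in> Lat n" if v: "v \<in> Lat n" for v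
  proof (rule LatI)
    fix k assume "k \<ge> n"
    then show "(snd (snd v) \<circ> swp i j) k = 0"
      using LatD(4)[OF v, of "swp i j k"] lt[of k] by simp
  qed (use LatD[OF v] lt in auto)
  have "aut n ?\<phi>"
    by (rule aut_I[where \<psi> = ?\<phi>])
      (simp_all add: m prod_eq_iff fun_eq_iff ss)
  then show ?thesis unfolding orb_def by (intro exI[of _ ?\<phi>] conjI) auto
qed

lemma orb_neg_last:
  assumes u: "u \<in> Lat (Suc N)"
  shows "orb (Suc N) u (fst u, fst (snd u), \<lambda>i. if i = N then - snd (snd u) i else snd (snd u) i)"
proof -
  let ?\<phi> = "\<lambda>v :: lvec. (fst v, fst (snd v), \<lambda>i. if i = N then - snd (snd v) i else snd (snd v) i)"
  have m: "?\<phi> v \<in> Lat (Suc N)" if v: "v \<in> Lat (Suc N)" for v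
    using LatD[OF v] by (intro LatI) (auto intro: L_neg)
  have "aut (Suc N) ?\<phi>"
    by (rule aut_I[where \<psi> = ?\<phi>])
      (auto simp: m intro!: lvec_eqI simp: elm_uminus_left)
  then show ?thesis unfolding orb_def by (intro exI[of _ ?\<phi>] conjI) auto
qed

lemma zs_mem: "u \<in> Lat n \<Longrightarrow> zs u \<in> cyc_ring d"
  using LatD(2) Y1_L L_ring by (auto simp: zs_def)

lemma zl_mem: "u \<in> Lat n \<Longrightarrow> i < n \<Longrightarrow> zl u i \<in> cyc_ring d"
  using LatD(3) L_ring by (auto simp: zl_def)

lemma zs_1: "u \<in> Lat n \<Longrightarrow> zs u 1 = 0"
  using LatD(2) Y1_aug by (auto simp: zs_def)

lemma onto_fun:
  assumes "\<And>i. e i \<in> cyc_ring d"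
  shows "\<exists>b. (\<forall>i::nat. b i \<in> L) \<and> (\<forall>i. fst (b i) = e i)"
proof -
  have "\<forall>i. \<exists>a. a \<in> L \<and> fst a = e i" by (intro allI) (rule L_onto[OF assms, unfolded Bex_def])
  then obtain b where "\<forall>i. b i \<in> L \<and> fst (b i) = e i" by (rule choice[THEN exE])
  then show ?thesis by (intro exI[of _ b]) simp
qed

lemma z_last:
  assumes u: "u \<in> Lat (Suc N)" and c: "c \<in> cyc_ring d" and e: "\<And>i. e i \<in> cyc_ring d"
  shows "\<exists>u'. orb (Suc N) u u' \<and> zs u' = zs u \<and>
    zl u' N = zl u N + c * zs u + (\<Sum>k<N. e k * zl u k) \<and> (\<forall>i<N. zl u' i = zl u i)"
proof -
  obtain a where a: "a \<in> L" "fst a = c" using L_onto[OF c] by auto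
  obtain b where B: "(\<forall>i::nat. b i \<in> L) \<and> (\<forall>i. fst (b i) = e i)" by (rule exE[OF onto_fun[OF e]])
  have b: "\<And>i. b i \<in> L" "\<And>i. fst (b i) = e i" using B by simp_all
  show ?thesis
    by (rule exI, rule conjI, rule orb_last[OF u a(1) b(1)])
      (simp add: zs_def zl_def fst_sum a b algebra_simps)
qed

text \<open>Corrections of the component in [y - 1) carry the factor \<open>y1\<close>, whose group
  ring part is the generator minus 1; this is why the coefficients must have augmentation 0.\<close>

lemma z_middle:
  assumes u: "u \<in> Lat n" and e: "\<And>i. e i \<in> cyc_ring d" "\<And>i. e i 1 = 0"
  shows "\<exists>u'. orb n u u' \<and> zs u' = zs u + (\<Sum>k<n. e k * zl u k) \<and> (\<forall>i. zl u' i = zl u i)"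
proof -
  have "\<forall>i. \<exists>c. c \<in> cyc_ring d \<and> e i = (cyc_gen d - 1) * c"
    using cyc_ring_aug_0[OF e] by (auto simp only: Bex_def)
  then obtain f where "\<forall>i. f i \<in> cyc_ring d \<and> e i = (cyc_gen d - 1) * f i"
    by (rule choice[THEN exE])
  then have f: "\<And>i. f i \<in> cyc_ring d" "\<And>i. e i = (cyc_gen d - 1) * f i" by simp_all
  obtain b where B: "(\<forall>i::nat. b i \<in> L) \<and> (\<forall>i. fst (b i) = f i)" by (rule exE[OF onto_fun[OF f(1)]])
  have b: "\<And>i. b i \<in> L" "\<And>i. fst (b i) = f i" using B by simp_all
  show ?thesis
    by (rule exI, rule conjI, rule orb_middle[OF u b(1)])
      (simp add: zs_def zl_def fst_sum fst_y b f(2) sum_distrib_left mult.assoc del: fst_diff add: fst_y1)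
qed

lemma z_by_last:
  assumes u: "u \<in> Lat (Suc N)" and e: "\<And>i. e i \<in> cyc_ring d"
  shows "\<exists>u'. orb (Suc N) u u' \<and> zs u' = zs u \<and> zl u' N = zl u N \<and>
    (\<forall>i<N. zl u' i = zl u i + e i * zl u N)"
proof -
  obtain b where B: "(\<forall>i::nat. b i \<in> L) \<and> (\<forall>i. fst (b i) = e i)" by (rule exE[OF onto_fun[OF e]])
  have b: "\<And>i. b i \<in> L" "\<And>i. fst (b i) = e i" using B by simp_all
  show ?thesis
    by (rule exI, rule conjI, rule orb_by_last[where b = b, OF u R2_0 Y1_0 b(1)])
      (simp add: zs_def zl_def b)
qed

lemma z_swap:
  assumes u: "u \<in> Lat n" and "i < n" "j < n"
  shows "\<exists>u'. orb n u u' \<and> zs u' = zs u \<and> zl u' j = zl u i"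
  by (rule exI, rule conjI, rule orb_swap[OF assms]) (simp add: zs_def zl_def swp_def)

lemma z_neg_last:
  assumes u: "u \<in> Lat (Suc N)"
  shows "\<exists>u'. orb (Suc N) u u' \<and> zs u' = zs u \<and> zl u' N = - zl u N"
  by (rule exI, rule conjI, rule orb_neg_last[OF assms]) (simp add: zs_def zl_def)

lemma uni_z:
  assumes "uni n u" "u \<in> Lat n"
  shows "\<exists>a b. a \<in> cyc_ring d \<and> (\<forall>i. b i \<in> cyc_ring d) \<and> a * zs u + (\<Sum>i<n. b i * zl u i) = 1"
proof -
  obtain r s l where u: "u = (r, s, l)" by (cases u) auto
  have "uni n (r, s, l)" "(r, s, l) \<in> Lat n" using assms unfolding u by auto
  from uni_rel[OF this] obtain a where a: "a \<in> L" and "\<exists>b c. (\<forall>i. b i \<in> L) \<and>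
     fst a * fst s + (\<Sum>i<n. fst (b i) * fst (l i)) = 1 \<and>
     (\<forall>i\<in>{1..d}. \<forall>j. (if i = j then int p else 0) =
        c i * r j + int p * snd (a \<star> s) i j + int p * (\<Sum>k<n. snd (b k \<star> l k) i j))" by (rule bexE)
  then obtain b where b: "\<forall>i. b i \<in> L" "fst a * fst s + (\<Sum>i<n. fst (b i) * fst (l i)) = 1"
    by (elim exE conjE)
  show ?thesis using L_ring a b unfolding u zs_def zl_def
    by (intro exI[of _ "fst a"] exI[of _ "\<lambda>i. fst (b i)"]) simp
qed

end

section \<open>Euclid's algorithm on augmentations, and combinations without zeros\<close>

context straight_core
begin

lemma cyc_ring_at_1:
  assumes "\<And>i::nat. e i \<in> cyc_ring d"
  shows "\<exists>k. \<forall>i. e i 1 = of_int (k i)"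
proof -
  have "\<forall>i. \<exists>k. e i 1 = of_int k" using cyc_ring_int_at_1[OF assms] by simp
  then show ?thesis by (rule choice)
qed

text \<open>The component in [y - 1) has augmentation 0, so the augmentations of the free
  coordinates alone are coprime integers and can be treated by division with remainder.\<close>

lemma orb_aug_1:
  assumes u: "u \<in> Lat (Suc N)" and uni: "uni (Suc N) u"
  shows "\<exists>u'. orb (Suc N) u u' \<and> zl u' N 1 = 1"
proof -
  \<comment> \<open>The absolute values of nonzero augmentations that the orbit attains in the last
    place; when the least one is attained, it divides the augmentations of the other
    coordinates.\<close>
  define P where "P k \<longleftrightarrow> (\<exists>u'. orb (Suc N) u u' \<and> (\<exists>m::int. zl u' N 1 = of_int m \<and> m \<noteq> 0 \<and> nat \<bar>m\<bar> = k))" for k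
  have PI: "P (nat \<bar>m\<bar>)" if h: "orb (Suc N) u v" "i < Suc N" "zl v i 1 = of_int m" "m \<noteq> 0" for v i m
  proof -
    obtain u' where "orb (Suc N) v u'" "zl u' N = zl v i"
      using z_swap[OF orb_mem[OF h(1) u] h(2) lessI] by (elim exE conjE)
    then show ?thesis unfolding P_def using h orb_trans[OF h(1)] by (intro exI[of _ u']) auto
  qed
  have "\<exists>k. P k"
  proof -
    obtain a b where ab: "a \<in> cyc_ring d" "\<forall>i. b i \<in> cyc_ring d" "a * zs u + (\<Sum>i<Suc N. b i * zl u i) = 1"
      using uni_z[OF uni u] by (elim exE conjE)
    have "(a * zs u + (\<Sum>i<Suc N. b i * zl u i)) 1 = 1" unfolding ab by simp
    then have "(\<Sum>i<Suc N. b i 1 * zl u i 1) = 1"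
      using zs_1[OF u] by (simp add: sum_fun_apply del: sum.lessThan_Suc)
    moreover have "(\<Sum>i<Suc N. b i 1 * zl u i 1) = 0" if "\<And>i. i < Suc N \<Longrightarrow> zl u i 1 = 0"
      by (rule sum.neutral) (use that in auto)
    ultimately obtain i where i: "i < Suc N" "zl u i 1 \<noteq> 0" by fastforce
    then obtain m where "zl u i 1 = of_int m" using cyc_ring_int_at_1[OF zl_mem[OF u i(1)]] by auto
    then show ?thesis using PI[OF orb_self i(1)] i(2) by auto
  qed
  define k0 where "k0 = (LEAST k. P k)"
  have "P k0" unfolding k0_def by (rule LeastI_ex) fact
  then obtain v m where v: "orb (Suc N) u v" "zl v N 1 = of_int m" "m \<noteq> 0" "nat \<bar>m\<bar> = k0"
    unfolding P_def by (elim exE conjE)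
  have vm: "v \<in> Lat (Suc N)" by (rule orb_mem[OF v(1) u])
  have dv: "\<exists>t. zl v i 1 = of_int (m * t)" if i: "i < N" for i
  proof -
    obtain n where n: "zl v i 1 = of_int n" using cyc_ring_int_at_1[OF zl_mem[OF vm, of i]] i by auto
    obtain w where w: "orb (Suc N) v w" "\<forall>i<N. zl w i = zl v i + of_int (- (n div m)) * zl v N"
      using z_by_last[where e = "\<lambda>_. of_int (- (n div m))", OF vm cyc.of_int_mem] by (elim exE conjE)
    have "zl w i 1 = of_int (n + (- (n div m)) * m)" using w(2) i by (simp add: n v(2))
    also have "n + (- (n div m)) * m = n mod m" by (simp add: minus_div_mult_eq_mod)
    finally have wi: "zl w i 1 = of_int (n mod m)" .
    have "n mod m = 0"
    proof (rule ccontr)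
      assume nz: "n mod m \<noteq> 0"
      have "P (nat \<bar>n mod m\<bar>)" by (rule PI[OF orb_trans[OF v(1) w(1)] _ wi nz]) (use i in simp)
      then have "nat \<bar>m\<bar> \<le> nat \<bar>n mod m\<bar>" unfolding v(4) k0_def by (rule Least_le)
      then show False using abs_mod_less[OF v(3), of n] by simp
    qed
    then have "n = m * (n div m)" by (metis add.right_neutral mult_div_mod_eq)
    then show ?thesis using n by metis
  qed
  have "\<forall>i. \<exists>t. i < N \<longrightarrow> zl v i 1 = of_int (m * t)" using dv by simp
  then obtain t where t: "\<forall>i. i < N \<longrightarrow> zl v i 1 = of_int (m * t i)" by (rule choice[THEN exE])
  obtain a b where ab: "a \<in> cyc_ring d" "\<forall>i. b i \<in> cyc_ring d" "a * zs v + (\<Sum>i<Suc N. b i * zl v i) = 1"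
    using uni_z[OF uni_orb[OF uni v(1) u] vm] by (elim exE conjE)
  obtain k where k: "\<forall>i. b i 1 = of_int (k i)" using cyc_ring_at_1[of b] ab(2) by auto
  have "(a * zs v + (\<Sum>i<Suc N. b i * zl v i)) 1 = 1" unfolding ab by simp
  then have "1 = (\<Sum>i<N. b i 1 * zl v i 1) + b N 1 * zl v N 1"
    using zs_1[OF vm] by (simp add: sum_fun_apply)
  also have "(\<Sum>i<N. b i 1 * zl v i 1) = (\<Sum>i<N. of_int (m * (k i * t i)))"
    by (rule sum.cong) (simp_all add: k t)
  also have "\<dots> + b N 1 * zl v N 1 = of_int (m * ((\<Sum>i<N. k i * t i) + k N))"
    by (simp add: k v(2) sum_distrib_left distrib_left)
  finally have "1 = m * ((\<Sum>i<N. k i * t i) + k N)" by (metis of_int_eq_1_iff)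
  then have "m dvd 1" by (metis dvd_triv_left)
  then have "m = 1 \<or> m = -1" by auto
  then show ?thesis
  proof
    assume "m = 1" then show ?thesis using v by (intro exI[of _ v]) simp
  next
    assume m: "m = -1"
    obtain w where "orb (Suc N) v w" "zl w N = - zl v N" using z_neg_last[OF vm] by (elim exE conjE)
    then show ?thesis using orb_trans[OF v(1)] v(2) m by (intro exI[of _ w]) simp
  qed
qed

text \<open>For each of the finitely many roots of unity the sum is a nonzero polynomial in
  \<open>K\<close>, with finitely many zeros, so some natural number avoids them all. Other
  arguments reduce to roots of unity through \<open>root_or_1\<close>.\<close>

lemma cyc_nonvanishing:
  assumes zl: "\<And>i. i \<le> n \<Longrightarrow> f i \<in> cyc_ring d" and nz: "\<And>w. \<exists>i\<le>n. f i w \<noteq> 0"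
  shows "\<exists>K::nat. \<forall>w. (\<Sum>i\<le>n. of_nat K ^ i * f i w) \<noteq> 0"
proof -
  define q where "q w = Poly (map (\<lambda>i. f i w) [0..<Suc n])" for w
  have cf: "poly.coeff (q w) i = (if i \<le> n then f i w else 0)" for w i
    by (auto simp: q_def nth_default_def simp del: upt_Suc)
  have "q w \<noteq> 0" for w
  proof
    assume "q w = 0"
    then have "poly.coeff (q w) i = 0" for i by simp
    then show False using nz[of w] cf by metis
  qed
  then have fin: "finite {x. poly (q w) x = 0}" for w by (rule poly_roots_finite)
  define B where "B = (\<Union>w\<in>insert 1 {w. w ^ d = 1}. {x. poly (q w) x = 0})"
  have "finite {w::complex. w ^ d = 1}" by (rule finite_roots_unity) (use d2 in simp)
  then have "finite B" using fin by (simp add: B_def)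
  then have "finite (of_nat -` B)" by (intro finite_vimageI inj_onI) auto
  then obtain K where K: "K \<notin> of_nat -` B" using ex_new_if_finite[OF infinite_UNIV_nat] by auto
  have ev: "poly (q w) x = (\<Sum>i\<le>n. x ^ i * f i w)" for w x
  proof -
    have "degree (q w) \<le> n" by (rule degree_le) (simp add: cf)
    then have "poly (q w) x = (\<Sum>i\<le>n. poly.coeff (q w) i * x ^ i)"
      unfolding poly_altdef by (intro sum.mono_neutral_left) (auto simp: coeff_eq_0)
    then show ?thesis by (simp add: cf mult.commute)
  qed
  have rt: "f i w = f i (root_or_1 d w)" if "i \<le> n" for i w
  proof -
    have "root_or_1 d (root_or_1 d w) = root_or_1 d w" by (simp add: root_or_1_def)
    then show ?thesis using zl[OF that] by (auto simp: cyc_ring_def cyc_ev_def)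
  qed
  have "(\<Sum>i\<le>n. of_nat K ^ i * f i w) \<noteq> 0" for w
  proof -
    have "root_or_1 d w \<in> insert 1 {w. w ^ d = 1}" by simp
    then have "poly (q (root_or_1 d w)) (of_nat K) \<noteq> 0" using K unfolding B_def by blast
    moreover have "(\<Sum>i\<le>n. of_nat K ^ i * f i w) = (\<Sum>i\<le>n. of_nat K ^ i * f i (root_or_1 d w))"
      by (rule sum.cong) (auto simp: rt[symmetric])
    ultimately show ?thesis unfolding ev by simp
  qed
  then show ?thesis by (intro exI[of _ K]) simp
qed

end

section \<open>From a unimodular vector to a pair congruent to (0, 1) modulo p over the cyclic group
  ring\<close>

context straight_core
begin

text \<open>Stable range one needs a finite quotient, so the last coordinate is first made free of
  zeros; then it divides a positive integer. Modulo it, \<open>unit_lift\<close> corrects the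
  component in [y - 1) to a unit. The augmentation of the last coordinate has to stay 1 throughout,
  and corrections in [y - 1) need augmentation 0.\<close>

lemma orb_z_unimodular:
  assumes u: "u \<in> Lat (Suc N)" and uni: "uni (Suc N) u"
  shows "\<exists>u'. orb (Suc N) u u' \<and> zl u' N 1 = 1 \<and>
    (\<exists>a\<in>cyc_ring d. \<exists>b\<in>cyc_ring d. a * zs u' + b * zl u' N = 1)"
proof -
  obtain v where v: "orb (Suc N) u v" "zl v N 1 = 1" using orb_aug_1[OF assms] by (elim exE conjE)
  have vm: "v \<in> Lat (Suc N)" by (rule orb_mem[OF v(1) u])
  \<comment> \<open>Subtracts from each other coordinate its augmentation times the last coordinate,
    so that later additions to the last coordinate leave its augmentation equal to 1.\<close>
  define e where "e i = (if i < N then - of_int (SOME k. zl v i 1 = of_int k) else (0 :: complex \<Rightarrow> complex))" for i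
  have e: "e i \<in> cyc_ring d" for i by (auto simp: e_def)
  have e1: "e i 1 = - zl v i 1" if "i < N" for i
  proof -
    have "\<exists>k::int. zl v i 1 = of_int k" using cyc_ring_int_at_1[OF zl_mem[OF vm, of i]] that by simp
    then have "zl v i 1 = of_int (SOME k. zl v i 1 = of_int k)" by (rule someI_ex)
    then show ?thesis using that by (simp add: e_def)
  qed
  obtain w where w: "orb (Suc N) v w" "zl w N = zl v N" "\<forall>i<N. zl w i = zl v i + e i * zl v N"
    using z_by_last[where e = e, OF vm e] by (elim exE conjE)
  have wm: "w \<in> Lat (Suc N)" by (rule orb_mem[OF w(1) vm])
  have w0: "zl w i 1 = 0" if "i < N" for i using w(3) v(2) e1[OF that] that by simp
  have w1: "zl w N 1 = 1" using w(2) v(2) by simp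
  \<comment> \<open>The last coordinate comes first and gets the coefficient 1, the component in [y
    - 1) gets \<open>K\<close>, and the others get \<open>K ^ 2\<close>, \<open>K ^ 3\<close> and so
    on.\<close>
  define f where "f i = (if i = 0 then zl w N else if i = 1 then zs w else zl w (i - 2))" for i
  have f: "f i \<in> cyc_ring d" if "i \<le> N + 1" for i
    using that zl_mem[OF wm, of "i - 2"] zl_mem[OF wm, of N] zs_mem[OF wm] by (auto simp: f_def)
  obtain a b where ab: "a \<in> cyc_ring d" "\<forall>i. b i \<in> cyc_ring d" "a * zs w + (\<Sum>i<Suc N. b i * zl w i) = 1"
    using uni_z[OF uni_orb[OF uni orb_trans[OF v(1) w(1)] u] wm] by (elim exE conjE)
  have nzf: "\<exists>i\<le>N + 1. f i z \<noteq> 0" for z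
  proof (rule ccontr)
    assume "\<not> ?thesis"
    then have f0: "f i z = 0" if "i \<le> N + 1" for i using that by simp
    have "zs w z = 0" using f0[of 1] by (simp add: f_def)
    moreover have "zl w i z = 0" if "i < Suc N" for i
    proof (cases "i = N")
      case True then show ?thesis using f0[of 0] by (simp add: f_def)
    next
      case False then show ?thesis using f0[of "i + 2"] that by (simp add: f_def)
    qed
    ultimately have "(a * zs w + (\<Sum>i<Suc N. b i * zl w i)) z = 0" by (simp add: sum_fun_apply)
    then show False unfolding ab(3) by simp
  qed
  have "\<exists>K::nat. \<forall>z. (\<Sum>i\<le>N + 1. of_nat K ^ i * f i z) \<noteq> 0"
    by (rule cyc_nonvanishing) (rule f, assumption, rule nzf)
  then obtain K :: nat where K: "\<forall>z. (\<Sum>i\<le>N + 1. of_nat K ^ i * f i z) \<noteq> 0" by (elim exE)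
  obtain x where x: "orb (Suc N) w x" "zs x = zs w"
    "zl x N = zl w N + of_nat K * zs w + (\<Sum>k<N. of_nat (K ^ (k + 2)) * zl w k)" "\<forall>i<N. zl x i = zl w i"
    using z_last[where e = "\<lambda>k. of_nat (K ^ (k + 2))", OF wm cyc.of_nat_mem[where n = K] cyc.of_nat_mem]
    by (elim exE conjE)
  have xm: "x \<in> Lat (Suc N)" by (rule orb_mem[OF x(1) wm])
  have xN: "zl x N \<in> cyc_ring d" by (rule zl_mem[OF xm]) simp
  have sumN: "(\<Sum>i\<le>N + 1. of_nat K ^ i * f i z) = zl x N z" for z
  proof -
    have "(\<Sum>i\<le>N + 1. of_nat K ^ i * f i z) = (\<Sum>i<Suc (Suc N). of_nat K ^ i * f i z)"
      by (simp add: lessThan_Suc_atMost del: sum.lessThan_Suc sum.atMost_Suc)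
    also have "\<dots> = zl w N z + (of_nat K * zs w z + (\<Sum>k<N. of_nat K ^ (k + 2) * zl w k z))"
      by (subst sum.lessThan_Suc_shift, subst sum.lessThan_Suc_shift) (simp add: f_def)
    also have "\<dots> = zl x N z" by (simp add: x(3) sum_fun_apply)
    finally show ?thesis .
  qed
  have nz: "zl x N z \<noteq> 0" for z using K[rule_format, of z] unfolding sumN .
  have x1: "zl x N 1 = 1" using w1 w0 zs_1[OF wm] by (simp add: x(3) sum_fun_apply)
  obtain M c where M: "(M::int) > 0" "c \<in> cyc_ring d" "of_int M = zl x N * c"
    using cyc_ring_divides_int[OF xN nz p_pos(2)] by (elim exE bexE conjE)
  obtain R where R: "finite R" "\<forall>z\<in>cyc_ring d. \<exists>r\<in>R. \<exists>c\<in>cyc_ring d. z = r + of_int M * c"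
    using cyc_ring_finite_mod[OF M(1) p_pos(2)] by (elim exE conjE)
  \<comment> \<open>Representatives modulo \<open>M\<close> also represent modulo the last
    coordinate, since that divides \<open>M\<close>.\<close>
  have rep: "\<exists>r\<in>R. \<exists>e\<in>cyc_ring d. z = r + zl x N * e" if z: "z \<in> cyc_ring d" for z
  proof -
    obtain r e where "r \<in> R" "e \<in> cyc_ring d" "z = r + of_int M * e" using R(2) z by blast
    then show ?thesis using M by (intro bexI[of _ r] bexI[of _ "c * e"]) (auto simp: mult.assoc)
  qed
  have kk: "\<exists>k\<ge>1. \<exists>c\<in>cyc_ring d. zs x ^ (2 * k) = zs x ^ k + zl x N * c"
    by (rule cyc.power_idem_mod[OF zs_mem[OF xm] xN R(1)]) (rule rep)
  obtain k e where k: "k \<ge> 1" "e \<in> cyc_ring d" "zs x ^ (2 * k) = zs x ^ k + zl x N * e"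
    using kk by (elim exE bexE conjE)
  obtain a b where ab: "a \<in> cyc_ring d" "\<forall>i. b i \<in> cyc_ring d" "a * zs x + (\<Sum>i<Suc N. b i * zl x i) = 1"
    using uni_z[OF uni_orb[OF uni orb_trans[OF v(1) orb_trans[OF w(1) x(1)]] u] xm] by (elim exE conjE)
  define y' where "y' = (\<Sum>i<N. b i * zl x i)"
  have y': "y' \<in> cyc_ring d" unfolding y'_def using ab(2) zl_mem[OF xm] by auto
  have "a * zs x + y' = 1 + zl x N * (- b N)"
    using ab(3) by (simp add: y'_def eq_diff_eq mult.commute add.assoc)
  then obtain g w' where gw: "g \<in> cyc_ring d" "w' \<in> cyc_ring d"
      "g * (zs x + (1 - zs x ^ k) * y') + zl x N * w' = 1"
    using cyc.unit_lift[OF zs_mem[OF xm] ab(1) y' xN _ k(2) k(1) k(3), of "- b N"] ab(2) by auto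
  \<comment> \<open>The factor \<open>1 - zl x N\<close> makes the augmentation vanish, as
    \<open>z_middle\<close> requires, and is 1 modulo the last coordinate, so the unit found by
    \<open>unit_lift\<close> remains one.\<close>
  define t where "t i = (if i < N then (1 - zs x ^ k) * (1 - zl x N) * b i else 0)" for i
  have t: "t i \<in> cyc_ring d" "t i 1 = 0" for i
    using ab(2) zs_mem[OF xm] xN x1 by (auto simp: t_def)
  obtain u' where u': "orb (Suc N) x u'" "zs u' = zs x + (\<Sum>i<Suc N. t i * zl x i)" "\<forall>i. zl u' i = zl x i"
    using z_middle[where e = t, OF xm t] by (elim exE conjE)
  have "(\<Sum>i<Suc N. t i * zl x i) = (\<Sum>i<N. (1 - zs x ^ k) * (1 - zl x N) * (b i * zl x i))"
    by (simp add: t_def mult.assoc)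
  also have "\<dots> = (1 - zs x ^ k) * (1 - zl x N) * y'" unfolding y'_def by (rule sum_distrib_left[symmetric])
  finally have s': "zs u' = zs x + (1 - zs x ^ k) * (1 - zl x N) * y'" using u'(2) by simp
  have "g * zs u' + (w' + g * (1 - zs x ^ k) * y') * zl u' N = 1"
    using gw(3) u'(3) by (simp add: s' algebra_simps)
  moreover have "w' + g * (1 - zs x ^ k) * y' \<in> cyc_ring d" using gw y' zs_mem[OF xm] by auto
  ultimately have "\<exists>a\<in>cyc_ring d. \<exists>b\<in>cyc_ring d. a * zs u' + b * zl u' N = 1" using gw(1) by blast
  moreover have "zl u' N 1 = 1" using u'(3) x1 by simp
  ultimately show ?thesis
    using orb_trans[OF v(1) orb_trans[OF w(1) orb_trans[OF x(1) u'(1)]]] by (intro exI[of _ u'] conjI)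
qed

lemma z_last1:
  assumes u: "u \<in> Lat (Suc N)" and c: "c \<in> cyc_ring d"
  shows "\<exists>u'. orb (Suc N) u u' \<and> zs u' = zs u \<and> zl u' N = zl u N + c * zs u"
proof -
  obtain u' where "orb (Suc N) u u'" "zs u' = zs u" "zl u' N = zl u N + c * zs u + (\<Sum>k<N. 0 * zl u k)"
    using z_last[where e = "\<lambda>_. 0", OF u c cyc.zero_mem] by (elim exE conjE)
  then show ?thesis by (intro exI[of _ u']) simp
qed

lemma z_middle1:
  assumes u: "u \<in> Lat (Suc N)" and c: "c \<in> cyc_ring d" "c 1 = 0"
  shows "\<exists>u'. orb (Suc N) u u' \<and> zs u' = zs u + c * zl u N \<and> zl u' N = zl u N"
proof -
  have "\<And>i. (if i = N then c else 0) \<in> cyc_ring d" "\<And>i. (if i = N then c else 0) 1 = 0" using c by auto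
  from z_middle[where e = "\<lambda>i. if i = N then c else 0", OF u this] obtain u' where "orb (Suc N) u u'"
    "zs u' = zs u + (\<Sum>k<Suc N. (if k = N then c else 0) * zl u k)" "\<forall>i. zl u' i = zl u i"
    by (elim exE conjE)
  then show ?thesis by (intro exI[of _ u']) simp
qed

text \<open>By stable range one the last coordinate becomes a unit \<open>v\<close> modulo
  \<open>p\<close>. A multiple of it moves the other component to \<open>1 - v\<close> modulo
  \<open>p\<close>, adding this to the last coordinate gives 1, and a multiple of the latter removes
  the former. Corrections in [y - 1) again need augmentation 0.\<close>

lemma orb_z_mod_p:
  assumes u: "u \<in> Lat (Suc N)" and u1: "zl u N 1 = 1"
    and ab: "a \<in> cyc_ring d" "b \<in> cyc_ring d" "a * zs u + b * zl u N = 1"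
  shows "\<exists>u'. orb (Suc N) u u' \<and>
    (\<exists>a\<in>cyc_ring d. \<exists>b\<in>cyc_ring d. a * zs u' + b * zl u' N = 1) \<and>
    (\<exists>e\<in>cyc_ring d. zs u' = of_nat p * e) \<and> (\<exists>e\<in>cyc_ring d. zl u' N = 1 + of_nat p * e)"
proof -
  let ?p = "of_nat p :: complex \<Rightarrow> complex"
  let ?s = "zs u" and ?l = "zl u N"
  have s: "?s \<in> cyc_ring d" "?s 1 = 0" and l: "?l \<in> cyc_ring d"
    using zs_mem[OF u] zs_1[OF u] zl_mem[OF u, of N] by auto
  obtain R where R: "finite R" "\<forall>z\<in>cyc_ring d. \<exists>r\<in>R. \<exists>c\<in>cyc_ring d. z = r + of_int (int p) * c"
    using cyc_ring_finite_mod[of "int p" d] by auto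
  have rep: "\<And>z. z \<in> cyc_ring d \<Longrightarrow> \<exists>r\<in>R. \<exists>c\<in>cyc_ring d. z = r + ?p * c" using R(2) by simp
  have kk: "\<exists>k\<ge>1. \<exists>c\<in>cyc_ring d. ?l ^ (2 * k) = ?l ^ k + ?p * c"
    by (rule cyc.power_idem_mod[OF l cyc.of_nat_mem R(1)]) (rule rep)
  obtain k e where k: "k \<ge> 1" "e \<in> cyc_ring d" "?l ^ (2 * k) = ?l ^ k + ?p * e"
    using kk by (elim exE bexE conjE)
  have as: "a * ?s \<in> cyc_ring d" using ab s by auto
  have "b * ?l + a * ?s = 1 + ?p * 0" using ab(3) by (simp add: add.commute)
  from cyc.unit_lift[OF l ab(2) as cyc.of_nat_mem cyc.zero_mem k(2) k(1) k(3) this]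
  obtain g w where gw: "g \<in> cyc_ring d" "w \<in> cyc_ring d" "g * (?l + (1 - ?l ^ k) * (a * ?s)) + ?p * w = 1"
    by (elim bexE)
  define v where "v = ?l + (1 - ?l ^ k) * (a * ?s)"
  have v: "v \<in> cyc_ring d" "v 1 = 1" using l as s u1 by (auto simp: v_def)
  have gv: "g * v = 1 - ?p * w" using gw(3) by (simp add: v_def eq_diff_eq)
  obtain u1 where u1: "orb (Suc N) u u1" "zs u1 = ?s" "zl u1 N = v"
    using z_last1[OF u, of "(1 - ?l ^ k) * a"] l ab unfolding v_def by (auto simp: mult.assoc)
  have u1m: "u1 \<in> Lat (Suc N)" by (rule orb_mem[OF u1(1) u])
  \<comment> \<open>\<open>g\<close> inverts \<open>v\<close> modulo \<open>p\<close>, so adding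
    \<open>c * v\<close> leads from \<open>?s\<close> to \<open>1 - v\<close> up to a multiple of
    \<open>p\<close>. The augmentation of \<open>c\<close> vanishes because \<open>v\<close> has
    augmentation 1 and \<open>?s\<close> has augmentation 0.\<close>
  define c where "c = (1 - v - ?s) * g"
  have c: "c \<in> cyc_ring d" "c 1 = 0" using v s gw by (auto simp: c_def)
  define e where "e = (1 - v - ?s) * w"
  have e: "e \<in> cyc_ring d" using v s gw by (auto simp: e_def)
  define s' where "s' = 1 - v - ?p * e"
  have "?s + c * v = ?s + (1 - v - ?s) * (g * v)" by (simp add: c_def mult.assoc)
  also have "\<dots> = s'" unfolding gv by (simp add: s'_def e_def algebra_simps)
  finally have s'eq: "?s + c * v = s'" .
  obtain u2 where u2: "orb (Suc N) u1 u2" "zs u2 = s'" "zl u2 N = v"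
    using z_middle1[OF u1m c] s'eq u1 by auto
  have u2m: "u2 \<in> Lat (Suc N)" by (rule orb_mem[OF u2(1) u1m])
  obtain u3 where u3: "orb (Suc N) u2 u3" "zs u3 = s'" "zl u3 N = v + 1 * s'"
    using z_last1[OF u2m cyc.one_mem] unfolding u2 by (elim exE conjE)
  have u3m: "u3 \<in> Lat (Suc N)" by (rule orb_mem[OF u3(1) u2m])
  have l3: "zl u3 N = 1 - ?p * e" using u3(3) by (simp add: s'_def)
  have s'm: "s' \<in> cyc_ring d" "s' 1 = 0" using zs_mem[OF u2m] zs_1[OF u2m] u2 by auto
  obtain u4 where u4: "orb (Suc N) u3 u4" "zs u4 = s' + (- s') * zl u3 N" "zl u4 N = zl u3 N"
    using z_middle1[OF u3m, of "- s'"] s'm u3(2) by auto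
  have s4: "zs u4 = ?p * (s' * e)" unfolding u4(2) l3 by (simp add: algebra_simps)
  have orb: "orb (Suc N) u u4" by (rule orb_trans[OF u1(1) orb_trans[OF u2(1) orb_trans[OF u3(1) u4(1)]]])
  \<comment> \<open>From here on the Bezout relation is carried through the moves, by expressing the
    old components in the new ones.\<close>
  have se: "?s = s' - c * v" using s'eq by (simp add: eq_diff_eq)
  have le: "?l = v - ((1 - ?l ^ k) * a) * ?s" by (simp add: v_def mult.assoc)
  define q where "q = (1 - ?l ^ k) * a"
  have q: "q \<in> cyc_ring d" using l ab by (auto simp: q_def)
  have "1 = a * ?s + b * (v - q * ?s)" using ab(3) le q_def by metis
  also have "\<dots> = (a - b * q) * ?s + b * v" by (simp add: algebra_simps)
  also have "\<dots> = (a - b * q) * s' + (b - (a - b * q) * c) * v" unfolding se by (simp add: algebra_simps)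
  finally have e2: "(a - b * q) * s' + (b - (a - b * q) * c) * v = 1" by (rule HOL.sym)
  define a' b' where "a' = a - b * q" and "b' = b - (a - b * q) * c"
  have ab': "a' \<in> cyc_ring d" "b' \<in> cyc_ring d" using ab q c by (auto simp: a'_def b'_def)
  have "1 = a' * s' + b' * v" using e2 unfolding a'_def b'_def by (rule HOL.sym)
  also have "\<dots> = (a' - b') * s' + b' * zl u3 N" unfolding u3(3) by (simp add: algebra_simps)
  also have "\<dots> = (a' - b') * zs u4 + (b' + (a' - b') * s') * zl u4 N" unfolding u4(2,3) by (simp add: algebra_simps)
  finally have e4: "(a' - b') * zs u4 + (b' + (a' - b') * s') * zl u4 N = 1" by (rule HOL.sym)
  have "\<exists>a\<in>cyc_ring d. \<exists>b\<in>cyc_ring d. a * zs u4 + b * zl u4 N = 1"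
    using ab' s'm e4 by (intro bexI[of _ "a' - b'"] bexI[of _ "b' + (a' - b') * s'"]) auto
  moreover have "\<exists>e\<in>cyc_ring d. zs u4 = ?p * e" using s4 s'm e by auto
  moreover have "\<exists>e\<in>cyc_ring d. zl u4 N = 1 + ?p * e" using l3 u4(3) e by (intro bexI[of _ "- e"]) auto
  ultimately show ?thesis using orb by (intro exI[of _ u4] conjI)
qed

end

section \<open>Matrices congruent to 1 modulo p over the group ring, and integer row operations on
  the matrix part\<close>

context straight_core
begin

text \<open>The matrix with rows (1 + p a, p b) and (p c, 1 + p e) acting on the group ring parts of
  the component in [y - 1) and of the last coordinate. The matrix parts stay fixed, which is
  possible because \<open>L_p\<close> allows multiples of \<open>p\<close> to be changed in the
  group ring alone.\<close>

definition pmap :: "nat \<Rightarrow> (complex \<Rightarrow> complex) \<Rightarrow> (complex \<Rightarrow> complex) \<Rightarrow> (complex \<Rightarrow> complex) \<Rightarrow>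
    (complex \<Rightarrow> complex) \<Rightarrow> lvec \<Rightarrow> lvec" where
  "pmap N a b c e v = (fst v, fst (snd v) + (of_nat p * (a * zs v + b * zl v N), 0),
     \<lambda>i. snd (snd v) i + (if i = N then (of_nat p * (c * zs v + e * zl v N), 0) else 0))"

lemma Y1_p:
  assumes "z \<in> cyc_ring d" "z 1 = 0"
  shows "(of_nat p * z, 0) \<in> Y1"
proof -
  obtain c where c: "c \<in> cyc_ring d" "z = (cyc_gen d - 1) * c" using cyc_ring_aug_0[OF assms] by auto
  have "(of_nat p * z, 0) = y1 \<star> (of_nat p * c, 0)"
    by (simp add: elm_def fst_y c(2) mult.left_commute fun_eq_iff)
  then show ?thesis using Y1_I[OF L_p[OF c(1)]] by simp
qed

lemma pmap_mem:
  assumes v: "v \<in> Lat (Suc N)" and m: "a \<in> cyc_ring d" "b \<in> cyc_ring d" "c \<in> cyc_ring d" "e \<in> cyc_ring d"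
    and b: "b 1 = 0"
  shows "pmap N a b c e v \<in> Lat (Suc N)"
proof -
  have zz: "zs v \<in> cyc_ring d" "zl v N \<in> cyc_ring d" "zs v 1 = 0"
    using zs_mem[OF v] zl_mem[OF v, of N] zs_1[OF v] by auto
  have 1: "(of_nat p * (a * zs v + b * zl v N), 0) \<in> Y1" by (rule Y1_p) (use m zz b in auto)
  have 2: "(of_nat p * (c * zs v + e * zl v N), 0) \<in> L" by (rule L_p) (use m zz in auto)
  show ?thesis unfolding pmap_def
    using LatD[OF v] 1 2 by (intro LatI) (auto intro: Y1_add L_add)
qed

lemma pmap_add: "pmap N a b c e (v + w) = pmap N a b c e v + pmap N a b c e w"
  by (rule lvec_eqI) (simp_all add: pmap_def zs_def zl_def algebra_simps)

lemma pmap_lact: "pmap N a b c e (lact d v x) = lact d (pmap N a b c e v) x"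
  by (rule lvec_eqI)
    (simp_all add: pmap_def zs_def zl_def elm_add_left, simp_all add: elm_def algebra_simps fun_eq_iff)

text \<open>The hypotheses say A + A' + p A' A = 0 for the two coefficient matrices; this is (1 + p
  A') (1 + p A) = 1 after division by \<open>p\<close>.\<close>

lemma pmap_inv:
  assumes "a + a' + of_nat p * (a' * a + b' * c) = 0" "b + b' + of_nat p * (a' * b + b' * e) = 0"
    "c + c' + of_nat p * (c' * a + e' * c) = 0" "e + e' + of_nat p * (c' * b + e' * e) = 0"
  shows "pmap N a' b' c' e' (pmap N a b c e v) = v"
proof -
  let ?p = "of_nat p :: complex \<Rightarrow> complex"
  let ?w = "pmap N a b c e v"
  have z: "zs ?w = zs v + ?p * (a * zs v + b * zl v N)" "zl ?w N = zl v N + ?p * (c * zs v + e * zl v N)"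
    by (simp_all add: pmap_def zs_def zl_def)
  have "?p * (a * zs v + b * zl v N) + ?p * (a' * zs ?w + b' * zl ?w N) =
      ?p * ((a + a' + ?p * (a' * a + b' * c)) * zs v + (b + b' + ?p * (a' * b + b' * e)) * zl v N)"
    unfolding z by (simp add: algebra_simps)
  then have 1: "?p * (a * zs v + b * zl v N) + ?p * (a' * zs ?w + b' * zl ?w N) = 0" unfolding assms by simp
  have "?p * (c * zs v + e * zl v N) + ?p * (c' * zs ?w + e' * zl ?w N) =
      ?p * ((c + c' + ?p * (c' * a + e' * c)) * zs v + (e + e' + ?p * (c' * b + e' * e)) * zl v N)"
    unfolding z by (simp add: algebra_simps)
  then have 2: "?p * (c * zs v + e * zl v N) + ?p * (c' * zs ?w + e' * zl ?w N) = 0" unfolding assms by simp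
  show ?thesis
    by (rule lvec_eqI; subst pmap_def) (simp_all add: pmap_def[of N a b c e v] prod_eq_iff add.assoc 1 2 del: fst_add snd_add add_Pair,
        simp_all add: pmap_def[symmetric] prod_eq_iff add.assoc 1 2)
qed

text \<open>The second row of the matrix is chosen so that the last coordinate loses
  \<open>of_nat p * \<mu>\<close> times the Bezout relation; the first row makes the determinant 1.
  The inverse is the adjugate.\<close>

lemma orb_z_one:
  assumes u: "u \<in> Lat (Suc N)" and ab: "a \<in> cyc_ring d" "b \<in> cyc_ring d" "a * zs u + b * zl u N = 1"
    and m: "s0 \<in> cyc_ring d" "\<mu> \<in> cyc_ring d" and s: "zs u = of_nat p * s0" and l: "zl u N = 1 + of_nat p * \<mu>"
  shows "\<exists>u'. orb (Suc N) u u' \<and> zl u' N = 1"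
proof -
  let ?p = "of_nat p :: complex \<Rightarrow> complex"
  have "zs u 1 = 0" by (rule zs_1[OF u])
  then have s01: "s0 1 = 0" by (simp add: s)
  have key: "1 - b - ?p * b * \<mu> - ?p * s0 * a = 0" using ab(3) unfolding s l by (simp add: algebra_simps)
  \<comment> \<open>Multiplied by \<open>p\<close>, the left side is the determinant of the matrix
    minus 1.\<close>
  have E1: "\<mu> + - (b * \<mu>) + ?p * (- (b * \<mu>) * \<mu> + s0 * - (a * \<mu>)) = 0"
  proof -
    have "\<mu> + - (b * \<mu>) + ?p * (- (b * \<mu>) * \<mu> + s0 * - (a * \<mu>)) = \<mu> * (1 - b - ?p * b * \<mu> - ?p * s0 * a)"
      by (simp add: algebra_simps)
    then show ?thesis unfolding key by simp
  qed
  let ?f = "pmap N \<mu> (- s0) (- (a * \<mu>)) (- (b * \<mu>))" and ?g = "pmap N (- (b * \<mu>)) s0 (a * \<mu>) \<mu>"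
  have inv1: "?g (?f v) = v" for v
    by (rule pmap_inv) (use E1 in \<open>simp_all add: algebra_simps\<close>)
  have inv2: "?f (?g v) = v" for v
    by (rule pmap_inv) (use E1 in \<open>simp_all add: algebra_simps\<close>)
  have "aut (Suc N) ?f"
    by (rule aut_I[where \<psi> = ?g]) (use m ab s01 in \<open>simp_all add: pmap_mem inv1 inv2 pmap_add pmap_lact\<close>)
  moreover have "zl (?f u) N = 1"
  proof -
    have "zl (?f u) N = zl u N - ?p * \<mu> * (a * zs u + b * zl u N)"
      by (simp add: pmap_def zl_def zs_def algebra_simps)
    then show ?thesis unfolding ab(3) by (simp add: l)
  qed
  ultimately show ?thesis unfolding orb_def by (intro exI[of _ "?f u"] conjI exI[of _ ?f]) auto
qed

lemma orb_zl_1: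
  assumes u: "u \<in> Lat (Suc N)" and uni: "uni (Suc N) u"
  shows "\<exists>u'. orb (Suc N) u u' \<and> zl u' N = 1"
proof -
  obtain v a b where v: "orb (Suc N) u v" "zl v N 1 = 1" "a \<in> cyc_ring d" "b \<in> cyc_ring d" "a * zs v + b * zl v N = 1"
    using orb_z_unimodular[OF assms] by (elim exE bexE conjE)
  have vm: "v \<in> Lat (Suc N)" by (rule orb_mem[OF v(1) u])
  obtain w a b s0 \<mu> where w: "orb (Suc N) v w" "a \<in> cyc_ring d" "b \<in> cyc_ring d" "a * zs w + b * zl w N = 1"
    "s0 \<in> cyc_ring d" "zs w = of_nat p * s0" "\<mu> \<in> cyc_ring d" "zl w N = 1 + of_nat p * \<mu>"
    using orb_z_mod_p[OF vm v(2-5)] by (elim exE bexE conjE)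
  have wm: "w \<in> Lat (Suc N)" by (rule orb_mem[OF w(1) vm])
  obtain x where "orb (Suc N) w x" "zl x N = 1"
    using orb_z_one[OF wm w(2-4) w(5) w(7) w(6) w(8)] by (elim exE conjE)
  then show ?thesis using orb_trans[OF v(1) orb_trans[OF w(1)]] by (intro exI[of _ x] conjI)
qed

lemma vm_sum_fun: "vm d (\<Sum>i::'a\<in>A. f i) t = (\<Sum>i\<in>A. vm d (f i) t)"
proof -
  have e: "(\<Sum>i\<in>A. g i) = (\<lambda>j. \<Sum>k\<in>A. g k j)" for g :: "'a \<Rightarrow> nat \<Rightarrow> int"
    by (rule ext) (rule sum_fun_apply)
  show ?thesis unfolding e by (rule vm_sum)
qed

lemma R2_sum: "(\<And>i. i \<in> A \<Longrightarrow> f i \<in> R2) \<Longrightarrow> sum f A \<in> R2"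
  by (induction A rule: infinite_finite_induct) (auto intro: R2_add)

lemma R2_p: "vm d (\<lambda>k. int p * A k) t \<in> R2"
  using vm_supp by (auto simp: R2_def vm_scale)

text \<open>Multiplication by \<open>p\<close> turns arbitrary row vectors into members of
  \<open>R2\<close>, so any integer combination of the rows of the other components, multiplied by
  \<open>p\<close>, may be added to the component in \<open>R2\<close>.\<close>

lemma orb_row:
  assumes u: "u \<in> Lat n"
  shows "orb n u (fst u + (vm d (\<lambda>k. int p * A k) (snd (fst (snd u))) +
      (\<Sum>i<n. vm d (\<lambda>k. int p * B i k) (snd (snd (snd u) i)))), fst (snd u), snd (snd u))"
proof -
  let ?\<theta> = "\<lambda>v :: lvec. (vm d (\<lambda>k. int p * A k) (snd (fst (snd v))) +
      (\<Sum>i<n. vm d (\<lambda>k. int p * B i k) (snd (snd (snd v) i))), 0 :: el, 0 :: nat \<Rightarrow> el)"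
  have "orb n u (u + ?\<theta> u)"
  proof (rule orb_transvection[OF u])
    fix v assume v: "v \<in> Lat n"
    show "?\<theta> v \<in> Lat n"
      by (intro LatI R2_add R2_sum R2_p) simp_all
    show "?\<theta> (?\<theta> v) = 0" by (rule lvec_eqI) simp_all
    fix w
    show "?\<theta> (v + w) = ?\<theta> v + ?\<theta> w"
      by (rule lvec_eqI) (simp_all add: vm_add_right sum.distrib)
    fix c
    show "?\<theta> (lact d v c) = lact d (?\<theta> v) c"
      by (rule lvec_eqI) (simp_all add: snd_elm vm_assoc vm_add vm_sum_fun)
  qed
  also have "u + ?\<theta> u = (fst u + (vm d (\<lambda>k. int p * A k) (snd (fst (snd u))) +
      (\<Sum>i<n. vm d (\<lambda>k. int p * B i k) (snd (snd (snd u) i)))), fst (snd u), snd (snd u))"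
    by (rule lvec_eqI) simp_all
  finally show ?thesis .
qed

text \<open>The integer matrix with rows \<open>(x, y')\<close> and
  \<open>(- \<rho>, \<alpha>)\<close> acting on row \<open>j\<close> of the last coordinate and the
  component in \<open>R2\<close>. Both are row vectors acted on from the right, so any such mixing
  is linear.\<close>

definition pair_map :: "nat \<Rightarrow> nat \<Rightarrow> int \<Rightarrow> int \<Rightarrow> int \<Rightarrow> int \<Rightarrow> lvec \<Rightarrow> lvec" where
  "pair_map N j x y' \<rho> \<alpha> v = (\<lambda>i. \<alpha> * fst v i + (- \<rho>) * snd (snd (snd v) N) j i, fst (snd v),
     \<lambda>n. snd (snd v) n + (if n = N then (0, \<lambda>k. if k = j then
        (\<lambda>i. (x - 1) * snd (snd (snd v) N) j i + y' * fst v i) else 0) else 0))"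

text \<open>The change of row \<open>j\<close> must lie in the radical: up to and including the
  diagonal it has to be divisible by \<open>p\<close>. The diagonal entry of row \<open>j\<close> is
  arbitrary, whence the condition on \<open>x\<close>. For \<open>j = 1\<close> the first entry of
  the vector in \<open>R2\<close> is divisible by \<open>p\<close>, and \<open>\<rho>\<close> must
  keep it so; for \<open>j > 1\<close> the entries of that vector at the places 2 to
  \<open>j\<close> force the condition on \<open>y'\<close>.\<close>

lemma pair_map_mem:
  assumes v: "v \<in> Lat (Suc N)" and j: "j \<in> {1..d}" and c: "int p dvd x - 1"
    "(j = 1 \<and> int p dvd \<rho>) \<or> (j > 1 \<and> int p dvd y')"
  shows "pair_map N j x y' \<rho> \<alpha> v \<in> Lat (Suc N)"
proof -
  let ?t = "snd (snd (snd v) N)"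
  have l: "snd (snd v) N \<in> L" using LatD(3)[OF v, of N] by simp
  have r: "fst v i = 0" if "i \<notin> {1..d}" for i using LatD(1)[OF v] that by (auto simp: R2_def)
  have r1: "int p dvd fst v 1" using LatD(1)[OF v] by (auto simp: R2_def)
  have "(\<lambda>i. \<alpha> * fst v i + (- \<rho>) * ?t j i) \<in> R2"
    unfolding R2_def using r r1 L_supp[OF l] c(2) L_tri[OF l, of 1 j] by auto
  moreover have "(0, \<lambda>k. if k = j then (\<lambda>i. (x - 1) * ?t j i + y' * fst v i) else 0) \<in> L"
    unfolding L_rad
  proof (intro allI conjI impI)
    fix k i assume "k \<notin> {1..d} \<or> i \<notin> {1..d}"
    then show "(if k = j then (\<lambda>i. (x - 1) * ?t j i + y' * fst v i) else 0) i = 0"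
      using r L_supp[OF l, of j i] j by auto
  next
    fix k i :: nat assume ik: "i \<le> k"
    have "int p dvd y' * fst v i" if "k = j"
    proof (cases "j = 1")
      case True
      then have "i = 0 \<or> i = 1" using that ik by auto
      then show ?thesis using r1 r[of 0] by auto
    qed (use c in auto)
    then show "int p dvd (if k = j then (\<lambda>i. (x - 1) * ?t j i + y' * fst v i) else 0) i"
      using c(1) by (auto intro!: dvd_add)
  qed
  ultimately show ?thesis unfolding pair_map_def
    using LatD[OF v] by (intro LatI) (auto intro: L_add)
qed

lemma pair_map_add: "pair_map N j x y' \<rho> \<alpha> (v + w) = pair_map N j x y' \<rho> \<alpha> v + pair_map N j x y' \<rho> \<alpha> w"
  by (rule lvec_eqI) (auto simp add: pair_map_def prod_eq_iff fun_eq_iff algebra_simps)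

lemma pair_map_lact: "pair_map N j x y' \<rho> \<alpha> (lact d v b) = lact d (pair_map N j x y' \<rho> \<alpha> v) b"
proof (rule lvec_eqI)
  show "fst (pair_map N j x y' \<rho> \<alpha> (lact d v b)) = fst (lact d (pair_map N j x y' \<rho> \<alpha> v) b)"
    by (simp only: pair_map_def fst_conv lact_simps snd_elm vm_comb)
  fix i
  show "snd (snd (pair_map N j x y' \<rho> \<alpha> (lact d v b))) i = snd (snd (lact d (pair_map N j x y' \<rho> \<alpha> v) b)) i"
    by (simp add: pair_map_def elm_add_left) (auto simp add: elm_def vm_comb fun_eq_iff if_distrib)
qed (simp add: pair_map_def)

lemma pair_map_inv:
  assumes "x * \<alpha> + y' * \<rho> = 1"
  shows "pair_map N j \<alpha> (- y') (- \<rho>) x (pair_map N j x y' \<rho> \<alpha> v) = v"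
proof -
  have A: "x * (\<alpha> * a) + (y' * (\<rho> * a)) = a" for a
  proof -
    have "x * (\<alpha> * a) + (y' * (\<rho> * a)) = (x * \<alpha> + y' * \<rho>) * a" by (simp add: algebra_simps)
    then show ?thesis by (simp add: assms)
  qed
  show ?thesis
  proof (rule lvec_eqI)
    show "fst (pair_map N j \<alpha> (- y') (- \<rho>) x (pair_map N j x y' \<rho> \<alpha> v)) = fst v"
    proof
      fix i
      show "fst (pair_map N j \<alpha> (- y') (- \<rho>) x (pair_map N j x y' \<rho> \<alpha> v)) i = fst v i"
        using A[of "fst v i"] by (simp add: pair_map_def algebra_simps)
    qed
    fix n
    have "snd (snd (snd (pair_map N j \<alpha> (- y') (- \<rho>) x (pair_map N j x y' \<rho> \<alpha> v))) n) k i = snd (snd (snd v) n) k i" for k i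
      using A[of "snd (snd (snd v) N) j i"] by (simp add: pair_map_def algebra_simps)
    then show "snd (snd (pair_map N j \<alpha> (- y') (- \<rho>) x (pair_map N j x y' \<rho> \<alpha> v))) n = snd (snd v) n"
      by (simp add: prod_eq_iff fun_eq_iff pair_map_def)
  qed (simp add: pair_map_def)
qed

lemma orb_pair:
  assumes u: "u \<in> Lat (Suc N)" and j: "j \<in> {1..d}" and c: "int p dvd x - 1" "int p dvd \<alpha> - 1"
    "(j = 1 \<and> int p dvd \<rho>) \<or> (j > 1 \<and> int p dvd y')" and det: "x * \<alpha> + y' * \<rho> = 1"
  shows "orb (Suc N) u (pair_map N j x y' \<rho> \<alpha> u)"
proof -
  have det': "\<alpha> * x + (- y') * (- \<rho>) = 1" using det by (simp add: mult.commute)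
  have inv: "pair_map N j x y' \<rho> \<alpha> (pair_map N j \<alpha> (- y') (- \<rho>) x v) = v" for v
    using pair_map_inv[OF det', of N j v] by simp
  have c': "(j = 1 \<and> int p dvd - \<rho>) \<or> (j > 1 \<and> int p dvd - y')" using c(3) by simp
  have "aut (Suc N) (pair_map N j x y' \<rho> \<alpha>)"
    by (rule aut_I[where \<psi> = "pair_map N j \<alpha> (- y') (- \<rho>) x"])
      (simp_all only: pair_map_mem[OF _ j c(1) c(3)] pair_map_mem[OF _ j c(2) c'] pair_map_add pair_map_lact pair_map_inv[OF det] inv)
  then show ?thesis unfolding orb_def by (intro exI conjI) auto
qed

text \<open>For \<open>k < j\<close> the places up to \<open>k\<close> of row \<open>j\<close> lie
  left of its diagonal and are divisible by \<open>p\<close>; for \<open>k > j\<close> the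
  divisibility is put on \<open>c k\<close>. As \<open>c j = 0\<close>, the move squares to
  zero.\<close>

lemma orb_clear:
  assumes u: "u \<in> Lat (Suc N)" and j: "j \<in> {1..d}" and c: "c j = 0" "\<And>k. k > j \<Longrightarrow> int p dvd c k"
    "\<And>k. k \<notin> {1..d} \<Longrightarrow> c k = 0"
  shows "orb (Suc N) u (fst u, fst (snd u), \<lambda>i. snd (snd u) i +
     (if i = N then (0, \<lambda>k i. c k * snd (snd (snd u) N) j i) else 0))"
proof -
  let ?\<theta> = "\<lambda>v :: lvec. (0 :: nat \<Rightarrow> int, 0 :: el, \<lambda>i. if i = N then (0 :: complex \<Rightarrow> complex, \<lambda>k i. c k * snd (snd (snd v) N) j i) else 0)"
  have "orb (Suc N) u (u + ?\<theta> u)"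
  proof (rule orb_transvection[OF u])
    fix v assume v: "v \<in> Lat (Suc N)"
    have l: "snd (snd v) N \<in> L" using LatD(3)[OF v, of N] by simp
    have "(0, \<lambda>k i. c k * snd (snd (snd v) N) j i) \<in> L"
      unfolding L_rad
    proof (intro allI conjI impI)
      fix k i assume "k \<notin> {1..d} \<or> i \<notin> {1..d}"
      then show "c k * snd (snd (snd v) N) j i = 0" using c(3) L_supp[OF l, of j i] by auto
    next
      fix k i :: nat assume "i \<le> k"
      then show "int p dvd c k * snd (snd (snd v) N) j i"
        using c(1) c(2)[of k] L_tri[OF l, of i j] by (cases "k = j"; cases "k > j") auto
    qed
    then show "?\<theta> v \<in> Lat (Suc N)" by (intro LatI) auto
    show "?\<theta> (?\<theta> v) = 0" by (rule lvec_eqI) (simp_all add: c(1) prod_eq_iff fun_eq_iff)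
    fix w
    show "?\<theta> (v + w) = ?\<theta> v + ?\<theta> w"
      by (rule lvec_eqI) (simp_all add: fun_eq_iff distrib_left)
    fix b
    show "?\<theta> (lact d v b) = lact d (?\<theta> v) b"
      by (rule lvec_eqI) (simp_all add: elm_def vm_scale fun_eq_iff prod_eq_iff)
  qed
  also have "u + ?\<theta> u = (fst u, fst (snd u), \<lambda>i. snd (snd u) i +
     (if i = N then (0, \<lambda>k i. c k * snd (snd (snd u) N) j i) else 0))"
    by (rule lvec_eqI) simp_all
  finally show ?thesis .
qed

end

section \<open>Column by column reduction of the matrix part to the identity\<close>

context straight_core
begin

definition Inv where
  "Inv N j u \<longleftrightarrow> u \<in> Lat (Suc N) \<and> uni (Suc N) u \<and> zl u N = 1 \<and>
     (\<forall>i\<in>{1..<j}. fst u i = 0 \<and> (\<forall>k\<in>{1..d}. snd (snd (snd u) N) k i = (if k = i then 1 else 0)))"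

text \<open>If the group ring part is 1, the difference from the identity lies in the
  radical.\<close>

lemma last_mod_p:
  assumes "u \<in> Lat (Suc N)" "zl u N = 1" "k \<in> {1..d}"
  shows "int p dvd snd (snd (snd u) N) k k - 1"
proof -
  have "snd (snd u) N - el_one d \<in> L" using LatD(3)[OF assms(1), of N] L_one by (simp add: L_diff)
  also have "snd (snd u) N - el_one d = (0, snd (snd (snd u) N) - snd (el_one d))"
    using assms(2) by (simp add: prod_eq_iff zl_def)
  finally have "int p dvd (snd (snd (snd u) N) - snd (el_one d)) k k" unfolding L_rad by blast
  then show ?thesis using assms(3) by (simp add: el_one_def)
qed

text \<open>Entry \<open>(j, j)\<close> of the relation in \<open>uni_rel\<close> shows that a
  common divisor of the entry in \<open>R2\<close>, the diagonal entry \<open>\<alpha>\<close> and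
  the combination \<open>ov\<close> of the remaining rows divides \<open>p\<close>; as
  \<open>\<alpha>\<close> is 1 modulo \<open>p\<close>, it is a unit. Then
  \<open>coprime_shift\<close> finds a multiple of \<open>ov\<close> whose addition makes the entry
  in \<open>R2\<close> coprime to \<open>\<alpha>\<close>.\<close>

lemma Inv_step1:
  assumes inv: "Inv N j u" and j: "j \<in> {1..d}"
  shows "\<exists>u'. orb (Suc N) u u' \<and> Inv N j u' \<and> coprime (fst u' j) (snd (snd (snd u') N) j j)"
proof -
  obtain r s l where u: "u = (r, s, l)" by (cases u) auto
  have um: "(r, s, l) \<in> Lat (Suc N)" "uni (Suc N) (r, s, l)" "zl (r, s, l) N = 1"
    and old: "\<forall>i\<in>{1..<j}. r i = 0 \<and> (\<forall>k\<in>{1..d}. snd (l N) k i = (if k = i then 1 else 0))"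
    using inv unfolding u Inv_def by auto
  let ?t = "snd (l N)"
  from uni_rel[OF um(2,1)] obtain a b c where a: "a \<in> L" and b: "\<forall>i. b i \<in> L"
    and rel: "\<forall>i\<in>{1..d}. \<forall>k. (if i = k then int p else 0) =
        c i * r k + int p * snd (a \<star> s) i k + int p * (\<Sum>n<Suc N. snd (b n \<star> l n) i k)"
    by (elim bexE exE conjE)
  define \<alpha> where "\<alpha> = ?t j j"
  define \<beta> where "\<beta> = int p * snd (b N) j j"
  \<comment> \<open>The contribution to the relation of all rows except \<open>r\<close> and row
    \<open>j\<close> of the last coordinate; by \<open>uni_rel\<close> it is a combination that
    \<open>orb_row\<close> can add.\<close>
  define ov where "ov k = (if j = k then int p else 0) - c j * r k - \<beta> * ?t j k" for k
  have \<alpha>: "int p dvd \<alpha> - 1" using last_mod_p[OF um(1,3) j] by (simp add: \<alpha>_def)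
  have pa: "coprime (int p) \<alpha>"
  proof (rule coprimeI)
    fix x assume x: "x dvd int p" "x dvd \<alpha>"
    have "x dvd \<alpha> - (\<alpha> - 1)" by (rule dvd_diff[OF x(2) dvd_trans[OF x(1) \<alpha>]])
    then show "x dvd 1" by (simp only: diff_diff_eq2 add_diff_cancel_left')
  qed
  have \<alpha>0: "\<alpha> \<noteq> 0"
  proof
    assume "\<alpha> = 0"
    then have "int p dvd 1" using \<alpha> by simp
    then show False using prime_gt_1_nat[OF prime] by simp
  qed
  have "gcd (gcd (r j) (ov j)) \<alpha> dvd ov j + c j * r j + \<beta> * \<alpha>"
    by (intro dvd_add dvd_mult) (auto intro: dvd_trans[OF gcd_dvd1])
  then have "gcd (gcd (r j) (ov j)) \<alpha> dvd int p" by (simp add: ov_def \<alpha>_def)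
  then have "is_unit (gcd (gcd (r j) (ov j)) \<alpha>)" by (rule coprime_common_divisor[OF pa]) simp
  then have "gcd (gcd (r j) (ov j)) \<alpha> = 1" by simp
  from coprime_shift[OF \<alpha>0 this] obtain q where q: "coprime (r j + q * ov j) \<alpha>" by (elim exE)
  define A where "A k = q * snd a j k" for k
  \<comment> \<open>Row \<open>j\<close> of the last coordinate is left out, so that the added
    vector is exactly \<open>q\<close> times \<open>ov\<close>.\<close>
  define B where "B i k = (if i = N \<and> k = j then 0 else q * snd (b i) j k)" for i k
  have vA: "vm d (\<lambda>k. int p * A k) (snd s) = (\<lambda>k. q * (int p * snd (a \<star> s) j k))"
    unfolding A_def mult.left_commute[of _ q] vm_scale by (simp add: snd_elm)
  have vB: "vm d (\<lambda>k. int p * B i k) (snd (l i)) =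
      (\<lambda>k. q * (int p * snd (b i \<star> l i) j k) - (if i = N then q * (\<beta> * ?t j k) else 0))" if "i < Suc N" for i
  proof (cases "i = N")
    case False
    then have "(\<lambda>k. int p * B i k) = (\<lambda>k. q * (int p * snd (b i) j k))" by (simp add: B_def mult.left_commute)
    then show ?thesis using False by (simp only: vm_scale snd_elm) simp
  next
    case True
    have "(\<lambda>k. int p * B i k) = (\<lambda>k. q * (int p * snd (b i) j k) + (- q * \<beta>) * (if k = j then 1 else 0))"
      using True by (auto simp: B_def \<beta>_def fun_eq_iff mult.left_commute)
    then have "vm d (\<lambda>k. int p * B i k) (snd (l i)) =
       (\<lambda>k. q * vm d (\<lambda>k. int p * snd (b i) j k) (snd (l i)) k + (- q * \<beta>) * vm d (\<lambda>k. if k = j then 1 else 0) (snd (l i)) k)"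
      by (simp only: vm_comb)
    also have "vm d (\<lambda>k. int p * snd (b i) j k) (snd (l i)) = (\<lambda>k. int p * snd (b i \<star> l i) j k)"
      by (simp only: vm_scale snd_elm)
    also have "vm d (\<lambda>k. if k = j then 1 else 0) (snd (l i)) = ?t j"
    proof
      fix k
      have "(\<Sum>n = 1..d. (if n = j then 1 else 0) * snd (l i) n k) = (\<Sum>n = 1..d. if n = j then snd (l i) n k else 0)"
        by (rule sum.cong) auto
      then show "vm d (\<lambda>k. if k = j then 1 else 0) (snd (l i)) k = ?t j k"
        using j True L_supp[OF LatD(3)[OF um(1), of N], of j k] by (auto simp: vm_def)
    qed
    finally show ?thesis using True by (simp add: fun_eq_iff)
  qed
  define r' where "r' = r + (vm d (\<lambda>k. int p * A k) (snd s) + (\<Sum>i<Suc N. vm d (\<lambda>k. int p * B i k) (snd (l i))))"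
  have r': "r' k = r k + q * ov k" for k
  proof -
    have "(\<Sum>i<Suc N. vm d (\<lambda>k. int p * B i k) (snd (l i))) k =
        (\<Sum>i<Suc N. q * (int p * snd (b i \<star> l i) j k) - (if i = N then q * (\<beta> * ?t j k) else 0))"
      unfolding sum_fun_apply by (rule sum.cong) (simp_all only: vB lessThan_iff)
    also have "\<dots> = q * (int p * (\<Sum>i<Suc N. snd (b i \<star> l i) j k)) - q * (\<beta> * ?t j k)"
      by (simp only: sum_subtractf sum_distrib_left) simp
    finally have "r' k = r k + q * (int p * snd (a \<star> s) j k + int p * (\<Sum>i<Suc N. snd (b i \<star> l i) j k) - \<beta> * ?t j k)"
      unfolding r'_def plus_fun_apply vA by (simp add: algebra_simps)
    also have "int p * snd (a \<star> s) j k + int p * (\<Sum>i<Suc N. snd (b i \<star> l i) j k) - \<beta> * ?t j k = ov k"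
      using rel[rule_format, OF j, of k] unfolding ov_def by linarith
    finally show ?thesis .
  qed
  have o: "orb (Suc N) (r, s, l) (r', s, l)" using orb_row[OF um(1), of A B] unfolding r'_def by simp
  have "Inv N j (r', s, l)"
    unfolding Inv_def
  proof (intro conjI ballI)
    show "(r', s, l) \<in> Lat (Suc N)" by (rule orb_mem[OF o um(1)])
    show "uni (Suc N) (r', s, l)" by (rule uni_orb[OF um(2) o um(1)])
    show "zl (r', s, l) N = 1" using um(3) by (simp add: zl_def)
    fix i assume i: "i \<in> {1..<j}"
    then have "r i = 0" "?t j i = 0" using old j by auto
    then show "fst (r', s, l) i = 0" using r' i by (simp add: ov_def)
    fix k assume k: "k \<in> {1..d}"
    show "snd (snd (snd (r', s, l)) N) k i = (if k = i then 1 else 0)" using old i k by simp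
  qed
  moreover have "coprime (fst (r', s, l) j) (snd (snd (snd (r', s, l)) N) j j)"
    using q by (simp add: r' \<alpha>_def)
  ultimately show ?thesis using o unfolding u by (intro exI[of _ "(r', s, l)"] conjI)
qed

text \<open>A Bezout relation completes the coprime pair to a matrix of determinant 1 that turns the
  diagonal entry into 1 and the entry in \<open>R2\<close> into 0. For \<open>j > 1\<close> the
  relation is taken for \<open>\<alpha>\<close> and \<open>int p * \<rho>\<close>, still coprime
  because \<open>\<alpha>\<close> is 1 modulo \<open>p\<close>; this makes \<open>y'\<close>
  divisible by \<open>p\<close>. For \<open>j = 1\<close> the factor \<open>p\<close> is already in
  \<open>\<rho>\<close>.\<close>

lemma Inv_step2:
  assumes inv: "Inv N j u" and j: "j \<in> {1..d}" and cop: "coprime (fst u j) (snd (snd (snd u) N) j j)"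
  shows "\<exists>u'. orb (Suc N) u u' \<and> Inv N j u' \<and> fst u' j = 0 \<and> snd (snd (snd u') N) j j = 1"
proof -
  have um: "u \<in> Lat (Suc N)" "uni (Suc N) u" "zl u N = 1"
    and old: "\<forall>i\<in>{1..<j}. fst u i = 0 \<and> (\<forall>k\<in>{1..d}. snd (snd (snd u) N) k i = (if k = i then 1 else 0))"
    using inv unfolding Inv_def by auto
  let ?t = "snd (snd (snd u) N)"
  define \<alpha> where "\<alpha> = ?t j j"
  define \<rho> where "\<rho> = fst u j"
  have \<alpha>: "int p dvd \<alpha> - 1" using last_mod_p[OF um(1,3) j] by (simp add: \<alpha>_def)
  have pa: "coprime (int p) \<alpha>"
  proof (rule coprimeI)
    fix x assume x: "x dvd int p" "x dvd \<alpha>"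
    have "x dvd \<alpha> - (\<alpha> - 1)" by (rule dvd_diff[OF x(2) dvd_trans[OF x(1) \<alpha>]])
    then show "x dvd 1" by (simp only: diff_diff_eq2 add_diff_cancel_left')
  qed
  have "\<exists>x y'. x * \<alpha> + y' * \<rho> = 1 \<and> ((j = 1 \<and> int p dvd \<rho>) \<or> (j > 1 \<and> int p dvd y'))"
  proof (cases "j = 1")
    case True
    have "int p dvd \<rho>" using LatD(1)[OF um(1)] True by (simp add: R2_def \<rho>_def)
    moreover obtain x z where "x * \<alpha> + z * \<rho> = 1"
      using bezout_int[of \<alpha> \<rho>] cop by (auto simp: \<alpha>_def \<rho>_def coprime_iff_gcd_eq_1 gcd.commute)
    ultimately show ?thesis using True by (intro exI[of _ x] exI[of _ z]) auto
  next
    case False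
    have "coprime \<alpha> (int p * \<rho>)" using cop pa by (simp add: \<alpha>_def \<rho>_def coprime_commute)
    then obtain x z where "x * \<alpha> + z * (int p * \<rho>) = 1"
      using bezout_int[of \<alpha> "int p * \<rho>"] by (auto simp: coprime_iff_gcd_eq_1)
    then show ?thesis using False j by (intro exI[of _ x] exI[of _ "z * int p"]) (auto simp: mult.assoc)
  qed
  then obtain x y' where xy: "x * \<alpha> + y' * \<rho> = 1" "(j = 1 \<and> int p dvd \<rho>) \<or> (j > 1 \<and> int p dvd y')"
    by (elim exE conjE)
  \<comment> \<open>Modulo \<open>p\<close> the product \<open>y' * \<rho>\<close> vanishes and
    \<open>\<alpha>\<close> is 1, so the Bezout relation leaves just \<open>x\<close>.\<close>
  have x1: "int p dvd x - 1"
  proof -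
    have "x - 1 = - (y' * \<rho>) - x * (\<alpha> - 1)" using xy(1) by (simp add: algebra_simps)
    moreover have "int p dvd y' * \<rho>" using xy(2) by auto
    ultimately show ?thesis using dvd_diff[OF _ dvd_mult[OF \<alpha>], of "- (y' * \<rho>)" x] by simp
  qed
  let ?v = "pair_map N j x y' \<rho> \<alpha> u"
  have o: "orb (Suc N) u ?v" by (rule orb_pair[OF um(1) j x1 \<alpha> xy(2) xy(1)])
  have fv: "fst ?v i = \<alpha> * fst u i - \<rho> * ?t j i" for i by (simp add: pair_map_def)
  have tv: "snd (snd (snd ?v) N) k i = (if k = j then x * ?t j i + y' * fst u i else ?t k i)" for k i
    by (simp add: pair_map_def algebra_simps)
  have "Inv N j ?v"
    unfolding Inv_def
  proof (intro conjI ballI)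
    show "?v \<in> Lat (Suc N)" by (rule orb_mem[OF o um(1)])
    show "uni (Suc N) ?v" by (rule uni_orb[OF um(2) o um(1)])
    show "zl ?v N = 1" using um(3) by (simp add: zl_def pair_map_def)
    fix i assume i: "i \<in> {1..<j}"
    then have 0: "fst u i = 0" "?t j i = 0" using old j by auto
    then show "fst ?v i = 0" by (simp add: fv)
    fix k assume k: "k \<in> {1..d}"
    show "snd (snd (snd ?v) N) k i = (if k = i then 1 else 0)" unfolding tv using 0 old i k by auto
  qed
  moreover have "fst ?v j = 0" unfolding fv by (simp add: \<alpha>_def \<rho>_def)
  moreover have "snd (snd (snd ?v) N) j j = 1" using xy(1) unfolding tv by (simp add: \<alpha>_def \<rho>_def)
  ultimately show ?thesis using o by (intro exI[of _ ?v] conjI)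
qed

text \<open>With 1 on the diagonal, multiples of row \<open>j\<close> clear the rest of column
  \<open>j\<close>; below the diagonal the multipliers are entries of a triangular matrix and hence
  divisible by \<open>p\<close>, as \<open>orb_clear\<close> demands. Earlier columns are not
  disturbed, since row \<open>j\<close> vanishes there.\<close>

lemma Inv_step3:
  assumes inv: "Inv N j u" and j: "j \<in> {1..d}" and uj: "fst u j = 0" "snd (snd (snd u) N) j j = 1"
  shows "\<exists>u'. orb (Suc N) u u' \<and> Inv N (Suc j) u'"
proof -
  have um: "u \<in> Lat (Suc N)" "uni (Suc N) u" "zl u N = 1"
    and old: "\<forall>i\<in>{1..<j}. fst u i = 0 \<and> (\<forall>k\<in>{1..d}. snd (snd (snd u) N) k i = (if k = i then 1 else 0))"
    using inv unfolding Inv_def by auto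
  have l: "snd (snd u) N \<in> L" using LatD(3)[OF um(1), of N] by simp
  let ?t = "snd (snd (snd u) N)"
  define c where "c k = (if k \<in> {1..d} \<and> k \<noteq> j then - ?t k j else 0)" for k
  have c: "c j = 0" "\<And>k. k > j \<Longrightarrow> int p dvd c k" "\<And>k. k \<notin> {1..d} \<Longrightarrow> c k = 0"
    using L_tri[OF l] by (auto simp: c_def)
  let ?v = "(fst u, fst (snd u), \<lambda>i. snd (snd u) i + (if i = N then (0, \<lambda>k i. c k * ?t j i) else 0))"
  have o: "orb (Suc N) u ?v" by (rule orb_clear[where c = c, OF um(1) j c])
  have tv: "snd (snd (snd ?v) N) k i = ?t k i + c k * ?t j i" for k i by simp
  have "Inv N (Suc j) ?v"
    unfolding Inv_def
  proof (intro conjI ballI)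
    show "?v \<in> Lat (Suc N)" by (rule orb_mem[OF o um(1)])
    show "uni (Suc N) ?v" by (rule uni_orb[OF um(2) o um(1)])
    show "zl ?v N = 1" using um(3) by (simp add: zl_def)
    fix i assume i: "i \<in> {1..<Suc j}"
    then show "fst ?v i = 0" using old uj(1) by (cases "i = j") auto
    fix k assume k: "k \<in> {1..d}"
    show "snd (snd (snd ?v) N) k i = (if k = i then 1 else 0)"
    proof (cases "i = j")
      case True
      then show ?thesis unfolding tv using k uj(2) by (simp add: c_def)
    next
      case False
      then have "?t j i = 0" "?t k i = (if k = i then 1 else 0)" using old i j k by auto
      then show ?thesis unfolding tv by simp
    qed
  qed
  then show ?thesis using o by (intro exI[of _ ?v] conjI)
qed

lemma Inv_end:
  assumes "Inv N 1 u" "j \<le> d"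
  shows "\<exists>u'. orb (Suc N) u u' \<and> Inv N (Suc j) u'"
  using assms(2)
proof (induction j)
  case 0
  then show ?case using assms(1) orb_self by (intro exI[of _ u]) simp
next
  case (Suc j)
  obtain v where v: "orb (Suc N) u v" "Inv N (Suc j) v"
    using Suc.IH[OF Suc_leD[OF Suc.prems]] by (elim exE conjE)
  have j: "Suc j \<in> {1..d}" using Suc.prems by simp
  obtain w where w: "orb (Suc N) v w" "Inv N (Suc j) w" "coprime (fst w (Suc j)) (snd (snd (snd w) N) (Suc j) (Suc j))"
    using Inv_step1[OF v(2) j] by (elim exE conjE)
  obtain x where x: "orb (Suc N) w x" "Inv N (Suc j) x" "fst x (Suc j) = 0" "snd (snd (snd x) N) (Suc j) (Suc j) = 1"
    using Inv_step2[OF w(2) j w(3)] by (elim exE conjE)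
  obtain y where y: "orb (Suc N) x y" "Inv N (Suc (Suc j)) y"
    using Inv_step3[OF x(2) j x(3,4)] by (elim exE conjE)
  show ?case using orb_trans[OF v(1) orb_trans[OF w(1) orb_trans[OF x(1) y(1)]]] y(2)
    by (intro exI[of _ y] conjI)
qed

theorem orb_unimodular:
  assumes u: "u \<in> Lat (Suc N)" and uni: "uni (Suc N) u"
  shows "orb (Suc N) u (0, 0, \<lambda>i. if i = N then el_one d else 0)"
proof -
  obtain v where v: "orb (Suc N) u v" "zl v N = 1" using orb_zl_1[OF assms] by (elim exE conjE)
  have "Inv N 1 v" unfolding Inv_def using orb_mem[OF v(1) u] uni_orb[OF uni v(1) u] v(2) by simp
  from Inv_end[OF this order.refl] obtain w where w: "orb (Suc N) v w" "Inv N (Suc d) w" by (elim exE conjE)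
  have wm: "w \<in> Lat (Suc N)" "zl w N = 1" using w(2) unfolding Inv_def by auto
  have l: "snd (snd w) i \<in> L" if "i < Suc N" for i using LatD(3)[OF wm(1)] that by simp
  have lN: "snd (snd w) N = el_one d"
  proof -
    have "snd (snd (snd w) N) k i = snd (el_one d) k i" for k i
      using w(2) L_supp[OF l[of N], of k i] by (cases "k \<in> {1..d} \<and> i \<in> {1..d}") (auto simp: Inv_def el_one_def)
    then show ?thesis using wm(2) by (simp add: prod_eq_iff fun_eq_iff zl_def)
  qed
  \<comment> \<open>The last coordinate is now the identity, so its multiples remove every other
    component.\<close>
  define b where "b i = (if i < N then - snd (snd w) i else 0)" for i
  have b: "b i \<in> L" for i using l by (auto simp: b_def intro: L_neg)
  have r: "- fst w \<in> R2" "- fst (snd w) \<in> Y1" using LatD[OF wm(1)] by (auto intro: R2_neg Y1_neg)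
  have o: "orb (Suc N) w (fst w + vm d (- fst w) (snd (el_one d)), fst (snd w) + (- fst (snd w)) \<star> el_one d,
    \<lambda>i. snd (snd w) i + (if i < N then b i \<star> el_one d else 0))"
    using orb_by_last[where b = b, OF wm(1) r b] unfolding lN .
  have one: "a \<star> el_one d = a" if "a \<in> L" for a using elm_one_right[of d a] L_supp[OF that] by simp
  have vone: "vm d (- fst w) (snd (el_one d)) = - fst w"
    by (rule vm_one) (use LatD(1)[OF wm(1)] in \<open>auto simp: R2_def\<close>)
  have "(fst w + vm d (- fst w) (snd (el_one d)), fst (snd w) + (- fst (snd w)) \<star> el_one d,
    \<lambda>i. snd (snd w) i + (if i < N then b i \<star> el_one d else 0)) = (0, 0, \<lambda>i. if i = N then el_one d else 0)"
    unfolding vone one[OF b] one[OF Y1_L[OF r(2)]]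
    using LatD(4)[OF wm(1)] lN by (auto simp: fun_eq_iff b_def)
  then show ?thesis using orb_trans[OF v(1) orb_trans[OF w(1) o]] by simp
qed

lemma not_uni_0: "u \<in> Lat 0 \<Longrightarrow> \<not> uni 0 u"
proof
  assume u: "u \<in> Lat 0" "uni 0 u"
  from uni_z[OF u(2,1)] obtain a where "a * zs u = 1" by auto
  then have "a 1 * zs u 1 = 1" by (metis one_fun_apply times_fun_apply)
  then show False using zs_1[OF u(1)] by simp
qed

end

section \<open>Arithmetic of the cyclotomic integers\<close>

locale zeta_field =
  fixes p :: nat
  assumes prime: "prime p" and odd: "odd p"
begin

abbreviation z where "z \<equiv> zeta p"

lemma p_gt: "p > 2"
  using prime_ge_2_nat[OF prime] odd by (cases "p = 2") auto

lemma zeta_pow: "z ^ n = exp (2 * of_real pi * \<i> * of_nat n / of_nat p)"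
  unfolding zeta_def exp_of_nat_mult[symmetric] by (simp add: algebra_simps)

lemma zeta_eq_iff: "z ^ k = z ^ l \<longleftrightarrow> [k = l] (mod p)"
  unfolding zeta_pow using complex_root_unity_eq[of p k l] p_gt by (simp add: cong_def)

lemma root_zeta:
  assumes "w ^ p = 1" obtains k where "k < p" "w = z ^ k"
proof -
  have "w \<in> {w. w ^ p = 1}" using assms by simp
  also have "{w. w ^ p = 1} = {exp (2 * of_real pi * \<i> * of_nat j / of_nat p) | j. j < p}"
    by (rule complex_roots_unity) (use p_gt in simp)
  finally obtain j where "j < p" "w = exp (2 * of_real pi * \<i> * of_nat j / of_nat p)" by auto
  then show ?thesis using that[of j] by (simp only: zeta_pow)
qed

lemma zeta_eq_1_iff: "z ^ k = 1 \<longleftrightarrow> p dvd k"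
  using zeta_eq_iff[of k 0] by (simp add: cong_0_iff)

lemma zeta_pow_p [simp]: "z ^ p = 1"
  by (simp add: zeta_eq_1_iff)

lemma zeta_root [simp]: "(z ^ k) ^ p = 1"
  by (simp only: power_mult[symmetric] mult.commute[of k p]) (simp only: power_mult zeta_pow_p power_one)

lemma zeta_nz [simp]: "z \<noteq> 0"
  by (simp add: zeta_def)

lemma root_sum: "w ^ p = 1 \<Longrightarrow> w \<noteq> 1 \<Longrightarrow> (\<Sum>i<p. w ^ i) = (0 :: complex)"
  by (simp add: geometric_sum)

lemma zeta_sum: "(\<Sum>i<p. (z ^ k) ^ i) = (if p dvd k then of_nat p else 0)"
proof (cases "p dvd k")
  case True
  then have "z ^ k = 1" by (simp add: zeta_eq_1_iff)
  then show ?thesis using True by simp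
next
  case False
  then show ?thesis using root_sum[of "z ^ k"] by (simp add: zeta_eq_1_iff)
qed

lemma pow_swap: "((w::complex) ^ i) ^ k = (w ^ k) ^ i"
  by (simp only: power_mult[symmetric] mult.commute[of i k])

text \<open>The constant coefficient after reduction modulo X^p - 1.\<close>

definition c0 :: "int poly \<Rightarrow> int" where
  "c0 f = (\<Sum>k\<in>{k. k \<le> degree f \<and> p dvd k}. poly.coeff f k)"

text \<open>Orthogonality of the powers of \<open>z\<close>: summing over all p-th roots of unity
  keeps just the exponents divisible by \<open>p\<close>.\<close>

lemma conj_sum: "(\<Sum>i<p. zpoly f (z ^ i)) = of_int (int p * c0 f)"
proof -
  have "(\<Sum>i<p. zpoly f (z ^ i)) = (\<Sum>i<p. \<Sum>k<Suc (degree f). of_int (poly.coeff f k) * (z ^ i) ^ k)"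
    by (intro sum.cong HOL.refl zpoly_altdef) simp
  also have "\<dots> = (\<Sum>k<Suc (degree f). of_int (poly.coeff f k) * (\<Sum>i<p. (z ^ k) ^ i))"
    unfolding sum_distrib_left by (subst sum.swap) (simp only: pow_swap)
  also have "\<dots> = (\<Sum>k<Suc (degree f). if p dvd k then of_int (int p * poly.coeff f k) else 0)"
    unfolding zeta_sum by (intro sum.cong) auto
  also have "\<dots> = (\<Sum>k\<in>{k. k \<le> degree f \<and> p dvd k}. of_int (int p * poly.coeff f k))"
    by (intro sum.mono_neutral_cong_right) auto
  finally show ?thesis by (simp add: c0_def sum_distrib_left)
qed

lemma inverse_mod:
  assumes "\<not> p dvd i" shows "\<exists>j\<in>{1..p - 1}. [i * j = 1] (mod p)"
proof -
  have "coprime i p" using prime_imp_coprime[OF prime assms] by (simp add: coprime_commute)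
  then obtain x where "[i * x = Suc 0] (mod p)" using cong_solve_coprime_nat[of i p] by auto
  then have x: "[i * x = 1] (mod p)" by simp
  have "\<not> p dvd x"
  proof
    assume "p dvd x"
    then have "p dvd i * x" by simp
    then have "p dvd 1" using cong_dvd_iff[OF x] by (simp only:)
    then show False using p_gt by simp
  qed
  then have "x mod p \<noteq> 0" "x mod p < p" using p_gt by (auto simp: dvd_eq_mod_eq_0)
  then have "x mod p \<in> {1..p - 1}" by auto
  moreover have "[i * (x mod p) = 1] (mod p)" using x by (simp add: cong_def mod_mult_right_eq)
  ultimately show ?thesis by (intro bexI[of _ "x mod p"])
qed

text \<open>The product \<open>F\<close> of the f(X^j) vanishes at every p-th root of unity except
  1, because each such root has a power equal to \<open>z\<close>. The sum of \<open>F\<close> over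
  all p-th roots is therefore its value at 1, a power of f(1); but it is also a multiple of
  \<open>p\<close>.\<close>

lemma dvd_at_1:
  assumes "zpoly f z = 0" shows "int p dvd poly f 1"
proof -
  define F where "F = (\<Prod>j\<in>{1..p - 1}. pcompose f (Polynomial.monom 1 j))"
  have F0: "zpoly F (z ^ i) = 0" if i: "\<not> p dvd i" for i
  proof -
    obtain j where j: "j \<in> {1..p - 1}" "[i * j = 1] (mod p)" using inverse_mod[OF i] by auto
    then have "z ^ (i * j) = z ^ 1" by (simp only: zeta_eq_iff)
    then have "zpoly f ((z ^ i) ^ j) = 0" using assms by (simp add: power_mult)
    then have "\<exists>j\<in>{1..p - 1}. zpoly (pcompose f (Polynomial.monom 1 j)) (z ^ i) = 0"
      using j(1) by (intro bexI[of _ j]) (simp_all only: zpoly_pcompose_monom)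
    then show ?thesis unfolding F_def zpoly_prod by (intro prod_zero) simp_all
  qed
  have small: "\<not> p dvd i" if "i < p" "i \<noteq> 0" for i using that by (auto dest: dvd_imp_le)
  have "(\<Sum>i<p. zpoly F (z ^ i)) = (\<Sum>i\<in>{0}. zpoly F (z ^ i))"
  proof (rule sum.mono_neutral_right)
    show "\<forall>i\<in>{..<p} - {0}. zpoly F (z ^ i) = 0" using F0 small by simp
  qed (use p_gt in auto)
  then have "of_int (poly F 1) = (of_int (int p * c0 F) :: complex)"
    using conj_sum[of F] by (simp add: zpoly_1)
  then have "poly F 1 = int p * c0 F" by (simp only: of_int_eq_iff)
  moreover have "poly F 1 = poly f 1 ^ (p - 1)" by (simp add: F_def poly_prod poly_pcompose poly_monom)
  ultimately have "int p dvd poly f 1 ^ (p - 1)" by simp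
  then show ?thesis by (rule prime_dvd_power[rotated]) (use prime in simp)
qed

text \<open>The powers of \<open>w\<close> sum to 0, so the differences \<open>w ^ i - 1\<close> sum
  to - p, and each of them is divisible by \<open>w - 1\<close>. The quotient is the same polynomial
  for all \<open>w\<close>.\<close>

lemma p_factor: "\<exists>h. \<forall>w. w ^ p = 1 \<longrightarrow> w \<noteq> 1 \<longrightarrow> of_nat p = (w - 1) * zpoly h w"
proof -
  define h where "h = - (\<Sum>i<p. \<Sum>j<i. Polynomial.monom (1::int) j)"
  have "of_nat p = (w - 1) * zpoly h w" if "w ^ p = 1" "w \<noteq> 1" for w
  proof -
    have "(w - 1) * zpoly h w = - (\<Sum>i<p. (w - 1) * (\<Sum>j<i. w ^ j))"
      by (simp add: h_def sum_distrib_left)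
    also have "(\<Sum>i<p. (w - 1) * (\<Sum>j<i. w ^ j)) = (\<Sum>i<p. w ^ i - 1)"
      by (simp only: power_diff_1_eq)
    also have "\<dots> = - of_nat p" using root_sum[OF that] by (simp add: sum_subtractf)
    finally show ?thesis by simp
  qed
  then show ?thesis by (intro exI[of _ h] allI impI)
qed

text \<open>Expansion of ((w - 1) + 1)^p = 1. All binomial coefficients on the right are divisible
  by \<open>p\<close>, so \<open>(w - 1) ^ p\<close> is \<open>p\<close> times a value of an integer
  polynomial.\<close>

lemma pi_pow_p:
  assumes "w ^ p = (1::complex)"
  shows "(w - 1) ^ p = - (\<Sum>j = 1..p - 1. of_nat (p choose j) * (w - 1) ^ j)"
proof -
  have "1 = ((w - 1) + 1) ^ p" using assms by simp
  also have "\<dots> = (\<Sum>j\<le>p. of_nat (p choose j) * (w - 1) ^ j)" by (subst binomial_ring) simp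
  also have "{..p} = insert 0 (insert p {1..p - 1})" using p_gt by auto
  also have "(\<Sum>j\<in>insert 0 (insert p {1..p - 1}). of_nat (p choose j) * (w - 1) ^ j) =
      1 + ((w - 1) ^ p + (\<Sum>j = 1..p - 1. of_nat (p choose j) * (w - 1) ^ j))"
    using p_gt by (subst sum.insert) auto
  finally show ?thesis by (simp add: eq_neg_iff_add_eq_0)
qed

lemma p_dvd_choose: "j \<in> {1..p - 1} \<Longrightarrow> p dvd (p choose j)"
  using p_gt by (intro dvd_choose_prime[OF _ _ _ prime]) auto

text \<open>A factor \<open>w - 1\<close> can be split off: \<open>f\<close> minus f(1) is divisible
  by X - 1, and f(1) is a multiple of \<open>p\<close>, by \<open>dvd_at_1\<close>, hence of
  \<open>w - 1\<close>. After \<open>p\<close> such steps \<open>pi_pow_p\<close> turns the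
  collected factor into a multiple of \<open>p\<close>.\<close>

lemma descent:
  assumes "zpoly f z = 0"
  shows "\<exists>g. zpoly g z = 0 \<and> (\<forall>w. w ^ p = 1 \<longrightarrow> w \<noteq> 1 \<longrightarrow> zpoly f w = of_nat p * zpoly g w)"
proof -
  obtain h where h: "\<forall>w. w ^ p = 1 \<longrightarrow> w \<noteq> 1 \<longrightarrow> of_nat p = (w - 1) * zpoly h w" using p_factor by auto
  have z1: "z \<noteq> 1" using zeta_eq_1_iff[of 1] p_gt by simp
  have step: "\<exists>g. zpoly g z = 0 \<and> (\<forall>w. w ^ p = 1 \<longrightarrow> w \<noteq> 1 \<longrightarrow> zpoly f w = (w - 1) * zpoly g w)"
    if f: "zpoly f z = 0" for f
  proof -
    obtain c where c: "poly f 1 = int p * c" using dvd_at_1[OF f] by (elim dvdE)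
    have "poly (f - [:poly f 1:]) 1 = 0" by simp
    then obtain f1 where f1: "f - [:poly f 1:] = [:-1, 1:] * f1" by (metis dvdE poly_eq_0_iff_dvd)
    define g where "g = f1 + Polynomial.smult c h"
    have e: "zpoly f w = (w - 1) * zpoly g w" if w: "w ^ p = 1" "w \<noteq> 1" for w
    proof -
      have "zpoly (f - [:poly f 1:]) w = (w - 1) * zpoly f1 w" unfolding f1 zpoly_mult by simp
      then have "zpoly f w = (w - 1) * zpoly f1 w + of_int c * of_nat p" by (simp add: c algebra_simps)
      also have "of_nat p = (w - 1) * zpoly h w" using h w by blast
      finally show ?thesis by (simp add: g_def algebra_simps)
    qed
    have "zpoly g z = 0" using e[of z] f z1 by simp
    then show ?thesis using e by blast
  qed
  have iter: "\<exists>g. zpoly g z = 0 \<and> (\<forall>w. w ^ p = 1 \<longrightarrow> w \<noteq> 1 \<longrightarrow> zpoly f w = (w - 1) ^ n * zpoly g w)" for n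
  proof (induction n)
    case 0
    then show ?case using assms by auto
  next
    case (Suc n)
    then obtain g where g: "zpoly g z = 0" "\<forall>w. w ^ p = 1 \<longrightarrow> w \<noteq> 1 \<longrightarrow> zpoly f w = (w - 1) ^ n * zpoly g w" by auto
    obtain g' where g': "zpoly g' z = 0" "\<forall>w. w ^ p = 1 \<longrightarrow> w \<noteq> 1 \<longrightarrow> zpoly g w = (w - 1) * zpoly g' w"
      using step[OF g(1)] by auto
    show ?case using g g' by (intro exI[of _ g']) (auto simp: mult.assoc mult.left_commute)
  qed
  obtain g where g: "zpoly g z = 0" "\<forall>w. w ^ p = 1 \<longrightarrow> w \<noteq> 1 \<longrightarrow> zpoly f w = (w - 1) ^ p * zpoly g w"
    using iter[of p] by auto
  define W where "W = - (\<Sum>j = 1..p - 1. Polynomial.smult (int ((p choose j) div p)) ([:-1, 1:] ^ j))"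
  have W: "(w - 1) ^ p = of_nat p * zpoly W w" if "w ^ p = 1" for w
  proof -
    have "of_nat (p choose j) * (w - 1) ^ j = of_nat p * (of_nat ((p choose j) div p) * (w - 1) ^ j)"
      if "j \<in> {1..p - 1}" for j
    proof -
      have "(p choose j) = p * ((p choose j) div p)" using p_dvd_choose[OF that] by simp
      then have "(of_nat (p choose j) :: complex) = of_nat p * of_nat ((p choose j) div p)" by (metis of_nat_mult)
      then show ?thesis by simp
    qed
    then have "(\<Sum>j = 1..p - 1. of_nat (p choose j) * (w - 1) ^ j) =
        of_nat p * (\<Sum>j = 1..p - 1. of_nat ((p choose j) div p) * (w - 1) ^ j)"
      unfolding sum_distrib_left by (intro sum.cong) auto
    then show ?thesis unfolding pi_pow_p[OF that] by (simp add: W_def algebra_simps)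
  qed
  have "zpoly f w = of_nat p * zpoly (W * g) w" if "w ^ p = 1" "w \<noteq> 1" for w
    using g(2) W[OF that(1)] that by simp
  then show ?thesis using g(1) by (intro exI[of _ "W * g"]) simp
qed

text \<open>A relation at \<open>\<zeta>\<close> can be divided by \<open>w - 1\<close> over and over, so its value at a conjugate \<open>w\<close> is
  divisible by every power of \<open>p\<close>.\<close>

lemma zero_at_conjugates:
  assumes f: "zpoly f z = 0" and w: "w ^ p = 1" "w \<noteq> 1"
  shows "zpoly f w = 0"
proof -
  have iter: "\<exists>g. zpoly g z = 0 \<and> (\<forall>w. w ^ p = 1 \<longrightarrow> w \<noteq> 1 \<longrightarrow> zpoly f w = of_nat p ^ n * zpoly g w)" for n
  proof (induction n)
    case 0
    then show ?case using f by auto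
  next
    case (Suc n)
    then obtain g where g: "zpoly g z = 0" "\<forall>w. w ^ p = 1 \<longrightarrow> w \<noteq> 1 \<longrightarrow> zpoly f w = of_nat p ^ n * zpoly g w" by auto
    obtain g' where g': "zpoly g' z = 0" "\<forall>w. w ^ p = 1 \<longrightarrow> w \<noteq> 1 \<longrightarrow> zpoly g w = of_nat p * zpoly g' w"
      using descent[OF g(1)] by auto
    show ?case using g g' by (intro exI[of _ g']) (auto simp: mult.assoc mult.left_commute)
  qed
  \<comment> \<open>The second factor vanishes at \<open>k = 0\<close>, so the sum over the
    nontrivial roots is a difference of two full sums, which \<open>conj_sum\<close> evaluates to
    integers divisible by \<open>p\<close>.\<close>
  have D: "(\<Sum>k\<in>{1..<p}. zpoly g (z ^ k) * ((z ^ e) ^ k - 1)) = of_int (int p * (c0 (g * Polynomial.monom 1 e) - c0 g))" for g e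
  proof -
    have sp: "(\<Sum>k<p. F k) = F 0 + (\<Sum>k\<in>{1..<p}. F k)" for F :: "nat \<Rightarrow> complex"
    proof -
      have "{..<p} = insert 0 {1..<p}" using p_gt by auto
      then show ?thesis by simp
    qed
    have e: "zpoly g (z ^ k) * ((z ^ e) ^ k - 1) = zpoly (g * Polynomial.monom 1 e) (z ^ k) - zpoly g (z ^ k)" for k
      by (simp add: pow_swap[of z e k] right_diff_distrib)
    have "(\<Sum>k\<in>{1..<p}. zpoly g (z ^ k) * ((z ^ e) ^ k - 1)) =
        (\<Sum>k<p. zpoly (g * Polynomial.monom 1 e) (z ^ k)) - (\<Sum>k<p. zpoly g (z ^ k))"
      unfolding sp e by (simp add: sum_subtractf)
    then show ?thesis unfolding conj_sum by (simp add: algebra_simps)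
  qed
  have zero: "c0 (f * Polynomial.monom 1 e) - c0 f = 0" for e
  proof (rule ccontr)
    define x where "x = c0 (f * Polynomial.monom 1 e) - c0 f"
    assume "c0 (f * Polynomial.monom 1 e) - c0 f \<noteq> 0"
    then have x: "x \<noteq> 0" by (simp add: x_def)
    have dv: "int p ^ n dvd x" for n
    proof -
      obtain g where g: "\<forall>w. w ^ p = 1 \<longrightarrow> w \<noteq> 1 \<longrightarrow> zpoly f w = of_nat p ^ n * zpoly g w" using iter[of n] by auto
      have "zpoly f (z ^ k) = of_nat p ^ n * zpoly g (z ^ k)" if "k \<in> {1..<p}" for k
      proof -
        have "z ^ k \<noteq> 1" using that by (auto simp: zeta_eq_1_iff dest: nat_dvd_not_less)
        moreover have "(z ^ k) ^ p = 1" by simp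
        ultimately show ?thesis using g by blast
      qed
      then have "(\<Sum>k\<in>{1..<p}. zpoly f (z ^ k) * ((z ^ e) ^ k - 1)) =
         of_nat p ^ n * (\<Sum>k\<in>{1..<p}. zpoly g (z ^ k) * ((z ^ e) ^ k - 1))"
        unfolding sum_distrib_left by (intro sum.cong) auto
      then have "(of_int (int p * x) :: complex) = of_int (int p ^ n * (int p * (c0 (g * Polynomial.monom 1 e) - c0 g)))"
        unfolding D x_def by simp
      then have "int p * x = int p ^ n * (int p * (c0 (g * Polynomial.monom 1 e) - c0 g))" by (simp only: of_int_eq_iff)
      then have "x = int p ^ n * (c0 (g * Polynomial.monom 1 e) - c0 g)" using p_gt by simp
      then show ?thesis by simp
    qed
    \<comment> \<open>A nonzero integer is not divisible by all powers of \<open>p\<close>; its own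
      absolute value is already too large an exponent.\<close>
    have "int p ^ nat \<bar>x\<bar> \<le> \<bar>x\<bar>" using dvd_imp_le_int[OF x dv] by simp
    moreover have "nat \<bar>x\<bar> < p ^ nat \<bar>x\<bar>" using p_gt by (intro power_gt_expt) simp
    then have "int (nat \<bar>x\<bar>) < int (p ^ nat \<bar>x\<bar>)" by (simp only: of_nat_less_iff)
    ultimately show False by simp
  qed
  have Z: "(\<Sum>k\<in>{1..<p}. zpoly f (z ^ k) * ((z ^ e) ^ k - 1)) = 0" for e using D[of f e] zero[of e] by simp
  obtain k0 where k0: "k0 < p" "w = z ^ k0" using root_zeta[OF w(1)] by auto
  have k01: "k0 \<noteq> 0" using k0 w by (metis power_0)
  have shift: "z ^ (e * m) * (F * ((z ^ e) ^ k - 1)) = F * ((z ^ (k + m)) ^ e - (z ^ m) ^ e)" for F e k m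
  proof -
    have "(z ^ (k + m)) ^ e = (z ^ e) ^ k * z ^ (e * m)"
      by (simp only: power_mult[symmetric] power_add[symmetric] add_mult_distrib mult.commute[of e])
    moreover have "(z ^ m) ^ e = z ^ (e * m)" by (simp only: power_mult[symmetric] mult.commute[of e])
    ultimately show ?thesis by (simp only: right_diff_distrib mult_1_right) (simp only: ac_simps)
  qed
  \<comment> \<open>Fourier inversion: multiplying by powers of \<open>z ^ (p - k0)\<close> and
    summing over \<open>e\<close> leaves only the term of \<open>k0\<close>.\<close>
  have "0 = (\<Sum>e<p. z ^ (e * (p - k0)) * (\<Sum>k\<in>{1..<p}. zpoly f (z ^ k) * ((z ^ e) ^ k - 1)))" by (simp only: Z mult_zero_right sum.neutral_const)
  also have "\<dots> = (\<Sum>k\<in>{1..<p}. \<Sum>e<p. zpoly f (z ^ k) * ((z ^ (k + (p - k0))) ^ e - (z ^ (p - k0)) ^ e))"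
    unfolding sum_distrib_left shift by (rule sum.swap)
  also have "\<dots> = (\<Sum>k\<in>{1..<p}. zpoly f (z ^ k) * (if k = k0 then of_nat p else 0))"
  proof (intro sum.cong HOL.refl)
    fix k assume k: "k \<in> {1..<p}"
    have "\<not> p dvd p - k0" using k01 k0 by (auto dest!: dvd_imp_le)
    moreover have "p dvd k + (p - k0) \<longleftrightarrow> k = k0"
    proof
      assume "p dvd k + (p - k0)"
      then obtain q where q: "k + (p - k0) = p * q" by (elim dvdE)
      have "k + (p - k0) < p * 2" "0 < k + (p - k0)" using k k0(1) k01 by auto
      then have "p * q < p * 2" "0 < p * q" unfolding q .
      then have "q < 2" "0 < q" by simp_all
      then have "q = 1" by simp
      then show "k = k0" using q k0 by simp
    qed (use k0 in simp)
    ultimately show "(\<Sum>e<p. zpoly f (z ^ k) * ((z ^ (k + (p - k0))) ^ e - (z ^ (p - k0)) ^ e)) =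
        zpoly f (z ^ k) * (if k = k0 then of_nat p else 0)"
      by (simp only: sum_distrib_left[symmetric] sum_subtractf zeta_sum) simp
  qed
  also have "\<dots> = zpoly f (z ^ k0) * of_nat p"
    using k01 k0 by (subst sum.remove[of _ k0]) auto
  finally show ?thesis using p_gt k0(2) by simp
qed

end

section \<open>The ideal of zeta - 1: its basis of powers of \<open>pr\<close> and coordinates
  modulo p\<close>

context zeta_field
begin

definition d where "d = p - 1"

lemma d_ge: "d \<ge> 2" "Suc d = p" "d < p" "{1..p - 1} = {1..d}"
  using p_gt by (auto simp: d_def)

text \<open>Fourier inversion on the p-th roots of unity recovers each coefficient up to the factor
  \<open>p\<close>.\<close>

lemma coeffs_zero:
  assumes "\<And>w. w ^ p = 1 \<Longrightarrow> (\<Sum>i<p. of_int (a i) * w ^ i) = (0 :: complex)" "i < p"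
  shows "a i = (0 :: int)"
proof -
  have "0 = (\<Sum>k<p. (z ^ (p - i)) ^ k * (\<Sum>j<p. of_int (a j) * (z ^ k) ^ j))"
    using assms(1)[OF zeta_root] by simp
  also have "\<dots> = (\<Sum>j<p. of_int (a j) * (\<Sum>k<p. (z ^ (j + (p - i))) ^ k))"
    unfolding sum_distrib_left
    by (subst sum.swap) (intro sum.cong HOL.refl, simp only: pow_swap[of z] power_add power_mult_distrib ac_simps)
  also have "\<dots> = (\<Sum>j<p. of_int (a j) * (if j = i then of_nat p else 0))"
  proof (intro sum.cong HOL.refl)
    fix j assume "j \<in> {..<p}"
    then have "p dvd j + (p - i) \<longleftrightarrow> j = i"
    proof -
      have "j = i" if h: "p dvd j + (p - i)"
      proof -
        obtain q where q: "j + (p - i) = p * q" using h by (elim dvdE)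
        have "j + (p - i) < p * 2" "0 < j + (p - i)" using \<open>j \<in> {..<p}\<close> assms(2) by auto
        then have "p * q < p * 2" "0 < p * q" unfolding q .
        then have "q < 2" "0 < q" by simp_all
        then have "q = 1" by simp
        then show ?thesis using q assms(2) by simp
      qed
      then show ?thesis using assms(2) by auto
    qed
    then show "of_int (a j) * (\<Sum>k<p. (z ^ (j + (p - i))) ^ k) = of_int (a j) * (if j = i then of_nat p else 0)"
      by (simp only: zeta_sum)
  qed
  also have "\<dots> = of_int (a i) * of_nat p" using assms(2) by (subst sum.remove[of _ i]) auto
  finally show ?thesis using p_gt by simp
qed

definition ZO where "ZO = range (\<lambda>f. zpoly f z)"

text \<open>The ideal generated by zeta - 1, described through polynomials: f(1) = 0 means
  divisibility by X - 1.\<close>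

definition P where "P = {zpoly f z | f. poly f 1 = 0}"

definition pr where "pr = z - 1"

lemma O_I [simp]: "zpoly f z \<in> ZO" by (simp add: ZO_def)

lemma O_add: "v \<in> ZO \<Longrightarrow> w \<in> ZO \<Longrightarrow> v + w \<in> ZO"
  by (auto simp: ZO_def simp flip: zpoly_add)

lemma O_mult: "v \<in> ZO \<Longrightarrow> w \<in> ZO \<Longrightarrow> v * w \<in> ZO"
  by (auto simp: ZO_def simp flip: zpoly_mult)

lemma O_int: "of_int k \<in> ZO"
  using O_I[of "[:k:]"] by (simp del: O_I)

lemma O_1: "1 \<in> ZO"
  using O_int[of 1] by simp

lemma O_zeta: "z \<in> ZO"
  using O_I[of "[:0, 1:]"] by (simp del: O_I)

lemma O_pr: "pr \<in> ZO"
  using O_I[of "[:-1, 1:]"] by (simp add: pr_def del: O_I)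

lemma O_power: "v \<in> ZO \<Longrightarrow> v ^ n \<in> ZO"
  by (induction n) (auto intro: O_1 O_mult)

lemma O_sum: "(\<And>i. i \<in> A \<Longrightarrow> f i \<in> ZO) \<Longrightarrow> sum f A \<in> ZO"
  by (induction A rule: infinite_finite_induct) (auto intro: O_add simp: O_int[of 0, simplified])

lemma P_I: "poly f 1 = 0 \<Longrightarrow> zpoly f z \<in> P" by (auto simp: P_def)

lemma P_O: "v \<in> P \<Longrightarrow> v \<in> ZO" by (auto simp: P_def)

lemma P_add: "v \<in> P \<Longrightarrow> w \<in> P \<Longrightarrow> v + w \<in> P"
  unfolding P_def
proof (elim CollectE exE conjE)
  fix f g assume "v = zpoly f z" "w = zpoly g z" "poly f 1 = 0" "poly g 1 = 0"
  then show "v + w \<in> {zpoly f z |f. poly f 1 = 0}"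
    by (intro CollectI exI[of _ "f + g"]) simp
qed

lemma P_mult: "v \<in> P \<Longrightarrow> w \<in> ZO \<Longrightarrow> v * w \<in> P"
  unfolding P_def ZO_def
proof (elim CollectE imageE exE conjE)
  fix f g assume "v = zpoly f z" "w = zpoly g z" "poly f 1 = 0"
  then show "v * w \<in> {zpoly f z |f. poly f 1 = 0}"
    by (intro CollectI exI[of _ "f * g"]) simp
qed

lemma P_0: "0 \<in> P" using P_I[of 0] by simp

lemma P_sum: "(\<And>i. i \<in> A \<Longrightarrow> f i \<in> P) \<Longrightarrow> sum f A \<in> P"
  by (induction A rule: infinite_finite_induct) (auto intro: P_add P_0)

lemma P_int: "v \<in> P \<Longrightarrow> of_int k * v \<in> P"
  using P_mult[OF _ O_int] by (simp add: mult.commute)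

lemma P_pr: "pr \<in> P"
  using P_I[of "[:-1, 1:]"] by (simp add: pr_def)

lemma P_pr_pow: "k \<ge> 1 \<Longrightarrow> pr ^ k \<in> P"
  using P_mult[OF P_pr O_power[OF O_pr, of "k - 1"]] by (cases k) auto

lemma P_factor: "v \<in> P \<Longrightarrow> \<exists>w\<in>ZO. v = pr * w"
proof -
  assume "v \<in> P"
  then obtain f where f: "v = zpoly f z" "poly f 1 = 0" by (auto simp: P_def)
  then obtain g where g: "f = [:-1, 1:] * g" by (metis dvdE poly_eq_0_iff_dvd)
  have "v = pr * zpoly g z" unfolding f(1) g zpoly_mult pr_def by simp
  then show ?thesis by (intro bexI[of _ "zpoly g z"]) simp_all
qed

definition lc :: "(nat \<Rightarrow> int) \<Rightarrow> complex" where
  "lc c = (\<Sum>j = 1..d. of_int (c j) * pr ^ j)"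

lemma lc_add: "lc c + lc e = lc (\<lambda>j. c j + e j)"
  by (simp add: lc_def sum.distrib[symmetric] distrib_right)

lemma lc_scale: "of_int k * lc c = lc (\<lambda>j. k * c j)"
  by (simp add: lc_def sum_distrib_left mult.assoc)

lemma lc_P: "lc c \<in> P"
  unfolding lc_def by (intro P_sum P_int P_pr_pow) simp

text \<open>Companion form of multiplication by \<open>pr\<close>: indices move up by one, and
  \<open>pr ^ p\<close> folds back by \<open>pi_pow_p\<close>.\<close>

definition shift :: "(nat \<Rightarrow> int) \<Rightarrow> nat \<Rightarrow> int" where
  "shift c j = (if 2 \<le> j \<and> j \<le> d then c (j - 1) else 0) - (if 1 \<le> j \<and> j \<le> d then c d * int (p choose j) else 0)"

lemma pr_lc: "pr * lc c = lc (shift c)"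
proof -
  have "pr * lc c = (\<Sum>j = 1..d. of_int (c j) * pr ^ Suc j)"
    by (simp add: lc_def sum_distrib_left mult.left_commute)
  also have "\<dots> = (\<Sum>j = 2..Suc d. of_int (c (j - 1)) * pr ^ j)"
    by (rule sum.reindex_bij_witness[of _ "\<lambda>j. j - 1" Suc]) auto
  also have "{2..Suc d} = insert p {2..d}" using d_ge by auto
  also have "(\<Sum>j\<in>insert p {2..d}. of_int (c (j - 1)) * pr ^ j) = of_int (c d) * pr ^ p + (\<Sum>j = 2..d. of_int (c (j - 1)) * pr ^ j)"
    using d_ge by (subst sum.insert) (auto simp: d_def)
  also have "pr ^ p = - (\<Sum>j = 1..d. of_nat (p choose j) * pr ^ j)"
    using pi_pow_p[OF zeta_pow_p] by (simp add: pr_def d_def)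
  also have "of_int (c d) * (- (\<Sum>j = 1..d. of_nat (p choose j) * pr ^ j)) =
      - (\<Sum>j = 1..d. of_int (c d * int (p choose j)) * pr ^ j)"
    by (simp add: sum_distrib_left mult.assoc)
  also have "(\<Sum>j = 2..d. of_int (c (j - 1)) * pr ^ j) = (\<Sum>j = 1..d. of_int (if 2 \<le> j \<and> j \<le> d then c (j - 1) else 0) * pr ^ j)"
    by (rule sum.mono_neutral_cong_left) auto
  also have "- (\<Sum>j = 1..d. of_int (c d * int (p choose j)) * pr ^ j) + \<dots> = lc (shift c)"
    unfolding lc_def shift_def by (simp add: sum_subtractf[symmetric] algebra_simps sum_negf[symmetric] sum.distrib[symmetric])
  finally show ?thesis .
qed

lemma P_span: assumes "v \<in> P" shows "\<exists>c. v = lc c"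
proof -
  have "\<exists>c. pr * zpoly g z = lc c" for g
  proof (induction g)
    case 0
    have "lc (\<lambda>_. 0) = 0" by (simp add: lc_def)
    then show ?case by (intro exI[of _ "\<lambda>_. 0"]) simp
  next
    case (pCons a g)
    then obtain c where c: "pr * zpoly g z = lc c" by auto
    have 1: "of_int a * pr = lc (\<lambda>j. if j = 1 then a else 0)"
    proof -
      have "lc (\<lambda>j. if j = 1 then a else 0) = (\<Sum>j = 1..d. if j = 1 then of_int a * pr else 0)"
        unfolding lc_def by (intro sum.cong) auto
      then show ?thesis using d_ge by simp
    qed
    have "pr * zpoly (pCons a g) z = of_int a * pr + (pr * (pr * zpoly g z) + pr * zpoly g z)"
      by (simp add: zpoly_pCons pr_def algebra_simps)
    also have "\<dots> = lc (\<lambda>j. (if j = 1 then a else 0) + (shift c j + c j))"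
      unfolding c pr_lc 1 lc_add ..
    finally show ?case by blast
  qed
  then show ?thesis using P_factor[OF assms] by (auto simp: ZO_def)
qed

lemma root_cases: "w ^ p = 1 \<Longrightarrow> zpoly f z = 0 \<Longrightarrow> poly f 1 = 0 \<Longrightarrow> zpoly f w = 0"
  using zero_at_conjugates[of f w] zpoly_1[of f] by (cases "w = 1") auto

text \<open>By \<open>root_cases\<close> the relation holds with \<open>w - 1\<close> in place of
  \<open>pr\<close> for all p-th roots \<open>w\<close>, so a polynomial of degree at most
  \<open>d\<close> has \<open>p\<close> zeros.\<close>

lemma lc_zero: assumes "lc c = 0" "j \<in> {1..d}" shows "c j = 0"
proof -
  define f where "f = (\<Sum>j = 1..d. Polynomial.smult (c j) ([:-1, 1:] ^ j))"
  have f: "zpoly f w = (\<Sum>j = 1..d. of_int (c j) * (w - 1) ^ j)" for w by (simp add: f_def)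
  have "zpoly f z = 0" using assms(1) by (simp add: f lc_def pr_def)
  moreover have "poly f 1 = 0" by (auto simp: f_def poly_sum zero_power intro!: sum.neutral)
  ultimately have f0: "zpoly f w = 0" if "w ^ p = 1" for w using root_cases that by blast
  define g where "g = (\<Sum>j = 1..d. Polynomial.monom (of_int (c j) :: complex) j)"
  have g: "poly g x = (\<Sum>j = 1..d. of_int (c j) * x ^ j)" for x by (simp add: g_def poly_sum poly_monom)
  have "g = 0"
  proof (rule ccontr)
    assume g0: "g \<noteq> 0"
    have "(\<lambda>k. z ^ k - 1) ` {..<p} \<subseteq> {x. poly g x = 0}"
      using f0[OF zeta_root] by (auto simp: g f)
    moreover have "inj_on (\<lambda>k. z ^ k - 1) {..<p}" by (auto simp: inj_on_def zeta_eq_iff cong_def)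
    ultimately have "p \<le> card {x. poly g x = 0}"
      using card_mono[OF poly_roots_finite[OF g0]] by (metis card_image card_lessThan)
    also have "\<dots> \<le> degree g" by (rule card_poly_roots_bound[OF g0])
    also have "degree g \<le> d" unfolding g_def
      by (rule degree_sum_le) (auto intro: order.trans[OF degree_monom_le])
    finally show False using d_ge by simp
  qed
  then have "poly.coeff g j = 0" by simp
  moreover have "poly.coeff g j = of_int (c j)"
  proof -
    have "poly.coeff g j = (\<Sum>k = 1..d. if k = j then of_int (c k) else 0)"
      unfolding g_def coeff_sum by (intro sum.cong) auto
    then show ?thesis using assms(2) by simp
  qed
  ultimately show ?thesis by simp
qed

lemma coords_lc: assumes "\<And>j. j \<notin> {1..d} \<Longrightarrow> c j = 0" shows "cyc_coords p (lc c) = c"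
  unfolding cyc_coords_def
proof (rule the_equality)
  show "(\<forall>j. j \<notin> {1..p - 1} \<longrightarrow> c j = 0) \<and> lc c = (\<Sum>j = 1..p - 1. of_int (c j) * (z - 1) ^ j)"
    using assms by (simp add: lc_def pr_def d_def)
  fix e assume e: "(\<forall>j. j \<notin> {1..p - 1} \<longrightarrow> e j = 0) \<and> lc c = (\<Sum>j = 1..p - 1. of_int (e j) * (z - 1) ^ j)"
  then have "lc c = lc e" by (simp add: lc_def pr_def d_def)
  moreover have "lc (\<lambda>j. c j + (-1) * e j) = lc c + of_int (-1) * lc e" by (simp only: lc_add lc_scale)
  ultimately have "lc (\<lambda>j. c j + (-1) * e j) = 0" by simp
  then have "c j + (-1) * e j = 0" if "j \<in> {1..d}" for j using lc_zero[OF _ that] by blast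
  then have "e j = c j" for j using assms[of j] e by (cases "j \<in> {1..d}") (auto simp: d_def)
  then show "e = c" by blast
qed

abbreviation co where "co \<equiv> cyc_coords p"

lemma coords:
  assumes "v \<in> P" shows "v = lc (co v)" "j \<notin> {1..d} \<Longrightarrow> co v j = 0"
proof -
  obtain c where c: "v = lc c" using P_span[OF assms] by auto
  define e where "e j = (if j \<in> {1..d} then c j else 0)" for j
  have v: "v = lc e" unfolding c lc_def by (intro sum.cong) (auto simp: e_def)
  have "co v = e" unfolding v by (rule coords_lc) (auto simp: e_def)
  then show "v = lc (co v)" "j \<notin> {1..d} \<Longrightarrow> co v j = 0" using v by (auto simp: e_def)
qed

lemma coords_add: "v \<in> P \<Longrightarrow> w \<in> P \<Longrightarrow> co (v + w) = (\<lambda>j. co v j + co w j)"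
  using coords_lc[of "\<lambda>j. co v j + co w j"] coords[of v] coords[of w] lc_add[of "co v" "co w"] by simp

lemma coords_scale: "v \<in> P \<Longrightarrow> co (of_int k * v) = (\<lambda>j. k * co v j)"
  using coords_lc[of "\<lambda>j. k * co v j"] coords[of v] lc_scale[of k "co v"] by simp

lemma coords_sum: "(\<And>i. i \<in> A \<Longrightarrow> f i \<in> P) \<Longrightarrow> co (sum f A) j = (\<Sum>i\<in>A. co (f i) j)"
proof (induction A rule: infinite_finite_induct)
  case (insert x F)
  then show ?case by (simp add: coords_add P_sum)
qed (use coords_scale[OF P_0, of 0] in simp_all)

lemma coords_pr_pow: "k \<in> {1..d} \<Longrightarrow> co (pr ^ k) = (\<lambda>j. if j = k then 1 else 0)"
proof -
  assume k: "k \<in> {1..d}"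
  have "lc (\<lambda>j. if j = k then 1 else 0) = (\<Sum>j = 1..d. if j = k then pr ^ k else 0)"
    unfolding lc_def by (intro sum.cong) auto
  then have "pr ^ k = lc (\<lambda>j. if j = k then 1 else 0)" using k by simp
  moreover have "co (lc (\<lambda>j. if j = k then 1 else 0)) = (\<lambda>j. if j = k then 1 else 0)"
    by (rule coords_lc) (use k in auto)
  ultimately show ?thesis by (simp only:)
qed

text \<open>The binomial coefficients that fold back are divisible by \<open>p\<close>, so modulo
  \<open>p\<close> multiplication by \<open>pr\<close> only shifts coordinates.\<close>

lemma coords_shift:
  assumes "v \<in> P" "j \<in> {1..d}"
  shows "int p dvd co (pr * v) j - (if j \<ge> 2 then co v (j - 1) else 0)"
proof -
  have "pr * v = lc (shift (co v))" using coords(1)[OF assms(1)] pr_lc by metis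
  moreover have "co (lc (shift (co v))) = shift (co v)" by (rule coords_lc) (auto simp: shift_def)
  ultimately have "co (pr * v) = shift (co v)" by (simp only:)
  moreover have "int p dvd co v d * int (p choose j)"
    using p_dvd_choose[of j] assms(2) by (simp add: d_def)
  ultimately show ?thesis using assms(2) by (simp add: shift_def)
qed

lemma coords_shift_pow:
  assumes "v \<in> P" "j \<in> {1..d}"
  shows "int p dvd co (pr ^ l * v) j - (if j > l then co v (j - l) else 0)"
  using assms(2)
proof (induction l arbitrary: j)
  case 0
  then show ?case by simp
next
  case (Suc l)
  have w: "pr ^ l * v \<in> P" using P_mult[OF assms(1) O_power[OF O_pr, of l]] by (simp add: mult.commute)
  have 1: "int p dvd co (pr ^ Suc l * v) j - (if j \<ge> 2 then co (pr ^ l * v) (j - 1) else 0)"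
    using coords_shift[OF w Suc.prems] by (simp add: mult.assoc)
  have "int p dvd (if j \<ge> 2 then co (pr ^ l * v) (j - 1) else 0) - (if j > Suc l then co v (j - Suc l) else 0)"
  proof (cases "j \<ge> 2")
    case True
    then have "j - 1 \<in> {1..d}" "l < j - 1 \<longleftrightarrow> Suc l < j" using Suc.prems by auto
    moreover have "(j - 1) - l = j - Suc l" by simp
    ultimately show ?thesis using Suc.IH[of "j - 1"] True by (simp only: if_True)
  qed (use Suc.prems in auto)
  from dvd_add[OF 1 this] show ?case by simp
qed

text \<open>Each factor \<open>pr\<close> shifts by one place modulo \<open>p\<close>, which leaves
  zeros behind. This is where the triangular shape of the matrices comes from.\<close>

lemma coords_dvd: "w \<in> ZO \<Longrightarrow> j \<in> {1..d} \<Longrightarrow> j \<le> l \<Longrightarrow> int p dvd co (pr ^ Suc l * w) j"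
  using coords_shift_pow[OF P_mult[OF P_pr], of w j l] by (simp add: ac_simps)

end

section \<open>Galois automorphisms of the cyclotomic integers\<close>

context zeta_field
begin

text \<open>The Galois automorphism sending \<open>z\<close> to \<open>z ^ k\<close>. The choice of
  the polynomial is immaterial, by \<open>zero_at_conjugates\<close>, when \<open>p\<close> does not
  divide \<open>k\<close>.\<close>

definition tau :: "nat \<Rightarrow> complex \<Rightarrow> complex" where
  "tau k v = zpoly (SOME f. v = zpoly f z) (z ^ k)"

lemma tau_zpoly: assumes "\<not> p dvd k" shows "tau k (zpoly f z) = zpoly f (z ^ k)"
proof -
  define g where "g = (SOME g. zpoly f z = zpoly g z)"
  have "zpoly f z = zpoly g z"
    unfolding g_def by (rule someI[of "\<lambda>g. zpoly f z = zpoly g z" f]) (rule HOL.refl)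
  then have "zpoly (f - g) z = 0" by (simp only: zpoly_diff diff_self)
  moreover have "z ^ k \<noteq> 1" using assms by (simp add: zeta_eq_1_iff)
  ultimately have "zpoly (f - g) (z ^ k) = 0" by (intro zero_at_conjugates[OF _ zeta_root])
  then have "zpoly f (z ^ k) = zpoly g (z ^ k)" by (simp only: zpoly_diff right_minus_eq)
  then show ?thesis unfolding tau_def g_def by (rule HOL.sym)
qed

lemma ZO_E: assumes "v \<in> ZO" obtains f where "v = zpoly f z"
  using assms by (auto simp: ZO_def)

lemma tau_add: assumes k: "\<not> p dvd k" and "v \<in> ZO" "w \<in> ZO" shows "tau k (v + w) = tau k v + tau k w"
proof -
  obtain f g where "v = zpoly f z" "w = zpoly g z" using assms(2,3) by (auto elim!: ZO_E)
  then show ?thesis using tau_zpoly[OF k, of "f + g"] by (simp add: tau_zpoly[OF k])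
qed

lemma tau_mult: assumes k: "\<not> p dvd k" and "v \<in> ZO" "w \<in> ZO" shows "tau k (v * w) = tau k v * tau k w"
proof -
  obtain f g where "v = zpoly f z" "w = zpoly g z" using assms(2,3) by (auto elim!: ZO_E)
  then show ?thesis using tau_zpoly[OF k, of "f * g"] by (simp add: tau_zpoly[OF k])
qed

lemma tau_int: "\<not> p dvd k \<Longrightarrow> tau k (of_int n) = of_int n"
  using tau_zpoly[of k "[:n:]"] by simp

lemma tau_0: "\<not> p dvd k \<Longrightarrow> tau k 0 = 0"
  using tau_int[of k 0] by simp

lemma tau_power: "\<not> p dvd k \<Longrightarrow> v \<in> ZO \<Longrightarrow> tau k (v ^ n) = tau k v ^ n"
  using tau_int[of k 1] by (induction n) (simp_all add: tau_mult O_power)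

lemma tau_sum: "\<not> p dvd k \<Longrightarrow> (\<And>i. i \<in> A \<Longrightarrow> f i \<in> ZO) \<Longrightarrow> tau k (sum f A) = (\<Sum>i\<in>A. tau k (f i))"
  by (induction A rule: infinite_finite_induct) (simp_all add: tau_0 tau_add O_sum)

lemma tau_zeta: "\<not> p dvd k \<Longrightarrow> tau k z = z ^ k"
  using tau_zpoly[of k "[:0, 1:]"] by simp

lemma tau_pr: "\<not> p dvd k \<Longrightarrow> tau k pr = z ^ k - 1"
  using tau_zpoly[of k "[:-1, 1:]"] by (simp add: pr_def)

lemma zpoly_zeta_pow: "zpoly f (z ^ k) = zpoly (pcompose f (Polynomial.monom 1 k)) z"
  by (simp add: zpoly_pcompose_monom)

lemma tau_ZO: "\<not> p dvd k \<Longrightarrow> v \<in> ZO \<Longrightarrow> tau k v \<in> ZO"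
  by (elim ZO_E) (simp add: tau_zpoly zpoly_zeta_pow)

lemma tau_P: assumes "\<not> p dvd k" "v \<in> P" shows "tau k v \<in> P"
proof -
  obtain f where f: "v = zpoly f z" "poly f 1 = 0" using assms(2) by (auto simp: P_def)
  then have "tau k v = zpoly (pcompose f (Polynomial.monom 1 k)) z"
    using assms(1) by (simp add: tau_zpoly zpoly_zeta_pow)
  moreover have "poly (pcompose f (Polynomial.monom 1 k)) 1 = 0" using f(2) by (simp add: poly_pcompose poly_monom)
  ultimately show ?thesis using P_I by simp
qed

lemma not_dvd_mult: "\<not> p dvd k \<Longrightarrow> \<not> p dvd l \<Longrightarrow> \<not> p dvd k * l"
  using prime by (simp add: prime_dvd_mult_iff)

lemma tau_tau: assumes "\<not> p dvd k" "\<not> p dvd l" "v \<in> ZO" shows "tau k (tau l v) = tau (l * k) v"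
proof -
  obtain f where f: "v = zpoly f z" using assms(3) by (rule ZO_E)
  have "tau k (tau l v) = tau k (zpoly (pcompose f (Polynomial.monom 1 l)) z)"
    unfolding f by (simp only: tau_zpoly[OF assms(2)] zpoly_zeta_pow)
  also have "\<dots> = zpoly (pcompose f (Polynomial.monom 1 l)) (z ^ k)" by (rule tau_zpoly[OF assms(1)])
  also have "\<dots> = zpoly f ((z ^ k) ^ l)" by (rule zpoly_pcompose_monom)
  also have "(z ^ k) ^ l = z ^ (l * k)" by (simp only: power_mult[symmetric] mult.commute)
  finally show ?thesis unfolding f by (simp only: tau_zpoly[OF not_dvd_mult[OF assms(2,1)]])
qed

lemma tau_cong: "[k = l] (mod p) \<Longrightarrow> tau k v = tau l v"
  using zeta_eq_iff[of k l] by (simp add: tau_def)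

lemma tau_one: "v \<in> ZO \<Longrightarrow> tau 1 v = v"
  using p_gt by (auto elim!: ZO_E simp: tau_zpoly)

lemma reduced_poly:
  "\<exists>c::nat \<Rightarrow> int. \<forall>w. w ^ p = 1 \<longrightarrow> zpoly f w = (\<Sum>i<p. of_int (c i) * w ^ i)"
proof -
  obtain c where c: "cyc_ev p f = (\<lambda>w. \<Sum>i<p. of_int (c i) * root_or_1 p w ^ i)"
    using cyc_ring_reduce[OF cyc_ev_mem[of p f]] p_gt by auto
  have "zpoly f w = (\<Sum>i<p. of_int (c i) * w ^ i)" if "w ^ p = 1" for w
    using fun_cong[OF c, of w] that by (simp add: cyc_ev_def root_or_1_def)
  then show ?thesis by (intro exI[of _ c]) simp
qed

end

section \<open>Traces and twisted operators on the cyclotomic integers\<close>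

locale zeta_prim = zeta_field +
  fixes mu :: nat
  assumes ord_mu: "ord p mu = p - 1"
begin

text \<open>The inverse of \<open>mu\<close> modulo \<open>p\<close>: since \<open>y\<close> acts by
  the inverse of \<open>sigma\<close>, its j-th power acts by \<open>tau (nu ^ j)\<close>.\<close>

definition nu where "nu = mu ^ (d - 1)"

lemma mu_d: "[mu ^ d = 1] (mod p)"
  using ord_divides[of mu d p] ord_mu by (simp add: d_def)

lemma mu_nu: "[mu * nu = 1] (mod p)"
proof -
  have "mu * nu = mu ^ d" using d_ge by (simp add: nu_def flip: power_Suc)
  then show ?thesis using mu_d by simp
qed

lemma not_dvd_unit: assumes "[k * l = 1] (mod p)" shows "\<not> p dvd k"
proof
  assume "p dvd k"
  then have "p dvd k * l" by simp
  then have "p dvd 1" using cong_dvd_iff[OF assms] by (simp only:)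
  then show False using p_gt by simp
qed

lemma nd_mu: "\<not> p dvd mu" by (rule not_dvd_unit[OF mu_nu])

lemma nd_nu: "\<not> p dvd nu" by (rule not_dvd_unit[of _ mu]) (use mu_nu in \<open>simp add: mult.commute\<close>)

lemma nd_nu_pow: "\<not> p dvd nu ^ j"
  using nd_nu prime prime_dvd_power[of p nu j] by blast

lemma nu_pow_1: "[nu ^ j = 1] (mod p) \<longleftrightarrow> d dvd j"
proof -
  have e: "[mu ^ j * nu ^ j = 1] (mod p)" using cong_pow[OF mu_nu, of j] by (simp add: power_mult_distrib)
  have "[nu ^ j = 1] (mod p) \<longleftrightarrow> [mu ^ j = 1] (mod p)"
  proof
    assume "[nu ^ j = 1] (mod p)"
    from cong_scalar_left[OF this, of "mu ^ j"] show "[mu ^ j = 1] (mod p)"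
      using e by (simp add: cong_def)
  next
    assume "[mu ^ j = 1] (mod p)"
    from cong_scalar_right[OF this, of "nu ^ j"] show "[nu ^ j = 1] (mod p)"
      using e by (simp add: cong_def)
  qed
  then show ?thesis using ord_divides[of mu j p] ord_mu by (simp add: d_def)
qed

lemma nu_pow_eq: "[nu ^ j = nu ^ k] (mod p) \<longleftrightarrow> [j = k] (mod d)"
proof -
  have *: "[nu ^ j = nu ^ k] (mod p) \<longleftrightarrow> [j = k] (mod d)" if jk: "j \<le> k" for j k
  proof -
    have "[nu ^ j * 1 = nu ^ j * nu ^ (k - j)] (mod p) \<longleftrightarrow> [1 = nu ^ (k - j)] (mod p)"
    proof (rule cong_mult_lcancel_nat)
      show "coprime (nu ^ j) p" using prime_imp_coprime[OF prime nd_nu_pow[of j]] by (simp add: coprime_commute)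
    qed
    moreover have "nu ^ j * nu ^ (k - j) = nu ^ k" using jk by (simp flip: power_add)
    ultimately have "[nu ^ j = nu ^ k] (mod p) \<longleftrightarrow> [nu ^ (k - j) = 1] (mod p)" by (simp add: cong_sym_eq)
    also have "\<dots> \<longleftrightarrow> d dvd k - j" by (rule nu_pow_1)
    also have "\<dots> \<longleftrightarrow> [k = j] (mod d)" using jk by (simp add: cong_altdef_nat)
    finally show ?thesis by (simp add: cong_sym_eq)
  qed
  show ?thesis using *[of j k] *[of k j] by (cases "j \<le> k") (auto simp: cong_sym_eq)
qed

lemma nu_bij: "bij_betw (\<lambda>j. nu ^ j mod p) {..<d} {1..d}"
proof -
  have inj: "inj_on (\<lambda>j. nu ^ j mod p) {..<d}"
    by (rule inj_onI) (use nu_pow_eq in \<open>auto simp: cong_def\<close>)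
  have sub: "(\<lambda>j. nu ^ j mod p) ` {..<d} \<subseteq> {1..d}"
  proof (rule image_subsetI)
    fix j
    have "nu ^ j mod p \<noteq> 0" "nu ^ j mod p < Suc d"
      unfolding d_ge(2) using nd_nu_pow[of j] p_gt by (auto simp: dvd_eq_mod_eq_0)
    then show "nu ^ j mod p \<in> {1..d}" unfolding atLeastAtMost_iff by linarith
  qed
  have "(\<lambda>j. nu ^ j mod p) ` {..<d} = {1..d}"
    by (rule card_subset_eq[OF _ sub]) (simp_all add: card_image[OF inj])
  then show ?thesis using inj by (simp add: bij_betw_def)
qed

abbreviation T where "T j \<equiv> tau (nu ^ j)"

lemma T_cong: "[j = k] (mod d) \<Longrightarrow> T j v = T k v"
  by (intro tau_cong) (simp add: nu_pow_eq)

lemma T_T: "v \<in> ZO \<Longrightarrow> T j (T k v) = T (j + k) v"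
  by (simp add: tau_tau nd_nu_pow power_add mult.commute)

definition Tr where "Tr v = (\<Sum>j<d. T j v)"

lemma Tr_zpoly: "Tr (zpoly f z) = (\<Sum>k = 1..d. zpoly f (z ^ k))"
proof -
  have "T j (zpoly f z) = zpoly f (z ^ (nu ^ j mod p))" for j
    using tau_zpoly[OF nd_nu_pow] zeta_eq_iff[of "nu ^ j" "nu ^ j mod p"] by (simp add: cong_def)
  then have "Tr (zpoly f z) = (\<Sum>j<d. zpoly f (z ^ (nu ^ j mod p)))" by (simp add: Tr_def)
  also have "\<dots> = (\<Sum>k\<in>{1..d}. zpoly f (z ^ k))" by (rule sum.reindex_bij_betw[OF nu_bij])
  finally show ?thesis .
qed

text \<open>Fourier inversion; as f(1) = 0, the trivial root may be added to the trace without
  changing it.\<close>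

lemma Tr_coeff:
  assumes c: "\<And>w. w ^ p = 1 \<Longrightarrow> zpoly f w = (\<Sum>i<p. of_int (c i) * w ^ i)" and f: "poly f 1 = 0" and i: "i < p"
  shows "Tr (zpoly f z * z ^ (p - i)) = of_nat p * of_int (c i)"
proof -
  have sp: "(\<Sum>k<p. F k) = F 0 + (\<Sum>k = 1..d. F k)" for F :: "nat \<Rightarrow> complex"
  proof -
    have "{..<p} = insert 0 {1..d}" using d_ge by auto
    then show ?thesis by simp
  qed
  have "Tr (zpoly f z * z ^ (p - i)) = (\<Sum>k = 1..d. zpoly f (z ^ k) * (z ^ k) ^ (p - i))"
    using Tr_zpoly[of "f * Polynomial.monom 1 (p - i)"] by simp
  also have "\<dots> = (\<Sum>k<p. zpoly f (z ^ k) * (z ^ k) ^ (p - i))"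
    unfolding sp using f by (simp add: zpoly_1)
  also have "\<dots> = (\<Sum>k<p. \<Sum>j<p. of_int (c j) * (z ^ (j + (p - i))) ^ k)"
    unfolding c[OF zeta_root] sum_distrib_right
    by (intro sum.cong HOL.refl) (simp only: pow_swap[of z] power_add power_mult_distrib ac_simps)
  also have "\<dots> = (\<Sum>j<p. of_int (c j) * (\<Sum>k<p. (z ^ (j + (p - i))) ^ k))"
    unfolding sum_distrib_left by (rule sum.swap)
  also have "\<dots> = (\<Sum>j<p. of_int (c j) * (if j = i then of_nat p else 0))"
  proof (rule sum.cong[OF HOL.refl])
    fix j assume j: "j \<in> {..<p}"
    have "p dvd j + (p - i) \<longleftrightarrow> [j + (p - i) = i + (p - i)] (mod p)"
      using i by (simp add: cong_def dvd_eq_mod_eq_0)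
    also have "\<dots> \<longleftrightarrow> j = i" using j i by (simp only: cong_add_rcancel_nat) (auto simp: cong_def)
    finally show "of_int (c j) * (\<Sum>k<p. (z ^ (j + (p - i))) ^ k) = of_int (c j) * (if j = i then of_nat p else 0)"
      by (simp only: zeta_sum)
  qed
  also have "\<dots> = of_nat p * of_int (c i)" using i by (subst sum.remove[of _ i]) auto
  finally show ?thesis .
qed

lemma Tr_sum: "(\<And>i. i \<in> A \<Longrightarrow> f i \<in> ZO) \<Longrightarrow> Tr (sum f A) = (\<Sum>i\<in>A. Tr (f i))"
  unfolding Tr_def by (subst sum.swap) (simp add: tau_sum nd_nu_pow)

lemma Tr_scale: "v \<in> ZO \<Longrightarrow> Tr (of_int k * v) = of_int k * Tr v"
  by (simp add: Tr_def tau_mult tau_int O_int nd_nu_pow sum_distrib_left)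

text \<open>If \<open>v\<close> is the combination of the \<open>z ^ i - 1\<close> with coefficients
  \<open>c i\<close>, then by \<open>Tr_coeff\<close> the trace of \<open>v * z ^ (p - i)\<close> is
  \<open>p\<close> times \<open>c i\<close>. Weighting these by the \<open>l\<close>-th coordinates
  of \<open>z ^ i - 1\<close> yields the dual vector \<open>a\<close>.\<close>

lemma dual_basis: "\<exists>a\<in>ZO. \<forall>v\<in>P. Tr (v * a) = of_int (int p * co v l)"
proof -
  define a where "a = (\<Sum>i = 1..d. of_int (co (z ^ i - 1) l) * z ^ (p - i))"
  have zp: "z ^ n \<in> ZO" for n by (intro O_power O_zeta)
  have a: "a \<in> ZO" unfolding a_def by (intro O_sum O_mult O_int zp)
  have zi: "z ^ i - 1 \<in> P" for i
    using P_I[of "Polynomial.monom 1 i - 1"] by (simp add: poly_monom)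
  have "Tr (v * a) = of_int (int p * co v l)" if v: "v \<in> P" for v
  proof -
    obtain f where f: "v = zpoly f z" "poly f 1 = 0" using v by (auto simp: P_def)
    obtain c where c: "\<And>w. w ^ p = 1 \<Longrightarrow> zpoly f w = (\<Sum>i<p. of_int (c i) * w ^ i)" using reduced_poly[of f] by auto
    have c1: "(\<Sum>i<p. of_int (c i)) = (0 :: complex)" using c[of 1] f(2) by (simp add: zpoly_1)
    have i0: "{..<p} = insert 0 {1..d}" using d_ge by auto
    have "v = (\<Sum>i<p. of_int (c i) * (z ^ i - 1))"
      unfolding f(1) c[OF zeta_pow_p] right_diff_distrib sum_subtractf mult_1_right c1 by simp
    then have v2: "v = (\<Sum>i = 1..d. of_int (c i) * (z ^ i - 1))" unfolding i0 by simp
    have co: "co v l = (\<Sum>i = 1..d. c i * co (z ^ i - 1) l)"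
      unfolding v2 by (subst coords_sum) (simp_all only: P_int[OF zi] coords_scale[OF zi])
    have "v * a = (\<Sum>i = 1..d. of_int (co (z ^ i - 1) l) * (v * z ^ (p - i)))"
      by (simp add: a_def sum_distrib_left mult.left_commute)
    also have "Tr \<dots> = (\<Sum>i = 1..d. of_int (co (z ^ i - 1) l) * Tr (v * z ^ (p - i)))"
      using P_O[OF v] by (subst Tr_sum) (simp_all only: O_mult O_int zp Tr_scale)
    also have "\<dots> = (\<Sum>i = 1..d. of_int (int p * (c i * co (z ^ i - 1) l)))"
    proof (rule sum.cong[OF HOL.refl])
      fix i assume "i \<in> {1..d}"
      then have "i < p" using d_ge by auto
      from Tr_coeff[OF c f(2) this] show "of_int (co (z ^ i - 1) l) * Tr (v * z ^ (p - i)) =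
         of_int (int p * (c i * co (z ^ i - 1) l))" unfolding f(1) by simp
    qed
    also have "\<dots> = of_int (int p * co v l)" unfolding co by (simp add: sum_distrib_left)
    finally show ?thesis .
  qed
  then show ?thesis using a by blast
qed

text \<open>Operators of the twisted group ring of the Galois group; \<open>act_op\<close> later
  writes the action of every element of Lambda in this form.\<close>

definition op :: "(nat \<Rightarrow> complex) \<Rightarrow> complex \<Rightarrow> complex" where
  "op g v = (\<Sum>j<d. T j v * g j)"

lemma op_P: "v \<in> ZO \<Longrightarrow> (\<And>j. g j \<in> P) \<Longrightarrow> op g v \<in> P"
  unfolding op_def using P_mult[OF _ tau_ZO[OF nd_nu_pow]] by (intro P_sum) (simp add: mult.commute)

text \<open>Coefficients are required in \<open>P\<close> because this is what the elements of
  Lambda killed by \<open>rho\<close> have. The goal is that all matrices in the radical are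
  realised.\<close>

definition W :: "(nat \<Rightarrow> nat \<Rightarrow> int) \<Rightarrow> bool" where
  "W t \<longleftrightarrow> (\<exists>g. (\<forall>j. g j \<in> P) \<and> (\<forall>i\<in>{1..d}. \<forall>k\<in>{1..d}. co (op g (pr ^ i)) k = t i k))"

lemma pr_pow_ZO: "pr ^ i \<in> ZO" by (intro O_power O_pr)

lemma W_add: assumes "W s" "W t" shows "W (\<lambda>i k. s i k + t i k)"
proof -
  obtain g h where g: "\<forall>j. g j \<in> P" "\<forall>i\<in>{1..d}. \<forall>k\<in>{1..d}. co (op g (pr ^ i)) k = s i k"
    and h: "\<forall>j. h j \<in> P" "\<forall>i\<in>{1..d}. \<forall>k\<in>{1..d}. co (op h (pr ^ i)) k = t i k"
    using assms unfolding W_def by auto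
  have e: "op (\<lambda>j. g j + h j) v = op g v + op h v" for v by (simp add: op_def distrib_left sum.distrib)
  have "co (op (\<lambda>j. g j + h j) (pr ^ i)) k = co (op g (pr ^ i)) k + co (op h (pr ^ i)) k" for i k
    unfolding e using coords_add[OF op_P op_P, OF pr_pow_ZO _ pr_pow_ZO] g(1) h(1) by simp
  then show ?thesis unfolding W_def using g h by (intro exI[of _ "\<lambda>j. g j + h j"]) (auto intro: P_add)
qed

lemma W_scale: assumes "W t" shows "W (\<lambda>i k. n * t i k)"
proof -
  obtain g where g: "\<forall>j. g j \<in> P" "\<forall>i\<in>{1..d}. \<forall>k\<in>{1..d}. co (op g (pr ^ i)) k = t i k"
    using assms unfolding W_def by auto
  have e: "op (\<lambda>j. of_int n * g j) v = of_int n * op g v" for v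
    by (simp add: op_def sum_distrib_left mult.left_commute)
  have "co (op (\<lambda>j. of_int n * g j) (pr ^ i)) k = n * co (op g (pr ^ i)) k" for i k
    unfolding e using coords_scale[OF op_P, OF pr_pow_ZO] g(1) by simp
  then show ?thesis unfolding W_def using g by (intro exI[of _ "\<lambda>j. of_int n * g j"]) (auto intro: P_int)
qed

lemma W_0: "W (\<lambda>_ _. 0)"
  unfolding W_def using coords_scale[OF P_0, of 0] by (intro exI[of _ "\<lambda>_. 0"]) (simp add: P_0 op_def)

lemma W_sum: "(\<And>x. x \<in> A \<Longrightarrow> W (f x)) \<Longrightarrow> W (\<lambda>i k. \<Sum>x\<in>A. f x i k)"
  by (induction A rule: infinite_finite_induct) (simp_all add: W_0 W_add)

lemma W_cong: "W s \<Longrightarrow> (\<And>i k. i \<in> {1..d} \<Longrightarrow> k \<in> {1..d} \<Longrightarrow> s i k = t i k) \<Longrightarrow> W t"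
  unfolding W_def by simp

text \<open>The operator sending \<open>v\<close> to \<open>Tr (v * a) * pr ^ k\<close>, with
  \<open>a\<close> dual to the \<open>l\<close>-th coordinate, is \<open>p\<close> times a matrix
  unit; its coefficients contain the factor \<open>pr ^ k\<close> and so lie in
  \<open>P\<close>.\<close>

lemma W_elem: assumes l: "l \<in> {1..d}" and k: "k \<in> {1..d}"
  shows "W (\<lambda>i j. if i = l \<and> j = k then int p else 0)"
proof -
  obtain a where a: "a \<in> ZO" "\<forall>v\<in>P. Tr (v * a) = of_int (int p * co v l)" using dual_basis[of l] by auto
  define g where "g j = T j a * pr ^ k" for j
  have g: "g j \<in> P" for j
    unfolding g_def using P_mult[OF P_pr_pow tau_ZO[OF nd_nu_pow a(1)], of k j] k by (simp add: mult.commute)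
  have "co (op g (pr ^ i)) j = (if i = l \<and> j = k then int p else 0)" if i: "i \<in> {1..d}" for i j
  proof -
    have "op g (pr ^ i) = (\<Sum>j<d. T j (pr ^ i * a)) * pr ^ k"
      by (simp add: op_def g_def tau_mult nd_nu_pow pr_pow_ZO a(1) sum_distrib_right mult.assoc)
    also have "\<dots> = of_int (int p * co (pr ^ i) l) * pr ^ k"
      using a(2) P_pr_pow[of i] i by (simp flip: Tr_def)
    also have "co (pr ^ i) l = (if i = l then 1 else 0)" using coords_pr_pow[OF i] l by auto
    finally show ?thesis
      using coords_scale[OF P_pr_pow, of k] coords_pr_pow[OF k] k by (simp del: of_int_mult)
  qed
  then show ?thesis unfolding W_def using g by (intro exI[of _ g]) simp
qed

lemma zeta_pow_expand: "\<exists>u\<in>ZO. z ^ e - 1 = of_nat e * pr + pr ^ 2 * u"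
proof (induction e)
  case 0
  then show ?case using O_int[of 0] by (intro bexI[of _ 0]) simp_all
next
  case (Suc e)
  then obtain u where u: "u \<in> ZO" "z ^ e - 1 = of_nat e * pr + pr ^ 2 * u" by auto
  have "z ^ Suc e - 1 = (z ^ e - 1) * (1 + pr) + pr" by (simp add: pr_def algebra_simps)
  also have "\<dots> = of_nat (Suc e) * pr + pr ^ 2 * (u * (1 + pr) + of_nat e)"
    unfolding u(2) by (simp add: algebra_simps power2_eq_square)
  finally show ?case using u(1) O_int[of "int e"] by (intro bexI[of _ "u * (1 + pr) + of_nat e"]) (auto intro: O_add O_mult O_1 O_pr)
qed

text \<open>Modulo higher powers of \<open>pr\<close>, the automorphism with exponent
  \<open>e\<close> multiplies \<open>pr ^ i\<close> by \<open>e ^ i\<close>. For a primitive root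
  \<open>e\<close> these eigenvalues are distinct modulo \<open>p\<close>, which separates the
  places on a superdiagonal.\<close>

lemma tau_pr_pow: "\<exists>u\<in>ZO. (z ^ e - 1) ^ i = of_nat (e ^ i) * pr ^ i + pr ^ Suc i * u"
proof (induction i)
  case 0
  then show ?case using O_int[of 0] by (intro bexI[of _ 0]) simp_all
next
  case (Suc i)
  then obtain u where u: "u \<in> ZO" "(z ^ e - 1) ^ i = of_nat (e ^ i) * pr ^ i + pr ^ Suc i * u" by auto
  obtain u' where u': "u' \<in> ZO" "z ^ e - 1 = of_nat e * pr + pr ^ 2 * u'" using zeta_pow_expand[of e] by auto
  have "(z ^ e - 1) ^ Suc i = (z ^ e - 1) * (of_nat (e ^ i) * pr ^ i + pr ^ Suc i * u)" by (simp add: u(2))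
  also have "\<dots> = of_nat (e ^ Suc i) * pr ^ Suc i + pr ^ Suc (Suc i) * (of_nat (e ^ i) * u' + (of_nat e + pr * u') * u)"
    unfolding u'(2) by (simp add: algebra_simps power2_eq_square)
  finally show ?case using u u' O_int[of "int e"] O_int[of "int (e ^ i)"]
    by (intro bexI[of _ "of_nat (e ^ i) * u' + (of_nat e + pr * u') * u"]) (auto intro!: O_add O_mult O_pr O_power)
qed

end

section \<open>The radical of the triangular matrices is realised by operators; uniqueness of
  coefficients and of \<open>sigma\<close>\<close>

context zeta_prim
begin

text \<open>The operator whose coefficients are those of \<open>Q\<close> times
  \<open>pr ^ l\<close> sends \<open>pr ^ i\<close> to \<open>poly Q (int nu ^ i)\<close> times
  \<open>pr ^ (i + l)\<close> plus higher terms. As \<open>Q\<close> vanishes at all these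
  eigenvalues except the one for \<open>j0\<close>, only one entry of the superdiagonal at distance
  \<open>l\<close> survives modulo \<open>p\<close>.\<close>

lemma W_diag:
  assumes j0: "j0 \<in> {1..d}" and l: "l \<ge> 1"
  shows "\<exists>t. W t \<and> (\<forall>i\<in>{1..d}. \<forall>k\<in>{1..d}. (k < i + l \<longrightarrow> int p dvd t i k) \<and>
     (k = i + l \<longrightarrow> (int p dvd t i k \<longleftrightarrow> i \<noteq> j0)))"
proof -
  define Q where "Q = (\<Prod>i\<in>{1..d} - {j0}. [:- (int nu ^ i), 1:])"
  have "degree Q \<le> (\<Sum>i\<in>{1..d} - {j0}. degree [:- (int nu ^ i), 1:])"
    using degree_prod_sum_le[of "{1..d} - {j0}" "\<lambda>i. [:- (int nu ^ i), 1:]"] by (simp add: o_def Q_def)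
  also have "\<dots> < d" using j0 d_ge(1) by simp
  finally have degQ: "degree Q < d" .
  have polyQ: "poly Q x = (\<Sum>k<d. poly.coeff Q k * x ^ k)" for x
    unfolding poly_altdef using degQ by (intro sum.mono_neutral_left) (auto simp: coeff_eq_0)
  have Q0: "poly Q (int nu ^ i) = 0" if "i \<in> {1..d}" "i \<noteq> j0" for i
    unfolding Q_def poly_prod by (rule prod_zero) (use that in auto)
  \<comment> \<open>The powers of \<open>nu\<close> with exponents in \<open>{1..d}\<close> are
    distinct modulo \<open>p\<close>, so no factor of the product is divisible by
    \<open>p\<close>.\<close>
  have Q1: "\<not> int p dvd poly Q (int nu ^ j0)"
  proof
    assume "int p dvd poly Q (int nu ^ j0)"
    then have *: "int p dvd (\<Prod>i\<in>{1..d} - {j0}. int nu ^ j0 - int nu ^ i)" by (simp add: Q_def poly_prod)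
    have "prime (int p)" using prime by simp
    from *[unfolded prime_dvd_prod_iff[OF finite_Diff[OF finite_atLeastAtMost] this]]
    obtain i where i: "i \<in> {1..d} - {j0}" "int p dvd int nu ^ j0 - int nu ^ i" by (rule bexE)
    then have "[int (nu ^ j0) = int (nu ^ i)] (mod int p)" by (simp add: cong_iff_dvd_diff)
    then have "[nu ^ j0 = nu ^ i] (mod p)" by (simp only: cong_int_iff)
    then have "[j0 = i] (mod d)" by (simp only: nu_pow_eq)
    then have e: "[j0 - 1 = i - 1] (mod d)" using i j0 cong_add_rcancel_nat[of "j0 - 1" 1 "i - 1" d] by simp
    have "j0 - 1 < d" "i - 1 < d" using i j0 by auto
    then have "j0 - 1 = i - 1" using e by (simp add: cong_def)
    then show False using i j0 by auto
  qed
  define g where "g k = of_int (poly.coeff Q k) * pr ^ l" for k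
  have g: "g k \<in> P" for k unfolding g_def by (intro P_int P_pr_pow l)
  have co_g: "\<exists>U\<in>ZO. \<forall>k. co (op g (pr ^ i)) k = poly Q (int nu ^ i) * co (pr ^ (i + l)) k + co (pr ^ Suc (i + l) * U) k" for i
  proof -
    have "\<forall>k. \<exists>u. u \<in> ZO \<and> T k (pr ^ i) = of_nat ((nu ^ k) ^ i) * pr ^ i + pr ^ Suc i * u"
      using tau_pr_pow[of "nu ^ _" i] by (auto simp: tau_power nd_nu_pow O_pr tau_pr)
    then obtain u where "\<forall>k. u k \<in> ZO \<and> T k (pr ^ i) = of_nat ((nu ^ k) ^ i) * pr ^ i + pr ^ Suc i * u k"
      by (rule choice[THEN exE])
    then have u: "u k \<in> ZO" "T k (pr ^ i) = of_nat ((nu ^ k) ^ i) * pr ^ i + pr ^ Suc i * u k" for k by auto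
    define U where "U = (\<Sum>k<d. of_int (poly.coeff Q k) * u k)"
    have U: "U \<in> ZO" unfolding U_def by (intro O_sum O_mult O_int u)
    have "T k (pr ^ i) * g k = of_int (poly.coeff Q k * (int nu ^ i) ^ k) * pr ^ (i + l) +
        pr ^ Suc (i + l) * (of_int (poly.coeff Q k) * u k)" for k
    proof -
      have "(of_nat ((nu ^ k) ^ i) :: complex) = of_int ((int nu ^ i) ^ k)"
        by (simp add: power_mult[symmetric] mult.commute)
      then show ?thesis unfolding u g_def by (simp add: algebra_simps power_add)
    qed
    then have "op g (pr ^ i) = of_int (poly Q (int nu ^ i)) * pr ^ (i + l) + pr ^ Suc (i + l) * U"
      unfolding op_def polyQ U_def of_int_sum sum_distrib_right sum_distrib_left sum.distrib[symmetric]
      by (rule sum.cong[OF HOL.refl])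
    moreover have 1: "pr ^ (i + l) \<in> P" "pr ^ Suc (i + l) * U \<in> P"
      using P_pr_pow[of "i + l"] P_mult[OF P_pr_pow U, of "Suc (i + l)"] l by auto
    ultimately show ?thesis using U coords_add[OF P_int[OF 1(1)] 1(2)] coords_scale[OF 1(1)] by (intro bexI[of _ U]) simp_all
  qed
  have res: "(k < i + l \<longrightarrow> int p dvd co (op g (pr ^ i)) k) \<and> (k = i + l \<longrightarrow> (int p dvd co (op g (pr ^ i)) k \<longleftrightarrow> i \<noteq> j0))"
    if i: "i \<in> {1..d}" and k: "k \<in> {1..d}" for i k
  proof -
    obtain U where U: "U \<in> ZO" "co (op g (pr ^ i)) k = poly Q (int nu ^ i) * co (pr ^ (i + l)) k + co (pr ^ Suc (i + l) * U) k"
      using co_g[of i] by auto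
    have d2: "int p dvd co (pr ^ Suc (i + l) * U) k" if "k \<le> i + l" by (rule coords_dvd[OF U(1) k that])
    have "int p dvd co (op g (pr ^ i)) k" if h: "k < i + l"
    proof -
      have "int p dvd co (pr ^ Suc (i + l - 1) * 1) k" by (rule coords_dvd[OF O_1 k]) (use h in simp)
      moreover have "Suc (i + l - 1) = i + l" using i by simp
      ultimately have "int p dvd co (pr ^ (i + l)) k" by (simp only: mult_1_right)
      then show ?thesis unfolding U(2) using d2 h by (intro dvd_add dvd_mult) auto
    qed
    moreover have "int p dvd co (op g (pr ^ i)) k \<longleftrightarrow> i \<noteq> j0" if h: "k = i + l"
    proof -
      have "co (pr ^ (i + l)) k = 1" using coords_pr_pow[of "i + l"] h k by simp
      then have "int p dvd co (op g (pr ^ i)) k \<longleftrightarrow> int p dvd poly Q (int nu ^ i)"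
        unfolding U(2) using d2 h by (simp add: dvd_add_left_iff)
      then show ?thesis using Q0[OF i] Q1 by auto
    qed
    ultimately show ?thesis by blast
  qed
  have "W (\<lambda>i k. co (op g (pr ^ i)) k)" unfolding W_def using g by (intro exI[of _ g]) simp
  then show ?thesis using res by (intro exI[of _ "\<lambda>i k. co (op g (pr ^ i)) k"]) simp
qed

text \<open>Induction from the far superdiagonals towards the diagonal: a matrix divisible by
  \<open>p\<close> is a combination of those in \<open>W_elem\<close>, and the matrices of
  \<open>W_diag\<close> allow one further superdiagonal to be cleared modulo
  \<open>p\<close>.\<close>

lemma W_deep:
  assumes "n < d" "\<And>i k. i \<in> {1..d} \<Longrightarrow> k \<in> {1..d} \<Longrightarrow> k < i + (d - n) \<Longrightarrow> int p dvd t i k"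
  shows "W t"
  using assms
proof (induction n arbitrary: t)
  case 0
  have "W (\<lambda>i k. \<Sum>x\<in>{1..d} \<times> {1..d}. (t (fst x) (snd x) div int p) * (if i = fst x \<and> k = snd x then int p else 0))"
    by (intro W_sum W_scale W_elem) auto
  then show ?case
  proof (rule W_cong)
    fix i k assume ik: "i \<in> {1..d}" "k \<in> {1..d}"
    have "(\<Sum>x\<in>{1..d} \<times> {1..d}. (t (fst x) (snd x) div int p) * (if i = fst x \<and> k = snd x then int p else 0)) =
       (\<Sum>x\<in>{1..d} \<times> {1..d}. if x = (i, k) then (t i k div int p) * int p else 0)"
      by (rule sum.cong) auto
    also have "\<dots> = (t i k div int p) * int p" using ik by simp
    also have "\<dots> = t i k" using "0.prems"(2)[OF ik] ik by simp
    finally show "(\<Sum>x\<in>{1..d} \<times> {1..d}. (t (fst x) (snd x) div int p) * (if i = fst x \<and> k = snd x then int p else 0)) = t i k" .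
  qed
next
  case (Suc n)
  define l where "l = d - Suc n"
  have l: "l \<ge> 1" "d - n = Suc l" using Suc.prems(1) by (auto simp: l_def)
  have t: "int p dvd t i k" if "i \<in> {1..d}" "k \<in> {1..d}" "k < i + l" for i k
    using Suc.prems(2)[OF that(1,2)] that(3) by (simp add: l_def)
  \<comment> \<open>\<open>x\<close> packs the matrix isolating row \<open>j\<close> together with
    the multiplier that matches the entry of \<open>t\<close> modulo \<open>p\<close>.\<close>
  have "\<exists>x. W (fst x) \<and> (\<forall>i\<in>{1..d}. \<forall>k\<in>{1..d}. k < i + l \<or> (k = i + l \<and> i \<noteq> j) \<longrightarrow> int p dvd fst x i k) \<and>
      (j + l \<in> {1..d} \<longrightarrow> int p dvd t j (j + l) - snd x * fst x j (j + l))" if j: "j \<in> {1..d}" for j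
  proof -
    obtain M where M: "W M" "\<forall>i\<in>{1..d}. \<forall>k\<in>{1..d}. (k < i + l \<longrightarrow> int p dvd M i k) \<and>
       (k = i + l \<longrightarrow> (int p dvd M i k \<longleftrightarrow> i \<noteq> j))" using W_diag[OF j l(1)] by auto
    have "\<exists>b. j + l \<in> {1..d} \<longrightarrow> int p dvd t j (j + l) - b * M j (j + l)"
    proof (cases "j + l \<in> {1..d}")
      case True
      have "\<not> int p dvd M j (j + l)" using M(2) j True by blast
      moreover have "prime (int p)" using prime by simp
      ultimately have "coprime (int p) (M j (j + l))" using prime_imp_coprime by blast
      then obtain x y where xy: "x * int p + y * M j (j + l) = 1"
        using bezout_int[of "int p" "M j (j + l)"] by (auto simp: coprime_iff_gcd_eq_1)
      have "t j (j + l) - (t j (j + l) * y) * M j (j + l) = t j (j + l) * (1 - y * M j (j + l))" by (simp add: algebra_simps)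
      also have "\<dots> = int p * (t j (j + l) * x)" using xy by (simp add: algebra_simps flip: xy)
      finally show ?thesis by (intro exI[of _ "t j (j + l) * y"]) simp
    qed auto
    then obtain b where "j + l \<in> {1..d} \<longrightarrow> int p dvd t j (j + l) - b * M j (j + l)" by auto
    then show ?thesis using M by (intro exI[of _ "(M, b)"]) auto
  qed
  then obtain X where X: "\<And>j. j \<in> {1..d} \<Longrightarrow> W (fst (X j))"
    "\<And>j i k. j \<in> {1..d} \<Longrightarrow> i \<in> {1..d} \<Longrightarrow> k \<in> {1..d} \<Longrightarrow> k < i + l \<or> (k = i + l \<and> i \<noteq> j) \<Longrightarrow> int p dvd fst (X j) i k"
    "\<And>j. j \<in> {1..d} \<Longrightarrow> j + l \<in> {1..d} \<Longrightarrow> int p dvd t j (j + l) - snd (X j) * fst (X j) j (j + l)"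
    by metis
  have "W (\<lambda>i k. t i k - (\<Sum>j\<in>{1..d}. snd (X j) * fst (X j) i k))"
  proof (rule Suc.IH)
    show "n < d" using Suc.prems(1) by simp
    fix i k assume ik: "i \<in> {1..d}" "k \<in> {1..d}" "k < i + (d - n)"
    then have "k < i + l \<or> k = i + l" using l by auto
    then show "int p dvd t i k - (\<Sum>j\<in>{1..d}. snd (X j) * fst (X j) i k)"
    proof
      assume h: "k < i + l"
      have "int p dvd (\<Sum>j\<in>{1..d}. snd (X j) * fst (X j) i k)"
        by (rule dvd_sum) (use X(2) ik h in auto)
      then show ?thesis using t[OF ik(1,2) h] by (rule dvd_diff[rotated])
    next
      assume h: "k = i + l"
      have "int p dvd (\<Sum>j\<in>{1..d} - {i}. snd (X j) * fst (X j) i k)"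
        by (rule dvd_sum) (use X(2) ik h in auto)
      moreover have "int p dvd t i k - snd (X i) * fst (X i) i k" using X(3)[OF ik(1)] ik h by simp
      moreover have "t i k - (\<Sum>j\<in>{1..d}. snd (X j) * fst (X j) i k) =
         (t i k - snd (X i) * fst (X i) i k) - (\<Sum>j\<in>{1..d} - {i}. snd (X j) * fst (X j) i k)"
        using ik(1) by (subst sum.remove[of _ i]) auto
      ultimately show ?thesis by (simp only: dvd_diff)
    qed
  qed
  moreover have "W (\<lambda>i k. \<Sum>j\<in>{1..d}. snd (X j) * fst (X j) i k)"
    by (intro W_sum W_scale X(1))
  ultimately have "W (\<lambda>i k. (t i k - (\<Sum>j\<in>{1..d}. snd (X j) * fst (X j) i k)) + (\<Sum>j\<in>{1..d}. snd (X j) * fst (X j) i k))"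
    by (rule W_add)
  then show ?case by simp
qed

lemma W_rad:
  assumes "\<And>i k. k \<le> i \<Longrightarrow> int p dvd t i k" shows "W t"
  by (rule W_deep[of "d - 1"]) (use assms d_ge(1) in auto)

text \<open>Independence of the automorphisms, made explicit: on \<open>pr * z ^ l\<close> the
  operator is a combination of \<open>l\<close>-th powers of distinct roots of unity, and Fourier
  inversion in \<open>l\<close> isolates one coefficient, up to the nonzero factor
  \<open>z ^ (nu ^ j0) - 1\<close>.\<close>

lemma op_inj:
  assumes "\<And>v. v \<in> P \<Longrightarrow> op g v = 0" "j0 < d"
  shows "g j0 = 0"
proof -
  define E where "E = nu ^ j0 mod p"
  define G where "G j = (z ^ (nu ^ j) - 1) * g j" for j
  have E: "E < p" using p_gt by (simp add: E_def)
  have zl: "z ^ l \<in> ZO" for l by (intro O_power O_zeta)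
  have s: "(\<Sum>j<d. G j * (z ^ (nu ^ j)) ^ l) = 0" for l
  proof -
    have "T j (pr * z ^ l) * g j = G j * (z ^ (nu ^ j)) ^ l" for j
      by (simp add: tau_mult nd_nu_pow O_pr zl tau_pr tau_power O_zeta tau_zeta G_def)
    then show ?thesis using assms(1)[OF P_mult[OF P_pr zl[of l]]] by (simp add: op_def)
  qed
  have "0 = (\<Sum>l<p. (z ^ (p - E)) ^ l * (\<Sum>j<d. G j * (z ^ (nu ^ j)) ^ l))" by (simp add: s)
  also have "\<dots> = (\<Sum>l<p. \<Sum>j<d. G j * (z ^ (nu ^ j + (p - E))) ^ l)"
    unfolding sum_distrib_left
    by (intro sum.cong HOL.refl) (simp only: power_add power_mult_distrib ac_simps)
  also have "\<dots> = (\<Sum>j<d. G j * (\<Sum>l<p. (z ^ (nu ^ j + (p - E))) ^ l))"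
    unfolding sum_distrib_left by (rule sum.swap)
  also have "\<dots> = (\<Sum>j<d. G j * (if j = j0 then of_nat p else 0))"
  proof (rule sum.cong[OF HOL.refl])
    fix j assume j: "j \<in> {..<d}"
    have "p dvd nu ^ j + (p - E) \<longleftrightarrow> [nu ^ j + (p - E) = E + (p - E)] (mod p)"
      using E by (simp add: cong_def dvd_eq_mod_eq_0)
    also have "\<dots> \<longleftrightarrow> [nu ^ j = nu ^ j0] (mod p)" by (simp only: cong_add_rcancel_nat) (simp add: cong_def E_def)
    also have "\<dots> \<longleftrightarrow> j = j0" using j assms(2) by (simp only: nu_pow_eq) (auto simp: cong_def)
    finally show "G j * (\<Sum>l<p. (z ^ (nu ^ j + (p - E))) ^ l) = G j * (if j = j0 then of_nat p else 0)"
      by (simp only: zeta_sum)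
  qed
  also have "\<dots> = G j0 * of_nat p" using assms(2) by (subst sum.remove[of _ j0]) auto
  finally have "G j0 = 0" using p_gt by simp
  moreover have "z ^ (nu ^ j0) \<noteq> 1" using nd_nu_pow by (simp add: zeta_eq_1_iff)
  ultimately show ?thesis by (simp add: G_def)
qed

lemma carrier_cyc: "carrier (cyc p) = ZO"
  by (simp add: cyc_def ZO_def zpoly_def)

lemma tau_inv: "v \<in> ZO \<Longrightarrow> tau mu (tau nu v) = v" "v \<in> ZO \<Longrightarrow> tau nu (tau mu v) = v"
proof -
  assume v: "v \<in> ZO"
  have "tau (nu * mu) v = v" "tau (mu * nu) v = v"
    using tau_cong[OF mu_nu, of v] tau_one[OF v] by (simp_all add: mult.commute)
  then show "tau mu (tau nu v) = v" "tau nu (tau mu v) = v" using v by (simp_all add: tau_tau nd_mu nd_nu)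
qed

text \<open>A ring automorphism is determined by the image of \<open>z\<close>, and extensionality
  fixes it outside the ring; so the description in \<open>sigma\<close> has exactly one
  solution.\<close>

lemma sigma_tau:
  assumes m: "z powi m = z ^ mu"
  shows "sigma p m = restrict (tau mu) ZO"
  unfolding sigma_def carrier_cyc
proof (rule the_equality)
  have "bij_betw (restrict (tau mu) ZO) ZO ZO"
    by (rule bij_betw_byWitness[of _ "tau nu"]) (auto simp: tau_inv tau_ZO nd_mu nd_nu)
  moreover have "restrict (tau mu) ZO \<in> ring_hom (cyc p) (cyc p)"
    unfolding ring_hom_def carrier_cyc
    using tau_int[OF nd_mu, of 1] by (auto simp: cyc_def tau_ZO nd_mu tau_mult tau_add O_mult O_add O_1)
  ultimately show "restrict (tau mu) ZO \<in> ring_iso (cyc p) (cyc p) \<and>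
      restrict (tau mu) ZO \<in> extensional ZO \<and> restrict (tau mu) ZO z = z powi m"
    using m by (simp add: ring_iso_def carrier_cyc O_zeta tau_zeta nd_mu)
next
  fix s assume s: "s \<in> ring_iso (cyc p) (cyc p) \<and> s \<in> extensional ZO \<and> s z = z powi m"
  then have h: "s \<in> ring_hom (cyc p) (cyc p)" by (simp add: ring_iso_def)
  have sm: "s (v * w) = s v * s w" "s (v + w) = s v + s w" if "v \<in> ZO" "w \<in> ZO" for v w
    using h that unfolding ring_hom_def carrier_cyc by (auto simp: cyc_def)
  have s1: "s 1 = 1" using h unfolding ring_hom_def by (auto simp: cyc_def)
  have s0: "s 0 = 0" using sm(2)[of 0 0] O_int[of 0] by simp
  have sn: "s (of_nat n) = of_nat n" for n
  proof (induction n)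
    case (Suc n)
    then show ?case using sm(2)[OF O_1, of "of_nat n"] O_int[of "int n"] s1 by simp
  qed (use s0 in simp)
  have si: "s (of_int a) = of_int a" for a
  proof (cases a)
    case (nonneg n)
    then show ?thesis using sn[of n] by simp
  next
    case (neg n)
    have "s (of_int a + of_nat (Suc n)) = s (of_int a) + of_nat (Suc n)"
      using sm(2)[OF O_int, of "of_nat (Suc n)" a] O_int[of "int (Suc n)"] sn[of "Suc n"] by simp
    moreover have e: "(of_int a :: complex) = - of_nat (Suc n)" using neg by simp
    then have "(of_int a :: complex) + of_nat (Suc n) = 0" by (simp only: eq_neg_iff_add_eq_0)
    ultimately have "s (of_int a) + of_nat (Suc n) = 0" using s0 by (simp only:)
    then have "s (of_int a) = - of_nat (Suc n)" by (simp only: eq_neg_iff_add_eq_0)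
    then show ?thesis using e by (simp only:)
  qed
  have "s (zpoly f z) = zpoly f (z ^ mu)" for f
  proof (induction f)
    case (pCons a f)
    have "s (of_int a + z * zpoly f z) = s (of_int a) + s z * s (zpoly f z)"
      using sm(2)[OF O_int O_mult[OF O_zeta O_I]] sm(1)[OF O_zeta O_I] by simp
    then show ?case using pCons.IH s m by (simp add: zpoly_pCons si)
  qed (simp add: s0)
  then have "s v = restrict (tau mu) ZO v" if "v \<in> ZO" for v
    using that tau_zpoly[OF nd_mu] by (auto elim!: ZO_E)
  moreover have "s v = restrict (tau mu) ZO v" if "v \<notin> ZO" for v
    using s that by (auto simp: extensional_def)
  ultimately show "s = restrict (tau mu) ZO" by blast
qed

lemma sigma_inv:
  assumes m: "z powi m = z ^ mu" and v: "v \<in> ZO"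
  shows "inv_into (carrier (cyc p)) (sigma p m) v = tau nu v"
  unfolding carrier_cyc sigma_tau[OF m]
proof (rule inv_into_f_eq)
  show "inj_on (restrict (tau mu) ZO) ZO" by (rule inj_on_inverseI[of _ "tau nu"]) (simp add: tau_inv)
qed (use v in \<open>simp_all add: tau_ZO nd_nu tau_inv\<close>)

end


section \<open>Normal forms in the metacyclic group\<close>

lemma pres_eq_context: "pres_eq E u v \<Longrightarrow> pres_eq E (a @ u @ b) (a @ v @ b)"
proof (induction rule: pres_eq.induct)
  case (refl u)
  show ?case by (rule pres_eq.refl)
next
  case (sym u v)
  show ?case by (rule pres_eq.sym[OF sym.IH])
next
  case (trans u v w)
  show ?case by (rule pres_eq.trans[OF trans.IH])
next
  case (cancel u s c v)
  show ?case using pres_eq.cancel[of E "a @ u" s c "v @ b"] by simp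
next
  case (relation l r u v)
  then show ?case using pres_eq.relation[of l r E "a @ u" "v @ b"] by simp
qed

lemma pres_eq_append:
  assumes "pres_eq E u v" "pres_eq E u' v'"
  shows "pres_eq E (u @ u') (v @ v')"
proof (rule pres_eq.trans)
  show "pres_eq E (u @ u') (v @ u')" using pres_eq_context[OF assms(1), of "[]" u'] by simp
  show "pres_eq E (v @ u') (v @ v')" using pres_eq_context[OF assms(2), of v "[]"] by simp
qed

lemma pres_class_eq_iff: "pres_class E u = pres_class E v \<longleftrightarrow> pres_eq E u v"
proof
  assume "pres_class E u = pres_class E v"
  moreover have "v \<in> pres_class E v" by (simp add: pres_class_def pres_eq.refl)
  ultimately have "v \<in> pres_class E u" by (simp only:)
  then show "pres_eq E u v" by (simp add: pres_class_def)
next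
  assume h: "pres_eq E u v"
  show "pres_class E u = pres_class E v"
    unfolding pres_class_def
    by (intro Collect_cong iffI) (erule pres_eq.trans[OF h] pres_eq.trans[OF pres_eq.sym[OF h]])+
qed

lemma presented_mult:
  "mult (presented_group E) (pres_class E u) (pres_class E v) = pres_class E (u @ v)"
proof -
  have "pres_class E (a @ b) = pres_class E (u @ v)" if h: "a \<in> pres_class E u" "b \<in> pres_class E v" for a b
  proof -
    have "pres_eq E u a" "pres_eq E v b" using h by (simp_all add: pres_class_def)
    then show ?thesis unfolding pres_class_eq_iff by (intro pres_eq.sym[OF pres_eq_append])
  qed
  note eq = this
  show ?thesis
    unfolding presented_group_def monoid.simps
  proof (intro equalityI subsetI)
    fix x assume "x \<in> (\<Union>a\<in>pres_class E u. \<Union>b\<in>pres_class E v. pres_class E (a @ b))"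
    then obtain a b where ab: "a \<in> pres_class E u" "b \<in> pres_class E v" "x \<in> pres_class E (a @ b)"
      by (elim UN_E)
    show "x \<in> pres_class E (u @ v)" using ab(3) unfolding eq[OF ab(1,2)] .
  next
    fix x assume "x \<in> pres_class E (u @ v)"
    then show "x \<in> (\<Union>a\<in>pres_class E u. \<Union>b\<in>pres_class E v. pres_class E (a @ b))"
      by (intro UN_I[of u] UN_I[of v]) (simp_all add: pres_class_def pres_eq.refl)
  qed
qed

text \<open>The exponent \<open>m\<close> may be negative; computations use its least nonnegative
  residue modulo \<open>p\<close>.\<close>

locale metacyclic_group = zeta_prim p "nat (m mod int p)" for p :: nat and m :: int
begin

abbreviation mu where "mu \<equiv> nat (m mod int p)"
abbreviation E where "E \<equiv> metacyclic_rels p m"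
abbreviation eqv (infix "\<bowtie>" 50) where "u \<bowtie> v \<equiv> pres_eq E u v"
abbreviation X where "X k \<equiv> replicate k (Gen_x, True)"
abbreviation Y where "Y k \<equiv> replicate k (Gen_y, True)"
abbreviation G where "G \<equiv> carrier (metacyclic p m)"

lemma ctx: "u \<bowtie> v \<Longrightarrow> a @ u @ b \<bowtie> a @ v @ b" by (rule pres_eq_context)

lemma cat: "u \<bowtie> v \<Longrightarrow> u' \<bowtie> v' \<Longrightarrow> u @ u' \<bowtie> v @ v'" by (rule pres_eq_append)

lemma X_p: "X p \<bowtie> []"
proof -
  have "(X p, []) \<in> E" by (simp add: metacyclic_rels_def gen_pow_def)
  from pres_eq.relation[OF this, of "[]" "[]"] show ?thesis by simp
qed

lemma Y_d: "Y d \<bowtie> []"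
proof -
  have "nat \<bar>int p - 1\<bar> = d" "0 \<le> int p - 1" using p_gt by (auto simp: d_def)
  then have "(Y d, []) \<in> E" by (simp add: metacyclic_rels_def gen_pow_def)
  from pres_eq.relation[OF this, of "[]" "[]"] show ?thesis by simp
qed

lemma X_mult: "X (p * k) \<bowtie> []"
proof (induction k)
  case (Suc k)
  have "X (p * Suc k) = X p @ X (p * k)" by (simp only: mult_Suc_right replicate_add)
  then show ?case using cat[OF X_p Suc.IH] by simp
qed (simp add: pres_eq.refl)

lemma Y_mult: "Y (d * k) \<bowtie> []"
proof (induction k)
  case (Suc k)
  have "Y (d * Suc k) = Y d @ Y (d * k)" by (simp only: mult_Suc_right replicate_add)
  then show ?case using cat[OF Y_d Suc.IH] by simp
qed (simp add: pres_eq.refl)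

lemma X_mod: "X k \<bowtie> X (k mod p)"
proof -
  have "X k = X (p * (k div p)) @ X (k mod p)"
    using replicate_add[of "p * (k div p)" "k mod p" "(Gen_x, True)"] by (simp only: mult_div_mod_eq)
  then show ?thesis using cat[OF X_mult pres_eq.refl, of "k div p" "X (k mod p)"] by simp
qed

lemma Y_mod: "Y k \<bowtie> Y (k mod d)"
proof -
  have "Y k = Y (d * (k div d)) @ Y (k mod d)"
    using replicate_add[of "d * (k div d)" "k mod d" "(Gen_y, True)"] by (simp only: mult_div_mod_eq)
  then show ?thesis using cat[OF Y_mult pres_eq.refl, of "k div d" "Y (k mod d)"] by simp
qed

lemma X_cong: "[k = l] (mod p) \<Longrightarrow> X k \<bowtie> X l"
  using X_mod[of k] X_mod[of l] unfolding cong_def by (simp only:) (rule pres_eq.trans[OF _ pres_eq.sym])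

lemma Y_cong: "[k = l] (mod d) \<Longrightarrow> Y k \<bowtie> Y l"
  using Y_mod[of k] Y_mod[of l] unfolding cong_def by (simp only:) (rule pres_eq.trans[OF _ pres_eq.sym])

lemma X_inv: "[(Gen_x, False)] \<bowtie> X (p - 1)"
proof -
  have "[(Gen_x, False)] @ X p = [] @ [(Gen_x, False), (Gen_x, \<not> False)] @ X (p - 1)"
    using p_gt by (cases p) auto
  then have "[(Gen_x, False)] @ X p \<bowtie> X (p - 1)"
    using pres_eq.cancel[of E "[]" Gen_x False "X (p - 1)"] by simp
  moreover have "[(Gen_x, False)] @ X p \<bowtie> [(Gen_x, False)]" using ctx[OF X_p, of "[(Gen_x, False)]" "[]"] by simp
  ultimately show ?thesis by (rule pres_eq.trans[OF pres_eq.sym, rotated])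
qed

lemma Y_inv: "[(Gen_y, False)] \<bowtie> Y (d - 1)"
proof -
  have "[(Gen_y, False)] @ Y d = [] @ [(Gen_y, False), (Gen_y, \<not> False)] @ Y (d - 1)"
    using d_ge(1) by (cases d) auto
  then have "[(Gen_y, False)] @ Y d \<bowtie> Y (d - 1)"
    using pres_eq.cancel[of E "[]" Gen_y False "Y (d - 1)"] by simp
  moreover have "[(Gen_y, False)] @ Y d \<bowtie> [(Gen_y, False)]" using ctx[OF Y_d, of "[(Gen_y, False)]" "[]"] by simp
  ultimately show ?thesis by (rule pres_eq.trans[OF pres_eq.sym, rotated])
qed

lemma mu_int: "int mu = m mod int p"
  using p_gt by simp

text \<open>For negative \<open>m\<close> the relation contains inverse letters, which are replaced
  by \<open>X (p - 1)\<close>.\<close>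

lemma X_m: "gen_pow Gen_x m \<bowtie> X mu"
proof (cases "m \<ge> 0")
  case True
  have "[int (nat m) = int mu] (mod int p)" unfolding mu_int using True by (simp add: cong_def)
  then have "[nat m = mu] (mod p)" by (simp only: cong_int_iff)
  from X_cong[OF this] show ?thesis using True by (simp add: gen_pow_def)
next
  case False
  have "replicate n (Gen_x, False) \<bowtie> X ((p - 1) * n)" for n
  proof (induction n)
    case (Suc n)
    have "replicate (Suc n) (Gen_x, False) = [(Gen_x, False)] @ replicate n (Gen_x, False)" by simp
    moreover have "X ((p - 1) * Suc n) = X (p - 1) @ X ((p - 1) * n)" by (simp add: replicate_add)
    ultimately show ?case using cat[OF X_inv Suc.IH] by simp
  qed (simp add: pres_eq.refl)
  then have "gen_pow Gen_x m \<bowtie> X ((p - 1) * nat (- m))" using False by (simp add: gen_pow_def)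
  moreover have "[int ((p - 1) * nat (- m)) = int mu] (mod int p)"
  proof -
    have "int ((p - 1) * nat (- m)) = (int p - 1) * (- m)" using False p_gt by simp
    also have "\<dots> = m + int p * (- m)" by (simp add: algebra_simps)
    finally show ?thesis unfolding mu_int by (simp only: cong_def mod_mult_self2 mod_mod_trivial)
  qed
  then have "[(p - 1) * nat (- m) = mu] (mod p)" by (simp only: cong_int_iff)
  ultimately show ?thesis by (rule pres_eq.trans[OF _ X_cong])
qed

lemma Y_X: "Y 1 @ X 1 \<bowtie> X mu @ Y 1"
proof -
  have "(Y 1 @ X 1, gen_pow Gen_x m @ Y 1) \<in> E" by (simp add: metacyclic_rels_def gen_pow_def)
  from pres_eq.relation[OF this, of "[]" "[]"] have "Y 1 @ X 1 \<bowtie> gen_pow Gen_x m @ Y 1" by simp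
  then show ?thesis using cat[OF X_m pres_eq.refl, of "Y 1"] by (rule pres_eq.trans)
qed

lemma Y_Xk: "Y 1 @ X k \<bowtie> X (mu * k) @ Y 1"
proof (induction k)
  case (Suc k)
  have "X (Suc k) = X 1 @ X k" by simp
  then have "Y 1 @ X (Suc k) = (Y 1 @ X 1) @ X k" by simp
  also have "\<dots> \<bowtie> (X mu @ Y 1) @ X k" by (rule cat[OF Y_X pres_eq.refl])
  finally have 1: "Y 1 @ X (Suc k) \<bowtie> X mu @ (Y 1 @ X k)" by simp
  have "X mu @ (Y 1 @ X k) \<bowtie> X mu @ (X (mu * k) @ Y 1)" by (rule cat[OF pres_eq.refl Suc.IH])
  also have "X mu @ (X (mu * k) @ Y 1) = X (mu * Suc k) @ Y 1" by (simp add: replicate_add)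
  finally show ?case by (rule pres_eq.trans[OF 1])
qed (simp add: pres_eq.refl)

lemma Yj_X: "Y j @ X k \<bowtie> X (mu ^ j * k) @ Y j"
proof (induction j)
  case (Suc j)
  have Y: "Y (Suc j) = Y 1 @ Y j" by simp
  have "Y (Suc j) @ X k = Y 1 @ (Y j @ X k)" by simp
  also have "\<dots> \<bowtie> Y 1 @ (X (mu ^ j * k) @ Y j)" by (rule cat[OF pres_eq.refl Suc.IH])
  finally have 1: "Y (Suc j) @ X k \<bowtie> (Y 1 @ X (mu ^ j * k)) @ Y j" by simp
  have "(Y 1 @ X (mu ^ j * k)) @ Y j \<bowtie> (X (mu * (mu ^ j * k)) @ Y 1) @ Y j" by (rule cat[OF Y_Xk pres_eq.refl])
  also have "(X (mu * (mu ^ j * k)) @ Y 1) @ Y j = X (mu ^ Suc j * k) @ Y (Suc j)" by (simp add: mult.assoc)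
  finally show ?case by (rule pres_eq.trans[OF 1])
qed (simp add: pres_eq.refl)

text \<open>Letters are appended on the right: an x is carried past the power of y by
  \<open>Yj_X\<close>, and inverse letters are positive powers.\<close>

lemma normal_form: "\<exists>i j. w \<bowtie> X i @ Y j"
proof (induction w rule: rev_induct)
  case Nil
  show ?case by (intro exI[of _ 0]) (simp add: pres_eq.refl)
next
  case (snoc a w)
  then obtain i j where w: "w \<bowtie> X i @ Y j" by auto
  have x: "\<exists>i' j'. w @ X k \<bowtie> X i' @ Y j'" for k
  proof -
    have "w @ X k \<bowtie> (X i @ Y j) @ X k" by (rule cat[OF w pres_eq.refl])
    moreover have "X i @ (Y j @ X k) \<bowtie> X i @ (X (mu ^ j * k) @ Y j)" by (rule cat[OF pres_eq.refl Yj_X])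
    ultimately have "w @ X k \<bowtie> X (i + mu ^ j * k) @ Y j"
      by (simp only: append_assoc replicate_add) (rule pres_eq.trans)
    then show ?thesis by blast
  qed
  have y: "\<exists>i' j'. w @ Y k \<bowtie> X i' @ Y j'" for k
  proof -
    have "w @ Y k \<bowtie> (X i @ Y j) @ Y k" by (rule cat[OF w pres_eq.refl])
    then have "w @ Y k \<bowtie> X i @ Y (j + k)" by (simp add: replicate_add)
    then show ?thesis by blast
  qed
  have step: "\<exists>i' j'. w @ [a] \<bowtie> X i' @ Y j'" if a: "[a] \<bowtie> u" and u: "\<exists>i' j'. w @ u \<bowtie> X i' @ Y j'" for u
  proof -
    obtain i' j' where "w @ u \<bowtie> X i' @ Y j'" using u by (elim exE)
    then show ?thesis using pres_eq.trans[OF cat[OF pres_eq.refl a, of w]] by (intro exI)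
  qed
  obtain s b where a: "a = (s, b)" by (cases a) auto
  show ?case
  proof (cases s)
    case Gen_x
    show ?thesis
    proof (cases b)
      case True
      then show ?thesis using x[of 1] a Gen_x by simp
    next
      case False
      then show ?thesis using step[OF _ x] X_inv a Gen_x by simp
    qed
  next
    case Gen_y
    show ?thesis
    proof (cases b)
      case True
      then show ?thesis using y[of 1] a Gen_y by simp
    next
      case False
      then show ?thesis using step[OF _ y] Y_inv a Gen_y by simp
    qed
  qed
qed

definition nf :: "nat \<Rightarrow> nat \<Rightarrow> gen word set" where
  "nf i j = pres_class E (X i @ Y j)"

lemma G_eq: "G = range (pres_class E)"
  by (simp add: metacyclic_def presented_group_def)

lemma nf_cong: "[i = i'] (mod p) \<Longrightarrow> [j = j'] (mod d) \<Longrightarrow> nf i j = nf i' j'"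
  unfolding nf_def pres_class_eq_iff by (intro cat X_cong Y_cong)

lemma nf_G: "nf i j \<in> G" by (simp add: nf_def G_eq)

lemma G_nf: "g \<in> G \<Longrightarrow> \<exists>i<p. \<exists>j<d. g = nf i j"
proof -
  assume "g \<in> G"
  then obtain w where "g = pres_class E w" by (auto simp: G_eq)
  moreover obtain i j where "w \<bowtie> X i @ Y j" using normal_form by blast
  ultimately have "g = nf i j" by (simp add: nf_def pres_class_eq_iff)
  also have "\<dots> = nf (i mod p) (j mod d)" by (rule nf_cong) (simp_all add: cong_def)
  finally show ?thesis using p_gt d_ge(1) by (intro exI[of _ "i mod p"] exI[of _ "j mod d"] conjI) auto
qed

lemma mult_class: "mult (metacyclic p m) (pres_class E u) (pres_class E v) = pres_class E (u @ v)"
  by (simp add: metacyclic_def presented_mult)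

lemma one_class: "one (metacyclic p m) = nf 0 0"
  by (simp add: metacyclic_def presented_group_def nf_def)

lemma mult_closed: "g \<in> G \<Longrightarrow> h \<in> G \<Longrightarrow> mult (metacyclic p m) g h \<in> G"
  by (auto simp: G_eq mult_class)

lemma y_class: "metacyclic_y p m = nf 0 1"
  by (simp add: metacyclic_y_def nf_def gen_pow_def)

lemma z_powi: "z powi m = z ^ mu"
proof -
  have "z powi m = z powi (m mod int p + int p * (m div int p))" by simp
  also have "\<dots> = z powi (m mod int p) * (z powi int p) powi (m div int p)"
    by (subst power_int_add) (simp_all add: power_int_mult)
  also have "z powi (m mod int p) = z ^ mu" using p_gt by (simp add: power_int_def)
  finally show ?thesis by simp
qed

lemma letter_act_ZO:
  assumes "v \<in> ZO"
  shows "letter_act p m v (Gen_x, True) = v * z" "letter_act p m v (Gen_x, False) = v * z ^ (p - 1)"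
    "letter_act p m v (Gen_y, True) = tau nu v" "letter_act p m v (Gen_y, False) = tau mu v"
proof -
  have "z * z ^ (p - 1) = 1" using p_gt zeta_pow_p by (simp flip: power_Suc)
  then have "inverse z = z ^ (p - 1)" by (rule inverse_unique)
  then show "letter_act p m v (Gen_x, False) = v * z ^ (p - 1)" by simp
  show "letter_act p m v (Gen_y, True) = tau nu v" by (simp only: letter_act.simps sigma_inv[OF z_powi assms])
  show "letter_act p m v (Gen_y, False) = tau mu v" using assms by (simp add: sigma_tau[OF z_powi])
qed simp

lemma letter_act_closed: "v \<in> ZO \<Longrightarrow> letter_act p m v a \<in> ZO"
proof -
  assume v: "v \<in> ZO"
  obtain s b where a: "a = (s, b)" by (cases a) auto
  show ?thesis unfolding a
    by (cases s; cases b) (simp_all only: letter_act_ZO[OF v] O_mult[OF v] O_zeta O_power tau_ZO[OF nd_nu v] tau_ZO[OF nd_mu v])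
qed

lemma word_act_append: "word_act p m v (u @ w) = word_act p m (word_act p m v u) w"
  by (simp add: word_act_def)

lemma word_act_ZO: "v \<in> ZO \<Longrightarrow> word_act p m v w \<in> ZO"
  unfolding word_act_def by (induction w arbitrary: v) (simp_all add: letter_act_closed del: letter_act.simps)

lemma word_act_X: "word_act p m v (X k) = v * z ^ k"
  by (induction k arbitrary: v) (simp_all add: word_act_def)

lemma word_act_Y: "v \<in> ZO \<Longrightarrow> word_act p m v (Y k) = T k v"
proof (induction k arbitrary: v)
  case 0
  then show ?case by (simp add: word_act_def tau_one[simplified])
next
  case (Suc k)
  have "word_act p m v (Y (Suc k)) = word_act p m (tau nu v) (Y k)"
    using letter_act_ZO(3)[OF Suc.prems] by (simp add: word_act_def del: letter_act.simps)
  also have "\<dots> = T k (T 1 v)" using Suc.IH[OF tau_ZO[OF nd_nu Suc.prems]] by simp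
  also have "\<dots> = T (k + 1) v" by (rule T_T[OF Suc.prems])
  finally show ?case by simp
qed

lemma letter_cancel: "v \<in> ZO \<Longrightarrow> word_act p m v [(s, b), (s, \<not> b)] = v"
proof -
  assume v: "v \<in> ZO"
  have e: "z * z ^ (p - 1) = 1" using p_gt zeta_pow_p by (simp flip: power_Suc)
  have zp: "z ^ (p - 1) \<in> ZO" by (intro O_power O_zeta)
  have e': "z ^ (p - 1) * z = 1" using e by (simp only: mult.commute)
  have 1: "letter_act p m (letter_act p m v (Gen_x, True)) (Gen_x, False) = v"
    by (simp only: letter_act_ZO(1)[OF v] letter_act_ZO(2)[OF O_mult[OF v O_zeta]] mult.assoc e mult_1_right)
  have 2: "letter_act p m (letter_act p m v (Gen_x, False)) (Gen_x, True) = v"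
    by (simp only: letter_act_ZO(2)[OF v] letter_act_ZO(1)[OF O_mult[OF v zp]] mult.assoc e' mult_1_right)
  have 3: "letter_act p m (letter_act p m v (Gen_y, True)) (Gen_y, False) = v"
    by (simp only: letter_act_ZO(3)[OF v] letter_act_ZO(4)[OF tau_ZO[OF nd_nu v]] tau_inv(1)[OF v])
  have 4: "letter_act p m (letter_act p m v (Gen_y, False)) (Gen_y, True) = v"
    by (simp only: letter_act_ZO(4)[OF v] letter_act_ZO(3)[OF tau_ZO[OF nd_mu v]] tau_inv(2)[OF v])
  show ?thesis
    unfolding word_act_def
    by (cases s; cases b) (simp_all only: foldl.simps 1 2 3 4 not_True_eq_False not_False_eq_True)
qed

lemma word_act_X_m: "v \<in> ZO \<Longrightarrow> word_act p m v (gen_pow Gen_x m) = v * z ^ mu"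
proof -
  assume v: "v \<in> ZO"
  have "word_act p m v (replicate n (Gen_x, False)) = v * inverse z ^ n" for n v
    by (induction n arbitrary: v) (simp_all add: word_act_def)
  then show ?thesis unfolding z_powi[symmetric] using word_act_X[of v "nat m"]
    by (simp add: gen_pow_def power_int_def)
qed

text \<open>Cancellations and the defining relations act trivially; for the relation between x and y
  this is the congruence \<open>mu_nu\<close>, since y acts by the inverse of
  \<open>sigma\<close>.\<close>

lemma word_act_cong: "u \<bowtie> w \<Longrightarrow> v \<in> ZO \<Longrightarrow> word_act p m v u = word_act p m v w"
proof (induction arbitrary: v rule: pres_eq.induct)
  case (cancel u s b w)
  have "word_act p m (word_act p m v u) [(s, b), (s, \<not> b)] = word_act p m v u"
    by (rule letter_cancel[OF word_act_ZO[OF cancel.prems]])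
  then show ?case by (simp only: word_act_append)
next
  case (relation l r u w)
  have "word_act p m v l = word_act p m v r" if v: "v \<in> ZO" for v
  proof -
    have 1: "nat \<bar>int p - 1\<bar> = d" "0 \<le> int p - 1" using p_gt by (auto simp: d_def)
    have "T d v = T 0 v" by (rule T_cong) (simp add: cong_def)
    then have 2: "word_act p m v (gen_pow Gen_y (int p - 1)) = v"
      using word_act_Y[OF v, of d] tau_one[OF v] 1 by (simp add: gen_pow_def)
    have 3: "word_act p m v (gen_pow Gen_x (int p)) = v"
      using word_act_X[of v p] by (simp add: gen_pow_def)
    have "word_act p m v (gen_pow Gen_x m @ gen_pow Gen_y 1) = tau nu (v * z ^ mu)"
      unfolding word_act_append word_act_X_m[OF v]
      using word_act_Y[of "v * z ^ mu" 1] O_mult[OF v O_power[OF O_zeta]] by (simp add: gen_pow_def)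
    also have "\<dots> = tau nu v * tau nu (z ^ mu)" by (rule tau_mult[OF nd_nu v O_power[OF O_zeta]])
    also have "tau nu (z ^ mu) = (z ^ nu) ^ mu" by (simp only: tau_power[OF nd_nu O_zeta] tau_zeta[OF nd_nu])
    also have "\<dots> = z ^ (mu * nu)" by (simp only: power_mult[symmetric] mult.commute)
    also have "\<dots> = z ^ 1" using mu_nu by (simp only: zeta_eq_iff)
    finally have 4: "word_act p m v (gen_pow Gen_x m @ gen_pow Gen_y 1) = tau nu v * z" by simp
    have 5: "word_act p m v (gen_pow Gen_y 1 @ gen_pow Gen_x 1) = tau nu v * z"
      unfolding word_act_append using word_act_Y[OF v, of 1] word_act_X[of "tau nu v" 1] by (simp add: gen_pow_def)
    have nil: "word_act p m v [] = v" by (simp add: word_act_def)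
    show ?thesis using relation.hyps unfolding metacyclic_rels_def using 2 3 4 5 nil by auto
  qed
  then show ?case using word_act_ZO[OF relation.prems, of u] by (simp only: word_act_append)
qed simp_all

lemma group_act_class: "v \<in> ZO \<Longrightarrow> group_act p m v (pres_class E w) = word_act p m v w"
proof -
  assume v: "v \<in> ZO"
  have "(SOME w'. w' \<in> pres_class E w) \<in> pres_class E w"
    by (rule someI[of "\<lambda>w'. w' \<in> pres_class E w" w]) (simp add: pres_class_def pres_eq.refl)
  then have "w \<bowtie> (SOME w'. w' \<in> pres_class E w)" by (simp add: pres_class_def)
  then show ?thesis unfolding group_act_def by (rule word_act_cong[OF _ v, symmetric])
qed

lemma group_act_nf: "v \<in> ZO \<Longrightarrow> group_act p m v (nf i j) = T j (v * z ^ i)"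
  unfolding nf_def using group_act_class[of v] word_act_Y[OF O_mult[OF _ O_power[OF O_zeta]], of v i j]
  by (simp add: word_act_append word_act_X)

lemma group_act_ZO: "v \<in> ZO \<Longrightarrow> g \<in> G \<Longrightarrow> group_act p m v g \<in> ZO"
  unfolding G_eq by (auto simp: group_act_class word_act_ZO)

lemma group_act_mult: "v \<in> ZO \<Longrightarrow> g \<in> G \<Longrightarrow> h \<in> G \<Longrightarrow>
    group_act p m v (mult (metacyclic p m) g h) = group_act p m (group_act p m v g) h"
  unfolding G_eq by (auto simp: mult_class group_act_class word_act_append word_act_ZO)

text \<open>The action on the cyclotomic integers separates normal forms: the images of 1 and
  \<open>z\<close> determine both exponents. So the presentation does not collapse, and the group
  has order \<open>p * d\<close>.\<close>

lemma nf_inj: assumes "nf i j = nf k l" shows "[i = k] (mod p)" "[j = l] (mod d)"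
proof -
  have e: "T j (v * z ^ i) = T l (v * z ^ k)" if "v \<in> ZO" for v
    using assms group_act_nf[OF that, of i j] group_act_nf[OF that, of k l] by simp
  have zk: "z ^ k \<in> ZO" for k by (intro O_power O_zeta)
  have 1: "(z ^ (nu ^ j)) ^ i = (z ^ (nu ^ l)) ^ k"
    using e[OF O_1] by (simp add: tau_power nd_nu_pow O_zeta tau_zeta)
  have "z ^ (nu ^ j) * (z ^ (nu ^ j)) ^ i = z ^ (nu ^ l) * (z ^ (nu ^ l)) ^ k"
    using e[OF O_zeta] by (simp add: tau_mult zk tau_power nd_nu_pow O_zeta tau_zeta)
  then have "z ^ (nu ^ j) = z ^ (nu ^ l)" unfolding 1 by simp
  then have jl: "[nu ^ j = nu ^ l] (mod p)" by (simp only: zeta_eq_iff)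
  then show "[j = l] (mod d)" by (simp only: nu_pow_eq)
  have "z ^ (nu ^ j) = z ^ (nu ^ l)" by fact
  then have "z ^ (nu ^ l * i) = z ^ (nu ^ l * k)" using 1 by (simp only: power_mult)
  then have "[nu ^ l * i = nu ^ l * k] (mod p)" by (simp only: zeta_eq_iff)
  then show "[i = k] (mod p)"
    using prime_imp_coprime[OF prime nd_nu_pow[of l]] by (simp add: cong_mult_lcancel_nat coprime_commute)
qed

end


section \<open>The group ring as a subring of pairs\<close>

text \<open>One-dimensional characters trivial on x; for \<open>r\<close> running over the d-th
  roots of unity they give the projection to the cyclic group ring.\<close>

fun letter_val :: "complex \<Rightarrow> gen \<times> bool \<Rightarrow> complex" where
  "letter_val r (Gen_x, b) = 1"
| "letter_val r (Gen_y, True) = r"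
| "letter_val r (Gen_y, False) = inverse r"

definition word_val :: "complex \<Rightarrow> gen word \<Rightarrow> complex" where
  "word_val r w = prod_list (map (letter_val r) w)"

lemma word_val_append: "word_val r (u @ w) = word_val r u * word_val r w"
  by (simp add: word_val_def)

context metacyclic_group
begin

abbreviation Lam where "Lam \<equiv> Lambda p m"
abbreviation gm (infixl "\<diamondop>" 70) where "g \<diamondop> h \<equiv> mult (metacyclic p m) g h"

lemma word_val_X: "word_val r (replicate k (Gen_x, b)) = 1"
  by (induction k) (simp_all add: word_val_def)

lemma word_val_Y: "word_val r (Y k) = r ^ k"
  by (induction k) (simp_all add: word_val_def)

lemma word_val_cong: "u \<bowtie> w \<Longrightarrow> r ^ d = 1 \<Longrightarrow> word_val r u = word_val r w"
proof (induction rule: pres_eq.induct)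
  case (cancel u s b w)
  then have "r \<noteq> 0" using d_ge(1) by (auto simp: power_0_left)
  then have "word_val r [(s, b), (s, \<not> b)] = 1"
    by (cases s; cases b) (simp_all add: word_val_def)
  then show ?case by (simp add: word_val_append del: append_Cons append_Nil)
next
  case (relation l r' u w)
  have 1: "nat \<bar>int p - 1\<bar> = d" "0 \<le> int p - 1" and gt0: "0 < p" using p_gt by (auto simp: d_def)
  have nil: "word_val r [] = 1" by (simp add: word_val_def)
  have rl: "word_val r (replicate d (Gen_y, True)) = 1" using relation.prems by (simp only: word_val_Y)
  have c: "word_val r [(Gen_y, True), (Gen_x, True)] = r" "word_val r [(Gen_y, True)] = r" by (simp_all add: word_val_def)
  have "word_val r l = word_val r r'"
    using relation.hyps unfolding metacyclic_rels_def gen_pow_def 1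
    by (auto simp: word_val_X word_val_append nil rl c gt0)
  then show ?case by (simp only: word_val_append)
qed simp_all

definition chi :: "complex \<Rightarrow> gen word set \<Rightarrow> complex" where
  "chi r g = word_val r (SOME w. w \<in> g)"

lemma chi_class: "r ^ d = 1 \<Longrightarrow> chi r (pres_class E w) = word_val r w"
proof -
  assume r: "r ^ d = 1"
  have "(SOME w'. w' \<in> pres_class E w) \<in> pres_class E w"
    by (rule someI[of "\<lambda>w'. w' \<in> pres_class E w" w]) (simp add: pres_class_def pres_eq.refl)
  then have "w \<bowtie> (SOME w'. w' \<in> pres_class E w)" by (simp add: pres_class_def)
  from word_val_cong[OF this r] show ?thesis unfolding chi_def by (rule HOL.sym)
qed

lemma chi_mult: "r ^ d = 1 \<Longrightarrow> g \<in> G \<Longrightarrow> h \<in> G \<Longrightarrow> chi r (g \<diamondop> h) = chi r g * chi r h"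
  unfolding G_eq by (auto simp: mult_class chi_class word_val_append)

lemma chi_nf: "r ^ d = 1 \<Longrightarrow> chi r (nf i j) = r ^ j"
  by (simp add: nf_def chi_class word_val_append word_val_X word_val_Y)

lemma nf_bij: "bij_betw (\<lambda>x. nf (fst x) (snd x)) ({..<p} \<times> {..<d}) G"
  unfolding bij_betw_def
proof
  show "inj_on (\<lambda>x. nf (fst x) (snd x)) ({..<p} \<times> {..<d})"
  proof (rule inj_onI)
    fix x y assume xy: "x \<in> {..<p} \<times> {..<d}" "y \<in> {..<p} \<times> {..<d}" "nf (fst x) (snd x) = nf (fst y) (snd y)"
    then show "x = y" using nf_inj[OF xy(3)] by (auto simp: cong_def)
  qed
  show "(\<lambda>x. nf (fst x) (snd x)) ` ({..<p} \<times> {..<d}) = G"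
  proof (intro equalityI subsetI)
    fix g assume "g \<in> G"
    then obtain i j where "i < p" "j < d" "g = nf i j" using G_nf by blast
    then show "g \<in> (\<lambda>x. nf (fst x) (snd x)) ` ({..<p} \<times> {..<d})" by (intro image_eqI[of _ _ "(i, j)"]) simp_all
  qed (auto simp: nf_G)
qed

lemma finite_G: "finite G"
  using bij_betw_finite[OF nf_bij] by simp

lemma sum_G: "(\<Sum>g\<in>G. F g) = (\<Sum>j<d. \<Sum>i<p. F (nf i j))"
proof -
  have "(\<Sum>g\<in>G. F g) = (\<Sum>x\<in>{..<p} \<times> {..<d}. F (nf (fst x) (snd x)))"
    by (rule sum.reindex_bij_betw[OF nf_bij, symmetric])
  also have "\<dots> = (\<Sum>i<p. \<Sum>j<d. F (nf i j))" by (simp add: sum.cartesian_product case_prod_beta)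
  also have "\<dots> = (\<Sum>j<d. \<Sum>i<p. F (nf i j))" by (rule sum.swap)
  finally show ?thesis .
qed

lemma Lam_carrier: "a \<in> carrier Lam \<longleftrightarrow> supp a \<subseteq> G"
  unfolding Lambda_def group_ring_def using finite_G by (auto intro: finite_subset)

lemma Lam_ops: "mult Lam = (\<lambda>f g z. \<Sum>(a, b) \<in> {(a, b) \<in> supp f \<times> supp g. a \<diamondop> b = z}. f a * g b)"
  "one Lam = basis_elt (nf 0 0)" "zero Lam = (\<lambda>_. 0)" "add Lam = (\<lambda>f g z. f z + g z)"
  by (simp_all add: Lambda_def group_ring_def one_class)

text \<open>Sorting the pairs of group elements by their product. One computation serves the
  multiplicativity of both \<open>rho\<close> and \<open>act\<close>.\<close>

lemma convolution:
  fixes F :: "gen word set \<Rightarrow> complex"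
  assumes a: "a \<in> carrier Lam" and b: "b \<in> carrier Lam"
  shows "(\<Sum>g\<in>G. of_int ((a \<otimes>\<^bsub>Lam\<^esub> b) g) * F g) = (\<Sum>g\<in>G. \<Sum>h\<in>G. of_int (a g * b h) * F (g \<diamondop> h))"
proof -
  have ab: "supp a \<subseteq> G" "supp b \<subseteq> G" using a b by (simp_all add: Lam_carrier)
  have "(a \<otimes>\<^bsub>Lam\<^esub> b) g = (\<Sum>x\<in>{x\<in>G \<times> G. fst x \<diamondop> snd x = g}. a (fst x) * b (snd x))" for g
    unfolding Lam_ops case_prod_beta
    by (rule sum.mono_neutral_left) (use ab finite_G in \<open>auto simp: supp_def\<close>)
  then have "(\<Sum>g\<in>G. of_int ((a \<otimes>\<^bsub>Lam\<^esub> b) g) * F g) =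
      (\<Sum>g\<in>G. \<Sum>x\<in>{x\<in>G \<times> G. fst x \<diamondop> snd x = g}. of_int (a (fst x) * b (snd x)) * F (fst x \<diamondop> snd x))"
    by (simp add: sum_distrib_right)
  also have "\<dots> = (\<Sum>x\<in>G \<times> G. of_int (a (fst x) * b (snd x)) * F (fst x \<diamondop> snd x))"
    by (rule sum.group) (use finite_G mult_closed in auto)
  also have "\<dots> = (\<Sum>g\<in>G. \<Sum>h\<in>G. of_int (a g * b h) * F (g \<diamondop> h))"
    by (simp add: sum.cartesian_product case_prod_beta)
  finally show ?thesis .
qed

lemma mult_carrier: assumes "a \<in> carrier Lam" "b \<in> carrier Lam" shows "a \<otimes>\<^bsub>Lam\<^esub> b \<in> carrier Lam"
proof -
  have ab: "supp a \<subseteq> G" "supp b \<subseteq> G" using assms by (simp_all add: Lam_carrier)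
  have "g \<in> G" if "(a \<otimes>\<^bsub>Lam\<^esub> b) g \<noteq> 0" for g
  proof -
    have "{(x, y) \<in> supp a \<times> supp b. x \<diamondop> y = g} \<noteq> {}"
    proof
      assume e: "{(x, y) \<in> supp a \<times> supp b. x \<diamondop> y = g} = {}"
      have "(a \<otimes>\<^bsub>Lam\<^esub> b) g = 0" unfolding Lam_ops e by simp
      then show False using that by simp
    qed
    then obtain x y where "x \<in> supp a" "y \<in> supp b" "x \<diamondop> y = g" by auto
    then show ?thesis using ab mult_closed by auto
  qed
  then show ?thesis unfolding Lam_carrier supp_def by auto
qed

text \<open>The image in the cyclic group ring, in the encoding of \<open>cyc_ring\<close> by values
  at roots of unity.\<close>

definition rho :: "lambda_elt \<Rightarrow> complex \<Rightarrow> complex" where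
  "rho a = (\<lambda>w. \<Sum>g\<in>G. of_int (a g) * chi (root_or_1 d w) g)"

lemma rho_coords: "rho a w = (\<Sum>j<d. of_int (\<Sum>i<p. a (nf i j)) * root_or_1 d w ^ j)"
  unfolding rho_def sum_G by (simp add: chi_nf sum_distrib_right)

lemma rho_ring: "rho a \<in> cyc_ring d"
proof -
  have "rho a = (\<lambda>w. \<Sum>j<d. of_int (\<Sum>i<p. a (nf i j)) * root_or_1 d w ^ j)" by (rule ext) (rule rho_coords)
  then show ?thesis using cyc_ring_sum_mem by metis
qed

lemma rho_mult: "a \<in> carrier Lam \<Longrightarrow> b \<in> carrier Lam \<Longrightarrow> rho (a \<otimes>\<^bsub>Lam\<^esub> b) = rho a * rho b"
proof
  fix w assume ab: "a \<in> carrier Lam" "b \<in> carrier Lam"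
  have "rho (a \<otimes>\<^bsub>Lam\<^esub> b) w = (\<Sum>g\<in>G. \<Sum>h\<in>G. of_int (a g * b h) * chi (root_or_1 d w) (g \<diamondop> h))"
    unfolding rho_def by (rule convolution[OF ab])
  also have "\<dots> = (\<Sum>g\<in>G. \<Sum>h\<in>G. (of_int (a g) * chi (root_or_1 d w) g) * (of_int (b h) * chi (root_or_1 d w) h))"
    by (intro sum.cong HOL.refl) (simp add: chi_mult)
  finally show "rho (a \<otimes>\<^bsub>Lam\<^esub> b) w = (rho a * rho b) w" by (simp add: rho_def sum_product)
qed

lemma supp_sum: "a \<in> carrier Lam \<Longrightarrow> (\<Sum>g\<in>supp a. of_int (a g) * F g) = (\<Sum>g\<in>G. of_int (a g) * (F g :: complex))"
  unfolding Lam_carrier by (rule sum.mono_neutral_left) (auto simp: finite_G supp_def)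

abbreviation act where "act \<equiv> cyc_act p m"

text \<open>The coefficient of the j-th power of y, an element of the group ring of x, evaluated at
  \<open>z\<close>.\<close>

definition fc :: "lambda_elt \<Rightarrow> nat \<Rightarrow> complex" where
  "fc a j = (\<Sum>i<p. of_int (a (nf i j)) * z ^ i)"

lemma zpow_ZO: "z ^ k \<in> ZO" by (intro O_power O_zeta)

lemma fc_ZO: "fc a j \<in> ZO" unfolding fc_def by (intro O_sum O_mult O_int zpow_ZO)

lemma T_closed: "v \<in> ZO \<Longrightarrow> T j v \<in> ZO" by (rule tau_ZO[OF nd_nu_pow])

lemma act_sum: assumes "a \<in> carrier Lam" "v \<in> ZO" shows "act v a = (\<Sum>j<d. T j (v * fc a j))"
proof -
  have "act v a = (\<Sum>j<d. \<Sum>i<p. of_int (a (nf i j)) * T j (v * z ^ i))"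
    unfolding cyc_act_def supp_sum[OF assms(1)] sum_G by (simp only: group_act_nf[OF assms(2)])
  also have "\<dots> = (\<Sum>j<d. T j (v * fc a j))"
  proof (rule sum.cong[OF HOL.refl])
    fix j
    have "T j (v * fc a j) = (\<Sum>i<p. T j (of_int (a (nf i j)) * (v * z ^ i)))"
      unfolding fc_def sum_distrib_left
      by (subst tau_sum[OF nd_nu_pow]) (auto simp: mult.left_commute intro!: O_mult O_int zpow_ZO assms(2))
    also have "\<dots> = (\<Sum>i<p. of_int (a (nf i j)) * T j (v * z ^ i))"
      by (intro sum.cong HOL.refl) (simp only: tau_mult[OF nd_nu_pow O_int O_mult[OF assms(2) zpow_ZO]] tau_int[OF nd_nu_pow])
    finally show "(\<Sum>i<p. of_int (a (nf i j)) * T j (v * z ^ i)) = T j (v * fc a j)" by (rule HOL.sym)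
  qed
  finally show ?thesis .
qed

text \<open>The coefficients are twisted by \<open>T j\<close> because in a normal form the power of
  x acts before the power of y.\<close>

lemma act_op: "a \<in> carrier Lam \<Longrightarrow> v \<in> ZO \<Longrightarrow> act v a = op (\<lambda>j. T j (fc a j)) v"
  unfolding op_def by (simp only: act_sum tau_mult[OF nd_nu_pow _ fc_ZO])

lemma act_ZO: "a \<in> carrier Lam \<Longrightarrow> v \<in> ZO \<Longrightarrow> act v a \<in> ZO"
  by (simp only: act_sum) (intro O_sum T_closed O_mult fc_ZO)

lemma act_P: "a \<in> carrier Lam \<Longrightarrow> v \<in> P \<Longrightarrow> act v a \<in> P"
  by (simp only: act_sum P_O) (intro P_sum tau_P nd_nu_pow P_mult fc_ZO)

lemma act_add: "a \<in> carrier Lam \<Longrightarrow> v \<in> ZO \<Longrightarrow> w \<in> ZO \<Longrightarrow> act (v + w) a = act v a + act w a"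
  by (simp only: act_sum O_add distrib_right tau_add[OF nd_nu_pow O_mult[OF _ fc_ZO] O_mult[OF _ fc_ZO]] sum.distrib)

lemma act_scale: "a \<in> carrier Lam \<Longrightarrow> v \<in> ZO \<Longrightarrow> act (of_int k * v) a = of_int k * act v a"
  by (simp only: act_sum O_mult O_int mult.assoc tau_mult[OF nd_nu_pow O_int O_mult[OF _ fc_ZO]] tau_int[OF nd_nu_pow] sum_distrib_left)

lemma act_lc: assumes a: "a \<in> carrier Lam" shows "act (lc c) a = (\<Sum>k = 1..d. of_int (c k) * act (pr ^ k) a)"
proof -
  have "act (\<Sum>k\<in>S. of_int (c k) * pr ^ k) a = (\<Sum>k\<in>S. of_int (c k) * act (pr ^ k) a)" if "finite S" for S
    using that
  proof (induction S rule: finite_induct)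
    case empty
    show ?case using act_scale[OF a O_int[of 0], of 0] by simp
  next
    case (insert x S)
    have m: "of_int (c x) * pr ^ x \<in> ZO" "(\<Sum>k\<in>S. of_int (c k) * pr ^ k) \<in> ZO"
      by (intro O_sum O_mult O_int pr_pow_ZO)+
    show ?case using insert by (simp add: act_add[OF a m] act_scale[OF a pr_pow_ZO])
  qed
  then show ?thesis by (simp add: lc_def)
qed

lemma act_mult:
  assumes a: "a \<in> carrier Lam" and b: "b \<in> carrier Lam" and v: "v \<in> ZO"
  shows "act v (a \<otimes>\<^bsub>Lam\<^esub> b) = act (act v a) b"
proof -
  have lin: "group_act p m (\<Sum>g\<in>S. of_int (a g) * group_act p m v g) h = (\<Sum>g\<in>S. of_int (a g) * group_act p m (group_act p m v g) h)"
    if h: "h \<in> G" and S: "S \<subseteq> G" for S h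
  proof -
    obtain i j where ij: "h = nf i j" using G_nf[OF h] by auto
    have m: "of_int (a g) * group_act p m v g \<in> ZO" if "g \<in> S" for g
      using S that by (intro O_mult O_int group_act_ZO v) auto
    have "group_act p m (\<Sum>g\<in>S. of_int (a g) * group_act p m v g) h =
       T j (\<Sum>g\<in>S. of_int (a g) * (group_act p m v g * z ^ i))"
      unfolding ij using m by (subst group_act_nf) (auto intro!: O_sum simp: sum_distrib_right mult.assoc)
    also have "\<dots> = (\<Sum>g\<in>S. T j (of_int (a g) * (group_act p m v g * z ^ i)))"
      using S by (subst tau_sum[OF nd_nu_pow]) (auto intro!: O_mult O_int zpow_ZO group_act_ZO v)
    also have "\<dots> = (\<Sum>g\<in>S. of_int (a g) * group_act p m (group_act p m v g) h)"
    proof (rule sum.cong[OF HOL.refl])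
      fix g assume "g \<in> S"
      then have "group_act p m v g \<in> ZO" using S by (intro group_act_ZO v) auto
      then show "T j (of_int (a g) * (group_act p m v g * z ^ i)) = of_int (a g) * group_act p m (group_act p m v g) h"
        unfolding ij by (simp add: group_act_nf tau_mult nd_nu_pow O_int O_mult zpow_ZO tau_int)
    qed
    finally show ?thesis .
  qed
  have "act v (a \<otimes>\<^bsub>Lam\<^esub> b) = (\<Sum>g\<in>G. \<Sum>h\<in>G. of_int (a g * b h) * group_act p m v (g \<diamondop> h))"
    unfolding cyc_act_def supp_sum[OF mult_carrier[OF a b]] by (rule convolution[OF a b])
  also have "\<dots> = (\<Sum>h\<in>G. \<Sum>g\<in>G. of_int (a g * b h) * group_act p m v (g \<diamondop> h))" by (rule sum.swap)
  also have "\<dots> = (\<Sum>h\<in>G. of_int (b h) * group_act p m (act v a) h)"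
    unfolding cyc_act_def supp_sum[OF a]
    by (rule sum.cong[OF HOL.refl]) (simp add: lin sum_distrib_left group_act_mult[OF v] ac_simps)
  finally show ?thesis unfolding cyc_act_def[of p m "act v a"] supp_sum[OF b] .
qed

text \<open>\<open>lam_tilde\<close> is not restricted to the index range; setting the other rows to
  0 makes comparing matrices the same as comparing functions.\<close>

definition Dm :: "lambda_elt \<Rightarrow> nat \<Rightarrow> nat \<Rightarrow> int" where
  "Dm a = (\<lambda>i. if i \<in> {1..d} then lam_tilde p m a i else (\<lambda>_. 0))"

lemma Dm_eq: "i \<in> {1..d} \<Longrightarrow> Dm a i = co (act (pr ^ i) a)"
  by (simp add: Dm_def lam_tilde_def pr_def fun_eq_iff)

lemma Dm_supp: assumes "a \<in> carrier Lam" "i \<notin> {1..d} \<or> k \<notin> {1..d}" shows "Dm a i k = 0"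
proof (cases "i \<in> {1..d}")
  case True
  then have "act (pr ^ i) a \<in> P" by (intro act_P[OF assms(1) P_pr_pow]) simp
  then show ?thesis using coords(2) assms(2) True by (simp only: Dm_eq) blast
next
  case False
  then show ?thesis unfolding Dm_def by (simp only: if_False)
qed

lemma Dm_comb:
  assumes a: "a \<in> carrier Lam"
  shows "co (act (lc c) a) = vm d c (Dm a)"
proof
  fix k
  have P: "act (pr ^ i) a \<in> P" if "i \<in> {1..d}" for i using act_P[OF a P_pr_pow] that by simp
  show "co (act (lc c) a) k = vm d c (Dm a) k"
  proof (cases "k \<in> {1..d}")
    case True
    have "co (act (lc c) a) k = (\<Sum>i = 1..d. co (of_int (c i) * act (pr ^ i) a) k)"
      unfolding act_lc[OF a] by (rule coords_sum) (rule P_int[OF P])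
    also have "\<dots> = (\<Sum>i = 1..d. c i * Dm a i k)"
      by (rule sum.cong[OF HOL.refl]) (simp only: coords_scale[OF P] Dm_eq)
    finally show ?thesis using True by (simp add: vm_def)
  next
    case False
    then show ?thesis using coords(2)[OF act_P[OF a lc_P]] by (simp only: vm_def if_False)
  qed
qed

lemma Dm_row: "a \<in> carrier Lam \<Longrightarrow> i \<in> {1..d} \<Longrightarrow> act (pr ^ i) a = lc (Dm a i)"
  using coords(1)[OF act_P[OF _ P_pr_pow]] by (simp add: Dm_eq)

definition Phi :: "lambda_elt \<Rightarrow> el" where "Phi a = (rho a, Dm a)"

lemma Phi_mult: assumes a: "a \<in> carrier Lam" and b: "b \<in> carrier Lam"
  shows "Phi (a \<otimes>\<^bsub>Lam\<^esub> b) = elm d (Phi a) (Phi b)"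
proof -
  have "Dm (a \<otimes>\<^bsub>Lam\<^esub> b) i = vm d (Dm a i) (Dm b)" for i
  proof (cases "i \<in> {1..d}")
    case True
    then show ?thesis
      by (simp only: Dm_eq[of i "a \<otimes>\<^bsub>Lam\<^esub> b"] act_mult[OF a b pr_pow_ZO] Dm_row[OF a] Dm_comb[OF b])
  next
    case False
    then have "Dm (a \<otimes>\<^bsub>Lam\<^esub> b) i = 0" "Dm a i = 0" by (auto simp: Dm_def zero_fun_def)
    then show ?thesis by simp
  qed
  then show ?thesis by (simp add: Phi_def elm_def rho_mult[OF a b] fun_eq_iff)
qed

lemma Lam_carrier_iff: "a \<in> carrier Lam \<longleftrightarrow> (\<forall>g. g \<notin> G \<longrightarrow> a g = 0)"
  unfolding Lam_carrier supp_def by auto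

lemma add_carrier: "a \<in> carrier Lam \<Longrightarrow> b \<in> carrier Lam \<Longrightarrow> a + b \<in> carrier Lam"
  unfolding Lam_carrier_iff by simp

lemma neg_carrier: "a \<in> carrier Lam \<Longrightarrow> - a \<in> carrier Lam"
  unfolding Lam_carrier supp_def by auto

lemma rho_add: "rho (a + b) = rho a + rho b"
  by (simp add: rho_def fun_eq_iff distrib_right sum.distrib)

lemma fc_add: "fc (a + b) j = fc a j + fc b j"
  by (simp add: fc_def distrib_right sum.distrib)

text \<open>\<open>e\<close> is kept separate from \<open>a + b\<close> so that the criterion also
  applies to a product \<open>e\<close>, where actions are compared instead of coefficients.\<close>

lemma Phi_addI:
  assumes a: "a \<in> carrier Lam" and b: "b \<in> carrier Lam" and e: "e \<in> carrier Lam"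
    and rho: "\<And>w. rho e w = rho a w + rho b w"
    and act: "\<And>v. v \<in> ZO \<Longrightarrow> act v e = act v a + act v b"
  shows "Phi e = Phi a + Phi b"
proof -
  have "Dm e i k = Dm a i k + Dm b i k" for i k
  proof (cases "i \<in> {1..d}")
    case True
    then have "act (pr ^ i) a \<in> P" "act (pr ^ i) b \<in> P" by (intro act_P a b P_pr_pow; simp)+
    then show ?thesis unfolding Dm_eq[OF True] act[OF pr_pow_ZO] by (simp add: coords_add)
  next
    case False
    then show ?thesis unfolding Dm_def by (simp only: if_False)
  qed
  then show ?thesis by (simp add: Phi_def rho fun_eq_iff)
qed

lemma Phi_add: assumes a: "a \<in> carrier Lam" and b: "b \<in> carrier Lam" shows "Phi (a + b) = Phi a + Phi b"
proof (rule Phi_addI[OF a b add_carrier[OF a b]])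
  show "act v (a + b) = act v a + act v b" if v: "v \<in> ZO" for v
    by (simp only: act_sum[OF add_carrier[OF a b] v] act_sum[OF a v] act_sum[OF b v] fc_add distrib_left
        tau_add[OF nd_nu_pow O_mult[OF v fc_ZO] O_mult[OF v fc_ZO]] sum.distrib)
qed (simp add: rho_add)

lemma Phi_0: "Phi 0 = 0"
proof -
  have 0: "0 \<in> carrier Lam" by (simp add: Lam_carrier supp_def)
  show ?thesis using Phi_add[OF 0 0] by simp
qed

lemma Phi_neg: "a \<in> carrier Lam \<Longrightarrow> Phi (- a) = - Phi a"
  using Phi_add[OF _ neg_carrier, of a a] Phi_0 by (simp add: eq_neg_iff_add_eq_0 add.commute)

lemma coeff_cyc_zero:
  assumes "\<And>w. (\<Sum>j<d. of_int (c j) * root_or_1 d w ^ j) = 0" "j < d"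
  shows "c j = (0 :: int)"
proof -
  define g where "g = (\<Sum>j<d. Polynomial.monom (of_int (c j) :: complex) j)"
  have g: "poly g x = (\<Sum>j<d. of_int (c j) * x ^ j)" for x by (simp add: g_def poly_sum poly_monom)
  have "g = 0"
  proof (rule ccontr)
    assume g0: "g \<noteq> 0"
    have "poly g w = 0" if "w ^ d = 1" for w using assms(1)[of w] that unfolding g by (simp add: root_or_1_def)
    then have "{w. w ^ d = 1} \<subseteq> {x. poly g x = 0}" by auto
    then have "card {w::complex. w ^ d = 1} \<le> card {x. poly g x = 0}" by (rule card_mono[OF poly_roots_finite[OF g0]])
    also have "card {w::complex. w ^ d = 1} = d" by (rule card_complex_roots_unity) (use d_ge(1) in simp)
    also have "card {x. poly g x = 0} \<le> degree g" by (rule card_poly_roots_bound[OF g0])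
    also have "degree g \<le> d - 1" unfolding g_def
      by (rule degree_sum_le) (auto intro: order.trans[OF degree_monom_le])
    finally show False using d_ge(1) by simp
  qed
  then have "poly.coeff g j = 0" by simp
  moreover have "poly.coeff g j = of_int (c j)"
  proof -
    have "poly.coeff g j = (\<Sum>k<d. if k = j then of_int (c k) else 0)"
      unfolding g_def coeff_sum by (intro sum.cong) auto
    then show ?thesis using assms(2) by simp
  qed
  ultimately show ?thesis by simp
qed

lemma rho_0: assumes "rho a = 0" "j < d" shows "(\<Sum>i<p. a (nf i j)) = 0"
  by (rule coeff_cyc_zero[OF _ assms(2)]) (use assms(1) rho_coords[of a] in \<open>simp add: fun_eq_iff\<close>)

lemma act_zero_fc:
  assumes a: "a \<in> carrier Lam" and "\<And>v. v \<in> P \<Longrightarrow> act v a = 0" and j: "j < d"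
  shows "fc a j = 0"
proof -
  have "T j (fc a j) = 0" by (rule op_inj[of "\<lambda>j. T j (fc a j)", OF _ j]) (use assms(2) act_op[OF a P_O] in simp)
  then have "T (d - j) (T j (fc a j)) = 0" using tau_0[OF nd_nu_pow] by simp
  moreover have "T (d - j) (T j (fc a j)) = T 0 (fc a j)"
    unfolding T_T[OF fc_ZO] using j by (intro T_cong) (simp add: cong_def)
  ultimately show ?thesis using tau_one[OF fc_ZO] by simp
qed

text \<open>The relation at \<open>z\<close> passes to its conjugates, and the vanishing sum of the
  coefficients is the relation at 1; this covers all p-th roots of unity.\<close>

lemma zeta_coeffs_zero:
  assumes z0: "(\<Sum>i<p. of_int (c i) * z ^ i) = 0" and s0: "(\<Sum>i<p. c i) = 0" and i: "i < p"
  shows "c i = (0 :: int)"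
proof (rule coeffs_zero[OF _ i])
  fix w :: complex assume w: "w ^ p = 1"
  define f where "f = (\<Sum>i<p. Polynomial.monom (c i) i)"
  have f: "zpoly f w = (\<Sum>i<p. of_int (c i) * w ^ i)" for w by (simp add: f_def)
  have "zpoly f z = 0" unfolding f by (rule z0)
  moreover have "poly f 1 = 0" using s0 by (simp add: f_def poly_sum poly_monom)
  ultimately show "(\<Sum>i<p. of_int (c i) * w ^ i) = 0" using root_cases[OF w] f by metis
qed

lemma act_zero: assumes a: "a \<in> carrier Lam" and D: "Dm a = 0" and v: "v \<in> P" shows "act v a = 0"
proof -
  have "act (lc (co v)) a = lc (co (act (lc (co v)) a))" by (rule coords(1)[OF act_P[OF a lc_P]])
  also have "co (act (lc (co v)) a) = vm d (co v) (Dm a)" by (rule Dm_comb[OF a])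
  also have "\<dots> = 0" unfolding D by simp
  also have "lc 0 = 0" by (simp add: lc_def)
  finally show ?thesis using coords(1)[OF v] by simp
qed

text \<open>For a fixed power of y, \<open>rho\<close> controls the sum of the coefficients and the
  action controls their combination with the powers of \<open>z\<close>; together these determine
  all of them.\<close>

lemma Phi_inj0: assumes a: "a \<in> carrier Lam" and "Phi a = 0" shows "a = 0"
proof
  fix g
  have r: "rho a = 0" and D: "Dm a = 0" using assms(2) by (auto simp: Phi_def prod_eq_iff)
  show "a g = 0 g"
  proof (cases "g \<in> G")
    case True
    then obtain i j where ij: "i < p" "j < d" "g = nf i j" using G_nf by blast
    have "a (nf i j) = 0"
      by (rule zeta_coeffs_zero[OF _ rho_0[OF r ij(2)] ij(1)])
        (use act_zero_fc[OF a act_zero[OF a D] ij(2)] in \<open>simp add: fc_def\<close>)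
    then show ?thesis by (simp add: ij)
  next
    case False
    then show ?thesis using a unfolding Lam_carrier supp_def by auto
  qed
qed

lemma Phi_inj: "inj_on Phi (carrier Lam)"
proof (rule inj_onI)
  fix a b assume ab: "a \<in> carrier Lam" "b \<in> carrier Lam" "Phi a = Phi b"
  then have "Phi (a + - b) = 0" by (simp only: Phi_add neg_carrier Phi_neg) simp
  then have "a + - b = 0" using Phi_inj0[OF add_carrier[OF ab(1) neg_carrier[OF ab(2)]]] by simp
  then show "a = b" by simp
qed

end


section \<open>The image of the group ring\<close>

context metacyclic_group
begin

definition elt :: "(nat \<Rightarrow> nat \<Rightarrow> int) \<Rightarrow> lambda_elt" where
  "elt A g = (\<Sum>j<d. \<Sum>i<p. if g = nf i j then A i j else 0)"

lemma nf_eq_iff: "i < p \<Longrightarrow> j < d \<Longrightarrow> k < p \<Longrightarrow> l < d \<Longrightarrow> nf i j = nf k l \<longleftrightarrow> i = k \<and> j = l"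
  using nf_inj[of i j k l] by (auto simp: cong_def)

lemma elt_nf: assumes "i < p" "j < d" shows "elt A (nf i j) = A i j"
proof -
  have "elt A (nf i j) = (\<Sum>l<d. \<Sum>k<p. if k = i then (if l = j then A i j else 0) else 0)"
    unfolding elt_def by (intro sum.cong HOL.refl) (use assms in \<open>auto simp: nf_eq_iff\<close>)
  also have "\<dots> = A i j" using assms by simp
  finally show ?thesis .
qed

lemma elt_carrier: "elt A \<in> carrier Lam"
  unfolding Lam_carrier_iff elt_def using nf_G by (auto intro!: sum.neutral)

lemma fc_elt: "j < d \<Longrightarrow> fc (elt A) j = (\<Sum>i<p. of_int (A i j) * z ^ i)"
  unfolding fc_def by (intro sum.cong HOL.refl) (simp add: elt_nf)

lemma rho_elt: "rho (elt A) w = (\<Sum>j<d. of_int (\<Sum>i<p. A i j) * root_or_1 d w ^ j)"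
  unfolding rho_coords by (intro sum.cong HOL.refl arg_cong2[where f = "(*)"] arg_cong[where f = of_int]) (simp add: elt_nf)

lemma supp_basis: "supp (basis_elt g) = {g}"
  by (auto simp: supp_def basis_elt_def)

lemma basis_carrier: "g \<in> G \<Longrightarrow> basis_elt g \<in> carrier Lam"
  unfolding Lam_carrier supp_basis by simp

lemma act_basis: "act v (basis_elt g) = group_act p m v g"
  unfolding cyc_act_def supp_basis by (simp add: basis_elt_def)

lemma rho_basis: assumes "g \<in> G" shows "rho (basis_elt g) w = chi (root_or_1 d w) g"
proof -
  have "rho (basis_elt g) w = (\<Sum>h\<in>G. if h = g then chi (root_or_1 d w) g else 0)"
    unfolding rho_def by (intro sum.cong) (auto simp: basis_elt_def)
  then show ?thesis using assms finite_G by simp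
qed

lemma T_0: "v \<in> ZO \<Longrightarrow> T 0 v = v" unfolding power_0 by (rule tau_one)

abbreviation one_L where "one_L \<equiv> basis_elt (nf 0 0)"
definition y_L where "y_L = basis_elt (nf 0 1)"

lemma act_one: "v \<in> ZO \<Longrightarrow> act v one_L = v"
  by (simp only: act_basis group_act_nf) (simp add: tau_one[unfolded One_nat_def])

lemma Phi_one: "Phi one_L = el_one d"
proof -
  have "Dm one_L i j = snd (el_one d) i j" for i j
  proof (cases "i \<in> {1..d}")
    case True
    have "act (pr ^ i) one_L = pr ^ i" by (rule act_one[OF pr_pow_ZO])
    then show ?thesis unfolding Dm_eq[OF True] using coords_pr_pow[OF True] True by (auto simp: el_one_def)
  next
    case False
    then show ?thesis unfolding Dm_def el_one_def by (simp only: snd_conv if_False simp_thms)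
  qed
  moreover have "rho one_L = 1" by (simp add: fun_eq_iff rho_basis nf_G chi_nf)
  ultimately show ?thesis by (simp add: Phi_def el_one_def fun_eq_iff)
qed

lemma act_y: "v \<in> ZO \<Longrightarrow> act v y_L = T 1 v"
  by (simp add: y_L_def act_basis group_act_nf)

lemma rho_y: "rho y_L w = root_or_1 d w"
  by (simp add: y_L_def rho_basis nf_G chi_nf)

lemma rho_zero: "rho 0 w = 0" by (simp add: rho_def)

lemma Dm_zeroI: assumes "\<And>v. v \<in> P \<Longrightarrow> act v a = 0" shows "Dm a = 0"
proof -
  have "Dm a i j = 0" for i j
  proof (cases "i \<in> {1..d}")
    case True
    then have "pr ^ i \<in> P" by (intro P_pr_pow) simp
    then have "Dm a i j = co (of_int 0 * pr ^ i) j" unfolding Dm_eq[OF True] by (simp add: assms)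
    also have "\<dots> = 0" unfolding coords_scale[OF \<open>pr ^ i \<in> P\<close>] by simp
    finally show ?thesis .
  next
    case False
    then show ?thesis unfolding Dm_def by (simp only: if_False)
  qed
  then show ?thesis by (simp add: fun_eq_iff)
qed

lemma sum_factor: assumes "\<And>j. j \<in> S \<Longrightarrow> \<exists>w\<in>ZO. F j = x * w" shows "\<exists>w\<in>ZO. sum F S = x * w"
proof -
  obtain h where h: "\<And>j. j \<in> S \<Longrightarrow> h j \<in> ZO \<and> F j = x * h j" using assms by metis
  then have "sum F S = x * (\<Sum>j\<in>S. h j)" by (simp add: sum_distrib_left)
  then show ?thesis using O_sum[of S h] h by blast
qed

lemma T_pr_pow: "\<exists>w\<in>ZO. T j (pr ^ i) = pr ^ i * w"
proof -
  obtain u where u: "u \<in> ZO" "(z ^ (nu ^ j) - 1) ^ i = of_nat ((nu ^ j) ^ i) * pr ^ i + pr ^ Suc i * u"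
    using tau_pr_pow by blast
  have "T j (pr ^ i) = (z ^ (nu ^ j) - 1) ^ i" by (simp only: tau_power[OF nd_nu_pow O_pr] tau_pr[OF nd_nu_pow])
  also have "\<dots> = pr ^ i * (of_int (int ((nu ^ j) ^ i)) + pr * u)" unfolding u(2) by (simp add: algebra_simps)
  finally show ?thesis using u(1) O_add[OF O_int O_mult[OF O_pr]] by blast
qed

lemma act_factor: assumes a: "a \<in> carrier Lam" shows "\<exists>w\<in>ZO. act (pr ^ i) a = pr ^ i * w"
  unfolding act_op[OF a pr_pow_ZO] op_def
proof (rule sum_factor)
  fix j
  obtain w where "w \<in> ZO" "T j (pr ^ i) = pr ^ i * w" using T_pr_pow by blast
  then show "\<exists>w\<in>ZO. T j (pr ^ i) * T j (fc a j) = pr ^ i * w"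
    by (intro bexI[of _ "w * T j (fc a j)"] O_mult T_closed fc_ZO) (simp_all add: mult.assoc)
qed

text \<open>The action preserves the filtration by powers of \<open>pr\<close>.\<close>

lemma Dm_tri: assumes a: "a \<in> carrier Lam" and "k < i" shows "int p dvd Dm a i k"
proof (cases "i \<in> {1..d} \<and> k \<in> {1..d}")
  case True
  obtain w where w: "w \<in> ZO" "act (pr ^ i) a = pr ^ i * w" using act_factor[OF a] by blast
  have "Suc (i - 1) = i" using True by simp
  then show ?thesis using coords_dvd[OF w(1), of k "i - 1"] w(2) True assms(2) by (simp add: Dm_eq)
next
  case False
  then show ?thesis using Dm_supp[OF a, of i k] by auto
qed

lemma rho_onto: assumes "s \<in> cyc_ring d" shows "\<exists>a\<in>carrier Lam. rho a = s"
proof -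
  obtain c where c: "s = (\<lambda>w. \<Sum>j<d. of_int (c j) * root_or_1 d w ^ j)"
    using cyc_ring_reduce[OF assms] d_ge by auto
  have "(\<Sum>i<p. if i = 0 then c j else 0) = c j" for j using p_gt by simp
  then have "rho (elt (\<lambda>i j. if i = 0 then c j else 0)) = s" unfolding c by (intro ext) (simp only: rho_elt)
  then show ?thesis using elt_carrier by blast
qed

lemma zeta_sum: "(\<Sum>i<p. z ^ i) = 0"
proof -
  have "(z - 1) * (\<Sum>i<p. z ^ i) = z ^ p - 1" by (rule power_diff_1_eq[symmetric])
  then show ?thesis using zeta_eq_1_iff[of 1] p_gt by simp
qed

text \<open>Coefficients that are constant along the powers of x: the powers of \<open>z\<close> sum
  to 0, so the action vanishes, while \<open>rho\<close> collects the factor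
  \<open>p\<close>.\<close>

lemma Phi_p: assumes "s \<in> cyc_ring d" shows "\<exists>a\<in>carrier Lam. Phi a = (of_nat p * s, 0)"
proof -
  obtain c where c: "s = (\<lambda>w. \<Sum>j<d. of_int (c j) * root_or_1 d w ^ j)"
    using cyc_ring_reduce[OF assms] d_ge by auto
  let ?a = "elt (\<lambda>i j. c j)"
  have "rho ?a = of_nat p * s"
    unfolding c by (intro ext) (simp add: rho_elt sum_distrib_left mult.assoc of_nat_fun_apply)
  moreover have "fc ?a j = 0" if "j < d" for j
    unfolding fc_elt[OF that] sum_distrib_left[symmetric] zeta_sum by simp
  then have "Dm ?a = 0" by (intro Dm_zeroI) (simp add: act_sum elt_carrier P_O tau_0 nd_nu_pow)
  ultimately show ?thesis using elt_carrier by (intro bexI[of _ ?a]) (simp_all add: Phi_def)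
qed

lemma fc_P: assumes "(\<Sum>i<p. a (nf i j)) = 0" shows "fc a j \<in> P"
proof -
  define f where "f = (\<Sum>i<p. Polynomial.monom (a (nf i j)) i)"
  have "fc a j = zpoly f z" by (simp add: f_def fc_def)
  moreover have "poly f 1 = 0" using assms by (simp add: f_def poly_sum poly_monom)
  ultimately show ?thesis unfolding P_def by blast
qed

text \<open>If \<open>rho\<close> vanishes, each coefficient \<open>fc a j\<close> lies in
  \<open>P\<close> and contributes one more factor \<open>pr\<close> than in \<open>Dm_tri\<close>;
  so the diagonal becomes divisible by \<open>p\<close> as well.\<close>

lemma Dm_rad: assumes a: "a \<in> carrier Lam" and r: "rho a = 0" and "k \<le> i" shows "int p dvd Dm a i k"
proof (cases "i \<in> {1..d} \<and> k \<in> {1..d}")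
  case True
  have "\<exists>w\<in>ZO. act (pr ^ i) a = pr ^ Suc i * w"
    unfolding act_op[OF a pr_pow_ZO] op_def
  proof (rule sum_factor)
    fix j assume "j \<in> {..<d}"
    then have "T j (fc a j) \<in> P" by (intro tau_P nd_nu_pow fc_P rho_0[OF r]) simp
    then obtain u where u: "u \<in> ZO" "T j (fc a j) = pr * u" using P_factor by blast
    obtain w where w: "w \<in> ZO" "T j (pr ^ i) = pr ^ i * w" using T_pr_pow by blast
    show "\<exists>w\<in>ZO. T j (pr ^ i) * T j (fc a j) = pr ^ Suc i * w"
      by (rule bexI[of _ "w * u", OF _ O_mult[OF w(1) u(1)]]) (simp add: u(2) w(2))
  qed
  then obtain w where w: "w \<in> ZO" "act (pr ^ i) a = pr ^ Suc i * w" by blast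
  have i: "i \<in> {1..d}" using True by simp
  show ?thesis unfolding Dm_eq[OF i] w(2) using True by (intro coords_dvd[OF w(1) _ assms(3)]) simp
next
  case False
  then show ?thesis using Dm_supp[OF a, of i k] by auto
qed

text \<open>\<open>W_rad\<close> realises the matrix by an operator with coefficients in
  \<open>P\<close>. Such coefficients come from integer coefficients with sum 0, which makes
  \<open>rho\<close> vanish.\<close>

lemma Phi_rad:
  assumes t: "\<And>i j. i \<notin> {1..d} \<or> j \<notin> {1..d} \<Longrightarrow> t i j = 0" "\<And>i j. j \<le> i \<Longrightarrow> int p dvd t i j"
  shows "\<exists>a\<in>carrier Lam. Phi a = (0, t)"
proof -
  have "W t" by (rule W_rad) (rule t(2))
  then obtain g where g: "\<And>j. g j \<in> P" "\<And>i k. i \<in> {1..d} \<Longrightarrow> k \<in> {1..d} \<Longrightarrow> co (op g (pr ^ i)) k = t i k"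
    unfolding W_def by blast
  \<comment> \<open>The action twists \<open>fc a j\<close> by \<open>T j\<close>, so the
    coefficients are taken from \<open>T (d - j) (g j)\<close>, which undoes the twist.\<close>
  have "\<exists>c::nat \<Rightarrow> int. (\<Sum>i<p. c i) = 0 \<and> T (d - j) (g j) = (\<Sum>i<p. of_int (c i) * z ^ i)" for j
  proof -
    have "T (d - j) (g j) \<in> P" by (intro tau_P nd_nu_pow g)
    then obtain f where f: "T (d - j) (g j) = zpoly f z" "poly f 1 = 0" unfolding P_def by blast
    obtain c where c: "\<And>w. w ^ p = 1 \<Longrightarrow> zpoly f w = (\<Sum>i<p. of_int (c i) * w ^ i)" using reduced_poly by blast
    have "of_int (\<Sum>i<p. c i) = zpoly f 1" using c[of 1] by simp
    then have "(of_int (\<Sum>i<p. c i) :: complex) = of_int 0" unfolding zpoly_1 f(2) by simp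
    then have "(\<Sum>i<p. c i) = 0" by (simp only: of_int_eq_iff)
    then show ?thesis using c[OF zeta_pow_p] f(1) by (intro exI[of _ c]) simp
  qed
  then obtain c :: "nat \<Rightarrow> nat \<Rightarrow> int" where
    c: "\<And>j. (\<Sum>i<p. c j i) = 0" "\<And>j. T (d - j) (g j) = (\<Sum>i<p. of_int (c j i) * z ^ i)" by metis
  let ?a = "elt (\<lambda>i j. c j i)"
  have fc: "T j (fc ?a j) = g j" if "j < d" for j
  proof -
    have "T j (fc ?a j) = T j (T (d - j) (g j))" by (simp only: fc_elt[OF that] c(2))
    also have "\<dots> = T 0 (g j)" unfolding T_T[OF P_O[OF g(1)]] using that by (intro T_cong) (simp add: cong_def)
    finally show ?thesis by (simp only: T_0[OF P_O[OF g(1)]])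
  qed
  have "act (pr ^ i) ?a = op g (pr ^ i)" for i
    unfolding act_op[OF elt_carrier pr_pow_ZO] op_def by (intro sum.cong HOL.refl) (simp add: fc)
  then have "Dm ?a i k = t i k" for i k
    using t(1)[of i k] Dm_supp[OF elt_carrier, of i k] g(2)[of i k] by (cases "i \<in> {1..d} \<and> k \<in> {1..d}") (auto simp: Dm_eq)
  moreover have "rho ?a = 0" by (simp add: fun_eq_iff rho_elt c(1))
  ultimately have "Phi ?a = (0, t)" by (simp add: Phi_def fun_eq_iff)
  then show ?thesis using elt_carrier by blast
qed

section \<open>The sum of the powers of y and its annihilator\<close>

definition s_L where "s_L = elt (\<lambda>i j. if i = 0 then 1 else 0)"

lemma s_carrier: "s_L \<in> carrier Lam" by (simp add: s_L_def elt_carrier)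

lemma rho_s: "rho s_L w = (\<Sum>j<d. root_or_1 d w ^ j)"
proof -
  have "(\<Sum>i<p. if i = 0 then 1 else 0) = (1 :: int)" using p_gt by simp
  then show ?thesis unfolding s_L_def rho_elt by simp
qed

lemma act_s: assumes "v \<in> ZO" shows "act v s_L = Tr v"
proof -
  have "fc s_L j = 1" if "j < d" for j
  proof -
    have "fc s_L j = (\<Sum>i<p. if i = 0 then 1 else 0)"
      unfolding s_L_def fc_elt[OF that] by (intro sum.cong) auto
    then show ?thesis using p_gt by simp
  qed
  then show ?thesis unfolding act_sum[OF s_carrier assms] Tr_def by simp
qed

lemma sum_rotate: fixes F :: "nat \<Rightarrow> complex" assumes "F n = F 0" shows "(\<Sum>j<n. F (Suc j)) = (\<Sum>j<n. F j)"
  using assms sum.lessThan_Suc_shift[of F n] sum.lessThan_Suc[of F n] by simp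

lemma T_d: "T d v = T 0 v" by (rule T_cong) (simp add: cong_def)

lemma Tr_T: assumes "v \<in> ZO" shows "Tr (T k v) = Tr v"
proof (induction k)
  case 0
  show ?case by (simp only: T_0[OF assms])
next
  case (Suc k)
  have "Tr (T (Suc k) v) = (\<Sum>j<d. T (Suc j) (T k v))"
    unfolding Tr_def by (simp only: T_T[OF assms] add_Suc add_Suc_right)
  also have "\<dots> = Tr (T k v)" unfolding Tr_def by (rule sum_rotate) (rule T_d)
  finally show ?case using Suc by simp
qed

lemma y_carrier: "y_L \<in> carrier Lam" unfolding y_L_def by (intro basis_carrier nf_G)

text \<open>Multiplication by y permutes the powers of y cyclically; for the action this is the
  invariance of the trace.\<close>

lemma y_s: "elm d (Phi y_L - el_one d) (Phi s_L) = 0"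
proof -
  have 0: "0 \<in> carrier Lam" by (simp add: Lam_carrier_iff)
  have "Phi (y_L \<otimes>\<^bsub>Lam\<^esub> s_L) = Phi s_L + Phi 0"
  proof (rule Phi_addI[OF s_carrier 0 mult_carrier[OF y_carrier s_carrier]])
    fix w
    let ?r = "root_or_1 d w"
    have "(\<Sum>j<d. ?r ^ Suc j) = (\<Sum>j<d. ?r ^ j)" by (rule sum_rotate) simp
    then show "rho (y_L \<otimes>\<^bsub>Lam\<^esub> s_L) w = rho s_L w + rho 0 w"
      by (simp add: rho_mult[OF y_carrier s_carrier] rho_y rho_s sum_distrib_left rho_zero)
  next
    fix v assume v: "v \<in> ZO"
    show "act v (y_L \<otimes>\<^bsub>Lam\<^esub> s_L) = act v s_L + act v 0"
      unfolding act_mult[OF y_carrier s_carrier v] act_y[OF v] act_s[OF T_closed[OF v]] act_s[OF v] Tr_T[OF v]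
      by (simp add: cyc_act_def supp_def)
  qed
  then have "elm d (Phi y_L) (Phi s_L) = Phi s_L" by (simp add: Phi_mult[OF y_carrier s_carrier] Phi_0)
  moreover have "elm d (el_one d) (Phi s_L) = Phi s_L"
    by (rule elm_one_left) (simp add: Phi_def Dm_supp[OF s_carrier])
  ultimately show ?thesis by (simp add: elm_diff_left)
qed

text \<open>Summation by parts around a cycle. The two indices of \<open>K\<close> are separate
  because multiplication by y raises the power of y while the coefficient keeps its index.\<close>

lemma telescope:
  fixes K :: "nat \<Rightarrow> nat \<Rightarrow> complex"
  assumes "K n n = K 0 0" "C n = C 0" "\<And>j. K (Suc j) j = K (Suc j) (Suc j) + C (Suc j)"
  shows "(\<Sum>j<n. K (Suc j) j) = (\<Sum>j<n. K j j) + (\<Sum>j<n. C j)"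
  using sum_rotate[of "\<lambda>j. K j j" n] sum_rotate[of C n] assms by (simp add: sum.distrib)

text \<open>An element killed by the sum of the powers of y has, for each power of x, coefficients
  along y with sum 0; partial sums along y then give the left factor.\<close>

lemma annihilator:
  assumes c: "c \<in> carrier Lam" and 0: "elm d (Phi c) (Phi s_L) = 0"
  shows "\<exists>a\<in>carrier Lam. Phi c = elm d (Phi a) (Phi y_L - el_one d)"
proof -
  have cs: "c \<otimes>\<^bsub>Lam\<^esub> s_L \<in> carrier Lam" by (rule mult_carrier[OF c s_carrier])
  have P0: "rho c * rho s_L = 0" "Dm (c \<otimes>\<^bsub>Lam\<^esub> s_L) = 0"
    using 0 unfolding Phi_mult[OF c s_carrier, symmetric] by (auto simp: Phi_def prod_eq_iff rho_mult[OF c s_carrier])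
  \<comment> \<open>The sum of all coefficients along y: being killed means that
    \<open>Tr (v * F)\<close> vanishes for all \<open>v\<close> in \<open>P\<close>, and then
    \<open>op_inj\<close> gives \<open>F = 0\<close>.\<close>
  define F where "F = (\<Sum>j<d. fc c j)"
  have F: "F \<in> ZO" unfolding F_def by (intro O_sum fc_ZO)
  have "op (\<lambda>k. T k F) v = 0" if v: "v \<in> P" for v
  proof -
    have O: "v \<in> ZO" by (rule P_O[OF v])
    have "0 = act (act v c) s_L" using act_zero[OF cs P0(2) v] act_mult[OF c s_carrier O] by simp
    also have "\<dots> = Tr (\<Sum>j<d. T j (v * fc c j))" by (simp only: act_s[OF act_ZO[OF c O]]) (simp only: act_sum[OF c O])
    also have "\<dots> = (\<Sum>j<d. Tr (v * fc c j))"
      by (subst Tr_sum) (auto simp: Tr_T O_mult O fc_ZO T_closed)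
    also have "\<dots> = Tr (v * F)" unfolding F_def sum_distrib_left by (rule Tr_sum[symmetric]) (intro O_mult O fc_ZO)
    also have "\<dots> = op (\<lambda>k. T k F) v" unfolding Tr_def op_def by (simp only: tau_mult[OF nd_nu_pow O F])
    finally show ?thesis by (rule HOL.sym)
  qed
  note op0 = this
  have d0: "0 < d" using d_ge(1) by simp
  have "T 0 F = 0" by (rule op_inj[where g = "\<lambda>k. T k F", OF op0 d0])
  then have "F = 0" by (simp only: T_0[OF F])
  then have F0: "(\<Sum>i<p. of_int (\<Sum>j<d. c (nf i j)) * z ^ i) = 0"
    unfolding F_def fc_def by (subst (asm) sum.swap) (simp add: sum_distrib_right)
  \<comment> \<open>The trivial character supplies the one relation among the row sums that
    \<open>F = 0\<close> does not see.\<close>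
  have "rho c 1 * rho s_L 1 = 0" using P0(1) by (metis times_fun_apply zero_fun_apply)
  then have "rho c 1 = 0" using d_ge(1) by (simp add: rho_s)
  then have "(of_int (\<Sum>j<d. \<Sum>i<p. c (nf i j)) :: complex) = of_int 0" by (simp add: rho_coords)
  then have "(\<Sum>j<d. \<Sum>i<p. c (nf i j)) = 0" by (simp only: of_int_eq_iff)
  then have "(\<Sum>i<p. \<Sum>j<d. c (nf i j)) = 0" by (subst sum.swap)
  then have row: "(\<Sum>j<d. c (nf i j)) = 0" if "i < p" for i by (rule zeta_coeffs_zero[OF F0 _ that])
  have nfd: "nf i d = nf i 0" for i by (rule nf_cong) (simp_all add: cong_def)
  \<comment> \<open>Negative partial sums starting at \<open>k = 1\<close>. They are 0 at
    \<open>j = 0\<close> and, by the vanishing row sums, again at \<open>j = d\<close>; so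
    multiplication by y is a cyclic shift of them, and the difference is \<open>c\<close>.\<close>
  define A where "A i j = - (\<Sum>k = 1..j. c (nf i k))" for i j
  have A0: "A i 0 = 0" for i by (simp add: A_def)
  have Ad: "A i d = 0" if "i < p" for i
  proof -
    have "(\<Sum>k = 1..d. c (nf i k)) = (\<Sum>k<d. c (nf i (Suc k)))"
      by (rule sum.reindex_bij_witness[of _ Suc "\<lambda>k. k - 1"]) auto
    also have "\<dots> = (\<Sum>k<d. c (nf i k))"
      using sum.lessThan_Suc_shift[of "\<lambda>k. c (nf i k)" d] sum.lessThan_Suc[of "\<lambda>k. c (nf i k)" d] nfd[of i] by simp
    finally show ?thesis using row[OF that] by (simp add: A_def)
  qed
  have AS: "A i j = A i (Suc j) + c (nf i (Suc j))" for i j by (simp add: A_def)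
  let ?a = "elt A"
  have a: "?a \<in> carrier Lam" by (rule elt_carrier)
  have "Phi (?a \<otimes>\<^bsub>Lam\<^esub> y_L) = Phi ?a + Phi c"
  proof (rule Phi_addI[OF a c mult_carrier[OF a y_carrier]])
    fix w
    let ?r = "root_or_1 d w"
    have "rho (?a \<otimes>\<^bsub>Lam\<^esub> y_L) w = (\<Sum>j<d. of_int (\<Sum>i<p. A i j) * ?r ^ Suc j)"
      by (simp only: rho_mult[OF a y_carrier] times_fun_apply rho_elt rho_y sum_distrib_right power_Suc2 mult.assoc)
    also have "\<dots> = (\<Sum>j<d. of_int (\<Sum>i<p. A i j) * ?r ^ j) + (\<Sum>j<d. of_int (\<Sum>i<p. c (nf i j)) * ?r ^ j)"
    proof (rule telescope[of "\<lambda>k j. of_int (\<Sum>i<p. A i j) * ?r ^ k"])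
      show "of_int (\<Sum>i<p. A i d) * ?r ^ d = of_int (\<Sum>i<p. A i 0) * ?r ^ 0" by (simp add: Ad A0)
      show "of_int (\<Sum>i<p. c (nf i d)) * ?r ^ d = of_int (\<Sum>i<p. c (nf i 0)) * ?r ^ 0" by (simp add: nfd)
      fix j
      have "(\<Sum>i<p. A i j) = (\<Sum>i<p. A i (Suc j)) + (\<Sum>i<p. c (nf i (Suc j)))"
        unfolding sum.distrib[symmetric] by (intro sum.cong HOL.refl AS)
      then show "of_int (\<Sum>i<p. A i j) * ?r ^ Suc j
        = of_int (\<Sum>i<p. A i (Suc j)) * ?r ^ Suc j + of_int (\<Sum>i<p. c (nf i (Suc j))) * ?r ^ Suc j"
        by (simp only: of_int_add distrib_right)
    qed
    finally show "rho (?a \<otimes>\<^bsub>Lam\<^esub> y_L) w = rho ?a w + rho c w" by (simp only: rho_elt rho_coords[of c])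
  next
    fix v assume v: "v \<in> ZO"
    define B where "B j = (\<Sum>i<p. of_int (A i j) * z ^ i)" for j
    have B: "B j \<in> ZO" for j unfolding B_def by (intro O_sum O_mult O_int zpow_ZO)
    have fB: "fc ?a j = B j" if "j < d" for j using that by (simp add: fc_elt B_def)
    have act_a: "act v ?a = (\<Sum>j<d. T j (v * B j))"
      unfolding act_sum[OF a v] by (intro sum.cong HOL.refl) (simp add: fB)
    have "act v (?a \<otimes>\<^bsub>Lam\<^esub> y_L) = T 1 (\<Sum>j<d. T j (v * B j))"
      by (simp only: act_mult[OF a y_carrier v] act_y[OF act_ZO[OF a v]]) (simp only: act_a)
    also have "\<dots> = (\<Sum>j<d. T 1 (T j (v * B j)))"
      by (rule tau_sum[OF nd_nu_pow]) (intro T_closed O_mult v B)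
    also have "\<dots> = (\<Sum>j<d. T (Suc j) (v * B j))"
      by (intro sum.cong HOL.refl) (simp only: T_T[OF O_mult[OF v B]] plus_1_eq_Suc)
    also have "\<dots> = (\<Sum>j<d. T j (v * B j)) + (\<Sum>j<d. T j (v * fc c j))"
    proof (rule telescope[of "\<lambda>k j. T k (v * B j)"])
      have "B d = B 0" by (simp add: B_def A0 Ad)
      then show "T d (v * B d) = T 0 (v * B 0)" by (simp only: T_d)
      have "fc c d = fc c 0" by (simp add: fc_def nfd)
      then show "T d (v * fc c d) = T 0 (v * fc c 0)" by (simp only: T_d)
      fix j
      have "B j = B (Suc j) + fc c (Suc j)"
        unfolding B_def fc_def sum.distrib[symmetric] by (intro sum.cong HOL.refl) (simp add: AS[of _ j] distrib_right)
      then show "T (Suc j) (v * B j) = T (Suc j) (v * B (Suc j)) + T (Suc j) (v * fc c (Suc j))"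
        by (simp only: distrib_left tau_add[OF nd_nu_pow O_mult[OF v B] O_mult[OF v fc_ZO]])
    qed
    finally show "act v (?a \<otimes>\<^bsub>Lam\<^esub> y_L) = act v ?a + act v c" by (simp only: act_a act_sum[OF c v])
  qed
  moreover have "elm d (Phi ?a) (el_one d) = Phi ?a"
    by (rule elm_one_right) (simp add: Phi_def Dm_supp[OF a])
  ultimately have "elm d (Phi ?a) (Phi y_L - el_one d) = Phi c"
    unfolding Phi_mult[OF a y_carrier] diff_conv_add_uminus elm_add_right elm_uminus_right by simp
  then show ?thesis using a by (intro bexI[of _ ?a]) simp_all
qed

sublocale straight_core p d "Phi ` carrier Lam" "Phi y_L" "Phi s_L"
proof
  show "d = p - 1" by (rule d_def)
  show "2 \<le> d" using p_gt by (simp add: d_def)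
  show "fst a \<in> cyc_ring d" if "a \<in> Phi ` carrier Lam" for a
    using that by (auto simp: Phi_def rho_ring)
  show "snd a i j = 0" if "a \<in> Phi ` carrier Lam" "i \<notin> {1..d} \<or> j \<notin> {1..d}" for a i j
    using that(1) by (elim imageE) (simp only: Phi_def snd_conv Dm_supp[OF _ that(2)])
  show "int p dvd snd a i j" if "a \<in> Phi ` carrier Lam" "j < i" for a i j
    using that(1) by (elim imageE) (simp only: Phi_def snd_conv Dm_tri[OF _ that(2)])
  show "a + b \<in> Phi ` carrier Lam" if "a \<in> Phi ` carrier Lam" "b \<in> Phi ` carrier Lam" for a b
    using that by (elim imageE) (simp only: Phi_add[symmetric] imageI add_carrier)
  show "- a \<in> Phi ` carrier Lam" if "a \<in> Phi ` carrier Lam" for a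
    using that by (elim imageE) (simp only: Phi_neg[symmetric] imageI neg_carrier)
  show "elm d a b \<in> Phi ` carrier Lam" if "a \<in> Phi ` carrier Lam" "b \<in> Phi ` carrier Lam" for a b
    using that by (elim imageE) (simp only: Phi_mult[symmetric] imageI mult_carrier)
  show "el_one d \<in> Phi ` carrier Lam" using Phi_one basis_carrier[OF nf_G] by (metis imageI)
  show "\<exists>a\<in>Phi ` carrier Lam. fst a = s" if "s \<in> cyc_ring d" for s
    using rho_onto[OF that] by (auto simp: Phi_def)
  show "(0, t) \<in> Phi ` carrier Lam \<longleftrightarrow>
        (\<forall>i j. (i \<notin> {1..d} \<or> j \<notin> {1..d} \<longrightarrow> t i j = 0) \<and> (j \<le> i \<longrightarrow> int p dvd t i j))" (is "?l \<longleftrightarrow> ?r") for t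
  proof
    assume ?l
    then obtain a where a: "a \<in> carrier Lam" "rho a = 0" "Dm a = t" by (auto simp: Phi_def)
    show ?r using Dm_supp[OF a(1)] Dm_rad[OF a(1,2)] unfolding a(3) by blast
  next
    assume ?r
    then have "\<exists>a\<in>carrier Lam. Phi a = (0, t)" by (intro Phi_rad) blast+
    then show ?l by (metis imageI)
  qed
  show "(of_nat p * s, 0) \<in> Phi ` carrier Lam" if "s \<in> cyc_ring d" for s
    using Phi_p[OF that] by (metis imageI)
  show "Phi y_L \<in> Phi ` carrier Lam" "Phi s_L \<in> Phi ` carrier Lam" by (intro imageI y_carrier s_carrier)+
  show "fst (Phi y_L) = cyc_gen d" by (simp add: Phi_def cyc_gen_def fun_eq_iff rho_y)
  show "elm d (Phi y_L - el_one d) (Phi s_L) = 0" by (rule y_s)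
  show "\<exists>a\<in>Phi ` carrier Lam. x = elm d a (Phi y_L - el_one d)"
    if "x \<in> Phi ` carrier Lam" "elm d x (Phi s_L) = 0" for x
    using that annihilator by (elim imageE) blast
qed (rule prime)

end


section \<open>Right modules up to isomorphism\<close>

lemma rmod_iso_trans:
  assumes "rmod_iso R M N" "rmod_iso R N K" shows "rmod_iso R M K"
proof -
  obtain f where f: "bij_betw f (carrier M) (carrier N)"
      "\<And>x y. x \<in> carrier M \<Longrightarrow> y \<in> carrier M \<Longrightarrow> f (x \<oplus>\<^bsub>M\<^esub> y) = f x \<oplus>\<^bsub>N\<^esub> f y"
      "\<And>x a. x \<in> carrier M \<Longrightarrow> a \<in> carrier R \<Longrightarrow> f (x \<triangleleft>\<^bsub>M\<^esub> a) = f x \<triangleleft>\<^bsub>N\<^esub> a"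
    using assms(1) unfolding rmod_iso_def by blast
  obtain g where g: "bij_betw g (carrier N) (carrier K)"
      "\<And>x y. x \<in> carrier N \<Longrightarrow> y \<in> carrier N \<Longrightarrow> g (x \<oplus>\<^bsub>N\<^esub> y) = g x \<oplus>\<^bsub>K\<^esub> g y"
      "\<And>x a. x \<in> carrier N \<Longrightarrow> a \<in> carrier R \<Longrightarrow> g (x \<triangleleft>\<^bsub>N\<^esub> a) = g x \<triangleleft>\<^bsub>K\<^esub> a"
    using assms(2) unfolding rmod_iso_def by blast
  have fN: "f x \<in> carrier N" if "x \<in> carrier M" for x using bij_betwE[OF f(1)] that by blast
  show ?thesis unfolding rmod_iso_def
    by (intro exI[of _ "g \<circ> f"] conjI ballI bij_betw_trans[OF f(1) g(1)]) (simp_all add: f g fN)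
qed

text \<open>The closure and zero laws that go into inverting isomorphisms and forming direct sums;
  they can be checked on the concrete modules directly.\<close>

definition premodule :: "('a, 'r) ring_scheme \<Rightarrow> ('a, 'b) rmodule \<Rightarrow> bool" where
  "premodule R M \<longleftrightarrow> \<zero>\<^bsub>M\<^esub> \<in> carrier M \<and>
     (\<forall>x\<in>carrier M. \<forall>y\<in>carrier M. x \<oplus>\<^bsub>M\<^esub> y \<in> carrier M) \<and>
     (\<forall>x\<in>carrier M. \<forall>a\<in>carrier R. x \<triangleleft>\<^bsub>M\<^esub> a \<in> carrier M) \<and>
     (\<forall>x\<in>carrier M. x \<oplus>\<^bsub>M\<^esub> \<zero>\<^bsub>M\<^esub> = x) \<and> (\<forall>a\<in>carrier R. \<zero>\<^bsub>M\<^esub> \<triangleleft>\<^bsub>M\<^esub> a = \<zero>\<^bsub>M\<^esub>)"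

lemma premoduleD:
  assumes "premodule R M"
  shows "\<zero>\<^bsub>M\<^esub> \<in> carrier M"
    and "x \<in> carrier M \<Longrightarrow> y \<in> carrier M \<Longrightarrow> x \<oplus>\<^bsub>M\<^esub> y \<in> carrier M"
    and "x \<in> carrier M \<Longrightarrow> a \<in> carrier R \<Longrightarrow> x \<triangleleft>\<^bsub>M\<^esub> a \<in> carrier M"
    and "x \<in> carrier M \<Longrightarrow> x \<oplus>\<^bsub>M\<^esub> \<zero>\<^bsub>M\<^esub> = x"
    and "a \<in> carrier R \<Longrightarrow> \<zero>\<^bsub>M\<^esub> \<triangleleft>\<^bsub>M\<^esub> a = \<zero>\<^bsub>M\<^esub>"
  using assms unfolding premodule_def by simp_all

lemma premodule_inverse:
  assumes M: "premodule R M" and f: "bij_betw f (carrier M) (carrier N)"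
    and add: "\<And>x y. x \<in> carrier M \<Longrightarrow> y \<in> carrier M \<Longrightarrow> f (x \<oplus>\<^bsub>M\<^esub> y) = f x \<oplus>\<^bsub>N\<^esub> f y"
    and act: "\<And>x a. x \<in> carrier M \<Longrightarrow> a \<in> carrier R \<Longrightarrow> f (x \<triangleleft>\<^bsub>M\<^esub> a) = f x \<triangleleft>\<^bsub>N\<^esub> a"
  defines "g \<equiv> inv_into (carrier M) f"
  shows "x \<in> carrier N \<Longrightarrow> y \<in> carrier N \<Longrightarrow> g (x \<oplus>\<^bsub>N\<^esub> y) = g x \<oplus>\<^bsub>M\<^esub> g y"
    and "x \<in> carrier N \<Longrightarrow> a \<in> carrier R \<Longrightarrow> g (x \<triangleleft>\<^bsub>N\<^esub> a) = g x \<triangleleft>\<^bsub>M\<^esub> a"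
proof -
  have gM: "g x \<in> carrier M" and fg: "f (g x) = x" if "x \<in> carrier N" for x
    using that f unfolding g_def bij_betw_def by (auto intro: inv_into_into f_inv_into_f)
  have gf: "g (f x) = x" if "x \<in> carrier M" for x
    using that f unfolding g_def bij_betw_def by simp
  show "g (x \<oplus>\<^bsub>N\<^esub> y) = g x \<oplus>\<^bsub>M\<^esub> g y" if "x \<in> carrier N" "y \<in> carrier N"
    using gf[OF premoduleD(2)[OF M gM[OF that(1)] gM[OF that(2)]]] by (simp add: add gM fg that)
  show "g (x \<triangleleft>\<^bsub>N\<^esub> a) = g x \<triangleleft>\<^bsub>M\<^esub> a" if "x \<in> carrier N" "a \<in> carrier R"
    using gf[OF premoduleD(3)[OF M gM[OF that(1)] that(2)]] by (simp add: act gM fg that)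
qed

lemma rmod_iso_sym:
  assumes M: "premodule R M" and "rmod_iso R M N" shows "rmod_iso R N M"
proof -
  obtain f where f: "bij_betw f (carrier M) (carrier N)"
      "\<And>x y. x \<in> carrier M \<Longrightarrow> y \<in> carrier M \<Longrightarrow> f (x \<oplus>\<^bsub>M\<^esub> y) = f x \<oplus>\<^bsub>N\<^esub> f y"
      "\<And>x a. x \<in> carrier M \<Longrightarrow> a \<in> carrier R \<Longrightarrow> f (x \<triangleleft>\<^bsub>M\<^esub> a) = f x \<triangleleft>\<^bsub>N\<^esub> a"
    using assms(2) unfolding rmod_iso_def by blast
  show ?thesis unfolding rmod_iso_def
    by (intro exI[of _ "inv_into (carrier M) f"] conjI ballI bij_betw_inv_into[OF f(1)]
        premodule_inverse[OF M f]) simp_all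
qed

lemma premodule_right_module: assumes "right_module R M" shows "premodule R M"
proof -
  interpret right_module R M by fact
  have "\<zero>\<^bsub>M\<^esub> \<triangleleft>\<^bsub>M\<^esub> a = \<zero>\<^bsub>M\<^esub>" if a: "a \<in> carrier R" for a
  proof -
    have "\<zero>\<^bsub>M\<^esub> \<triangleleft>\<^bsub>M\<^esub> a \<oplus>\<^bsub>M\<^esub> \<zero>\<^bsub>M\<^esub> \<triangleleft>\<^bsub>M\<^esub> a = \<zero>\<^bsub>M\<^esub> \<triangleleft>\<^bsub>M\<^esub> a"
      using ract_l_distr[OF M.zero_closed M.zero_closed a] by simp
    then show ?thesis using ract_closed[OF M.zero_closed a] by (metis M.add.l_cancel_one' M.zero_closed)
  qed
  then show ?thesis unfolding premodule_def by simp
qed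

lemma rmod_sum_simps [simp]:
  "carrier (M [+] N) = carrier M \<times> carrier N" "\<zero>\<^bsub>M [+] N\<^esub> = (\<zero>\<^bsub>M\<^esub>, \<zero>\<^bsub>N\<^esub>)"
  "x \<oplus>\<^bsub>M [+] N\<^esub> y = (fst x \<oplus>\<^bsub>M\<^esub> fst y, snd x \<oplus>\<^bsub>N\<^esub> snd y)"
  "x \<triangleleft>\<^bsub>M [+] N\<^esub> a = (fst x \<triangleleft>\<^bsub>M\<^esub> a, snd x \<triangleleft>\<^bsub>N\<^esub> a)"
  by (simp_all add: rmod_sum_def case_prod_beta)

lemma regular_simps [simp]:
  "carrier (regular_rmodule R) = carrier R" "\<zero>\<^bsub>regular_rmodule R\<^esub> = \<zero>\<^bsub>R\<^esub>"
  "x \<oplus>\<^bsub>regular_rmodule R\<^esub> y = x \<oplus>\<^bsub>R\<^esub> y" "x \<triangleleft>\<^bsub>regular_rmodule R\<^esub> a = x \<otimes>\<^bsub>R\<^esub> a"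
  by (simp_all add: regular_rmodule_def)

lemma free_simps [simp]:
  "carrier (free_rmodule R n) = {..<n} \<rightarrow>\<^sub>E carrier R" "\<zero>\<^bsub>free_rmodule R n\<^esub> = (\<lambda>i\<in>{..<n}. \<zero>\<^bsub>R\<^esub>)"
  "x \<oplus>\<^bsub>free_rmodule R n\<^esub> y = (\<lambda>i\<in>{..<n}. x i \<oplus>\<^bsub>R\<^esub> y i)"
  "x \<triangleleft>\<^bsub>free_rmodule R n\<^esub> a = (\<lambda>i\<in>{..<n}. x i \<otimes>\<^bsub>R\<^esub> a)"
  by (simp_all add: free_rmodule_def)

lemma premodule_sum: "premodule R M \<Longrightarrow> premodule R N \<Longrightarrow> premodule R (M [+] N)"
  unfolding premodule_def by auto

lemma premodule_free: assumes R: "premodule R (regular_rmodule R)" shows "premodule R (free_rmodule R n)"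
  unfolding premodule_def free_simps
proof (intro conjI ballI)
  note D = premoduleD[OF R, unfolded regular_simps]
  show "(\<lambda>i\<in>{..<n}. \<zero>\<^bsub>R\<^esub>) \<in> {..<n} \<rightarrow>\<^sub>E carrier R" by (rule restrict_PiE_iff[THEN iffD2]) (simp add: D(1))
  show "(\<lambda>i\<in>{..<n}. (\<lambda>i\<in>{..<n}. \<zero>\<^bsub>R\<^esub>) i \<otimes>\<^bsub>R\<^esub> a) = (\<lambda>i\<in>{..<n}. \<zero>\<^bsub>R\<^esub>)"
    if a: "a \<in> carrier R" for a
    by (rule restrict_ext) (simp add: D(5)[OF a])
  fix x y assume x: "x \<in> {..<n} \<rightarrow>\<^sub>E carrier R"
  show "(\<lambda>i\<in>{..<n}. x i \<oplus>\<^bsub>R\<^esub> y i) \<in> {..<n} \<rightarrow>\<^sub>E carrier R" if "y \<in> {..<n} \<rightarrow>\<^sub>E carrier R"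
    by (intro restrict_PiE_iff[THEN iffD2] ballI D(2) PiE_mem[OF x] PiE_mem[OF that])
  show "(\<lambda>i\<in>{..<n}. x i \<oplus>\<^bsub>R\<^esub> (\<lambda>i\<in>{..<n}. \<zero>\<^bsub>R\<^esub>) i) = x"
  proof
    fix i show "(\<lambda>i\<in>{..<n}. x i \<oplus>\<^bsub>R\<^esub> (\<lambda>i\<in>{..<n}. \<zero>\<^bsub>R\<^esub>) i) i = x i"
      using D(4)[OF PiE_mem[OF x, of i]] PiE_arb[OF x, of i] by (cases "i < n") simp_all
  qed
  show "(\<lambda>i\<in>{..<n}. x i \<otimes>\<^bsub>R\<^esub> a) \<in> {..<n} \<rightarrow>\<^sub>E carrier R" if a: "a \<in> carrier R" for a
    by (intro restrict_PiE_iff[THEN iffD2] ballI D(3) PiE_mem[OF x] a)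
qed

lemma rmod_iso_sum_left: assumes "rmod_iso R M N" shows "rmod_iso R (M [+] K) (N [+] K)"
proof -
  obtain f where f: "bij_betw f (carrier M) (carrier N)"
      "\<And>x y. x \<in> carrier M \<Longrightarrow> y \<in> carrier M \<Longrightarrow> f (x \<oplus>\<^bsub>M\<^esub> y) = f x \<oplus>\<^bsub>N\<^esub> f y"
      "\<And>x a. x \<in> carrier M \<Longrightarrow> a \<in> carrier R \<Longrightarrow> f (x \<triangleleft>\<^bsub>M\<^esub> a) = f x \<triangleleft>\<^bsub>N\<^esub> a"
    using assms unfolding rmod_iso_def by blast
  show ?thesis unfolding rmod_iso_def
    by (intro exI[of _ "map_prod f id"] conjI ballI)
      (use bij_betw_map_prod[OF f(1) bij_betw_id, of "carrier K"] in \<open>auto simp: f id_def\<close>)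
qed

lemma free_zero_iso: "rmod_iso R (M [+] free_rmodule R 0) M"
  unfolding rmod_iso_def
  by (intro exI[of _ fst] conjI ballI) (auto simp: bij_betw_def inj_on_def image_iff)

lemma free_Suc_iso:
  fixes M :: "('a, 'b) rmodule"
  shows "rmod_iso R (M [+] free_rmodule R (Suc n)) ((M [+] free_rmodule R n) [+] regular_rmodule R)"
proof -
  let ?f = "\<lambda>x :: 'b \<times> (nat \<Rightarrow> 'a). ((fst x, restrict (snd x) {..<n}), snd x n)"
  let ?g = "\<lambda>x :: ('b \<times> (nat \<Rightarrow> 'a)) \<times> 'a. (fst (fst x), (snd (fst x))(n := snd x))"
  have n: "{..<Suc n} = insert n {..<n}" by auto
  have "bij_betw ?f (carrier (M [+] free_rmodule R (Suc n))) (carrier ((M [+] free_rmodule R n) [+] regular_rmodule R))"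
    unfolding rmod_sum_simps free_simps regular_simps
  proof (rule bij_betw_byWitness[where f' = ?g]; (intro ballI subsetI)?)
    fix x assume x: "x \<in> carrier M \<times> ({..<Suc n} \<rightarrow>\<^sub>E carrier R)"
    then have s: "snd x \<in> {..<Suc n} \<rightarrow>\<^sub>E carrier R" by (simp only: mem_Times_iff)
    have "((restrict (snd x) {..<n})(n := snd x n)) i = snd x i" for i
      using PiE_arb[OF s, of i] by auto
    then have "(restrict (snd x) {..<n})(n := snd x n) = snd x" by (rule ext)
    then show "?g (?f x) = x" by (simp only: fst_conv snd_conv prod.collapse)
  next
    fix x assume x: "x \<in> (carrier M \<times> ({..<n} \<rightarrow>\<^sub>E carrier R)) \<times> carrier R"
    then have s: "snd (fst x) \<in> {..<n} \<rightarrow>\<^sub>E carrier R" by (simp only: mem_Times_iff)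
    have "restrict ((snd (fst x))(n := snd x)) {..<n} i = snd (fst x) i" for i
      using PiE_arb[OF s, of i] by auto
    then have "restrict ((snd (fst x))(n := snd x)) {..<n} = snd (fst x)" by (rule ext)
    then show "?f (?g x) = x" by (simp only: fst_conv snd_conv prod.collapse fun_upd_same)
  next
    fix u assume "u \<in> ?f ` (carrier M \<times> ({..<Suc n} \<rightarrow>\<^sub>E carrier R))"
    then obtain x where x: "x \<in> carrier M \<times> ({..<Suc n} \<rightarrow>\<^sub>E carrier R)" "u = ?f x" by (rule imageE)
    then have s: "snd x \<in> {..<Suc n} \<rightarrow>\<^sub>E carrier R" by (simp only: mem_Times_iff)
    have "restrict (snd x) {..<n} \<in> {..<n} \<rightarrow>\<^sub>E carrier R"
      by (rule restrict_PiE_iff[THEN iffD2]) (auto intro: PiE_mem[OF s])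
    moreover have "snd x n \<in> carrier R" by (rule PiE_mem[OF s]) simp
    ultimately show "u \<in> (carrier M \<times> ({..<n} \<rightarrow>\<^sub>E carrier R)) \<times> carrier R"
      using x by (simp only: mem_Times_iff fst_conv snd_conv simp_thms)
  next
    fix u assume "u \<in> ?g ` ((carrier M \<times> ({..<n} \<rightarrow>\<^sub>E carrier R)) \<times> carrier R)"
    then obtain x where x: "x \<in> (carrier M \<times> ({..<n} \<rightarrow>\<^sub>E carrier R)) \<times> carrier R" "u = ?g x" by (rule imageE)
    then have "(snd (fst x))(n := snd x) \<in> {..<Suc n} \<rightarrow>\<^sub>E carrier R"
      unfolding n by (intro PiE_fun_upd) (simp_all only: mem_Times_iff)
    then show "u \<in> carrier M \<times> ({..<Suc n} \<rightarrow>\<^sub>E carrier R)"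
      using x by (simp only: mem_Times_iff fst_conv snd_conv simp_thms)
  qed
  then show ?thesis unfolding rmod_iso_def
    by (intro exI[of _ ?f] conjI ballI) (simp_all add: fun_eq_iff)
qed


section \<open>Coordinates and ranks of abelian groups\<close>

text \<open>Additive integer-valued coordinates turn sums and multiples in the abstract group into
  sums of integers.\<close>

locale coordinates = abelian_group N for N :: "('b, 's) ring_scheme" (structure) +
  fixes F :: "'b \<Rightarrow> 'i \<Rightarrow> int"
  assumes F_add: "x \<in> carrier N \<Longrightarrow> y \<in> carrier N \<Longrightarrow> F (x \<oplus> y) t = F x t + F y t"
begin

lemma F_zero: "F \<zero> t = 0"
  using F_add[OF zero_closed zero_closed, of t] by simp

lemma F_neg: "x \<in> carrier N \<Longrightarrow> F (\<ominus> x) t = - F x t"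
  using F_add[of x "\<ominus> x" t] by (simp add: F_zero r_neg)

lemma F_nat: "x \<in> carrier N \<Longrightarrow> F ([(n :: nat)] \<cdot> x) t = int n * F x t"
  by (induction n) (simp_all add: F_zero F_add distrib_right)

lemma F_int: "x \<in> carrier N \<Longrightarrow> F ([(k :: int)] \<cdot> x) t = k * F x t"
proof -
  assume x: "x \<in> carrier N"
  show ?thesis
  proof (cases "k \<ge> 0")
    case True
    then have "[k] \<cdot> x = [nat k] \<cdot> x" unfolding add_pow_def by (subst int_pow_def2) simp
    then show ?thesis using F_nat[OF x, of "nat k" t] True by simp
  next
    case False
    then have "[k] \<cdot> x = \<ominus> ([nat (- k)] \<cdot> x)" unfolding add_pow_def a_inv_def by (subst int_pow_def2) simp
    then show ?thesis using F_nat[OF x, of "nat (- k)" t] False x by (simp add: F_neg)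
  qed
qed

lemma F_finsum: "f \<in> A \<rightarrow> carrier N \<Longrightarrow> F (finsum N f A) t = (\<Sum>a\<in>A. F (f a) t)"
proof (induction A rule: infinite_finite_induct)
  case (infinite A)
  then show ?case by (simp add: finsum_infinite F_zero)
next
  case (insert a A)
  then have "f \<in> A \<rightarrow> carrier N" "f a \<in> carrier N" by auto
  then show ?case using insert by (simp add: F_add)
qed (simp add: F_zero)

lemma F_comb: "B \<subseteq> carrier N \<Longrightarrow> F (\<Oplus>b\<in>B. [(c b :: int)] \<cdot> b) t = (\<Sum>b\<in>B. c b * F b t)"
proof -
  assume B: "B \<subseteq> carrier N"
  then have "F (\<Oplus>b\<in>B. [c b] \<cdot> b) t = (\<Sum>b\<in>B. F ([c b] \<cdot> b) t)" by (intro F_finsum) auto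
  then show ?thesis using B by (auto simp: F_int intro!: sum.cong)
qed

end

locale faithful_coordinates = coordinates +
  fixes D :: "'c set"
  assumes F_inj: "x \<in> carrier N \<Longrightarrow> y \<in> carrier N \<Longrightarrow> (\<And>t. F x t = F y t) \<Longrightarrow> x = y"
    and D: "finite D" "x \<in> carrier N \<Longrightarrow> t \<notin> D \<Longrightarrow> F x t = 0"
begin

lemma torsion_free: "torsion_free N"
  unfolding torsion_free_def
proof (intro ballI allI impI)
  fix x and k :: int assume x: "x \<in> carrier N" "k \<noteq> 0" "[k] \<cdot> x = \<zero>"
  have "F x t = F \<zero> t" for t using F_int[OF x(1), of k t] x(2,3) by (simp add: F_zero)
  then show "x = \<zero>" by (intro F_inj x zero_closed)
qed

lemma comb_closed: "B \<subseteq> carrier N \<Longrightarrow> (\<Oplus>b\<in>B. [(c b :: int)] \<cdot> b) \<in> carrier N"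
  by (intro finsum_closed) auto

lemma z_independent_iff:
  "z_independent N B \<longleftrightarrow> finite B \<and> B \<subseteq> carrier N \<and>
     (\<forall>c. (\<forall>t. (\<Sum>b\<in>B. c b * F b t) = 0) \<longrightarrow> (\<forall>b\<in>B. c b = 0))"
proof -
  have "(\<Oplus>b\<in>B. [c b] \<cdot> b) = \<zero> \<longleftrightarrow> (\<forall>t. (\<Sum>b\<in>B. c b * F b t) = 0)" if B: "B \<subseteq> carrier N" for c
  proof
    assume "(\<Oplus>b\<in>B. [c b] \<cdot> b) = \<zero>"
    then show "\<forall>t. (\<Sum>b\<in>B. c b * F b t) = 0" using F_comb[OF B, of c] F_zero by metis
  next
    assume "\<forall>t. (\<Sum>b\<in>B. c b * F b t) = 0"
    then show "(\<Oplus>b\<in>B. [c b] \<cdot> b) = \<zero>"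
      by (intro F_inj comb_closed[OF B] zero_closed) (simp add: F_comb[OF B] F_zero)
  qed
  then show ?thesis unfolding z_independent_def by auto
qed

text \<open>More elements than coordinates are dependent, by \<open>int_relation\<close>; this bound
  also shows that the maximum in \<open>z_rank\<close> exists.\<close>

lemma z_independent_card: assumes "z_independent N B" shows "card B \<le> card D"
proof (rule ccontr)
  assume "\<not> card B \<le> card D"
  obtain h where h: "bij_betw h {0..<card D} D" using ex_bij_betw_nat_finite[OF D(1)] by blast
  have B: "finite B" "B \<subseteq> carrier N" "\<And>c. (\<forall>t. (\<Sum>b\<in>B. c b * F b t) = 0) \<Longrightarrow> \<forall>b\<in>B. c b = 0"
    using assms unfolding z_independent_iff by blast+
  obtain c where c: "\<exists>b\<in>B. c b \<noteq> 0" "\<forall>i<card D. (\<Sum>b\<in>B. c b * F b (h i)) = 0"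
    using int_relation[OF B(1), of "card D" "\<lambda>b i. F b (h i)"] \<open>\<not> card B \<le> card D\<close> by auto
  have "(\<Sum>b\<in>B. c b * F b t) = 0" for t
  proof (cases "t \<in> D")
    case True
    then have "t \<in> h ` {0..<card D}" using h unfolding bij_betw_def by simp
    then obtain i where "i < card D" "t = h i" by auto
    then show ?thesis using c(2) by simp
  next
    case False
    then show ?thesis using D(2) B(2) by (intro sum.neutral) auto
  qed
  then show False using B(3)[of c] c(1) by blast
qed

lemma z_rank_witness: "\<exists>B. z_independent N B \<and> card B = z_rank N"
  unfolding z_rank_def
proof (rule GreatestI_nat[where b = "card D" and k = 0])
  have "z_independent N {}" unfolding z_independent_iff by simp
  then show "\<exists>B. z_independent N B \<and> card B = 0" by (intro exI[of _ "{}"]) simp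
qed (use z_independent_card in auto)

lemma card_le_z_rank: "z_independent N B \<Longrightarrow> card B \<le> z_rank N"
  unfolding z_rank_def by (rule Greatest_le_nat[where b = "card D"]) (use z_independent_card in auto)

end

text \<open>Ranks are compared without being computed: an independent set of maximal size is carried
  over and enlarged by \<open>e\<close>, the only member with a nonzero coordinate at
  \<open>t0\<close>.\<close>

lemma z_rank_less:
  assumes N: "faithful_coordinates N F D" and N': "faithful_coordinates N' F' D'"
    and sub: "F ` carrier N \<subseteq> F' ` carrier N'"
    and e: "e \<in> carrier N'" "F' e t0 \<noteq> 0" and t0: "\<And>x. x \<in> carrier N \<Longrightarrow> F x t0 = 0"
  shows "z_rank N < z_rank N'"
proof -
  interpret N: faithful_coordinates N F D by (rule N)
  interpret N': faithful_coordinates N' F' D' by (rule N')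
  obtain B where B: "z_independent N B" "card B = z_rank N" using N.z_rank_witness by blast
  have BN: "finite B" "B \<subseteq> carrier N" "\<And>c. (\<forall>t. (\<Sum>b\<in>B. c b * F b t) = 0) \<Longrightarrow> \<forall>b\<in>B. c b = 0"
    using B(1) unfolding N.z_independent_iff by blast+
  have "\<exists>y\<in>carrier N'. F' y = F b" if "b \<in> B" for b
  proof -
    have "F b \<in> F' ` carrier N'" using sub BN(2) that by blast
    then show ?thesis by (metis imageE)
  qed
  then obtain g where g: "\<And>b. b \<in> B \<Longrightarrow> g b \<in> carrier N' \<and> F' (g b) = F b" by metis
  have inj: "inj_on g B"
  proof (rule inj_onI)
    fix a b assume ab: "a \<in> B" "b \<in> B" "g a = g b"
    then have "F a = F b" using g by metis
    then show "a = b" using ab BN(2) by (intro N.F_inj) auto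
  qed
  have enew: "e \<notin> g ` B"
  proof
    assume "e \<in> g ` B"
    then obtain b where "b \<in> B" "e = g b" by blast
    then have "F' e t0 = F b t0" "b \<in> carrier N" using g BN(2) by auto
    then show False using e(2) t0 by simp
  qed
  have "z_independent N' (insert e (g ` B))"
    unfolding N'.z_independent_iff
  proof (intro conjI allI impI)
    show "finite (insert e (g ` B))" "insert e (g ` B) \<subseteq> carrier N'" using BN(1) e(1) g by auto
    fix c assume "\<forall>t. (\<Sum>b\<in>insert e (g ` B). c b * F' b t) = 0"
    then have r: "c e * F' e t + (\<Sum>b\<in>B. c (g b) * F b t) = 0" for t
      using BN(1) enew g by (simp add: sum.reindex[OF inj])
    have "(\<Sum>b\<in>B. c (g b) * F b t0) = 0" using t0 BN(2) by (intro sum.neutral) auto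
    then have ce: "c e = 0" using r[of t0] e(2) by simp
    then have "\<forall>b\<in>B. c (g b) = 0" using BN(3)[of "\<lambda>b. c (g b)"] r by simp
    then show "\<forall>b\<in>insert e (g ` B). c b = 0" using ce by simp
  qed
  then have "card (insert e (g ` B)) \<le> z_rank N'" by (rule N'.card_le_z_rank)
  then show ?thesis using BN(1) enew B(2) by (simp add: card_image[OF inj])
qed


section \<open>Lattices over the group ring\<close>

context metacyclic_group
begin

definition Mrec :: "nat \<Rightarrow> (lambda_elt, lvec) rmodule" where
  "Mrec n = \<lparr>carrier = Lat n, mult = undefined, one = undefined, zero = 0, add = (+),
     ract = (\<lambda>u a. lact d u (Phi a))\<rparr>"

lemma Mrec_simps [simp]: "carrier (Mrec n) = Lat n" "u \<oplus>\<^bsub>Mrec n\<^esub> v = u + v" "u \<triangleleft>\<^bsub>Mrec n\<^esub> a = lact d u (Phi a)"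
  by (simp_all add: Mrec_def)

lemma Lam_add: "a \<oplus>\<^bsub>Lam\<^esub> b = a + b"
  by (simp add: Lam_ops fun_eq_iff)

lemma Lam_zero: "\<zero>\<^bsub>Lam\<^esub> = 0"
  by (simp add: Lam_ops fun_eq_iff)

lemma zero_carrier: "0 \<in> carrier Lam"
  by (simp add: Lam_carrier_iff)

lemma one_carrier: "one_L \<in> carrier Lam"
  by (intro basis_carrier nf_G)

lemma Phi_eqD: "a \<in> carrier Lam \<Longrightarrow> b \<in> carrier Lam \<Longrightarrow> Phi a = Phi b \<Longrightarrow> a = b"
  using Phi_inj by (rule inj_onD)

lemma snd_Phi: "snd (Phi a) = Dm a"
  by (simp add: Phi_def)

lemma one_Phi: "a \<in> carrier Lam \<Longrightarrow> elm d (el_one d) (Phi a) = Phi a"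
  by (rule elm_one_left) (simp add: snd_Phi Dm_supp)

lemma one_mult: assumes a: "a \<in> carrier Lam" shows "one_L \<otimes>\<^bsub>Lam\<^esub> a = a"
  by (rule Phi_eqD[OF mult_carrier[OF one_carrier a] a])
    (simp only: Phi_mult[OF one_carrier a] Phi_one one_Phi[OF a])

lemma zero_mult: assumes a: "a \<in> carrier Lam" shows "0 \<otimes>\<^bsub>Lam\<^esub> a = 0"
  by (rule Phi_eqD[OF mult_carrier[OF zero_carrier a] zero_carrier])
    (simp only: Phi_mult[OF zero_carrier a] Phi_0 elm_0)

lemma Lam_minus: assumes "a \<in> carrier Lam" "b \<in> carrier Lam" shows "a \<ominus>\<^bsub>Lam\<^esub> b = a + - b"
proof -
  have "\<ominus>\<^bsub>Lam\<^esub> b = - b"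
    unfolding a_inv_def m_inv_def
  proof (rule the_equality)
    show "- b \<in> carrier (add_monoid Lam) \<and> b \<otimes>\<^bsub>add_monoid Lam\<^esub> - b = \<one>\<^bsub>add_monoid Lam\<^esub> \<and>
        - b \<otimes>\<^bsub>add_monoid Lam\<^esub> b = \<one>\<^bsub>add_monoid Lam\<^esub>"
      using neg_carrier[OF assms(2)] by (simp add: Lam_add Lam_zero)
    fix c assume "c \<in> carrier (add_monoid Lam) \<and> b \<otimes>\<^bsub>add_monoid Lam\<^esub> c = \<one>\<^bsub>add_monoid Lam\<^esub> \<and>
        c \<otimes>\<^bsub>add_monoid Lam\<^esub> b = \<one>\<^bsub>add_monoid Lam\<^esub>"
    then have "b + c = 0" by (simp add: Lam_add Lam_zero)
    then show "c = - b" by (rule minus_unique[symmetric])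
  qed
  then show ?thesis by (simp add: a_minus_def Lam_add)
qed

lemma premodule_Lam: "premodule Lam (regular_rmodule Lam)"
  unfolding premodule_def regular_simps Lam_add Lam_zero
  by (intro conjI ballI zero_carrier add_carrier mult_carrier zero_mult) simp_all

text \<open>The automorphism that moves the image of the free generator to the last coordinate vector
  identifies the complement of the free summand.\<close>

lemma peel:
  assumes S: "premodule Lam S" and iso: "rmod_iso Lam (S [+] regular_rmodule Lam) (Mrec n)"
  shows "\<exists>k. n = Suc k \<and> rmod_iso Lam S (Mrec k)"
proof -
  let ?SR = "S [+] regular_rmodule Lam"
  note SD = premoduleD[OF S]
  have SR: "premodule Lam ?SR" by (rule premodule_sum[OF S premodule_Lam])
  have SR_iff: "x \<in> carrier ?SR \<longleftrightarrow> fst x \<in> carrier S \<and> snd x \<in> carrier Lam" for x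
    by (simp add: mem_Times_iff)
  obtain f where f: "bij_betw f (carrier ?SR) (carrier (Mrec n))"
      "\<And>x y. x \<in> carrier ?SR \<Longrightarrow> y \<in> carrier ?SR \<Longrightarrow> f (x \<oplus>\<^bsub>?SR\<^esub> y) = f x \<oplus>\<^bsub>Mrec n\<^esub> f y"
      "\<And>x a. x \<in> carrier ?SR \<Longrightarrow> a \<in> carrier Lam \<Longrightarrow> f (x \<triangleleft>\<^bsub>?SR\<^esub> a) = f x \<triangleleft>\<^bsub>Mrec n\<^esub> a"
    using iso unfolding rmod_iso_def by blast
  define g where "g = inv_into (carrier ?SR) f"
  have g: "bij_betw g (Lat n) (carrier ?SR)"
    unfolding g_def using bij_betw_inv_into[OF f(1)] by (simp only: Mrec_simps)
  have gC: "snd (g v) \<in> carrier Lam" if "v \<in> Lat n" for v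
    using bij_betwE[OF g] that SR_iff by blast
  have g_add: "g (v + w) = g v \<oplus>\<^bsub>?SR\<^esub> g w" if "v \<in> Lat n" "w \<in> Lat n" for v w
  proof -
    have "g (v \<oplus>\<^bsub>Mrec n\<^esub> w) = g v \<oplus>\<^bsub>?SR\<^esub> g w"
      unfolding g_def by (rule premodule_inverse(1)[OF SR f(1)]) (simp_all only: f(2,3) Mrec_simps that)
    then show ?thesis by (simp only: Mrec_simps)
  qed
  have g_act: "g (lact d v (Phi a)) = g v \<triangleleft>\<^bsub>?SR\<^esub> a" if "v \<in> Lat n" "a \<in> carrier Lam" for v a
  proof -
    have "g (v \<triangleleft>\<^bsub>Mrec n\<^esub> a) = g v \<triangleleft>\<^bsub>?SR\<^esub> a"
      unfolding g_def by (rule premodule_inverse(2)[OF SR f(1)]) (simp_all only: f(2,3) Mrec_simps that)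
    then show ?thesis by (simp only: Mrec_simps)
  qed
  have u0: "(\<zero>\<^bsub>S\<^esub>, one_L) \<in> carrier ?SR" unfolding SR_iff by (simp add: SD(1) one_carrier)
  let ?u = "f (\<zero>\<^bsub>S\<^esub>, one_L)"
  have uL: "?u \<in> Lat n" using bij_betwE[OF f(1)] u0 by (simp only: Mrec_simps)
  \<comment> \<open>The functional is the inverse isomorphism followed by the projection to the free
    summand.\<close>
  have "uni n ?u" unfolding uni_def
  proof (intro exI[of _ "\<lambda>v. Phi (snd (g v))"] conjI ballI)
    show "Phi (snd (g v)) \<in> Phi ` carrier Lam" if "v \<in> Lat n" for v by (intro imageI gC that)
    show "Phi (snd (g (v + w))) = Phi (snd (g v)) + Phi (snd (g w))" if "v \<in> Lat n" "w \<in> Lat n" for v w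
      by (simp only: g_add[OF that] rmod_sum_simps regular_simps snd_conv Lam_add Phi_add[OF gC[OF that(1)] gC[OF that(2)]])
    show "Phi (snd (g (lact d v b))) = elm d (Phi (snd (g v))) b" if v: "v \<in> Lat n" and "b \<in> Phi ` carrier Lam" for v b
    proof -
      obtain a where a: "a \<in> carrier Lam" "b = Phi a" using \<open>b \<in> Phi ` carrier Lam\<close> by (elim imageE)
      show ?thesis unfolding a(2) by (simp only: g_act[OF v a(1)] rmod_sum_simps regular_simps snd_conv Phi_mult[OF gC[OF v] a(1)])
    qed
    have "g ?u = (\<zero>\<^bsub>S\<^esub>, one_L)" unfolding g_def by (rule bij_betw_inv_into_left[OF f(1) u0])
    then show "Phi (snd (g ?u)) = el_one d" by (simp only: snd_conv Phi_one)
  qed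
  then have "n \<noteq> 0" using not_uni_0 uL by metis
  then obtain k where n: "n = Suc k" using not0_implies_Suc by blast
  define e where "e = ((0, 0, \<lambda>i. if i = k then el_one d else 0) :: lvec)"
  obtain \<phi> where \<phi>: "aut n \<phi>" "\<phi> ?u = e"
    using orb_unimodular[of ?u k] uL \<open>uni n ?u\<close> unfolding n orb_def e_def by blast
  define F where "F x = \<phi> (f x)" for x
  have \<phi>b: "bij_betw \<phi> (Lat n) (Lat n)" using \<phi>(1) unfolding aut_def by blast
  have fL: "f x \<in> Lat n" if "x \<in> carrier ?SR" for x using bij_betwE[OF f(1)] that by (simp only: Mrec_simps)
  have F: "bij_betw F (carrier ?SR) (Lat n)"
    unfolding F_def using bij_betw_trans[OF f(1)[unfolded Mrec_simps] \<phi>b] by (simp add: comp_def)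
  have F_add: "F (x \<oplus>\<^bsub>?SR\<^esub> y) = F x + F y" if "x \<in> carrier ?SR" "y \<in> carrier ?SR" for x y
    using \<phi>(1) fL that unfolding F_def aut_def by (simp only: f(2) Mrec_simps)
  have F_act: "F (x \<triangleleft>\<^bsub>?SR\<^esub> a) = lact d (F x) (Phi a)" if "x \<in> carrier ?SR" "a \<in> carrier Lam" for x a
    using \<phi>(1) fL that unfolding F_def aut_def by (simp only: f(3) Mrec_simps imageI)
  have FL: "F x \<in> Lat n" if "x \<in> carrier ?SR" for x using bij_betwE[OF F] that by blast
  define \<delta> where "\<delta> c = ((0, 0, \<lambda>i. if i = k then c else 0) :: lvec)" for c
  define \<pi> where "\<pi> u = ((fst u, fst (snd u), \<lambda>i. if i < k then snd (snd u) i else 0) :: lvec)" for u :: lvec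
  have pi_add: "\<pi> (u + v) = \<pi> u + \<pi> v" for u v by (rule lvec_eqI) (simp_all add: \<pi>_def)
  have pi_act: "\<pi> (lact d u b) = lact d (\<pi> u) b" for u b by (rule lvec_eqI) (simp_all add: \<pi>_def)
  have pi_delta: "\<pi> (\<delta> c) = 0" for c by (rule lvec_eqI) (simp_all add: \<pi>_def \<delta>_def)
  have pi_L: "\<pi> u \<in> Lat k" if "u \<in> Lat n" for u
    unfolding \<pi>_def using LatD[OF that] n by (intro LatI) simp_all
  have split: "u = \<pi> u + \<delta> (snd (snd u) k)" if "u \<in> Lat n" for u
    by (rule lvec_eqI) (use LatD(4)[OF that] n in \<open>auto simp: \<pi>_def \<delta>_def\<close>)
  have pi_id: "\<pi> u = u" "u \<in> Lat n" if u: "u \<in> Lat k" for u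
  proof -
    show "\<pi> u = u" by (rule lvec_eqI) (use LatD(4)[OF u] in \<open>auto simp: \<pi>_def\<close>)
    show "u \<in> Lat n" using LatD[OF u] LatI[of "fst u" "fst (snd u)" n "snd (snd u)"] L_0 unfolding n
      by (metis less_Suc_eq not_less prod.collapse Suc_leD)
  qed
  \<comment> \<open>The free generator goes to the last coordinate vector, so the free summand is
    mapped to the last coordinate and disappears under \<open>\<pi>\<close>.\<close>
  have F_split: "F (s, a) = F (s, 0) + \<delta> (Phi a)" if s: "s \<in> carrier S" and a: "a \<in> carrier Lam" for s a
  proof -
    have s0: "(s, 0) \<in> carrier ?SR" unfolding SR_iff by (simp add: s zero_carrier)
    have ua: "(\<zero>\<^bsub>S\<^esub>, one_L) \<triangleleft>\<^bsub>?SR\<^esub> a = (\<zero>\<^bsub>S\<^esub>, a)" by (simp add: SD(5)[OF a] one_mult[OF a])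
    have 0: "(\<zero>\<^bsub>S\<^esub>, a) \<in> carrier ?SR" unfolding SR_iff by (simp add: SD(1) a)
    have "(s, a) = (s, 0) \<oplus>\<^bsub>?SR\<^esub> (\<zero>\<^bsub>S\<^esub>, a)" by (simp add: SD(4)[OF s] Lam_add)
    then have "F (s, a) = F (s, 0) + F (\<zero>\<^bsub>S\<^esub>, a)" using F_add[OF s0 0] by (simp only:)
    also have "F (\<zero>\<^bsub>S\<^esub>, a) = lact d e (Phi a)" using F_act[OF u0 a] unfolding ua F_def \<phi>(2) .
    also have "\<dots> = \<delta> (Phi a)"
      by (rule lvec_eqI) (simp_all add: e_def \<delta>_def one_Phi[OF a])
    finally show ?thesis .
  qed
  define H where "H s = \<pi> (F (s, 0))" for s
  have s0: "(s, 0) \<in> carrier ?SR" if "s \<in> carrier S" for s unfolding SR_iff by (simp add: that zero_carrier)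
  have "bij_betw H (carrier S) (Lat k)"
    unfolding bij_betw_def
  proof
    show "inj_on H (carrier S)"
    proof (rule inj_onI)
      fix s t assume st: "s \<in> carrier S" "t \<in> carrier S" "H s = H t"
      \<comment> \<open>Vectors with equal projection differ only in the last coordinate, hence by
        the image of an element of the free summand; injectivity of \<open>F\<close> then compares
        the first components.\<close>
      let ?a = "snd (snd (F (s, 0))) k" and ?b = "snd (snd (F (t, 0))) k"
      have "?a \<in> Phi ` carrier Lam" "?b \<in> Phi ` carrier Lam" using LatD(3)[OF FL[OF s0]] st(1,2) n by simp_all
      then obtain a b where ab: "a \<in> carrier Lam" "b \<in> carrier Lam" "?a = Phi a" "?b = Phi b" by (elim imageE)
      let ?c = "a + - b"
      have c: "?c \<in> carrier Lam" by (intro add_carrier neg_carrier ab)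
      have "F (s, 0) = H t + \<delta> (Phi a)" using split[OF FL[OF s0[OF st(1)]]] unfolding ab(3) H_def[symmetric] st(3) .
      also have "\<delta> (Phi a) = \<delta> (Phi b) + \<delta> (Phi ?c)"
        by (rule lvec_eqI) (simp_all add: \<delta>_def Phi_add[OF ab(1) neg_carrier[OF ab(2)]] Phi_neg[OF ab(2)] del: add_uminus_conv_diff)
      also have "H t + (\<delta> (Phi b) + \<delta> (Phi ?c)) = F (t, 0) + \<delta> (Phi ?c)"
        using split[OF FL[OF s0[OF st(2)]]] unfolding ab(4) H_def[symmetric] by (simp only: add.assoc)
      also have "\<dots> = F (t, ?c)" by (rule F_split[OF st(2) c, symmetric])
      finally have eq: "F (s, 0) = F (t, ?c)" .
      have "(t, ?c) \<in> carrier ?SR" unfolding SR_iff using st(2) c by simp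
      then have "(s, 0) = (t, ?c)" by (rule inj_onD[OF bij_betw_imp_inj_on[OF F] eq s0[OF st(1)]])
      then show "s = t" by simp
    qed
    show "H ` carrier S = Lat k"
    proof (intro equalityI subsetI)
      fix w assume "w \<in> H ` carrier S"
      then show "w \<in> Lat k" unfolding H_def using pi_L FL s0 by blast
    next
      fix w assume w: "w \<in> Lat k"
      have "w \<in> F ` carrier ?SR" using bij_betw_imp_surj_on[OF F] pi_id(2)[OF w] by (simp only:)
      then obtain x where x: "x \<in> carrier ?SR" "w = F x" by (elim imageE)
      have sx: "fst x \<in> carrier S" "snd x \<in> carrier Lam" using x(1) SR_iff by blast+
      have "w = F (fst x, 0) + \<delta> (Phi (snd x))" using F_split[OF sx] x(2) by simp
      then have "\<pi> w = H (fst x)" by (simp only: pi_add pi_delta H_def add_0_right)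
      then show "w \<in> H ` carrier S" using sx(1) pi_id(1)[OF w] by (metis imageI)
    qed
  qed
  moreover have "H (s \<oplus>\<^bsub>S\<^esub> t) = H s + H t" if "s \<in> carrier S" "t \<in> carrier S" for s t
  proof -
    have "(s \<oplus>\<^bsub>S\<^esub> t, 0) = (s, 0) \<oplus>\<^bsub>?SR\<^esub> (t, 0)" by (simp add: Lam_add)
    then show ?thesis unfolding H_def by (simp only: F_add[OF s0[OF that(1)] s0[OF that(2)]] pi_add)
  qed
  moreover have "H (s \<triangleleft>\<^bsub>S\<^esub> a) = lact d (H s) (Phi a)" if "s \<in> carrier S" "a \<in> carrier Lam" for s a
  proof -
    have "(s \<triangleleft>\<^bsub>S\<^esub> a, 0) = (s, 0) \<triangleleft>\<^bsub>?SR\<^esub> a" by (simp add: zero_mult[OF that(2)])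
    then show ?thesis unfolding H_def by (simp only: F_act[OF s0[OF that(1)] that(2)] pi_act)
  qed
  ultimately have "rmod_iso Lam S (Mrec k)" unfolding rmod_iso_def Mrec_simps by (intro exI[of _ H] conjI ballI)
  then show ?thesis using n by blast
qed

abbreviation XR where "XR \<equiv> row_module p m 2 [+] y_minus_1 p m"

lemma row_simps: "carrier (row_module p m 2) = R2" "\<zero>\<^bsub>row_module p m 2\<^esub> = 0"
  "r \<oplus>\<^bsub>row_module p m 2\<^esub> s = r + s" "r \<triangleleft>\<^bsub>row_module p m 2\<^esub> a = vm d r (Dm a)"
proof -
  have "{1..<2} = {1 :: nat}" by auto
  then show "carrier (row_module p m 2) = R2" unfolding row_module_def R2_def d_def[symmetric] by simp
  have "(\<Sum>k = 1..d. r k * lam_tilde p m a k j) = (\<Sum>k = 1..d. r k * Dm a k j)" for j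
    by (rule sum.cong) (simp_all only: Dm_def if_True)
  then show "r \<triangleleft>\<^bsub>row_module p m 2\<^esub> a = vm d r (Dm a)"
    unfolding row_module_def vm_def d_def[symmetric] by (simp only: rmodule.simps)
qed (simp_all add: row_module_def fun_eq_iff)

text \<open>Since \<open>Phi\<close> is injective, membership in [y - 1) can be tested on the
  image.\<close>

lemma y_simps: "c \<in> carrier (y_minus_1 p m) \<longleftrightarrow> c \<in> carrier Lam \<and> Phi c \<in> Y1" "\<zero>\<^bsub>y_minus_1 p m\<^esub> = 0"
  "c \<oplus>\<^bsub>y_minus_1 p m\<^esub> e = c + e" "c \<triangleleft>\<^bsub>y_minus_1 p m\<^esub> a = c \<otimes>\<^bsub>Lam\<^esub> a"
proof -
  let ?y = "y_L + - one_L"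
  have y: "?y \<in> carrier Lam" by (intro add_carrier neg_carrier y_carrier one_carrier)
  have Py: "Phi ?y = Phi y_L - el_one d"
    unfolding Phi_add[OF y_carrier neg_carrier[OF one_carrier]] Phi_neg[OF one_carrier] Phi_one
    by (rule add_uminus_conv_diff)
  have C: "carrier (y_minus_1 p m) = (\<lambda>b. ?y \<otimes>\<^bsub>Lam\<^esub> b) ` carrier Lam"
    using Lam_minus[OF y_carrier one_carrier]
    by (simp add: y_minus_1_def principal_right_ideal_def y_class y_L_def Lam_ops(2))
  show "c \<in> carrier (y_minus_1 p m) \<longleftrightarrow> c \<in> carrier Lam \<and> Phi c \<in> Y1"
  proof
    assume "c \<in> carrier (y_minus_1 p m)"
    then obtain b where b: "b \<in> carrier Lam" "c = ?y \<otimes>\<^bsub>Lam\<^esub> b" unfolding C by (elim imageE)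
    then have "Phi c = elm d (Phi y_L - el_one d) (Phi b)" by (simp only: Phi_mult[OF y b(1)] Py)
    then show "c \<in> carrier Lam \<and> Phi c \<in> Y1" using b mult_carrier[OF y b(1)] Y1_I[OF imageI[OF b(1)]] by simp
  next
    assume c: "c \<in> carrier Lam \<and> Phi c \<in> Y1"
    then obtain b where b: "b \<in> carrier Lam" "Phi c = elm d (Phi y_L - el_one d) (Phi b)"
      unfolding Y1_def by (elim conjE imageE) blast
    have "c = ?y \<otimes>\<^bsub>Lam\<^esub> b"
      by (rule Phi_eqD[OF _ mult_carrier[OF y b(1)]]) (use c b(2) in \<open>simp_all only: Phi_mult[OF y b(1)] Py\<close>)
    then show "c \<in> carrier (y_minus_1 p m)" unfolding C using b(1) by (rule image_eqI)
  qed
qed (simp_all add: y_minus_1_def principal_right_ideal_def Lam_add Lam_zero)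

lemma premodule_X: "premodule Lam XR"
proof (rule premodule_sum)
  have R0: "0 \<in> R2" by (simp add: R2_def)
  show "premodule Lam (row_module p m 2)"
    unfolding premodule_def row_simps
  proof (intro conjI ballI R0)
    show "r + s \<in> R2" if "r \<in> R2" "s \<in> R2" for r s using that by (rule R2_add)
    show "vm d r (Dm a) \<in> R2" if "r \<in> R2" "a \<in> carrier Lam" for r a
      using R2_vm[OF that(1) imageI[OF that(2)]] by (simp add: Phi_def)
  qed simp_all
  have "0 \<in> Y1" using LatD(2)[OF Lat_0[of 0]] by simp
  then show "premodule Lam (y_minus_1 p m)"
    unfolding premodule_def y_simps
  proof (intro conjI ballI zero_carrier)
    show "Phi 0 \<in> Y1" using \<open>0 \<in> Y1\<close> by (simp only: Phi_0)
    fix c assume c: "c \<in> carrier (y_minus_1 p m)"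
    then have cL: "c \<in> carrier Lam" and cY: "Phi c \<in> Y1" by (simp_all only: y_simps)
    show "c + e \<in> carrier Lam" "Phi (c + e) \<in> Y1" if "e \<in> carrier (y_minus_1 p m)" for e
      using that cL cY by (simp_all only: y_simps add_carrier Phi_add Y1_add)
    show "c \<otimes>\<^bsub>Lam\<^esub> a \<in> carrier Lam" "Phi (c \<otimes>\<^bsub>Lam\<^esub> a) \<in> Y1" if "a \<in> carrier Lam" for a
      using that cL cY by (simp_all only: mult_carrier Phi_mult Y1_mul imageI)
    show "c + 0 = c" by simp
  qed (rule zero_mult)
qed

lemma X_free_iso: "rmod_iso Lam (XR [+] free_rmodule Lam n) (Mrec n)"
proof -
  let ?XF = "XR [+] free_rmodule Lam n"
  let ?f = "\<lambda>x :: ((nat \<Rightarrow> int) \<times> lambda_elt) \<times> (nat \<Rightarrow> lambda_elt).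
    ((fst (fst x), Phi (snd (fst x)), \<lambda>i. if i < n then Phi (snd x i) else 0) :: lvec)"
  have C: "fst (fst x) \<in> R2" "snd (fst x) \<in> carrier Lam" "Phi (snd (fst x)) \<in> Y1" "snd x \<in> {..<n} \<rightarrow>\<^sub>E carrier Lam"
    if "x \<in> carrier ?XF" for x
    using that by (simp_all only: rmod_sum_simps free_simps mem_Times_iff row_simps y_simps)
  have "bij_betw ?f (carrier ?XF) (Lat n)"
    unfolding bij_betw_def
  proof
    show "inj_on ?f (carrier ?XF)"
    proof (rule inj_onI)
      fix x y assume x: "x \<in> carrier ?XF" and y: "y \<in> carrier ?XF" and e: "?f x = ?f y"
      have 1: "fst (fst x) = fst (fst y)" "Phi (snd (fst x)) = Phi (snd (fst y))"
        and l: "(\<lambda>i. if i < n then Phi (snd x i) else 0) = (\<lambda>i. if i < n then Phi (snd y i) else 0)"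
        using e by (simp_all only: prod.inject)
      have 2: "snd (fst x) = snd (fst y)" by (rule Phi_eqD[OF C(2)[OF x] C(2)[OF y] 1(2)])
      have "snd x i = snd y i" for i
      proof (cases "i < n")
        case True
        then show ?thesis using fun_cong[OF l, of i] PiE_mem[OF C(4)[OF x], of i] PiE_mem[OF C(4)[OF y], of i]
          by (intro Phi_eqD) simp_all
      next
        case False
        then show ?thesis using PiE_arb[OF C(4)[OF x], of i] PiE_arb[OF C(4)[OF y], of i] by simp
      qed
      then have "snd x = snd y" by (rule ext)
      then show "x = y" using 1(1) 2 by (simp only: prod_eq_iff)
    qed
    show "?f ` carrier ?XF = Lat n"
    proof (intro equalityI subsetI)
      fix u assume "u \<in> ?f ` carrier ?XF"
      then obtain x where x: "x \<in> carrier ?XF" "u = ?f x" by (elim imageE)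
      show "u \<in> Lat n" unfolding x(2)
        by (rule LatI[OF C(1,3)[OF x(1)]]) (use PiE_mem[OF C(4)[OF x(1)]] in simp_all)
    next
      fix u assume u: "u \<in> Lat n"
      have "fst (snd u) \<in> Phi ` carrier Lam" by (intro Y1_L LatD(2)[OF u])
      then obtain c where c: "c \<in> carrier Lam" "fst (snd u) = Phi c" by (elim imageE)
      have "\<exists>a. i < n \<longrightarrow> a \<in> carrier Lam \<and> snd (snd u) i = Phi a" for i using LatD(3)[OF u, of i] by blast
      then obtain a where a: "\<And>i. i < n \<Longrightarrow> a i \<in> carrier Lam \<and> snd (snd u) i = Phi (a i)" by metis
      let ?x = "((fst u, c), restrict a {..<n})"
      have "?x \<in> carrier ?XF"
        using LatD(1,2)[OF u] c a by (simp add: row_simps y_simps)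
      moreover have "u = ?f ?x"
        by (rule lvec_eqI) (use c a LatD(4)[OF u] in auto)
      ultimately show "u \<in> ?f ` carrier ?XF" by (intro image_eqI)
    qed
  qed
  moreover have "?f (x \<oplus>\<^bsub>?XF\<^esub> y) = ?f x + ?f y" if x: "x \<in> carrier ?XF" and y: "y \<in> carrier ?XF" for x y
    by (rule lvec_eqI)
      (use PiE_mem[OF C(4)[OF x]] PiE_mem[OF C(4)[OF y]] in
        \<open>simp_all add: row_simps y_simps Phi_add C(2)[OF x] C(2)[OF y] Lam_add\<close>)
  moreover have "?f (x \<triangleleft>\<^bsub>?XF\<^esub> a) = lact d (?f x) (Phi a)" if x: "x \<in> carrier ?XF" and a: "a \<in> carrier Lam" for x a
    by (rule lvec_eqI)
      (use PiE_mem[OF C(4)[OF x]] in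
        \<open>simp_all add: row_simps y_simps Phi_mult C(2)[OF x] a snd_Phi\<close>)
  ultimately show ?thesis unfolding rmod_iso_def Mrec_simps by (intro exI[of _ ?f] conjI ballI)
qed

text \<open>The free summands are removed one at a time by \<open>peel\<close>.\<close>

lemma stable_iso:
  assumes "premodule Lam N" "rmod_iso Lam (N [+] free_rmodule Lam a) (Mrec b)"
  shows "\<exists>k. rmod_iso Lam N (Mrec k)"
  using assms(2)
proof (induction a arbitrary: b)
  case 0
  have "rmod_iso Lam N (N [+] free_rmodule Lam 0)"
    by (rule rmod_iso_sym[OF premodule_sum[OF assms(1) premodule_free[OF premodule_Lam]] free_zero_iso])
  then show ?case using rmod_iso_trans 0 by blast
next
  case (Suc a)
  have "rmod_iso Lam ((N [+] free_rmodule Lam a) [+] regular_rmodule Lam) (N [+] free_rmodule Lam (Suc a))"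
    by (rule rmod_iso_sym[OF premodule_sum[OF assms(1) premodule_free[OF premodule_Lam]] free_Suc_iso])
  from peel[OF premodule_sum[OF assms(1) premodule_free[OF premodule_Lam]] rmod_iso_trans[OF this Suc.prems]]
  obtain k where "rmod_iso Lam (N [+] free_rmodule Lam a) (Mrec k)" by blast
  then show ?case by (rule Suc.IH)
qed

lemma X_iso: "rmod_iso Lam XR (Mrec 0)"
  using rmod_iso_trans[OF rmod_iso_sym[OF premodule_sum[OF premodule_X premodule_free[OF premodule_Lam]] free_zero_iso] X_free_iso] .

lemma X_Lam_iso: "rmod_iso Lam (XR [+] regular_rmodule Lam) (Mrec 1)"
proof -
  have F: "premodule Lam (XR [+] free_rmodule Lam n)" for n
    by (rule premodule_sum[OF premodule_X premodule_free[OF premodule_Lam]])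
  have 1: "rmod_iso Lam (XR [+] regular_rmodule Lam) ((XR [+] free_rmodule Lam 0) [+] regular_rmodule Lam)"
    by (rule rmod_iso_sum_left[OF rmod_iso_sym[OF F free_zero_iso]])
  have 2: "rmod_iso Lam ((XR [+] free_rmodule Lam 0) [+] regular_rmodule Lam) (XR [+] free_rmodule Lam (Suc 0))"
    by (rule rmod_iso_sym[OF F free_Suc_iso])
  show ?thesis using rmod_iso_trans[OF rmod_iso_trans[OF 1 2] X_free_iso] by simp
qed

lemma cancellation:
  assumes S: "premodule Lam S" and iso: "rmod_iso Lam (S [+] regular_rmodule Lam) (XR [+] regular_rmodule Lam)"
  shows "rmod_iso Lam S XR"
proof -
  \<comment> \<open>Peeling one summand from level 1 leaves level 0, which is R(2) together with [y
    - 1).\<close>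
  have "rmod_iso Lam S (Mrec 0)" using peel[OF S rmod_iso_trans[OF iso X_Lam_iso]] by auto
  then show ?thesis by (rule rmod_iso_trans[OF _ rmod_iso_sym[OF premodule_X X_iso]])
qed

section \<open>Integer coordinates, ranks and generators of the members of the stable module\<close>

lemma Lam_group: "right_module Lam N \<Longrightarrow> abelian_group Lam"
  unfolding right_module_def ring_def by simp

text \<open>Level \<open>0\<close> of the index set carries \<open>R(2) \<oplus> [y - 1)\<close>, level \<open>i + 1\<close> the \<open>i\<close>-th free summand.\<close>

definition coord :: "nat \<Rightarrow> ((nat \<Rightarrow> int) \<times> lambda_elt) \<times> (nat \<Rightarrow> lambda_elt) \<Rightarrow> nat \<times> (nat + gen word set) \<Rightarrow> int" where
  "coord k x t = (case snd t of Inl j \<Rightarrow> if fst t = 0 then fst (fst x) j else 0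
     | Inr g \<Rightarrow> if fst t = 0 then snd (fst x) g else if fst t \<le> k then snd x (fst t - 1) g else 0)"

abbreviation XF where "XF k \<equiv> carrier (XR [+] free_rmodule Lam k)"

lemma XF_iff: "x \<in> XF k \<longleftrightarrow> fst (fst x) \<in> R2 \<and> snd (fst x) \<in> carrier Lam \<and> Phi (snd (fst x)) \<in> Y1 \<and>
    snd x \<in> {..<k} \<rightarrow>\<^sub>E carrier Lam"
  by (simp only: rmod_sum_simps free_simps mem_Times_iff row_simps y_simps conj_assoc)

lemma XF_snd: assumes "x \<in> XF k" "i < k" shows "snd x i \<in> carrier Lam"
proof -
  have "snd x \<in> {..<k} \<rightarrow>\<^sub>E carrier Lam" using assms(1) XF_iff by blast
  from PiE_mem[OF this, of i] show ?thesis using assms(2) by simp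
qed

lemma coord_inj: assumes x: "x \<in> XF k" and y: "y \<in> XF k" and e: "\<And>t. coord k x t = coord k y t" shows "x = y"
proof -
  have "fst (fst x) j = fst (fst y) j" for j using e[of "(0, Inl j)"] by (simp add: coord_def)
  moreover have "snd (fst x) g = snd (fst y) g" for g using e[of "(0, Inr g)"] by (simp add: coord_def)
  moreover have "snd x i = snd y i" for i
  proof (cases "i < k")
    case True
    then show ?thesis using e[of "(Suc i, Inr g)" for g] by (simp add: coord_def fun_eq_iff)
  next
    case False
    have "snd x \<in> {..<k} \<rightarrow>\<^sub>E carrier Lam" "snd y \<in> {..<k} \<rightarrow>\<^sub>E carrier Lam" using x y XF_iff by blast+
    then show ?thesis using PiE_arb[of "snd x" _ _ i] PiE_arb[of "snd y" _ _ i] False by (metis lessThan_iff)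
  qed
  ultimately have "fst (fst x) = fst (fst y)" "snd (fst x) = snd (fst y)" "snd x = snd y" by (simp_all only: fun_eq_iff) simp_all
  then show ?thesis by (simp only: prod_eq_iff)
qed

lemma coord_add: "coord k (x \<oplus>\<^bsub>XR [+] free_rmodule Lam k\<^esub> y) t = coord k x t + coord k y t"
  by (auto simp: coord_def row_simps y_simps Lam_add split: sum.split)

definition coord_dom :: "nat \<Rightarrow> (nat \<times> (nat + gen word set)) set" where
  "coord_dom k = {0} \<times> Inl ` {1..d} \<union> {..k} \<times> Inr ` G"

lemma finite_coord_dom: "finite (coord_dom k)"
  unfolding coord_dom_def using finite_G by simp

lemma coord_supp: assumes x: "x \<in> XF k" and t: "t \<notin> coord_dom k" shows "coord k x t = 0"
proof (cases "snd t")
  case (Inl j)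
  have "fst (fst x) j = 0" if "j \<notin> {1..d}" using x that unfolding XF_iff R2_def by simp
  moreover have "j \<notin> {1..d}" if "fst t = 0" using t Inl that by (cases t) (auto simp: coord_dom_def)
  ultimately show ?thesis using Inl by (simp add: coord_def)
next
  case (Inr g)
  have g: "g \<notin> G" if "fst t \<le> k" using t Inr that by (cases t) (auto simp: coord_dom_def)
  have "snd (fst x) \<in> carrier Lam" using x XF_iff by blast
  moreover have "snd x i \<in> carrier Lam" if "i < k" for i by (rule XF_snd[OF x that])
  ultimately show ?thesis using g Inr unfolding Lam_carrier_iff by (cases "fst t") (auto simp: coord_def)
qed

text \<open>The coordinates have the same range as those of the standard model, so that modules over
  different types can be compared.\<close>

lemma lattice_coordinates:
  assumes N: "right_module Lam N" and iso: "rmod_iso Lam N (Mrec k)"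
  shows "\<exists>F. faithful_coordinates N F (coord_dom k) \<and> F ` carrier N = coord k ` XF k"
proof -
  interpret right_module Lam N by (rule N)
  have "rmod_iso Lam N (XR [+] free_rmodule Lam k)"
    by (rule rmod_iso_trans[OF iso rmod_iso_sym[OF premodule_sum[OF premodule_X premodule_free[OF premodule_Lam]] X_free_iso]])
  then obtain f where f: "bij_betw f (carrier N) (XF k)"
      "\<And>x y. x \<in> carrier N \<Longrightarrow> y \<in> carrier N \<Longrightarrow> f (x \<oplus>\<^bsub>N\<^esub> y) = f x \<oplus>\<^bsub>XR [+] free_rmodule Lam k\<^esub> f y"
    unfolding rmod_iso_def by blast
  have fX: "f x \<in> XF k" if "x \<in> carrier N" for x using bij_betwE[OF f(1)] that by blast
  have "faithful_coordinates N (\<lambda>x. coord k (f x)) (coord_dom k)"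
  proof
    show "coord k (f (x \<oplus>\<^bsub>N\<^esub> y)) t = coord k (f x) t + coord k (f y) t"
      if "x \<in> carrier N" "y \<in> carrier N" for x y t
      by (simp only: f(2)[OF that] coord_add)
    show "x = y" if "x \<in> carrier N" "y \<in> carrier N" "\<And>t. coord k (f x) t = coord k (f y) t" for x y
      using coord_inj[OF fX fX that(3)] that(1,2) bij_betw_imp_inj_on[OF f(1)] by (simp add: inj_on_eq_iff)
    show "coord k (f x) t = 0" if "x \<in> carrier N" "t \<notin> coord_dom k" for x t
      by (rule coord_supp[OF fX[OF that(1)] that(2)])
  qed (rule finite_coord_dom)
  moreover have "(\<lambda>x. coord k (f x)) ` carrier N = coord k ` XF k"
    using bij_betw_imp_surj_on[OF f(1)] by (simp only: image_image[symmetric])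
  ultimately show ?thesis by blast
qed

text \<open>The standard models are nested in one coordinate space; the coefficient of the neutral
  element at level \<open>Suc k\<close> vanishes on the smaller one but not on the larger.\<close>

lemma rank_strict:
  assumes N: "right_module Lam N" "rmod_iso Lam N (Mrec k)" and N': "right_module Lam N'" "rmod_iso Lam N' (Mrec k')"
    and k: "k < k'"
  shows "z_rank N < z_rank N'"
proof -
  obtain F where F: "faithful_coordinates N F (coord_dom k)" "F ` carrier N = coord k ` XF k"
    using lattice_coordinates[OF N] by blast
  obtain F' where F': "faithful_coordinates N' F' (coord_dom k')" "F' ` carrier N' = coord k' ` XF k'"
    using lattice_coordinates[OF N'] by blast
  have sub: "coord k ` XF k \<subseteq> coord k' ` XF k'"
  proof
    fix v assume "v \<in> coord k ` XF k"
    then obtain x where x: "x \<in> XF k" "v = coord k x" by (elim imageE)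
    let ?x = "(fst x, \<lambda>i\<in>{..<k'}. if i < k then snd x i else 0)"
    have "snd x i \<in> carrier Lam" if "i < k" for i by (rule XF_snd[OF x(1) that])
    then have "?x \<in> XF k'" using x(1) zero_carrier unfolding XF_iff by (simp add: restrict_PiE_iff)
    moreover have "v = coord k' ?x"
      unfolding x(2) by (rule ext) (use k in \<open>auto simp: coord_def split: sum.split\<close>)
    ultimately show "v \<in> coord k' ` XF k'" by (rule rev_image_eqI)
  qed
  let ?e = "((0, 0), \<lambda>i\<in>{..<k'}. if i = k then one_L else 0) :: ((nat \<Rightarrow> int) \<times> lambda_elt) \<times> (nat \<Rightarrow> lambda_elt)"
  have "0 \<in> R2" "0 \<in> Y1" using LatD(1,2)[OF Lat_0[of 0]] by simp_all
  then have "?e \<in> XF k'" unfolding XF_iff by (simp add: restrict_PiE_iff zero_carrier one_carrier Phi_0)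
  then have "coord k' ?e \<in> F' ` carrier N'" unfolding F'(2) by (rule imageI)
  then obtain e where e: "e \<in> carrier N'" "F' e = coord k' ?e" by (elim imageE) simp
  let ?t = "(Suc k, Inr (nf 0 0)) :: nat \<times> (nat + gen word set)"
  show ?thesis
  proof (rule z_rank_less[OF F(1) F'(1) _ e(1), of ?t])
    show "F ` carrier N \<subseteq> F' ` carrier N'" unfolding F(2) F'(2) by (rule sub)
    show "F' e ?t \<noteq> 0" unfolding e(2) using k by (simp add: coord_def basis_elt_def)
    show "F x ?t = 0" if "x \<in> carrier N" for x
    proof -
      have "F x \<in> coord k ` XF k" unfolding F(2)[symmetric] using that by (rule imageI)
      then obtain w where "F x = coord k w" by (elim imageE)
      then show ?thesis by (simp add: coord_def)
    qed
  qed
qed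

lemma basis_span:
  assumes ag: "abelian_group Lam" and a: "a \<in> carrier Lam"
  shows "\<exists>c :: lambda_elt \<Rightarrow> int. a = (\<Oplus>\<^bsub>Lam\<^esub>e\<in>basis_elt ` G. [c e] \<cdot>\<^bsub>Lam\<^esub> e)"
proof -
  interpret A: abelian_group Lam by (rule ag)
  interpret C: coordinates Lam "\<lambda>a t. a t" by unfold_locales (simp add: Lam_add)
  have inj: "inj_on basis_elt G" by (rule inj_onI) (metis basis_elt_def zero_neq_one)
  let ?c = "\<lambda>e. a (inv_into G basis_elt e)"
  have B: "basis_elt ` G \<subseteq> carrier Lam" using basis_carrier by blast
  have "(\<Oplus>\<^bsub>Lam\<^esub>e\<in>basis_elt ` G. [?c e] \<cdot>\<^bsub>Lam\<^esub> e) t = a t" for t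
  proof -
    have "(\<Oplus>\<^bsub>Lam\<^esub>e\<in>basis_elt ` G. [?c e] \<cdot>\<^bsub>Lam\<^esub> e) t = (\<Sum>e\<in>basis_elt ` G. ?c e * e t)" by (rule C.F_comb[OF B])
    also have "\<dots> = (\<Sum>g\<in>G. a g * basis_elt g t)"
      by (subst sum.reindex[OF inj]) (simp add: inv_into_f_f[OF inj])
    also have "\<dots> = (\<Sum>g\<in>G. if g = t then a t else 0)" by (intro sum.cong) (auto simp: basis_elt_def)
    also have "\<dots> = a t" using a finite_G unfolding Lam_carrier_iff by simp
    finally show ?thesis .
  qed
  then have "a = (\<Oplus>\<^bsub>Lam\<^esub>e\<in>basis_elt ` G. [?c e] \<cdot>\<^bsub>Lam\<^esub> e)" by (intro ext) (rule HOL.sym)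
  then show ?thesis by (rule exI[of _ ?c])
qed

text \<open>Generators over the group ring, multiplied by the group elements, generate over the
  integers.\<close>

lemma z_fin_gen:
  fixes N :: "(lambda_elt, 'b) rmodule"
  assumes N: "right_module Lam N" and fg: "fin_gen Lam N" and F: "faithful_coordinates N F D"
  shows "z_fin_gen N"
proof -
  interpret right_module Lam N by (rule N)
  interpret F: faithful_coordinates N F D by (rule F)
  obtain B where B: "finite B" "B \<subseteq> carrier N"
    "\<And>x. x \<in> carrier N \<Longrightarrow> \<exists>c\<in>B \<rightarrow> carrier Lam. x = (\<Oplus>\<^bsub>N\<^esub>b\<in>B. b \<triangleleft>\<^bsub>N\<^esub> c b)"
    using fg unfolding fin_gen_def by blast
  define Q where "Q = B \<times> basis_elt ` G"
  define q where "q x = fst x \<triangleleft>\<^bsub>N\<^esub> snd x" for x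
  have Q: "finite Q" unfolding Q_def using B(1) finite_G by simp
  have E: "basis_elt ` G \<subseteq> carrier Lam" using basis_carrier by blast
  have qN: "q ` Q \<subseteq> carrier N" unfolding q_def Q_def using B(2) E by (auto intro!: ract_closed)
  show ?thesis unfolding z_fin_gen_def
  proof (intro exI[of _ "q ` Q"] conjI ballI finite_imageI Q qN)
    fix x assume x: "x \<in> carrier N"
    obtain c where c: "c \<in> B \<rightarrow> carrier Lam" "x = (\<Oplus>\<^bsub>N\<^esub>b\<in>B. b \<triangleleft>\<^bsub>N\<^esub> c b)" using B(3)[OF x] by blast
    define C where "C b = (SOME C :: lambda_elt \<Rightarrow> int. c b = (\<Oplus>\<^bsub>Lam\<^esub>e\<in>basis_elt ` G. [C e] \<cdot>\<^bsub>Lam\<^esub> e))" for b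
    have C: "c b = (\<Oplus>\<^bsub>Lam\<^esub>e\<in>basis_elt ` G. [C b e] \<cdot>\<^bsub>Lam\<^esub> e)" if "b \<in> B" for b
    proof -
      have "c b \<in> carrier Lam" using c(1) that by (rule funcset_mem)
      from someI_ex[OF basis_span[OF Lam_group[OF N] this]] show ?thesis unfolding C_def .
    qed
    have lin: "F (b \<triangleleft>\<^bsub>N\<^esub> c b) t = (\<Sum>e\<in>basis_elt ` G. C b e * F (b \<triangleleft>\<^bsub>N\<^esub> e) t)" if b: "b \<in> B" for b t
    proof -
      have bN: "b \<in> carrier N" using B(2) b by blast
      interpret A: abelian_group Lam by (rule Lam_group[OF N])
      interpret K: coordinates Lam "\<lambda>a t. F (b \<triangleleft>\<^bsub>N\<^esub> a) t"
      proof
        fix a a' t assume "a \<in> carrier Lam" "a' \<in> carrier Lam"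
        then show "F (b \<triangleleft>\<^bsub>N\<^esub> (a \<oplus>\<^bsub>Lam\<^esub> a')) t = F (b \<triangleleft>\<^bsub>N\<^esub> a) t + F (b \<triangleleft>\<^bsub>N\<^esub> a') t"
          by (simp only: ract_r_distr[OF bN] F.F_add ract_closed[OF bN])
      qed
      show ?thesis unfolding C[OF b] by (rule K.F_comb[OF E])
    qed
    \<comment> \<open>Different pairs may give the same product, so coefficients are collected along
      the fibres of \<open>q\<close>.\<close>
    define c' where "c' v = (\<Sum>y\<in>{y \<in> Q. q y = v}. C (fst y) (snd y))" for v
    have "F x t = F (\<Oplus>\<^bsub>N\<^esub>v\<in>q ` Q. [c' v] \<cdot>\<^bsub>N\<^esub> v) t" for t
    proof -
      have "F x t = (\<Sum>b\<in>B. F (b \<triangleleft>\<^bsub>N\<^esub> c b) t)"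
        unfolding c(2) by (rule F.F_finsum) (use B(2) c(1) in auto)
      also have "\<dots> = (\<Sum>b\<in>B. \<Sum>e\<in>basis_elt ` G. C b e * F (b \<triangleleft>\<^bsub>N\<^esub> e) t)" by (intro sum.cong HOL.refl lin)
      also have "\<dots> = (\<Sum>y\<in>Q. C (fst y) (snd y) * F (q y) t)"
        unfolding Q_def q_def by (simp add: sum.cartesian_product case_prod_beta)
      also have "\<dots> = (\<Sum>v\<in>q ` Q. \<Sum>y\<in>{y \<in> Q. q y = v}. C (fst y) (snd y) * F (q y) t)"
        by (rule sum.image_gen[OF Q])
      also have "\<dots> = (\<Sum>v\<in>q ` Q. c' v * F v t)"
        unfolding c'_def sum_distrib_right by (intro sum.cong HOL.refl) auto
      also have "\<dots> = F (\<Oplus>\<^bsub>N\<^esub>v\<in>q ` Q. [c' v] \<cdot>\<^bsub>N\<^esub> v) t" by (rule F.F_comb[OF qN, symmetric])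
      finally show ?thesis .
    qed
    then have "x = (\<Oplus>\<^bsub>N\<^esub>v\<in>q ` Q. [c' v] \<cdot>\<^bsub>N\<^esub> v)" by (intro F.F_inj x F.comb_closed[OF qN])
    then show "\<exists>c :: 'b \<Rightarrow> int. x = (\<Oplus>\<^bsub>N\<^esub>v\<in>q ` Q. [c v] \<cdot>\<^bsub>N\<^esub> v)" by (rule exI[of _ c'])
  qed
qed

lemma straight_stable: "straight Lam (stable_module Lam XR :: (lambda_elt, 't) rmodule set)"
  unfolding straight_def
proof (intro conjI ballI impI)
  have iso: "\<exists>k. rmod_iso Lam N (Mrec k)" if N: "N \<in> stable_module Lam XR" for N :: "(lambda_elt, 't) rmodule"
  proof -
    obtain a b where "rmod_iso Lam (N [+] free_rmodule Lam a) (XR [+] free_rmodule Lam b)"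
      using N unfolding stable_module_def stably_equivalent_def by blast
    moreover have "premodule Lam N" using N unfolding stable_module_def by (intro premodule_right_module) simp
    ultimately show ?thesis using stable_iso rmod_iso_trans[OF _ X_free_iso] by blast
  qed
  have rm: "right_module Lam N" "fin_gen Lam N" if "N \<in> stable_module Lam XR" for N :: "(lambda_elt, 't) rmodule"
    using that unfolding stable_module_def by simp_all
  show "rmod_lattice Lam N" if N: "N \<in> stable_module Lam XR" for N :: "(lambda_elt, 't) rmodule"
  proof -
    obtain k F where F: "faithful_coordinates N F (coord_dom k)"
      using lattice_coordinates[OF rm(1)[OF N]] iso[OF N] by blast
    show ?thesis unfolding rmod_lattice_def
      by (intro conjI rm(1)[OF N] z_fin_gen[OF rm[OF N] F] faithful_coordinates.torsion_free[OF F])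
  qed
  fix M N :: "(lambda_elt, 't) rmodule"
  assume M: "M \<in> stable_module Lam XR" and N: "N \<in> stable_module Lam XR" and r: "z_rank M = z_rank N"
  obtain k l where k: "rmod_iso Lam M (Mrec k)" and l: "rmod_iso Lam N (Mrec l)" using iso M N by blast
  have "k = l"
    using rank_strict[OF rm(1)[OF M] k rm(1)[OF N] l] rank_strict[OF rm(1)[OF N] l rm(1)[OF M] k] r
    by (cases k l rule: linorder_cases) simp_all
  show "rmod_iso Lam M N"
    using rmod_iso_trans[OF k rmod_iso_sym[OF premodule_right_module[OF rm(1)[OF N]] l[folded \<open>k = l\<close>]]] .
qed

end

theorem theorem5:
  fixes p :: nat and m :: int
  assumes "prime p" and "odd p"
    and "ord p (nat (m mod int p)) = p - 1"
  shows "(\<forall>S :: (lambda_elt, 's) rmodule.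
            right_module (Lambda p m) S \<longrightarrow>
            rmod_iso (Lambda p m)
              (S [+] regular_rmodule (Lambda p m))
              (row_module p m 2 [+] y_minus_1 p m [+] regular_rmodule (Lambda p m)) \<longrightarrow>
            rmod_iso (Lambda p m) S (row_module p m 2 [+] y_minus_1 p m)) \<and>
         straight (Lambda p m)
           (stable_module (Lambda p m) (row_module p m 2 [+] y_minus_1 p m) :: (lambda_elt, 't) rmodule set)"
proof -
  interpret metacyclic_group p m by unfold_locales (rule assms)+
  show ?thesis by (intro conjI allI impI straight_stable cancellation premodule_right_module)
qed

end
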